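(* Let $A\in\mathrm{SL}(2,\mathbb R)$ and let $I\subset\mathbb R$ be a bounded interval of positive length $|I|$. Then as $\tau\to\infty$, $$N_I(A\Lambda_q,\tau)\sim\frac{|I|}{m_q(R_q)}\tau^2,$$ and the probability measures $\rho_{A\Lambda_q,I,\tau}$ on $\mathscr T^q$ converge weakly to $m_q$ (i.e. $\int f\,d\rho_{A\Lambda_q,I,\tau}\to\int f\,dm_q$ for every bounded continuous $f:\mathscr T^q\to\mathbb R$).
   Context: Fix an integer $q\ge3$, let $\lambda_q=2\cos(\pi/q)$, and let $G_q\subset \mathrm{SL}(2,\mathbb R)$ be the Hecke triangle group generated by $S=\begin{pmatrix}0&-1\\1&0\end{pmatrix}$ and $T_q=\begin{pmatrix}1&\lambda_q\\0&1\end{pmatrix}$, acting linearly on $\mathbb R^2$; $\Lambda_q=G_q(1,0)^T$, $A\Lambda_q=\{A\mathbf v:\mathbf v\in\Lambda_q\}$. Matrices: $h_s=\begin{pmatrix}1&0\\-s&1\end{pmatrix}$, $s_\tau=\mathrm{diag}(\tau,\tau^{-1})$, $g_{a,b}=\begin{pmatrix}a&b\\0&a^{-1}\end{pmatrix}$. $S_\tau=\{(x,y)^T:0<x\le\tau\}$; slope of $(x,y)^T$ is $y/x$. $\mathscr T^q=\{(a,b):0<a\le1,\ 1-\lambda_qa<b\le1\}$ with $m_q=\frac2{\lambda_q}\,da\,db$. $R_q(a,b)$ is the smallest positive slope among vectors of $g_{a,b}\Lambda_q\cap S_1$, and $m_q(R_q)=\int R_q\,dm_q$ (finite). For $\mathbf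 u\in A\Lambda_q\cap S_\tau$, $\mathrm{FTR}_q(A,\tau,\mathbf u)$ is the unique $(a,b)\in\mathscr T^q$ with $s_{1/\tau}h_{\mathrm{slope}(\mathbf u)}A\Lambda_q=g_{a,b}\Lambda_q$ (it exists and is unique). Define $\mathcal F_I(A\Lambda_q,\tau)=\{\mathbf u\in A\Lambda_q\cap S_\tau:\mathrm{slope}(\mathbf u)\in I\}$, $N_I(A\Lambda_q,\tau)=\#\mathcal F_I(A\Lambda_q,\tau)$, and when this set is nonempty $\rho_{A\Lambda_q,I,\tau}=\frac1{N_I(A\Lambda_q,\tau)}\sum_{\mathbf u\in\mathcal F_I(A\Lambda_q,\tau)}\delta_{\mathrm{FTR}_q(A,\tau,\mathbf u)}$. *)

theory Defs
  imports "HOL-Analysis.Analysis" "HOL-Library.Landau_Symbols"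
begin

definition mat2 :: "real \<Rightarrow> real \<Rightarrow> real \<Rightarrow> real \<Rightarrow> real^2^2" where
  "mat2 a b c d = (\<chi> i j. if i = 1 then (if j = 1 then a else b) else (if j = 1 then c else d))"

definition vec2 :: "real \<Rightarrow> real \<Rightarrow> real^2" where
  "vec2 x y = (\<chi> i. if i = 1 then x else y)"

definition lambda_q :: "nat \<Rightarrow> real" where
  "lambda_q q = 2 * cos (pi / real q)"

definition S_mat :: "real^2^2" where
  "S_mat = mat2 0 (-1) 1 0"

definition T_mat :: "nat \<Rightarrow> real^2^2" where
  "T_mat q = mat2 1 (lambda_q q) 0 1"

inductive_set hecke_group :: "nat \<Rightarrow> (real^2^2) set" for q where
  id: "mat 1 \<in> hecke_group q"
| S: "M \<in> hecke_group q \<Longrightarrow> S_mat ** M \<in> hecke_group q"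
| S_inv: "M \<in> hecke_group q \<Longrightarrow> matrix_inv S_mat ** M \<in> hecke_group q"
| T: "M \<in> hecke_group q \<Longrightarrow> T_mat q ** M \<in> hecke_group q"
| T_inv: "M \<in> hecke_group q \<Longrightarrow> matrix_inv (T_mat q) ** M \<in> hecke_group q"

definition Lambda_q :: "nat \<Rightarrow> (real^2) set" where
  "Lambda_q q = (\<lambda>M. M *v vec2 1 0) ` hecke_group q"

definition lat :: "real^2^2 \<Rightarrow> nat \<Rightarrow> (real^2) set" where
  "lat A q = (\<lambda>v. A *v v) ` Lambda_q q"

definition h_mat :: "real \<Rightarrow> real^2^2" where
  "h_mat s = mat2 1 0 (-s) 1"

definition s_mat :: "real \<Rightarrow> real^2^2" where
  "s_mat t = mat2 t 0 0 (1 / t)"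

definition g_mat :: "real \<Rightarrow> real \<Rightarrow> real^2^2" where
  "g_mat a b = mat2 a b 0 (1 / a)"

definition strip :: "real \<Rightarrow> (real^2) set" where
  "strip t = {v. 0 < v $ 1 \<and> v $ 1 \<le> t}"

definition slope :: "real^2 \<Rightarrow> real" where
  "slope v = v $ 2 / v $ 1"

definition Tq :: "nat \<Rightarrow> (real \<times> real) set" where
  "Tq q = {(a, b). 0 < a \<and> a \<le> 1 \<and> 1 - lambda_q q * a < b \<and> b \<le> 1}"

definition mq_integral :: "nat \<Rightarrow> (real \<times> real \<Rightarrow> real) \<Rightarrow> real" where
  "mq_integral q f = (LINT x : Tq q | lborel. (2 / lambda_q q) * f x)"

definition R_q :: "nat \<Rightarrow> real \<times> real \<Rightarrow> real" where
  "R_q q p = Inf {slope v | v. v \<in> lat (g_mat (fst p) (snd p)) q \<inter> strip 1 \<and> 0 < slope v}"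

definition FTR :: "nat \<Rightarrow> real^2^2 \<Rightarrow> real \<Rightarrow> real^2 \<Rightarrow> real \<times> real" where
  "FTR q A t u = (THE p. p \<in> Tq q \<and>
      lat (s_mat (1 / t) ** h_mat (slope u) ** A) q = lat (g_mat (fst p) (snd p)) q)"

definition F_set :: "nat \<Rightarrow> real^2^2 \<Rightarrow> real set \<Rightarrow> real \<Rightarrow> (real^2) set" where
  "F_set q A I t = {u \<in> lat A q \<inter> strip t. slope u \<in> I}"

definition N_count :: "nat \<Rightarrow> real^2^2 \<Rightarrow> real set \<Rightarrow> real \<Rightarrow> nat" where
  "N_count q A I t = card (F_set q A I t)"

definition rho_integral :: "nat \<Rightarrow> real^2^2 \<Rightarrow> real set \<Rightarrow> real \<Rightarrow> (real \<times> real \<Rightarrow> real) \<Rightarrow> real" where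
  "rho_integral q A I t f = (\<Sum>u\<in>F_set q A I t. f (FTR q A t u)) / real (N_count q A I t)"

end

theory Submission
  imports Defs "HOL-Probability.Conditional_Expectation"
begin

text \<open>
  A vector \<open>u = A \<gamma> e\<^sub>1\<close> of the strip of width \<open>\<tau>\<close> determines \<open>\<gamma>\<close> up to the stabiliser \<open>\<langle>T\<rangle>\<close> of \<open>e\<^sub>1\<close>, and
  asking that the first row of \<open>A \<gamma>\<close>, divided by \<open>\<tau>\<close>, lie in \<open>Tq\<close> selects exactly one \<open>\<gamma>\<close>; this first
  row is then the Farey parameter of \<open>u\<close>. So the theorem counts the visits of the expanding horocycle
  \<open>s \<mapsto> diag(1/\<tau>, \<tau>) h\<^sub>s A\<close> to the section \<open>g\<^sub>a\<^sub>,\<^sub>b\<close>, \<open>(a,b) \<in> Tq\<close>, in the quotient of \<open>SL(2,\<real>)\<close> by the Hecke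
  group. The region under the graph of the return time \<open>R_q\<close> over \<open>Tq\<close> is a fundamental domain, of finite
  volume because \<open>R_q\<close> is dominated by an integrable function.

  The horocycle flow is ergodic: an \<open>L\<^sup>1\<close> limit of Birkhoff averages is invariant under the unipotent
  \<open>u\<^sub>1\<close>, hence under \<open>diag(2, 1/2)\<close> because \<open>u\<^sub>2\<^sub>k h u\<^sub>-\<^sub>k\<close> tends to this matrix for suitable \<open>h\<close> tending to \<open>1\<close>,
  hence under the whole group. Since the geodesic flow contracts \<open>u\<^sub>k\<close>, the mean ergodic theorem for
  \<open>u\<^sub>1\<close> makes the geodesic flow mixing. Averaging over matrices near \<open>A\<close> then gives the limit of the
  counting function, because moving \<open>A\<close> a little changes the strip, the slope interval and the Farey
  parameters only a little.
\<close>

section \<open>The Hecke group\<close>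

text \<open>Mixing speaks about almost every matrix, while \<open>A\<close> is a single point, so
  only one-sided comparisons with nearby matrices are available. Counts can be bounded above,
  because a slightly wider strip and interval catch every vector after a perturbation. The Farey
  parameters may jump near the edge of \<open>Tq q\<close>, so sums are bounded below, for functions
  vanishing near that edge. Both bounds have the same constant, and with the limit of the counts the
  lower bounds for C + f and C - f determine the limit for f. Haar measure is replaced by Lebesgue
  measure on matrices of determinant in (0, 1], with functions constant on rays. The extra dimension
  contributes 1/2 to the total mass \<open>Rint / 2\<close> and also 1/2 to the integral of a
  section function over a unit window, and so cancels; for f = 1 the quotient is (lam / 2) / Rint,
  the reciprocal of the mean return time. The horocycle is cut into unit windows of renormalised
  time instead of return times: hits in the strip of width 1 are at least 1 apart, so window
  functions are bounded although \<open>R_q\<close> is not.\<close>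

text \<open>A real \<open>2 \<times> 2\<close> matrix is the pair of its rows, so that Lebesgue measure on matrices is an iterated
  product and row and column operations are shears.\<close>

type_synonym m4 = "(real \<times> real) \<times> (real \<times> real)"

section \<open>Matrix algebra on pairs of rows\<close>

definition mm :: "m4 \<Rightarrow> m4 \<Rightarrow> m4" where
  "mm A B = (fst (fst A) *\<^sub>R fst B + snd (fst A) *\<^sub>R snd B,
             fst (snd A) *\<^sub>R fst B + snd (snd A) *\<^sub>R snd B)"

definition dt :: "m4 \<Rightarrow> real" where
  "dt A = fst (fst A) * snd (snd A) - snd (fst A) * fst (snd A)"

definition adj :: "m4 \<Rightarrow> m4" where
  "adj A = ((snd (snd A), - snd (fst A)), (- fst (snd A), fst (fst A)))"

definition tup :: "real^2^2 \<Rightarrow> m4" where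
  "tup A = ((A$1$1, A$1$2), (A$2$1, A$2$2))"

abbreviation one4 :: m4 where "one4 \<equiv> ((1, 0), (0, 1))"

abbreviation S4 :: m4 where "S4 \<equiv> ((0, -1), (1, 0))"

lemma mm_tuple [simp]:
  "mm ((a, b), (c, d)) ((x, z), (y, w)) = ((a*x + b*y, a*z + b*w), (c*x + d*y, c*z + d*w))"
  by (simp add: mm_def)

lemma dt_tuple [simp]: "dt ((x, z), (y, w)) = x*w - z*y"
  by (simp add: dt_def)

lemma adj_tuple [simp]: "adj ((x, z), (y, w)) = ((w, -z), (-y, x))"
  by (simp add: adj_def)

lemma m4_cases [case_names entries]:
  fixes A :: m4
  obtains x z y w where "A = ((x, z), (y, w))"
  by (metis surj_pair)

lemma mm_assoc: "mm (mm A B) C = mm A (mm B C)"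
  by (cases A rule: m4_cases; cases B rule: m4_cases; cases C rule: m4_cases)
     (simp add: algebra_simps)

lemma mm_one [simp]: "mm one4 A = A" "mm A one4 = A"
  by (cases A rule: m4_cases; simp)+

lemma dt_mm [simp]: "dt (mm A B) = dt A * dt B"
  by (cases A rule: m4_cases; cases B rule: m4_cases) (simp add: algebra_simps)

lemma dt_adj [simp]: "dt (adj A) = dt A"
  by (cases A rule: m4_cases) (simp add: algebra_simps)

lemma mm_uminus [simp]: "mm (- A) B = - mm A B" "mm A (- B) = - mm A B"
  by (cases A rule: m4_cases; cases B rule: m4_cases; simp)+

lemma adj_mm: "adj (mm A B) = mm (adj B) (adj A)"
  by (cases A rule: m4_cases; cases B rule: m4_cases) (simp add: algebra_simps)

lemma adj_adj [simp]: "adj (adj A) = A"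
  by (cases A rule: m4_cases) simp

lemma mm_adj: "dt A = 1 \<Longrightarrow> mm A (adj A) = one4" "dt A = 1 \<Longrightarrow> mm (adj A) A = one4"
  by (cases A rule: m4_cases; simp add: algebra_simps)+

lemma mm_adj_cancel:
  assumes "dt A = 1"
  shows "mm A (mm (adj A) B) = B" "mm (adj A) (mm A B) = B"
    "mm (mm B A) (adj A) = B" "mm (mm B (adj A)) A = B"
  using mm_adj[OF assms] by (simp_all add: mm_assoc) (simp_all add: mm_assoc[symmetric])

lemma mm_scaleR [simp]: "mm (c *\<^sub>R A) B = c *\<^sub>R mm A B" "mm A (c *\<^sub>R B) = c *\<^sub>R mm A B"
  by (cases A rule: m4_cases; cases B rule: m4_cases; simp add: algebra_simps)+

lemma dt_scaleR [simp]: "dt (c *\<^sub>R A) = c\<^sup>2 * dt A"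
  by (cases A rule: m4_cases) (simp add: algebra_simps power2_eq_square)

lemma tup_mult: "tup (A ** B) = mm (tup A) (tup B)"
  by (simp add: tup_def matrix_matrix_mult_def sum_2)

lemma tup_mat2 [simp]: "tup (mat2 a b c d) = ((a, b), (c, d))"
  by (simp add: tup_def mat2_def)

lemma tup_mat1 [simp]: "tup (mat 1) = one4"
  by (simp add: tup_def mat_def)

lemma dt_tup: "dt (tup A) = det A"
  by (simp add: tup_def det_2)

lemma tup_matrix_inv:
  assumes "det A = 1"
  shows "tup (matrix_inv A) = adj (tup A)"
proof -
  have "A ** matrix_inv A = mat 1 \<and> matrix_inv A ** A = mat 1"
    unfolding matrix_inv_def
    by (rule someI_ex) (use assms in \<open>simp add: invertible_det_nz[symmetric, unfolded invertible_def]
          invertible_def[symmetric] invertible_det_nz\<close>)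
  then have "mm (tup A) (tup (matrix_inv A)) = one4"
    by (metis tup_mult tup_mat1)
  then have "mm (adj (tup A)) (mm (tup A) (tup (matrix_inv A))) = adj (tup A)"
    by simp
  then show ?thesis
    using mm_adj_cancel(2)[of "tup A"] assms by (simp add: dt_tup)
qed

section \<open>Sine quotients and the group generated by \<open>S4\<close> and
  \<open>T4\<close>\<close>

locale hecke =
  fixes q :: nat
  assumes q3: "q \<ge> 3"
begin

definition lam :: real where "lam = lambda_q q"

definition th :: real where "th = pi / real q"

text \<open>These are the entries of the powers of the elliptic element \<open>U = T S\<close>, see \<open>Uj\<close> below.\<close>

definition sg :: "real \<Rightarrow> real" where "sg x = sin (x * th) / sin th"

lemma th_bounds: "0 < th" "th \<le> pi / 3"
  using q3 by (auto simp: th_def divide_simps)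

lemma sin_th_pos: "sin th > 0"
  using th_bounds by (intro sin_gt_zero) (auto intro: order.strict_trans1)

lemma lam_eq: "lam = 2 * cos th"
  by (simp add: lam_def lambda_q_def th_def)

lemma lam_bounds: "1 \<le> lam" "lam < 2" "0 < lam"
proof -
  have "cos (pi / 3) \<le> cos th"
    using th_bounds pi_gt_zero by (intro cos_monotone_0_pi_le) auto
  then show "1 \<le> lam" by (simp add: lam_eq cos_60)
  then show "0 < lam" by simp
  have "cos th < cos 0"
    using th_bounds pi_gt_zero by (intro cos_monotone_0_pi) auto
  then show "lam < 2" by (simp add: lam_eq)
qed

lemma q_th: "real q * th = pi"
  using q3 by (simp add: th_def)

lemma sg_rec: "sg (x + 1) = lam * sg x - sg (x - 1)"
  using sin_th_pos by (simp add: sg_def lam_eq field_simps sin_add sin_diff)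

lemma sg_01 [simp]: "sg 0 = 0" "sg 1 = 1" "sg (-1) = -1"
  using sin_th_pos by (simp_all add: sg_def)

lemma sg_q: "sg (real q - x) = sg x"
proof -
  have "sin ((real q - x) * th) = sin (x * th)"
    using q_th by (simp add: left_diff_distrib)
  then show ?thesis by (simp add: sg_def)
qed

lemma sg_2 [simp]: "sg 2 = lam"
  using sg_rec[of 1] by simp

text \<open>The sine increases up to pi/2, and q times \<open>th\<close> is pi, so the reflection of
  x to q - x covers the other half. The bound 1, attained at x = 1, is the origin of the gap between
  0 and 1 in the entries of the group.\<close>

lemma sg_ge_1:
  assumes "1 \<le> x" "x \<le> real q - 1"
  shows "1 \<le> sg x"
proof -
  have *: "sin th \<le> sin (x * th)" if "1 \<le> x" "x * th \<le> pi / 2" for x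
    using that th_bounds by (intro sin_monotone_2pi_le) (auto simp: field_simps intro: order_trans)
  have "sin th \<le> sin (x * th)"
  proof (cases "x * th \<le> pi / 2")
    case True
    then show ?thesis using * assms by simp
  next
    case False
    have "sin th \<le> sin ((real q - x) * th)"
      using assms False q_th by (intro *) (auto simp: left_diff_distrib)
    also have "sin ((real q - x) * th) = sin (x * th)"
      using q_th by (simp add: left_diff_distrib)
    finally show ?thesis .
  qed
  then show ?thesis using sin_th_pos by (simp add: sg_def)
qed

text \<open>This is the determinant of \<open>Uj x\<close> and of \<open>Mj x\<close>. It comes from
  sin(u)^2 - sin(u + v) sin(u - v) = sin(v)^2 with v = \<open>th\<close>.\<close>

lemma sg_det: "sg x * sg x - sg (x + 1) * sg (x - 1) = 1"
proof -
  have alg: "s * s - (s * C + c * S) * (s * C - c * S) = S * S"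
    if "s * s + c * c = 1" "S * S + C * C = 1" for s c S C :: real
    using that by algebra
  have "sin (x*th) * sin (x*th) - sin ((x+1)*th) * sin ((x-1)*th) = (sin th)\<^sup>2"
    using alg[of "sin (x*th)" "cos (x*th)" "sin th" "cos th"]
      sin_cos_squared_add[of "x*th"] sin_cos_squared_add[of th]
    by (simp add: distrib_right left_diff_distrib sin_add sin_diff power2_eq_square)
  then show ?thesis
    using sin_th_pos by (simp add: sg_def power2_eq_square divide_simps)
qed

abbreviation T4 :: m4 where "T4 \<equiv> ((1, lam), (0, 1))"

inductive_set Gam :: "m4 set" where
  one: "one4 \<in> Gam"
| S: "M \<in> Gam \<Longrightarrow> mm S4 M \<in> Gam"
| S_inv: "M \<in> Gam \<Longrightarrow> mm (adj S4) M \<in> Gam"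
| T: "M \<in> Gam \<Longrightarrow> mm T4 M \<in> Gam"
| T_inv: "M \<in> Gam \<Longrightarrow> mm (adj T4) M \<in> Gam"

lemma tup_S: "tup S_mat = S4" and tup_T: "tup (T_mat q) = T4"
  by (simp_all add: S_mat_def T_mat_def lam_def)

lemma tup_S_inv: "tup (matrix_inv S_mat) = adj S4"
  by (subst tup_matrix_inv) (simp_all add: tup_S flip: dt_tup)

lemma tup_T_inv: "tup (matrix_inv (T_mat q)) = adj T4"
  by (subst tup_matrix_inv) (simp_all add: tup_T flip: dt_tup)

lemma Gam_eq: "Gam = tup ` hecke_group q"
proof (intro equalityI subsetI)
  fix M assume "M \<in> Gam"
  then show "M \<in> tup ` hecke_group q"
  proof induction
    case one
    then show ?case using hecke_group.id by (metis image_eqI tup_mat1)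
  next
    case (S M)
    then show ?case using hecke_group.S by (metis (no_types) imageE image_eqI tup_mult tup_S)
  next
    case (S_inv M)
    then show ?case using hecke_group.S_inv by (metis (no_types) imageE image_eqI tup_mult tup_S_inv)
  next
    case (T M)
    then show ?case using hecke_group.T by (metis (no_types) imageE image_eqI tup_mult tup_T)
  next
    case (T_inv M)
    then show ?case using hecke_group.T_inv by (metis (no_types) imageE image_eqI tup_mult tup_T_inv)
  qed
next
  fix M assume "M \<in> tup ` hecke_group q"
  then obtain N where "N \<in> hecke_group q" "M = tup N" by blast
  then show "M \<in> Gam"
  proof (induction arbitrary: M)
    case id then show ?case using Gam.one by simp
  next
    case (S N) then show ?case using Gam.S by (simp only: tup_mult tup_S)
  next
    case (S_inv N) then show ?case using Gam.S_inv by (simp only: tup_mult tup_S_inv)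
  next
    case (T N) then show ?case using Gam.T by (simp only: tup_mult tup_T)
  next
    case (T_inv N) then show ?case using Gam.T_inv by (simp only: tup_mult tup_T_inv)
  qed
qed

lemma dt_Gam: "M \<in> Gam \<Longrightarrow> dt M = 1"
  by (induction rule: Gam.induct) simp_all

lemma Gam_mm: "M \<in> Gam \<Longrightarrow> N \<in> Gam \<Longrightarrow> mm M N \<in> Gam"
  by (induction rule: Gam.induct) (simp_all only: mm_assoc mm_one Gam.intros)

lemma S_Gam: "S4 \<in> Gam" and T_Gam: "T4 \<in> Gam" and Si_Gam: "adj S4 \<in> Gam" and Ti_Gam: "adj T4 \<in> Gam"
  using Gam.S[OF Gam.one] Gam.T[OF Gam.one] Gam.S_inv[OF Gam.one] Gam.T_inv[OF Gam.one] by simp_all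

lemma Gam_adj: "M \<in> Gam \<Longrightarrow> adj M \<in> Gam"
proof (induction rule: Gam.induct)
  case one then show ?case using Gam.one by simp
qed (simp_all only: adj_mm adj_adj Gam_mm S_Gam T_Gam Si_Gam Ti_Gam)

text \<open>\<open>S4\<close> squares to minus the identity.\<close>

lemma Gam_uminus: "M \<in> Gam \<Longrightarrow> - M \<in> Gam"
  using Gam.S[OF Gam.S] by (cases M rule: m4_cases) force

lemma Gam_Tpow: "((1, of_int k * lam), (0, 1)) \<in> Gam"
proof (induction k rule: int_induct[where k = 0])
  case base then show ?case using Gam.one by simp
next
  case (step1 i)
  then show ?case using Gam.T[OF step1(2)] by (simp add: algebra_simps)
next
  case (step2 i)
  then show ?case using Gam.T_inv[OF step2(2)] by (simp add: algebra_simps)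
qed

text \<open>The index is real so that \<open>sg (x - 1)\<close> is -1 at x = 0, where natural
  subtraction would truncate. Hence \<open>Uj 0\<close> is the identity and \<open>Uj j\<close> is
  the j-th power of T S.\<close>

definition Uj :: "real \<Rightarrow> m4" where
  "Uj x = ((sg (x + 1), - sg x), (sg x, - sg (x - 1)))"

lemma Uj_step: "mm (mm T4 S4) (Uj x) = Uj (x + 1)"
  using sg_rec[of "x + 1"] sg_rec[of x] by (simp add: Uj_def algebra_simps)

lemma Uj_Gam: "Uj (real j) \<in> Gam"
proof (induction j)
  case 0 then show ?case using Gam.one by (simp add: Uj_def)
next
  case (Suc j)
  have "mm (mm T4 S4) (Uj j) \<in> Gam" using Suc by (intro Gam_mm T_Gam S_Gam)
  then show ?case by (subst (asm) Uj_step) (simp add: add.commute)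
qed

section \<open>Discreteness of the group\<close>

text \<open>Every element of the group is, up to sign and multiplication by \<open>S\<close> on either side, a product of
  the nonnegative matrices \<open>Mj j\<close>, whose entries lie in \<open>{0} \<union> [1,\<infinity>)\<close>; that set is closed under
  sums and products. This is the discreteness of the group.\<close>

definition Mj :: "real \<Rightarrow> m4" where
  "Mj x = ((sg x, sg (x + 1)), (sg (x - 1), sg x))"

text \<open>\<open>Mj j\<close> is the j-th power of T S times the inverse of \<open>S4\<close>, and
  the q-th power of T S is minus the identity. So these are, up to sign, the words in which powers
  of T S with exponents from 1 to q - 1 alternate with \<open>S4\<close>.\<close>

inductive_set X0 :: "m4 set" where
  one: "one4 \<in> X0"
| S: "S4 \<in> X0"
| neg: "M \<in> X0 \<Longrightarrow> - M \<in> X0"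
| Mj: "M \<in> X0 \<Longrightarrow> 1 \<le> j \<Longrightarrow> j \<le> q - 1 \<Longrightarrow> mm (Mj (real j)) M \<in> X0"

definition big :: "real \<Rightarrow> bool" where "big x \<longleftrightarrow> x = 0 \<or> 1 \<le> x"

lemma big_add: "big x \<Longrightarrow> big y \<Longrightarrow> big (x + y)"
  by (auto simp: big_def)

lemma big_mult: "big x \<Longrightarrow> big y \<Longrightarrow> big (x * y)"
  by (auto simp: big_def mult_ge1_I)

definition big4 :: "m4 \<Rightarrow> bool" where
  "big4 M \<longleftrightarrow> big (fst (fst M)) \<and> big (snd (fst M)) \<and> big (fst (snd M)) \<and> big (snd (snd M))"

lemma big4_mm: "big4 A \<Longrightarrow> big4 B \<Longrightarrow> big4 (mm A B)"
  by (cases A rule: m4_cases; cases B rule: m4_cases) (simp add: big4_def big_add big_mult)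

lemma big_sg: "j \<le> q \<Longrightarrow> big (sg (real j))"
proof -
  assume j: "j \<le> q"
  consider "j = 0" | "j = q" | "1 \<le> j" "j \<le> q - 1" using j by linarith
  then show ?thesis
  proof cases
    case 3
    then have "1 \<le> sg (real j)" using q3 by (intro sg_ge_1) auto
    then show ?thesis by (simp add: big_def)
  qed (use sg_q[of 0] in \<open>simp_all add: big_def\<close>)
qed

lemma big4_Mj: "1 \<le> j \<Longrightarrow> j \<le> q - 1 \<Longrightarrow> big4 (Mj (real j))"
  using big_sg[of j] big_sg[of "j + 1"] big_sg[of "j - 1"] q3
  by (simp add: big4_def Mj_def of_nat_diff add.commute)

text \<open>Factors are added on the left only, so a separate \<open>S4\<close> can stand only at
  the right end, and the nonnegative factors collect in N.\<close>

lemma X0_big: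
  assumes "M \<in> X0"
  shows "\<exists>N. big4 N \<and> (M = N \<or> M = - N \<or> M = mm N S4 \<or> M = - mm N S4)"
  using assms
proof induction
  case one
  show ?case by (rule exI[of _ one4]) (auto simp: big4_def big_def)
next
  case S
  show ?case by (rule exI[of _ one4]) (auto simp: big4_def big_def)
next
  case (neg M)
  then show ?case by (metis minus_minus)
next
  case (Mj M j)
  then obtain N where N: "big4 N" "M = N \<or> M = - N \<or> M = mm N S4 \<or> M = - mm N S4" by blast
  then show ?case using Mj.hyps big4_mm[OF big4_Mj N(1), of j]
    by (intro exI[of _ "mm (Mj (real j)) N"]) (metis mm_assoc mm_uminus(2))
qed

definition U4 :: m4 where "U4 = mm T4 S4"

lemma U4_eq: "U4 = ((lam, -1), (1, 0))"
  by (simp add: U4_def)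

lemma Mj_1: "Mj 1 = T4" using sg_2 by (simp add: Mj_def)

lemma U_Mj: "mm U4 (Mj x) = Mj (x + 1)"
  using sg_rec[of "x + 1"] sg_rec[of x] by (simp add: Mj_def U4_eq algebra_simps)

lemma Mj_q: "Mj (real q) = S4"
  using sg_q[of 0] sg_q[of 1] sg_q[of "-1"] by (simp add: Mj_def)

text \<open>Allowing one \<open>S4\<close> on the left makes the set stable under left
  multiplication by \<open>S4\<close> and \<open>U4\<close>, hence by the generators of the group,
  since T is minus \<open>U4\<close> times \<open>S4\<close>.\<close>

definition Hs :: "m4 set" where "Hs = X0 \<union> mm S4 ` X0"

lemma Hs_uminus: "M \<in> Hs \<Longrightarrow> - M \<in> Hs"
  unfolding Hs_def using X0.neg mm_uminus(2)[symmetric] by blast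

lemma Hs_S: "M \<in> Hs \<Longrightarrow> mm S4 M \<in> Hs"
proof -
  have "mm S4 (mm S4 M) = - M" for M
    by (cases M rule: m4_cases) simp
  then show "M \<in> Hs \<Longrightarrow> mm S4 M \<in> Hs"
    using X0.neg by (auto simp: Hs_def)
qed

text \<open>\<open>U4\<close> raises the index of the leading factor \<open>Mj j\<close> by one. At
  index q that factor has become \<open>S4\<close>, which is the left factor that \<open>Hs\<close>
  permits.\<close>

lemma Hs_U:
  assumes "M \<in> Hs" shows "mm U4 M \<in> Hs"
proof -
  have MjX: "mm T4 N \<in> X0" if "N \<in> X0" for N
    using X0.Mj[OF that, of 1] q3 by (simp add: Mj_1)
  have "mm U4 M \<in> Hs" if "M \<in> X0" for M
    using that
  proof induction
    case one
    then show ?case using MjX[OF X0.S] by (simp add: U4_def Hs_def)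
  next
    case S
    then show ?case using X0.neg[OF MjX[OF X0.one]] by (simp add: U4_def Hs_def)
  next
    case (neg M)
    then show ?case using Hs_uminus by simp
  next
    case (Mj M j)
    have "mm U4 (mm (Mj (real j)) M) = mm (Mj (real (j + 1))) M"
      using U_Mj[of "real j"] by (simp add: add.commute flip: mm_assoc)
    moreover have "mm (Mj (real (j + 1))) M \<in> Hs"
    proof (cases "j + 1 = q")
      case True
      have "mm S4 M \<in> Hs" using Mj(1) by (auto simp: Hs_def)
      then show ?thesis by (simp only: True Mj_q)
    next
      case False
      then have "mm (Mj (real (j + 1))) M \<in> X0" using Mj by (intro X0.Mj) auto
      then show ?thesis by (simp add: Hs_def)
    qed
    ultimately show ?case by simp
  qed
  moreover have "mm U4 (mm S4 M) \<in> Hs" if "M \<in> X0" for M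
  proof -
    have "mm U4 (mm S4 M) = - mm T4 M"
      by (cases M rule: m4_cases) (simp add: U4_eq)
    then show ?thesis using X0.neg[OF MjX[OF that]] by (simp add: Hs_def)
  qed
  ultimately show ?thesis using assms unfolding Hs_def by blast
qed

lemma Hs_Uj: "M \<in> Hs \<Longrightarrow> mm (Uj (real j)) M \<in> Hs"
proof (induction j)
  case 0
  then show ?case by (simp add: Uj_def)
next
  case (Suc j)
  have "mm (Uj (real (Suc j))) M = mm U4 (mm (Uj (real j)) M)"
    using Uj_step[of j] by (simp add: U4_def add.commute flip: mm_assoc)
  then show ?case using Suc Hs_U by simp
qed

lemma Gam_Hs: "M \<in> Gam \<Longrightarrow> M \<in> Hs"
proof (induction rule: Gam.induct)
  case one
  then show ?case using X0.one by (auto simp: Hs_def)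
next
  case (S M)
  then show ?case by (intro Hs_S)
next
  case (S_inv M)
  have "mm (adj S4) M = - mm S4 M" by (cases M rule: m4_cases) simp
  then show ?case using Hs_uminus Hs_S[OF S_inv(2)] by simp
next
  case (T M)
  have "mm T4 M = - mm U4 (mm S4 M)" by (cases M rule: m4_cases) (simp add: U4_eq)
  then show ?case using Hs_uminus Hs_U Hs_S[OF T(2)] by simp
next
  case (T_inv M)
  \<comment> \<open>Only nonnegative powers of \<open>U4\<close> are at hand; its inverse is minus
    its power with exponent q - 1.\<close>
  have "Uj (real (q - 1)) = ((0, -1), (1, - lam))"
    using q3 sg_q[of 0] sg_q[of 1] sg_q[of 2]
    by (simp add: Uj_def of_nat_diff)
  then have "mm (adj T4) M = - mm S4 (mm (Uj (real (q - 1))) M)"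
    by (cases M rule: m4_cases) simp
  then show ?case using Hs_uminus Hs_S Hs_Uj[OF T_inv(2)] by simp
qed

text \<open>The normal form puts the entries in {0} or [1, \<infinity>) up to sign, and a factor
  \<open>S4\<close> only permutes them and changes signs. The gap separates slopes of lattice
  vectors and forces small entries to vanish.\<close>

lemma Gam_entries:
  assumes "((x, z), (y, w)) \<in> Gam"
  shows "x = 0 \<or> 1 \<le> \<bar>x\<bar>" "z = 0 \<or> 1 \<le> \<bar>z\<bar>" "y = 0 \<or> 1 \<le> \<bar>y\<bar>" "w = 0 \<or> 1 \<le> \<bar>w\<bar>"
proof -
  define P where "P M \<longleftrightarrow> (\<forall>e\<in>{fst (fst M), snd (fst M), fst (snd M), snd (snd M)}. e = 0 \<or> 1 \<le> \<bar>e\<bar>)"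
    for M :: m4
  have *: "P M" if M: "M \<in> X0" for M
  proof -
    obtain N where "big4 N" "M = N \<or> M = - N \<or> M = mm N S4 \<or> M = - mm N S4"
      using X0_big[OF M] by blast
    then show ?thesis
      by (cases N rule: m4_cases) (auto simp: P_def big4_def big_def)
  qed
  have "P (mm S4 M)" if "P M" for M
    using that by (cases M rule: m4_cases) (auto simp: P_def)
  then have "P M" if "M \<in> Gam" for M
    using Gam_Hs[OF that] * unfolding Hs_def by blast
  from this[OF assms] show "x = 0 \<or> 1 \<le> \<bar>x\<bar>" "z = 0 \<or> 1 \<le> \<bar>z\<bar>" "y = 0 \<or> 1 \<le> \<bar>y\<bar>" "w = 0 \<or> 1 \<le> \<bar>w\<bar>"
    by (auto simp: P_def)
qed

text \<open>Because \<open>lam\<close> is below 2, the remainder modulo \<open>lam\<close> nearest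
  to 0 is strictly below 1 in absolute value, where the entry gap leaves only 0.\<close>

lemma round_lam: "\<bar>z - of_int (round (z / lam)) * lam\<bar> < 1"
proof -
  have "\<bar>of_int (round (z / lam)) - z / lam\<bar> * lam \<le> 1/2 * lam"
    using lam_bounds by (intro mult_right_mono of_int_round_abs_le) auto
  also have "\<bar>of_int (round (z / lam)) - z / lam\<bar> * lam = \<bar>(of_int (round (z / lam)) - z / lam) * lam\<bar>"
    using lam_bounds by (simp add: abs_mult)
  also have "\<dots> = \<bar>z - of_int (round (z / lam)) * lam\<bar>"
    using lam_bounds by (simp add: left_diff_distrib abs_minus_commute)
  finally show ?thesis using lam_bounds by simp
qed

text \<open>The diagonal entries have product 1 and absolute value at least 1, so both are 1 or both
  are -1. A power of T then brings the corner below 1, hence to 0.\<close>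

lemma Gam_upper:
  assumes "((x, z), (0, w)) \<in> Gam"
  shows "\<exists>k::int. ((x, z), (0::real, w)) = ((1, of_int k * lam), (0, 1))
    \<or> ((x, z), (0::real, w)) = - ((1, of_int k * lam), (0, 1))"
proof -
  have xw: "x * w = 1" using dt_Gam[OF assms] by simp
  then have nz: "1 \<le> \<bar>x\<bar>" "1 \<le> \<bar>w\<bar>" using Gam_entries[OF assms] by auto
  have "\<bar>x\<bar> * \<bar>w\<bar> = 1" using xw by (metis abs_mult abs_one)
  then have "\<bar>x\<bar> = 1" using nz
    by (metis abs_ge_zero antisym mult.right_neutral mult_left_mono zero_less_one_class.zero_le_one)
  then have x: "x = 1 \<and> w = 1 \<or> x = -1 \<and> w = -1" using xw by (auto simp: abs_if split: if_splits)
  define k where "k = round (z * x / lam)"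
  have "mm ((x, z), (0, w)) ((1, of_int (- k) * lam), (0, 1)) \<in> Gam"
    by (intro Gam_mm assms Gam_Tpow)
  then have "((x, z - x * of_int k * lam), (0, w)) \<in> Gam" by (simp add: algebra_simps)
  from Gam_entries(2)[OF this] have "z - x * of_int k * lam = 0"
    using round_lam[of "z * x"] x by (auto simp: k_def abs_minus_commute)
  then show ?thesis using x by (intro exI[of _ k]) auto
qed

text \<open>The same reduction, applied to the entry above a 1. It serves to recover the second
  Farey coordinate from the lattice.\<close>

lemma Gam_unit_row:
  assumes "((x, z), (1, w)) \<in> Gam"
  shows "\<exists>k::int. x = of_int k * lam"
proof -
  define k where "k = round (x / lam)"
  have "mm ((1, of_int (- k) * lam), (0, 1)) ((x, z), (1, w)) \<in> Gam"
    by (intro Gam_mm assms Gam_Tpow)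
  then have "((x - of_int k * lam, z - of_int k * lam * w), (1, w)) \<in> Gam" by (simp add: algebra_simps)
  from Gam_entries(1)[OF this] show ?thesis
    using round_lam[of x] by (auto simp: k_def)
qed

text \<open>Conjugation by diag(1, -1) sends each generator to its inverse. This symmetry reverses
  the order of slopes.\<close>

lemma Gam_reflect: "((x, z), (y, w)) \<in> Gam \<Longrightarrow> ((x, -z), (-y, w)) \<in> Gam"
proof -
  have "mm ((1, 0), (0, -1)) (mm M ((1, 0), (0, -1))) \<in> Gam" if "M \<in> Gam" for M
    using that
  proof induction
    case one then show ?case using Gam.one by simp
  next
    case (S M)
    then show ?case using Gam.S_inv[OF S(2)] by (cases M rule: m4_cases) simp
  next
    case (S_inv M)
    then show ?case using Gam.S[OF S_inv(2)] by (cases M rule: m4_cases) simp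
  next
    case (T M)
    then show ?case using Gam.T_inv[OF T(2)] by (cases M rule: m4_cases) (simp add: algebra_simps)
  next
    case (T_inv M)
    then show ?case using Gam.T[OF T_inv(2)] by (cases M rule: m4_cases) (simp add: algebra_simps)
  qed
  from this[of "((x, z), (y, w))"] show "((x, z), (y, w)) \<in> Gam \<Longrightarrow> ((x, -z), (-y, w)) \<in> Gam" by simp
qed

lemma countable_Gam: "countable Gam"
proof -
  define step where "step M n = mm (if n = 0 then S4 else if n = 1 then adj S4 else if n = 2 then T4 else adj T4) M"
    for M and n :: nat
  have step: "step M 0 = mm S4 M" "step M 1 = mm (adj S4) M" "step M 2 = mm T4 M" "step M 3 = mm (adj T4) M"
    for M by (simp_all add: step_def)
  have "Gam \<subseteq> (\<lambda>ns. foldl step one4 ns) ` UNIV"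
  proof
    fix M assume "M \<in> Gam"
    then show "M \<in> (\<lambda>ns. foldl step one4 ns) ` UNIV"
    proof induction
      case one then show ?case by (auto intro: image_eqI[of _ _ "[]"])
    next
      case (S M)
      then obtain ns where "M = foldl step one4 ns" by auto
      then show ?case by (intro image_eqI[of _ _ "ns @ [0]"]) (simp_all only: foldl_append foldl.simps step UNIV_I)
    next
      case (S_inv M)
      then obtain ns where "M = foldl step one4 ns" by auto
      then show ?case by (intro image_eqI[of _ _ "ns @ [1]"]) (simp_all only: foldl_append foldl.simps step UNIV_I)
    next
      case (T M)
      then obtain ns where "M = foldl step one4 ns" by auto
      then show ?case by (intro image_eqI[of _ _ "ns @ [2]"]) (simp_all only: foldl_append foldl.simps step UNIV_I)
    next
      case (T_inv M)
      then obtain ns where "M = foldl step one4 ns" by auto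
      then show ?case by (intro image_eqI[of _ _ "ns @ [3]"]) (simp_all only: foldl_append foldl.simps step UNIV_I)
    qed
  qed
  then show ?thesis by (rule countable_subset) (intro countable_image countableI_type)
qed

end

section \<open>Lattice vectors in a strip\<close>

definition sl :: "m4 \<Rightarrow> real" where "sl M = fst (snd M) / fst (fst M)"

lemma sl_tuple [simp]: "sl ((x, z), (y, w)) = y / x"
  by (simp add: sl_def)

lemma sl_scaleR [simp]: "c \<noteq> 0 \<Longrightarrow> sl (c *\<^sub>R M) = sl M"
  by (cases M rule: m4_cases) simp

context hecke
begin

lemma Tq_iff: "(a, b) \<in> Tq q \<longleftrightarrow> 0 < a \<and> a \<le> 1 \<and> 1 - lam * a < b \<and> b \<le> 1"
  by (simp add: Tq_def lam_def)

text \<open>A matrix is first scaled to determinant 1. The condition on the second entry of the first row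
  selects one representative modulo right multiplication by powers of \<open>T\<close>.\<close>

definition hit :: "real \<Rightarrow> m4 \<Rightarrow> bool" where
  "hit t M \<longleftrightarrow> 0 < dt M \<and> (1 / (t * sqrt (dt M))) *\<^sub>R fst M \<in> Tq q"

lemma hit_scaleR [simp]:
  assumes "c > 0" shows "hit t (c *\<^sub>R M) \<longleftrightarrow> hit t M"
proof -
  have "sqrt (dt (c *\<^sub>R M)) = c * sqrt (dt M)"
    using assms by (simp add: real_sqrt_mult)
  then show ?thesis using assms by (cases M rule: m4_cases) (simp add: hit_def zero_less_mult_iff)
qed

lemma hit_iff:
  assumes "dt ((x, z), (y, w)) = d" "0 < d" "0 < t"
  shows "hit t ((x, z), (y, w)) \<longleftrightarrow> 0 < x \<and> x \<le> t * sqrt d \<and> t * sqrt d - lam * x < z \<and> z \<le> t * sqrt d"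
proof -
  have p: "0 < t * sqrt d" using assms by simp
  have "hit t ((x, z), (y, w)) \<longleftrightarrow> (x / (t * sqrt d), z / (t * sqrt d)) \<in> Tq q"
    unfolding hit_def using assms by simp
  also have "\<dots> \<longleftrightarrow> 0 < x \<and> x \<le> t * sqrt d \<and> t * sqrt d - lam * x < z \<and> z \<le> t * sqrt d"
  proof -
    have "1 - lam * (x / T) < z / T \<longleftrightarrow> T - lam * x < z" if "0 < T" for T :: real
    proof -
      have "1 - lam * (x / T) = (T - lam * x) / T" using that by (simp add: diff_divide_distrib)
      then show ?thesis using that by (simp add: divide_less_cancel)
    qed
    from this[OF p] show ?thesis using p by (simp add: Tq_iff zero_less_divide_iff)
  qed
  finally show ?thesis .
qed

lemma Gam_pos_stab:
  assumes "((p, r), (0, v)) \<in> Gam" "0 < p"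
  shows "\<exists>k::int. p = 1 \<and> r = of_int k * lam \<and> v = 1"
  using Gam_upper[OF assms(1)] assms(2) by auto

text \<open>If s is the lower left entry of g, the slopes differ by s d / (x x'), where x and x' are
  at most t sqrt d and \<bar>s\<bar> is 0 or at least 1. For s = 0 positivity of x and x' makes g a
  power of T, and the half-open window of length \<open>lam\<close> x for the second entry admits
  only the exponent 0.\<close>

lemma hit_gap:
  assumes t: "0 < t" and N: "hit t N" and g: "g \<in> Gam" "hit t (mm N g)" "g \<noteq> one4"
  shows "1 / t\<^sup>2 \<le> \<bar>sl (mm N g) - sl N\<bar>"
proof -
  obtain x z y w where Ne: "N = ((x, z), (y, w))" by (cases N rule: m4_cases)
  obtain p r s v where ge: "g = ((p, r), (s, v))" by (cases g rule: m4_cases)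
  define d where "d = dt N"
  have d: "0 < d" using N by (simp add: hit_def d_def)
  have dg: "dt (mm N g) = d" using dt_Gam[OF g(1)] by (simp add: d_def)
  define T where "T = t * sqrt d"
  have h1: "0 < x" "x \<le> T" "T - lam * x < z" "z \<le> T"
    using N hit_iff[of x z y w d t] d t by (simp_all add: Ne d_def T_def)
  define x' where "x' = x * p + z * s"
  define z' where "z' = x * r + z * v"
  define y' where "y' = y * p + w * s"
  define w' where "w' = y * r + w * v"
  note e' = x'_def z'_def y'_def w'_def
  have mN: "mm N g = ((x', z'), (y', w'))" by (simp add: Ne ge e')
  have h2: "0 < x'" "x' \<le> T" "T - lam * x' < z'" "z' \<le> T"
    using g(2) hit_iff[of x' z' y' w' d t] dg d t by (simp_all add: mN T_def)
  have s0: "s \<noteq> 0"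
  proof
    assume s: "s = 0"
    then have "x' = x * p" by (simp add: e')
    then have "0 < p" using h1 h2 by (simp add: zero_less_mult_iff)
    then obtain k :: int where k: "p = 1" "r = of_int k * lam" "v = 1"
      using Gam_pos_stab[of p r v] g(1) s by (auto simp: ge)
    have "x' = x" "z' = z + of_int k * (lam * x)" by (simp_all add: e' k s)
    then have "\<bar>of_int k * (lam * x)\<bar> < lam * x" using h1 h2 by (simp add: abs_less_iff)
    then have "\<bar>of_int k\<bar> * (lam * x) < 1 * (lam * x)" using h1 lam_bounds by (simp add: abs_mult)
    then have "\<bar>of_int k :: real\<bar> < 1" using h1 lam_bounds by (simp add: mult_less_cancel_right)
    then have "k = 0" by linarith
    then show False using g(3) by (simp add: ge s k)
  qed
  then have s1: "1 \<le> \<bar>s\<bar>" using Gam_entries(3)[of p r s v] g(1) by (simp add: ge)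
  have "sl (mm N g) - sl N = (x * y' - y * x') / (x * x')"
    using h1 h2 unfolding mN by (simp add: Ne field_simps)
  also have "x * y' - y * x' = s * d"
    by (simp add: e' d_def Ne algebra_simps)
  finally have "\<bar>sl (mm N g) - sl N\<bar> = \<bar>s\<bar> * d / (x * x')"
    using h1 h2 d by (simp add: abs_mult)
  moreover have "1 / t\<^sup>2 = 1 * d / (T * T)"
    using d t by (simp add: T_def field_simps power2_eq_square)
  moreover have "1 * d / (T * T) \<le> \<bar>s\<bar> * d / (x * x')"
    using h1 h2 s1 d by (intro frac_le mult_mono mult_right_mono) auto
  ultimately show ?thesis by simp
qed

lemma shift_to_window:
  assumes "0 < x" shows "\<exists>k::int. T - lam * x < z + of_int k * lam * x \<and> z + of_int k * lam * x \<le> T"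
proof -
  define k where "k = \<lfloor>(T - z) / (lam * x)\<rfloor>"
  have p: "0 < lam * x" using assms lam_bounds by simp
  have "of_int k \<le> (T - z) / (lam * x)" "(T - z) / (lam * x) < of_int k + 1"
    by (simp_all add: k_def)
  then have "of_int k * (lam * x) \<le> T - z" "T - z < (of_int k + 1) * (lam * x)"
    using p by (simp_all add: pos_le_divide_eq pos_divide_less_eq)
  then show ?thesis by (intro exI[of _ k]) (simp add: algebra_simps)
qed

lemma hit_shift:
  assumes "dt ((x, z), (y, w)) = d" "0 < d" "0 < t" "0 < x" "x \<le> t * sqrt d"
  shows "\<exists>k::int. hit t (mm ((x, z), (y, w)) ((1, of_int k * lam), (0, 1)))"
proof -
  obtain k :: int where k: "t * sqrt d - lam * x < z + of_int k * lam * x" "z + of_int k * lam * x \<le> t * sqrt d"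
    using shift_to_window[OF assms(4)] by blast
  have "dt (mm ((x, z), (y, w)) ((1, of_int k * lam), (0, 1))) = d"
    using assms(1) by (simp only: dt_mm) simp
  then show ?thesis
    using k assms hit_iff[of x "z + of_int k * lam * x" y "w + of_int k * lam * y" d t]
    by (intro exI[of _ k]) (simp add: algebra_simps)
qed

text \<open>A power of T on the right fixes the first column and shifts the second entry of the
  first row by multiples of \<open>lam\<close> x. So a group element whose column lies in the strip
  can be traded for a hit with the same column.\<close>

lemma hit_of_column:
  assumes d: "dt M = d" "0 < d" and t: "0 < t" and g: "g \<in> Gam"
    and x: "0 < fst (fst (mm M g))" "fst (fst (mm M g)) \<le> t * sqrt d"
  shows "\<exists>g'\<in>Gam. hit t (mm M g') \<and> sl (mm M g') = sl (mm M g)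
    \<and> fst (fst (mm M g')) = fst (fst (mm M g)) \<and> fst (snd (mm M g')) = fst (snd (mm M g))"
proof -
  obtain x z y w where e: "mm M g = ((x, z), (y, w))" by (cases "mm M g" rule: m4_cases)
  have "dt ((x, z), (y, w)) = d" using d dt_Gam[OF g] by (metis dt_mm e mult.right_neutral)
  from hit_shift[OF this d(2) t] x obtain k :: int
    where k: "hit t (mm ((x, z), (y, w)) ((1, of_int k * lam), (0, 1)))" by (auto simp: e)
  have "mm M (mm g ((1, of_int k * lam), (0, 1))) = mm ((x, z), (y, w)) ((1, of_int k * lam), (0, 1))"
    by (simp only: e[symmetric] mm_assoc)
  then show ?thesis
    using k Gam_mm[OF g Gam_Tpow[of k]]
    by (intro bexI[of _ "mm g ((1, of_int k * lam), (0, 1))"]) (simp_all add: e)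
qed

section \<open>Neighbouring strip vectors\<close>

text \<open>The linear forms \<open>L j = a \<cdot> sg (j + 1) + b \<cdot> sg j\<close> satisfy
  \<open>sg j \<cdot> L (j - 1) = sg (j - 1) \<cdot> L j + a\<close>, so the first one that drops to at most 1 is still positive.\<close>

lemma next_form:
  assumes "(a, b) \<in> Tq q"
  shows "\<exists>j::nat. 2 \<le> j \<and> j \<le> q - 1 \<and> a * sg (j + 1) + b * sg j \<le> 1 \<and>
    0 < a * sg (j + 1) + b * sg j \<and> sg j - a < sg (real j - 1) * (a * sg (j + 1) + b * sg j)"
proof -
  define L where "L j = a * sg (real j + 1) + b * sg (real j)" for j :: nat
  have ab: "0 < a" "a \<le> 1" "1 - lam * a < b" "b \<le> 1" using assms by (auto simp: Tq_iff)
  have L1: "1 < L 1" using ab by (simp add: L_def algebra_simps)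
  have Lq: "L (q - 1) \<le> 1"
    using ab q3 sg_q[of 0] sg_q[of 1] by (simp add: L_def of_nat_diff)
  define P where "P j \<longleftrightarrow> 1 \<le> j \<and> L j \<le> 1" for j
  define j where "j = (LEAST j. P j)"
  have "P (q - 1)" using Lq q3 by (simp add: P_def)
  then have Pj: "P j" and jq: "j \<le> q - 1" unfolding j_def by (auto intro: LeastI Least_le)
  have j1: "j \<noteq> 1" using Pj L1 by (auto simp: P_def)
  then have j2: "2 \<le> j" using Pj by (auto simp: P_def)
  have "\<not> P (j - 1)" using not_less_Least[of "j - 1" P] j2 by (simp add: j_def[symmetric])
  moreover have "1 \<le> j - 1" using j2 by simp
  ultimately have Lj1: "1 < L (j - 1)" by (simp add: P_def)
  have sj: "1 \<le> sg (real j)" "1 \<le> sg (real j - 1)" using j2 jq q3 by (intro sg_ge_1; linarith)+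
  have "sg j * L (j - 1) = sg (real j - 1) * L j + a * (sg j * sg j - sg (real j + 1) * sg (real j - 1))"
    using j2 by (simp add: L_def of_nat_diff algebra_simps)
  then have "sg j * L (j - 1) = sg (real j - 1) * L j + a" by (simp add: sg_det)
  moreover have "sg j * 1 < sg j * L (j - 1)" using Lj1 sj by (intro mult_strict_left_mono) auto
  ultimately have *: "sg j - a < sg (real j - 1) * L j" by simp
  have "0 \<le> sg j - a" using ab sj by simp
  with * have "0 < sg (real j - 1) * L j" by simp
  then have "0 < L j" using sj by (simp add: zero_less_mult_iff)
  then show ?thesis using * Pj j2 jq by (intro exI[of _ j]) (simp add: L_def P_def add.commute)
qed

text \<open>Going back in slope is going forward for the mirror image: \<open>next_form\<close> is
  applied to (a, -b) shifted into the window, and \<open>Gam_reflect\<close> carries the resulting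
  group element back. The slope drops by \<open>sg j\<close> / (a x'), which is positive.\<close>

lemma prev_hit_unimodular:
  assumes "dt N = 1" "hit 1 N"
  shows "\<exists>g\<in>Gam. hit 1 (mm N g) \<and> sl (mm N g) < sl N"
proof -
  obtain a b y w where Ne: "N = ((a, b), (y, w))" by (cases N rule: m4_cases)
  have ab: "0 < a" "a \<le> 1" using assms hit_iff[of a b y w 1 1] by (auto simp: Ne)
  obtain k :: int where "1 - lam * a < - b + of_int k * lam * a" "- b + of_int k * lam * a \<le> 1"
    using shift_to_window[OF ab(1)] by blast
  then have "(a, - b + of_int k * lam * a) \<in> Tq q" using ab by (simp add: Tq_iff)
  from next_form[OF this] obtain j :: nat where j: "2 \<le> j" "j \<le> q - 1"
    and L: "a * sg (j + 1) + (- b + of_int k * lam * a) * sg j \<le> 1"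
      "0 < a * sg (j + 1) + (- b + of_int k * lam * a) * sg j" by blast
  have sj: "1 \<le> sg j" using j q3 by (intro sg_ge_1) auto
  define p where "p = sg (real j + 1) + of_int k * lam * sg (real j)"
  have "mm ((1, of_int k * lam), (0, 1)) (Uj (real j)) \<in> Gam" by (intro Gam_mm Gam_Tpow Uj_Gam)
  then obtain r v where "((p, r), (sg j, v)) \<in> Gam" by (simp add: Uj_def p_def)
  from Gam_reflect[OF this] have g: "((p, - r), (- sg j, v)) \<in> Gam" .
  define x' where "x' = a * p - b * sg j"
  have x': "0 < x'" "x' \<le> 1" using L by (simp_all add: x'_def p_def algebra_simps)
  obtain g' where g': "g' \<in> Gam" "hit 1 (mm N g')" "sl (mm N g') = sl (mm N ((p, - r), (- sg j, v)))"
    using hit_of_column[OF assms(1) _ _ g, of 1] x' by (auto simp: Ne x'_def)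
  have "sl N - sl (mm N ((p, - r), (- sg j, v))) = y / a - (y * p - w * sg j) / x'"
    by (simp add: Ne x'_def)
  also have "\<dots> = (y * x' - (y * p - w * sg j) * a) / (a * x')"
    using ab x' by (simp add: field_simps)
  also have "y * x' - (y * p - w * sg j) * a = sg j * (a * w - b * y)"
    by (simp add: x'_def algebra_simps)
  also have "\<dots> = sg j" using assms(1) by (simp add: Ne)
  finally have "sl (mm N ((p, - r), (- sg j, v))) < sl N"
    using ab x' sj by (smt (verit) divide_pos_pos mult_pos_pos)
  then show ?thesis using g' by (intro bexI[of _ g']) auto
qed

lemma unimodular_scale:
  assumes "0 < dt N"
  obtains c N1 where "0 < c" "dt N1 = 1" "N = c *\<^sub>R N1"
proof
  show "0 < sqrt (dt N)" using assms by simp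
  show "dt ((1 / sqrt (dt N)) *\<^sub>R N) = 1" using assms by (simp add: power_divide)
  show "N = sqrt (dt N) *\<^sub>R (1 / sqrt (dt N)) *\<^sub>R N" using assms by simp
qed

text \<open>The gap between hits improves a strict drop to a drop by at least 1, so that repeated
  steps go below every bound.\<close>

lemma prev_hit:
  assumes "hit 1 N"
  shows "\<exists>g\<in>Gam. hit 1 (mm N g) \<and> sl (mm N g) \<le> sl N - 1"
proof -
  have "0 < dt N" using assms by (simp add: hit_def)
  then obtain c N1 where c: "0 < c" "dt N1 = 1" "N = c *\<^sub>R N1" by (rule unimodular_scale)
  obtain g where g: "g \<in> Gam" "hit 1 (mm N1 g)" "sl (mm N1 g) < sl N1"
    using prev_hit_unimodular[of N1] assms c by auto
  then have "g \<noteq> one4" by auto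
  with g c assms hit_gap[of 1 N g] show ?thesis by (intro bexI[of _ g]) auto
qed

text \<open>Lattices with a vertical vector are excluded: there the nonzero first coordinates stay
  away from 0, and the strip may contain no vector at all.\<close>

definition generic :: "m4 \<Rightarrow> bool" where
  "generic M \<longleftrightarrow> (\<forall>g\<in>Gam. fst (fst (mm M g)) \<noteq> 0)"

text \<open>This is the Euclidean algorithm with nearest multiples of \<open>lam\<close>: a power of
  T shifts the second entry into the centred window, \<open>S4\<close> moves it to the first place,
  and the size shrinks by the factor \<open>lam\<close> / 2 < 1. Genericity keeps it nonzero, and
  the sign is corrected by negating the group element.\<close>

lemma generic_column:
  assumes "generic M"
  shows "\<exists>g\<in>Gam. 0 < fst (fst (mm M g)) \<and> fst (fst (mm M g)) \<le> (lam / 2) ^ n * \<bar>fst (fst M)\<bar>"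
proof (induction n)
  case 0
  have "fst (fst M) \<noteq> 0" using assms Gam.one unfolding generic_def by force
  then show ?case
    using Gam.one Gam_uminus[OF Gam.one]
    by (cases "0 < fst (fst M)"; cases M rule: m4_cases)
       (force intro: bexI[of _ one4], force intro: bexI[of _ "- one4"])
next
  case (Suc n)
  then obtain g where g: "g \<in> Gam" "0 < fst (fst (mm M g))" "fst (fst (mm M g)) \<le> (lam / 2) ^ n * \<bar>fst (fst M)\<bar>"
    by blast
  obtain x z y w where e: "mm M g = ((x, z), (y, w))" by (cases "mm M g" rule: m4_cases)
  obtain k :: int where k: "lam * x / 2 - lam * x < z + of_int k * lam * x" "z + of_int k * lam * x \<le> lam * x / 2"
    using shift_to_window[of x "lam * x / 2" z] g(2) by (simp only: e fst_conv) blast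
  define g' where "g' = mm (mm g ((1, of_int k * lam), (0, 1))) S4"
  have g': "g' \<in> Gam" unfolding g'_def by (intro Gam_mm g Gam_Tpow S_Gam)
  have fe: "fst (fst (mm M g')) = z + of_int k * lam * x"
    unfolding g'_def by (simp add: mm_assoc[symmetric] e algebra_simps)
  have nz: "fst (fst (mm M g')) \<noteq> 0" using assms g' by (simp add: generic_def)
  have "lam / 2 * x \<le> lam / 2 * ((lam / 2) ^ n * \<bar>fst (fst M)\<bar>)"
    using g lam_bounds by (intro mult_left_mono) (auto simp: e)
  moreover have "\<bar>z + of_int k * lam * x\<bar> \<le> lam / 2 * x"
    using k unfolding abs_le_iff by linarith
  ultimately have le: "\<bar>fst (fst (mm M g'))\<bar> \<le> (lam / 2) ^ Suc n * \<bar>fst (fst M)\<bar>"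
    by (simp add: fe mult.assoc)
  show ?case
  proof (cases "0 < fst (fst (mm M g'))")
    case True
    then show ?thesis using g' le by (intro bexI[of _ g']) auto
  next
    case False
    then show ?thesis using g' Gam_uminus[OF g'] nz le by (intro bexI[of _ "- g'"]) auto
  qed
qed

lemma generic_hit:
  assumes "generic M" "0 < dt M" "0 < t"
  shows "\<exists>g\<in>Gam. hit t (mm M g)"
proof -
  have "(\<lambda>n. (lam / 2) ^ n * \<bar>fst (fst M)\<bar>) \<longlonglongrightarrow> 0 * \<bar>fst (fst M)\<bar>"
    using lam_bounds by (intro tendsto_mult LIMSEQ_power_zero tendsto_const) auto
  then have "eventually (\<lambda>n. (lam / 2) ^ n * \<bar>fst (fst M)\<bar> < t * sqrt (dt M)) sequentially"
    using assms by (intro order_tendstoD) auto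
  then obtain n where "(lam / 2) ^ n * \<bar>fst (fst M)\<bar> < t * sqrt (dt M)"
    by (auto simp: eventually_sequentially)
  then obtain g where "g \<in> Gam" "0 < fst (fst (mm M g))" "fst (fst (mm M g)) \<le> t * sqrt (dt M)"
    using generic_column[OF assms(1), of n] by force
  then show ?thesis using hit_of_column[OF refl assms(2,3)] by blast
qed

section \<open>A fundamental domain for the group\<close>

text \<open>The first column of a matrix in \<open>Dom\<close> is the strip vector of largest nonpositive slope.\<close>

definition Dom :: "m4 set" where
  "Dom = {M. hit 1 M \<and> dt M \<le> 1 \<and> sl M \<le> 0 \<and>
     (\<forall>g\<in>Gam. \<not> (hit 1 (mm M g) \<and> sl M < sl (mm M g) \<and> sl (mm M g) \<le> 0))}"

lemma hit_gap2:
  assumes "0 < t" "g \<in> Gam" "g' \<in> Gam" "hit t (mm M g)" "hit t (mm M g')" "g \<noteq> g'"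
  shows "1 / t\<^sup>2 \<le> \<bar>sl (mm M g') - sl (mm M g)\<bar>"
proof -
  have g1: "dt g = 1" using dt_Gam assms by blast
  have e: "mm (mm M g) (mm (adj g) g') = mm M g'"
    using g1 by (simp add: mm_assoc mm_adj_cancel)
  have "mm (adj g) g' \<noteq> one4"
    using mm_adj_cancel(1)[OF g1, of g'] assms(6) by auto
  then show ?thesis
    using hit_gap[of t "mm M g" "mm (adj g) g'"] assms Gam_mm Gam_adj by (simp add: e)
qed

text \<open>Hits in the strip of width 1 have slopes at least 1 apart and continue downwards without
  end, so a largest nonpositive slope exists and belongs to one group element only.\<close>

lemma Dom_unique_translate:
  assumes "generic M" "0 < dt M" "dt M \<le> 1"
  shows "\<exists>!g. g \<in> Gam \<and> mm M g \<in> Dom"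
proof -
  define H where "H = {g \<in> Gam. hit 1 (mm M g)}"
  have gap: "1 \<le> \<bar>sl (mm M g') - sl (mm M g)\<bar>" if "g \<in> H" "g' \<in> H" "g \<noteq> g'" for g g'
    using hit_gap2[of 1 g g' M] that by (simp add: H_def)
  obtain g0 where "g0 \<in> H" using generic_hit[OF assms(1,2), of 1] by (auto simp: H_def)
  \<comment> \<open>A hit with the least truncated ceiling: were its slope positive, the previous
    hit would have a smaller ceiling.\<close>
  then obtain g1 where g1: "g1 \<in> H" "\<And>g. g \<in> H \<Longrightarrow> nat \<lceil>sl (mm M g1)\<rceil> \<le> nat \<lceil>sl (mm M g)\<rceil>"
    using ex_has_least_nat[of "\<lambda>g. g \<in> H" g0 "\<lambda>g. nat \<lceil>sl (mm M g)\<rceil>"] by blast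
  have g1le: "sl (mm M g1) \<le> 0"
  proof (rule ccontr)
    assume a: "\<not> sl (mm M g1) \<le> 0"
    obtain g where g: "g \<in> Gam" "hit 1 (mm (mm M g1) g)" "sl (mm (mm M g1) g) \<le> sl (mm M g1) - 1"
      using prev_hit[of "mm M g1"] g1 by (auto simp: H_def)
    then have "mm g1 g \<in> H" using g1 Gam_mm by (auto simp: H_def mm_assoc)
    then have "nat \<lceil>sl (mm M g1)\<rceil> \<le> nat \<lceil>sl (mm M (mm g1 g))\<rceil>" by (rule g1(2))
    moreover have "\<lceil>sl (mm M (mm g1 g))\<rceil> \<le> \<lceil>sl (mm M g1)\<rceil> - 1" using g(3) by (simp add: mm_assoc) linarith
    moreover have "0 < \<lceil>sl (mm M g1)\<rceil>" using a by simp
    ultimately show False by linarith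
  qed
  \<comment> \<open>Rounding loses nothing in this comparison, because different hits are at least 1
    apart.\<close>
  obtain g2 where g2: "g2 \<in> H" "sl (mm M g2) \<le> 0"
    "\<And>g. g \<in> H \<Longrightarrow> sl (mm M g) \<le> 0 \<Longrightarrow> nat \<lfloor>- sl (mm M g2)\<rfloor> \<le> nat \<lfloor>- sl (mm M g)\<rfloor>"
    using ex_has_least_nat[of "\<lambda>g. g \<in> H \<and> sl (mm M g) \<le> 0" g1 "\<lambda>g. nat \<lfloor>- sl (mm M g)\<rfloor>"] g1 g1le by blast
  have max: "\<not> (sl (mm M g2) < sl (mm M g) \<and> sl (mm M g) \<le> 0)" if "g \<in> H" for g
  proof
    assume a: "sl (mm M g2) < sl (mm M g) \<and> sl (mm M g) \<le> 0"
    then have "sl (mm M g2) + 1 \<le> sl (mm M g)" using gap[OF g2(1) that] by fastforce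
    moreover have "nat \<lfloor>- sl (mm M g2)\<rfloor> \<le> nat \<lfloor>- sl (mm M g)\<rfloor>" using g2(3)[OF that] a by blast
    ultimately show False using a by linarith
  qed
  have HD: "mm M g \<in> Dom \<longleftrightarrow> sl (mm M g) \<le> 0 \<and> (\<forall>g'\<in>H. \<not> (sl (mm M g) < sl (mm M g') \<and> sl (mm M g') \<le> 0))"
    if "g \<in> H" for g
  proof -
    have g: "g \<in> Gam" "hit 1 (mm M g)" "dt g = 1" using that dt_Gam by (auto simp: H_def)
    have "(\<forall>h\<in>Gam. \<not> (hit 1 (mm (mm M g) h) \<and> sl (mm M g) < sl (mm (mm M g) h) \<and> sl (mm (mm M g) h) \<le> 0))
      \<longleftrightarrow> (\<forall>g'\<in>H. \<not> (sl (mm M g) < sl (mm M g') \<and> sl (mm M g') \<le> 0))" (is "?l \<longleftrightarrow> ?r")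
    proof
      assume l: ?l
      show ?r
      proof
        fix g' assume "g' \<in> H"
        then have "mm (adj g) g' \<in> Gam" "mm (mm M g) (mm (adj g) g') = mm M g'" "hit 1 (mm M g')"
          using g Gam_mm Gam_adj by (auto simp: H_def mm_assoc mm_adj_cancel)
        then show "\<not> (sl (mm M g) < sl (mm M g') \<and> sl (mm M g') \<le> 0)" using l by metis
      qed
    next
      assume r: ?r
      have "mm g h \<in> H" if "h \<in> Gam" "hit 1 (mm (mm M g) h)" for h
        using that g Gam_mm by (simp add: H_def mm_assoc)
      then show ?l using r unfolding mm_assoc by blast
    qed
    then show ?thesis using g assms by (simp add: Dom_def)
  qed
  show ?thesis
  proof (rule ex1I[of _ g2])
    show "g2 \<in> Gam \<and> mm M g2 \<in> Dom"
      using HD[OF g2(1)] g2 max by (auto simp: H_def)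
    fix g assume g: "g \<in> Gam \<and> mm M g \<in> Dom"
    then have gH: "g \<in> H" by (auto simp: Dom_def H_def)
    show "g = g2"
    proof (rule ccontr)
      assume "g \<noteq> g2"
      then have "1 \<le> \<bar>sl (mm M g2) - sl (mm M g)\<bar>" using gap[OF gH g2(1)] by blast
      moreover have "\<not> sl (mm M g) < sl (mm M g2)" using HD[OF gH] g g2 by blast
      moreover have "\<not> sl (mm M g2) < sl (mm M g)" using max[OF gH] HD[OF gH] g by blast
      ultimately show False by linarith
    qed
  qed
qed

end

section \<open>The invariant measure on the quotient\<close>

definition pres :: "('a::euclidean_space \<Rightarrow> 'a) \<Rightarrow> bool" where
  "pres h \<longleftrightarrow> h \<in> borel_measurable borel \<and> distr lborel borel h = lborel"

lemma presI:
  assumes "h \<in> borel_measurable borel"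
    and "\<And>f. f \<in> borel_measurable borel \<Longrightarrow> (\<integral>\<^sup>+x. f (h x) \<partial>lborel) = (\<integral>\<^sup>+x. f x \<partial>lborel)"
  shows "pres h"
  unfolding pres_def
proof (intro conjI assms measure_eqI)
  fix A assume "A \<in> sets (distr lborel borel h)"
  then have A [measurable]: "A \<in> sets borel" by simp
  note assms(1)[measurable]
  have "emeasure (distr lborel borel h) A = (\<integral>\<^sup>+x. indicator A x \<partial>distr lborel borel h)"
    by (rule nn_integral_indicator[symmetric]) simp
  also have "\<dots> = (\<integral>\<^sup>+x. indicator A (h x) \<partial>lborel)"
    by (rule nn_integral_distr) measurable
  also have "\<dots> = (\<integral>\<^sup>+x. indicator A x \<partial>lborel)"
    by (rule assms(2)) measurable
  finally show "emeasure (distr lborel borel h) A = emeasure lborel A" by simp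
qed simp

lemma presD:
  assumes "pres h" "f \<in> borel_measurable borel"
  shows "(\<integral>\<^sup>+x. f (h x) \<partial>lborel) = (\<integral>\<^sup>+x. f x \<partial>lborel)"
proof -
  have [measurable]: "h \<in> borel_measurable borel" using assms by (simp add: pres_def)
  have "(\<integral>\<^sup>+x. f x \<partial>lborel) = (\<integral>\<^sup>+x. f x \<partial>distr lborel borel h)"
    using assms by (simp add: pres_def)
  also have "\<dots> = (\<integral>\<^sup>+x. f (h x) \<partial>lborel)"
    using assms(2) by (subst nn_integral_distr) auto
  finally show ?thesis by simp
qed

lemma pres_comp:
  assumes "pres h" "pres k" shows "pres (\<lambda>x. h (k x))"
proof (rule presI)
  have [measurable]: "h \<in> borel_measurable borel" "k \<in> borel_measurable borel"
    using assms by (auto simp: pres_def)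
  show "(\<lambda>x. h (k x)) \<in> borel_measurable borel" by measurable
  fix f :: "'a \<Rightarrow> ennreal" assume [measurable]: "f \<in> borel_measurable borel"
  have "(\<integral>\<^sup>+x. f (h (k x)) \<partial>lborel) = (\<integral>\<^sup>+x. f (h x) \<partial>lborel)"
    by (rule presD[OF assms(2)]) measurable
  also have "\<dots> = (\<integral>\<^sup>+x. f x \<partial>lborel)" by (rule presD[OF assms(1)]) measurable
  finally show "(\<integral>\<^sup>+x. f (h (k x)) \<partial>lborel) = (\<integral>\<^sup>+x. f x \<partial>lborel)" .
qed

lemma pres_translate: "pres (\<lambda>x::'a::euclidean_space. x + c)"
proof -
  have "distr lborel borel (\<lambda>x. x + c) = distr lborel borel ((+) c)"
    by (intro distr_cong) (auto simp: add.commute)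
  then show ?thesis by (simp add: pres_def lborel_distr_plus)
qed

text \<open>On each fibre over the second coordinate the shear is a translation, so Tonelli reduces
  it to translation invariance.\<close>

lemma pres_shear_fst:
  fixes L :: "'b::euclidean_space \<Rightarrow> 'a::euclidean_space"
  assumes [measurable]: "L \<in> borel_measurable borel"
  shows "pres (\<lambda>p. (fst p + L (snd p), snd p))"
proof (rule presI)
  show "(\<lambda>p. (fst p + L (snd p), snd p)) \<in> borel_measurable borel"
    by (simp add: borel_prod[symmetric])
  fix f :: "'a \<times> 'b \<Rightarrow> ennreal" assume "f \<in> borel_measurable borel"
  then have f [measurable]: "f \<in> borel_measurable (borel \<Otimes>\<^sub>M borel)" by (simp add: borel_prod)
  have "(\<integral>\<^sup>+p. f (fst p + L (snd p), snd p) \<partial>(lborel \<Otimes>\<^sub>M lborel))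
      = (\<integral>\<^sup>+y. \<integral>\<^sup>+x. f (x + L y, y) \<partial>lborel \<partial>lborel)"
    by (subst lborel_pair.nn_integral_snd[symmetric]) auto
  also have "\<dots> = (\<integral>\<^sup>+y. \<integral>\<^sup>+x. f (x, y) \<partial>lborel \<partial>lborel)"
    by (intro nn_integral_cong presD[OF pres_translate]) measurable
  also have "\<dots> = (\<integral>\<^sup>+p. f p \<partial>(lborel \<Otimes>\<^sub>M lborel))"
    by (subst lborel_pair.nn_integral_snd) auto
  finally show "(\<integral>\<^sup>+p. f (fst p + L (snd p), snd p) \<partial>lborel) = (\<integral>\<^sup>+p. f p \<partial>lborel)"
    by (simp add: lborel_prod)
qed

lemma pres_shear_snd:
  fixes L :: "'a::euclidean_space \<Rightarrow> 'b::euclidean_space"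
  assumes [measurable]: "L \<in> borel_measurable borel"
  shows "pres (\<lambda>p. (fst p, snd p + L (fst p)))"
proof (rule presI)
  show "(\<lambda>p. (fst p, snd p + L (fst p))) \<in> borel_measurable borel"
    by (simp add: borel_prod[symmetric])
  fix f :: "'a \<times> 'b \<Rightarrow> ennreal" assume "f \<in> borel_measurable borel"
  then have f [measurable]: "f \<in> borel_measurable (borel \<Otimes>\<^sub>M borel)" by (simp add: borel_prod)
  have "(\<integral>\<^sup>+p. f (fst p, snd p + L (fst p)) \<partial>(lborel \<Otimes>\<^sub>M lborel))
      = (\<integral>\<^sup>+x. \<integral>\<^sup>+y. f (x, y + L x) \<partial>lborel \<partial>lborel)"
    by (subst lborel.nn_integral_fst[symmetric]) auto
  also have "\<dots> = (\<integral>\<^sup>+x. \<integral>\<^sup>+y. f (x, y) \<partial>lborel \<partial>lborel)"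
    by (intro nn_integral_cong presD[OF pres_translate]) measurable
  also have "\<dots> = (\<integral>\<^sup>+p. f p \<partial>(lborel \<Otimes>\<^sub>M lborel))"
    by (subst lborel.nn_integral_fst) auto
  finally show "(\<integral>\<^sup>+p. f (fst p, snd p + L (fst p)) \<partial>lborel) = (\<integral>\<^sup>+p. f p \<partial>lborel)"
    by (simp add: lborel_prod)
qed

text \<open>Right multiplication applies one map to both rows, which is this product form.\<close>

lemma pres_map_prod:
  fixes h :: "'a::euclidean_space \<Rightarrow> 'a"
  assumes "pres h"
  shows "pres (\<lambda>p. (h (fst p), h (snd p)))"
proof (rule presI)
  have [measurable]: "h \<in> borel_measurable borel" using assms by (simp add: pres_def)
  show "(\<lambda>p. (h (fst p), h (snd p))) \<in> borel_measurable borel"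
    by (simp add: borel_prod[symmetric])
  fix f :: "'a \<times> 'a \<Rightarrow> ennreal" assume "f \<in> borel_measurable borel"
  then have f [measurable]: "f \<in> borel_measurable (borel \<Otimes>\<^sub>M borel)" by (simp add: borel_prod)
  have "(\<integral>\<^sup>+p. f (h (fst p), h (snd p)) \<partial>(lborel \<Otimes>\<^sub>M lborel))
      = (\<integral>\<^sup>+x. \<integral>\<^sup>+y. f (h x, h y) \<partial>lborel \<partial>lborel)"
    by (subst lborel.nn_integral_fst[symmetric]) auto
  also have "\<dots> = (\<integral>\<^sup>+x. \<integral>\<^sup>+y. f (h x, y) \<partial>lborel \<partial>lborel)"
    by (intro nn_integral_cong presD[OF assms]) measurable
  also have "\<dots> = (\<integral>\<^sup>+x. \<integral>\<^sup>+y. f (x, y) \<partial>lborel \<partial>lborel)"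
    by (intro presD[OF assms, of "\<lambda>x. \<integral>\<^sup>+y. f (x, y) \<partial>lborel"]) measurable
  also have "\<dots> = (\<integral>\<^sup>+p. f p \<partial>(lborel \<Otimes>\<^sub>M lborel))"
    by (subst lborel.nn_integral_fst) auto
  finally show "(\<integral>\<^sup>+p. f (h (fst p), h (snd p)) \<partial>lborel) = (\<integral>\<^sup>+p. f p \<partial>lborel)"
    by (simp add: lborel_prod)
qed

abbreviation up :: "real \<Rightarrow> m4" where "up r \<equiv> ((1, r), (0, 1))"
abbreviation lo :: "real \<Rightarrow> m4" where "lo s \<equiv> ((1, 0), (s, 1))"

text \<open>A lower left entry c \<noteq> 0 gives a factorisation into an upper, a lower and an
  upper shear. For c = 0 the first row is added to the second, which puts a \<noteq> 0 into that
  corner, and \<open>lo (-1)\<close> undoes this.\<close>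

lemma sl2_shear_induct [consumes 1, case_names up lo mm]:
  assumes "dt g = 1" and "\<And>r. P (up r)" and "\<And>s. P (lo s)" and mm: "\<And>g h. P g \<Longrightarrow> P h \<Longrightarrow> P (mm g h)"
  shows "P g"
proof -
  have *: "P ((a, b), (c, d))" if "a * d - b * c = 1" "c \<noteq> 0" for a b c d
  proof -
    have "P (mm (up ((a - 1) / c)) (mm (lo c) (up ((d - 1) / c))))"
      by (intro assms)
    also have "mm (up ((a - 1) / c)) (mm (lo c) (up ((d - 1) / c))) = ((a, b), (c, d))"
      using that by (simp add: field_simps)
    finally show ?thesis .
  qed
  obtain a b c d where g: "g = ((a, b), (c, d))" by (cases g rule: m4_cases)
  show ?thesis
  proof (cases "c = 0")
    case False
    then show ?thesis using * assms(1) g by simp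
  next
    case True
    then have "a \<noteq> 0" "a * d = 1" using assms(1) g by auto
    then have "P ((a, b), (a, b + d))" by (intro *) (simp_all add: algebra_simps)
    then have "P (mm (lo (-1)) ((a, b), (a, b + d)))" by (intro assms)
    then show ?thesis using g True by simp
  qed
qed

lemma continuous_mm [continuous_intros]:
  "continuous_on S f \<Longrightarrow> continuous_on S h \<Longrightarrow> continuous_on S (\<lambda>x. mm (f x) (h x))"
  unfolding mm_def by (intro continuous_intros)

lemma measurable_mm [measurable (raw)]:
  "f \<in> borel_measurable N \<Longrightarrow> h \<in> borel_measurable N \<Longrightarrow> (\<lambda>x. mm (f x) (h x)) \<in> borel_measurable N"
  by (rule borel_measurable_continuous_Pair) (auto intro!: continuous_intros)

lemma continuous_dt [continuous_intros]:
  "continuous_on S f \<Longrightarrow> continuous_on S (\<lambda>x. dt (f x))"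
  unfolding dt_def by (intro continuous_intros)

lemma measurable_dt [measurable]: "dt \<in> borel_measurable borel"
  by (intro borel_measurable_continuous_onI continuous_intros)

lemma measurable_fst_borel [measurable (raw)]:
  fixes f :: "'c \<Rightarrow> 'a::second_countable_topology \<times> 'b::second_countable_topology"
  assumes "f \<in> borel_measurable N"
  shows "(\<lambda>x. fst (f x)) \<in> borel_measurable N" "(\<lambda>x. snd (f x)) \<in> borel_measurable N"
  using assms by (auto intro!: measurable_compose[OF assms] borel_measurable_continuous_onI continuous_intros)

lemma measurable_sl [measurable]: "sl \<in> borel_measurable borel"
  unfolding sl_def by measurable

lemma left_pres: "dt g = 1 \<Longrightarrow> pres (mm g)"
proof (induction rule: sl2_shear_induct)
  case (up r)
  have "mm (up r) = (\<lambda>p. (fst p + r *\<^sub>R snd p, snd p))" by (auto simp: mm_def fun_eq_iff)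
  then show ?case using pres_shear_fst[of "\<lambda>x. r *\<^sub>R x"] by simp
next
  case (lo s)
  have "mm (lo s) = (\<lambda>p. (fst p, snd p + s *\<^sub>R fst p))" by (auto simp: mm_def fun_eq_iff)
  then show ?case using pres_shear_snd[of "\<lambda>x. s *\<^sub>R x"] by simp
next
  case (mm g h)
  then show ?case using pres_comp[of "mm g" "mm h"] by (simp add: mm_assoc)
qed

lemma right_pres: "dt g = 1 \<Longrightarrow> pres (\<lambda>M. mm M g)"
proof (induction rule: sl2_shear_induct)
  case (up r)
  have "(\<lambda>M. mm M (up r)) = (\<lambda>p. ((fst (fst p), snd (fst p) + r * fst (fst p)), (fst (snd p), snd (snd p) + r * fst (snd p))))"
    by (auto simp: fun_eq_iff)
  then show ?case using pres_map_prod[OF pres_shear_snd[of "\<lambda>x. r * x"]] by simp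
next
  case (lo s)
  have "(\<lambda>M. mm M (lo s)) = (\<lambda>p. ((fst (fst p) + s * snd (fst p), snd (fst p)), (fst (snd p) + s * snd (snd p), snd (snd p))))"
    by (auto simp: fun_eq_iff)
  then show ?case using pres_map_prod[OF pres_shear_fst[of "\<lambda>x. s * x"]] by simp
next
  case (mm g h)
  then show ?case using pres_comp[of "\<lambda>M. mm M h" "\<lambda>M. mm M g"] by (simp add: mm_assoc)
qed

lemma AE_pres:
  assumes "pres h" "AE x in lborel. P x" shows "AE x in lborel. P (h x)"
proof -
  have [measurable]: "h \<in> measurable lborel lborel" using assms by (simp add: pres_def)
  have "distr lborel lborel h = distr lborel borel h" by (intro distr_cong) auto
  then have e: "distr lborel lborel h = lborel" using assms by (simp add: pres_def)
  have "AE x in distr lborel lborel h. P x" unfolding e by (rule assms(2))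
  from AE_distrD[OF _ this] show ?thesis by measurable
qed

text \<open>Otherwise quantified matrices are split into their entries.\<close>

declare split_paired_All [simp del] split_paired_Ex [simp del]

section \<open>Unfolding over the group\<close>

context hecke
begin

text \<open>For a fixed g the exceptional matrices form a hyperplane, whose normal carries the first
  column of g; the group is countable.\<close>

lemma AE_generic: "AE M in lborel. generic M"
proof -
  have "AE M in lborel. fst (fst (mm M g)) \<noteq> 0" if "g \<in> Gam" for g
  proof -
    obtain p r s v where g: "g = ((p, r), (s, v))" by (cases g rule: m4_cases)
    have nz: "((p, s), (0, 0)) \<noteq> (0 :: m4)" using dt_Gam[OF that] by (auto simp: g zero_prod_def)
    have "{M. fst (fst (mm M g)) = 0} = {M. ((p, s), (0, 0)) \<bullet> M = 0}"
      by (auto simp: g mult.commute)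
    then have n: "negligible {M. fst (fst (mm M g)) = 0}"
      using negligible_hyperplane[of "((p, s), (0, 0)) :: m4" 0] nz by simp
    have "{M. fst (fst (mm M g)) = 0} \<in> sets borel" by measurable
    with n have "{M. fst (fst (mm M g)) = 0} \<in> null_sets lborel"
      by (simp add: negligible_iff_null_sets null_sets_def)
    then show ?thesis by (rule AE_I') simp
  qed
  then show ?thesis unfolding generic_def using countable_Gam by (simp add: AE_ball_countable)
qed

lemma Tq_borel [measurable]: "Tq q \<in> sets borel"
proof -
  have "Tq q = {p. 0 < fst p \<and> fst p \<le> 1 \<and> 1 - lam * fst p < snd p \<and> snd p \<le> 1}"
    by (auto simp: Tq_iff)
  then show ?thesis by simp
qed

lemma measurable_hit [measurable]: "Measurable.pred borel (hit t)"
  unfolding hit_def by measurable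

lemma Dom_borel [measurable]: "Dom \<in> sets borel"
proof -
  have "(\<Inter>g\<in>Gam. {M. \<not> (hit 1 (mm M g) \<and> sl M < sl (mm M g) \<and> sl (mm M g) \<le> 0)}) \<in> sets borel"
    using countable_Gam Gam.one by (intro sets.countable_INT') auto
  moreover have "{M. hit 1 M \<and> dt M \<le> 1 \<and> sl M \<le> 0} \<in> sets borel" by measurable
  moreover have "Dom = {M. hit 1 M \<and> dt M \<le> 1 \<and> sl M \<le> 0} \<inter>
    (\<Inter>g\<in>Gam. {M. \<not> (hit 1 (mm M g) \<and> sl M < sl (mm M g) \<and> sl (mm M g) \<le> 0)})"
    unfolding Dom_def by blast
  ultimately show ?thesis by simp
qed

text \<open>The Poincare series of f, written as an integral over counting measure so that Tonelli
  exchanges it with Lebesgue integrals.\<close>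

definition sumG :: "(m4 \<Rightarrow> ennreal) \<Rightarrow> m4 \<Rightarrow> ennreal" where
  "sumG f M = (\<integral>\<^sup>+g. f (mm M g) \<partial>count_space Gam)"

lemma bij_adj: "bij_betw adj Gam Gam"
  by (rule bij_betwI[of _ _ _ adj]) (auto simp: Gam_adj)

lemma bij_mm: "g \<in> Gam \<Longrightarrow> bij_betw (mm g) Gam Gam"
  using Gam_mm Gam_adj dt_Gam by (intro bij_betwI[of _ _ _ "mm (adj g)"]) (auto simp: mm_adj_cancel)

lemma sumG_measurable [measurable]:
  assumes [measurable]: "f \<in> borel_measurable borel"
  shows "sumG f \<in> borel_measurable borel"
proof -
  interpret sigma_finite_measure "count_space Gam"
    using countable_Gam by (rule sigma_finite_measure_count_space_countable)
  have "(\<lambda>p. f (mm (snd p) (fst p))) \<in> borel_measurable (count_space Gam \<Otimes>\<^sub>M borel)"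
    using countable_Gam by (intro measurable_pair_measure_countable1) (simp_all, measurable)
  from measurable_pair_swap[OF this] show ?thesis
    unfolding sumG_def by (intro borel_measurable_nn_integral) (simp add: case_prod_beta)
qed

lemma Dom_dt: "M \<in> Dom \<Longrightarrow> 0 < dt M \<and> dt M \<le> 1"
  by (simp add: Dom_def hit_def)

lemma sumG_Dom:
  assumes "generic M"
  shows "sumG (indicator Dom) M = indicator {M. 0 < dt M \<and> dt M \<le> 1} M"
proof (cases "0 < dt M \<and> dt M \<le> 1")
  case True
  note ex = Dom_unique_translate[OF assms conjunct1[OF True] conjunct2[OF True]]
  define h where "h = (THE g. g \<in> Gam \<and> mm M g \<in> Dom)"
  have h: "h \<in> Gam" "mm M h \<in> Dom" "\<And>g. g \<in> Gam \<Longrightarrow> mm M g \<in> Dom \<Longrightarrow> g = h"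
    unfolding h_def by (rule theI'[OF ex, THEN conjunct1], rule theI'[OF ex, THEN conjunct2])
       (rule the1_equality[OF ex, symmetric], rule conjI)
  have "sumG (indicator Dom) M = (\<integral>\<^sup>+g. indicator {h} g \<partial>count_space Gam)"
    unfolding sumG_def
  proof (rule nn_integral_cong)
    fix g assume "g \<in> space (count_space Gam)"
    then have "mm M g \<in> Dom \<longleftrightarrow> g = h" using h(2) h(3)[of g] by (metis space_count_space)
    then show "indicator Dom (mm M g) = (indicator {h} g :: ennreal)"
      unfolding indicator_def singleton_iff by (rule arg_cong)
  qed
  also have "\<dots> = 1" using h(1) by (subst nn_integral_indicator) simp_all
  finally show ?thesis using True by simp
next
  case False
  have "mm M g \<notin> Dom" if "g \<in> Gam" for g
    using Dom_dt[of "mm M g"] dt_Gam[OF that] False by auto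
  then have "sumG (indicator Dom) M = (\<integral>\<^sup>+g. 0 \<partial>count_space Gam)"
    unfolding sumG_def by (intro nn_integral_cong) simp
  then show ?thesis using False by simp
qed

text \<open>Replacing M by M times the inverse of g moves the group sum from f to the indicator of
  \<open>Dom\<close>, and the translates of \<open>Dom\<close> cover almost every matrix of
  determinant in (0, 1] exactly once.\<close>

lemma unfolding_Dom:
  assumes [measurable]: "f \<in> borel_measurable borel"
  shows "(\<integral>\<^sup>+M. indicator Dom M * sumG f M \<partial>lborel)
    = (\<integral>\<^sup>+M. f M * indicator {M. 0 < dt M \<and> dt M \<le> 1} M \<partial>lborel)"
proof -
  have "(\<integral>\<^sup>+M. indicator Dom M * sumG f M \<partial>lborel)
      = (\<integral>\<^sup>+M. \<integral>\<^sup>+g. indicator Dom M * f (mm M g) \<partial>count_space Gam \<partial>lborel)"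
    unfolding sumG_def by (simp add: nn_integral_cmult)
  also have "\<dots> = (\<integral>\<^sup>+g. \<integral>\<^sup>+M. indicator Dom M * f (mm M g) \<partial>lborel \<partial>count_space Gam)"
    using countable_Gam by (intro nn_integral_count_space_nn_integral) measurable
  also have "\<dots> = (\<integral>\<^sup>+g. \<integral>\<^sup>+M. indicator Dom (mm M (adj g)) * f M \<partial>lborel \<partial>count_space Gam)"
  proof (rule nn_integral_cong)
    fix g assume "g \<in> space (count_space Gam)"
    then have g: "dt g = 1" using dt_Gam by simp
    have "(\<integral>\<^sup>+M. indicator Dom (mm (mm M g) (adj g)) * f (mm M g) \<partial>lborel)
      = (\<integral>\<^sup>+M. indicator Dom (mm M (adj g)) * f M \<partial>lborel)"
      by (rule presD[OF right_pres[OF g], of "\<lambda>M. indicator Dom (mm M (adj g)) * f M"]) measurable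
    then show "(\<integral>\<^sup>+M. indicator Dom M * f (mm M g) \<partial>lborel)
      = (\<integral>\<^sup>+M. indicator Dom (mm M (adj g)) * f M \<partial>lborel)"
      by (simp add: mm_adj_cancel g)
  qed
  also have "\<dots> = (\<integral>\<^sup>+M. \<integral>\<^sup>+g. indicator Dom (mm M (adj g)) * f M \<partial>count_space Gam \<partial>lborel)"
    using countable_Gam by (intro nn_integral_count_space_nn_integral[symmetric]) measurable
  also have "\<dots> = (\<integral>\<^sup>+M. f M * sumG (indicator Dom) M \<partial>lborel)"
    using nn_integral_bij_count_space[OF bij_adj, of "\<lambda>g. indicator Dom (mm M g)" for M]
    by (intro nn_integral_cong) (simp add: nn_integral_multc sumG_def mult.commute[of "f _"])
  also have "\<dots> = (\<integral>\<^sup>+M. f M * indicator {M. 0 < dt M \<and> dt M \<le> 1} M \<partial>lborel)"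
    using AE_generic by (intro nn_integral_cong_AE) (auto simp: sumG_Dom)
  finally show ?thesis .
qed

definition mu :: "m4 measure" where "mu = density lborel (indicator Dom)"

lemma sets_mu [simp, measurable_cong]: "sets mu = sets borel" and space_mu [simp]: "space mu = UNIV"
  by (simp_all add: mu_def)

lemma nn_integral_mu:
  "f \<in> borel_measurable borel \<Longrightarrow> (\<integral>\<^sup>+M. f M \<partial>mu) = (\<integral>\<^sup>+M. indicator Dom M * f M \<partial>lborel)"
  unfolding mu_def by (subst nn_integral_density) auto

text \<open>Left multiplication by h commutes with the right action of the group, so it carries
  \<open>Dom\<close> to another fundamental domain, and an invariant function has the same integral
  over both. Unfolding makes the comparison.\<close>

lemma nn_integral_mu_left:
  assumes f [measurable]: "f \<in> borel_measurable borel" and inv: "\<And>M g. g \<in> Gam \<Longrightarrow> f (mm M g) = f M"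
    and h: "dt h = 1"
  shows "(\<integral>\<^sup>+M. f (mm h M) \<partial>mu) = (\<integral>\<^sup>+M. f M \<partial>mu)"
proof -
  have h': "dt (adj h) = 1" using h by simp
  have "(\<integral>\<^sup>+M. f (mm h M) \<partial>mu) = (\<integral>\<^sup>+M. indicator Dom M * f (mm h M) \<partial>lborel)"
    by (rule nn_integral_mu) measurable
  also have "\<dots> = (\<integral>\<^sup>+M. indicator Dom (mm (adj h) (mm h M)) * f (mm h M) \<partial>lborel)"
    by (simp add: mm_adj_cancel h)
  also have "\<dots> = (\<integral>\<^sup>+M. indicator Dom (mm (adj h) M) * f M \<partial>lborel)"
    by (rule presD[OF left_pres[OF h], of "\<lambda>M. indicator Dom (mm (adj h) M) * f M"]) measurable
  also have "\<dots> = (\<integral>\<^sup>+M. (indicator Dom (mm (adj h) M) * f M) * indicator {M. 0 < dt M \<and> dt M \<le> 1} M \<partial>lborel)"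
  proof (rule nn_integral_cong)
    fix M show "indicator Dom (mm (adj h) M) * f M =
        (indicator Dom (mm (adj h) M) * f M) * indicator {M. 0 < dt M \<and> dt M \<le> 1} M"
      using Dom_dt[of "mm (adj h) M"] h by (auto simp: indicator_def)
  qed
  also have "\<dots> = (\<integral>\<^sup>+M. indicator Dom M * sumG (\<lambda>M. indicator Dom (mm (adj h) M) * f M) M \<partial>lborel)"
    by (rule unfolding_Dom[symmetric]) measurable
  also have "\<dots> = (\<integral>\<^sup>+M. indicator Dom M * f M \<partial>lborel)"
  proof (rule nn_integral_cong_AE)
    have "AE M in lborel. generic (mm (adj h) M)"
      by (rule AE_pres[OF left_pres[OF h'] AE_generic])
    then show "AE M in lborel. indicator Dom M * sumG (\<lambda>M. indicator Dom (mm (adj h) M) * f M) M = indicator Dom M * f M"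
    proof (rule AE_mp, intro AE_I2 impI)
      fix M assume gen: "generic (mm (adj h) M)"
      have "sumG (\<lambda>M. indicator Dom (mm (adj h) M) * f M) M = (\<integral>\<^sup>+g. indicator Dom (mm (mm (adj h) M) g) * f M \<partial>count_space Gam)"
        unfolding sumG_def by (intro nn_integral_cong) (auto simp: inv mm_assoc)
      also have "\<dots> = sumG (indicator Dom) (mm (adj h) M) * f M"
        by (simp add: sumG_def nn_integral_multc)
      also have "\<dots> = indicator {M. 0 < dt M \<and> dt M \<le> 1} M * f M"
        using sumG_Dom[OF gen] h by (simp add: indicator_def)
      finally show "indicator Dom M * sumG (\<lambda>M. indicator Dom (mm (adj h) M) * f M) M = indicator Dom M * f M"
        using Dom_dt[of M] by (simp add: indicator_def)
    qed
  qed
  also have "\<dots> = (\<integral>\<^sup>+M. f M \<partial>mu)" by (rule nn_integral_mu[symmetric]) measurable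
  finally show ?thesis .
qed

section \<open>The quotient as a sub-sigma-algebra\<close>

text \<open>The quotient of the group is encoded by the \<open>\<sigma>\<close>-algebra of Borel sets invariant under right
  multiplication by the Hecke group and under positive scalars, with the measure of the part inside
  the fundamental domain \<open>Dom\<close>.\<close>

definition invs :: "m4 set set" where
  "invs = {A \<in> sets borel. (\<forall>M. \<forall>g\<in>Gam. mm M g \<in> A \<longleftrightarrow> M \<in> A) \<and> (\<forall>M. \<forall>c>0. c *\<^sub>R M \<in> A \<longleftrightarrow> M \<in> A)}"

definition MX :: "m4 measure" where "MX = restr_to_subalg mu (sigma UNIV invs)"

lemma sets_sigma_invs: "sets (sigma UNIV invs) = invs"
proof -
  have "sigma_algebra UNIV invs"
    unfolding sigma_algebra_iff2
  proof (intro conjI allI impI ballI)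
    fix A assume "A \<in> invs"
    then have "UNIV - A \<in> sets borel" by (intro sets.Diff) (simp_all add: invs_def)
    then show "UNIV - A \<in> invs" using \<open>A \<in> invs\<close> by (simp add: invs_def)
  next
    fix A :: "nat \<Rightarrow> m4 set" assume "range A \<subseteq> invs"
    then have A: "A i \<in> invs" for i by blast
    then have "(\<Union>i. A i) \<in> sets borel" by (intro sets.countable_UN) (simp add: invs_def image_subset_iff)
    then show "(\<Union>i. A i) \<in> invs" using A by (simp add: invs_def)
  qed (simp_all add: invs_def)
  then show ?thesis by (simp add: sigma_algebra.sigma_sets_eq)
qed

lemma subalgebra_invs: "subalgebra mu (sigma UNIV invs)"
  unfolding subalgebra_def sets_sigma_invs by (auto simp: invs_def)

lemma sets_MX: "sets MX = invs" and space_MX [simp]: "space MX = UNIV"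
  by (simp_all add: MX_def sets_restr_to_subalg[OF subalgebra_invs] sets_sigma_invs space_restr_to_subalg)

lemma MX_measurableI:
  fixes f :: "m4 \<Rightarrow> real"
  assumes [measurable]: "f \<in> borel_measurable borel"
    and "\<And>M g. g \<in> Gam \<Longrightarrow> f (mm M g) = f M" "\<And>M c. c > 0 \<Longrightarrow> f (c *\<^sub>R M) = f M"
  shows "f \<in> borel_measurable MX"
proof (rule measurableI)
  fix A :: "real set" assume "A \<in> sets borel"
  then have "f -` A \<inter> space borel \<in> sets borel" by (intro measurable_sets) auto
  then show "f -` A \<inter> space MX \<in> sets MX" using assms by (simp add: sets_MX invs_def)
qed simp

text \<open>Level sets of a real function measurable for \<open>MX\<close> are invariant sets, so
  its invariance holds at every point and not only almost everywhere.\<close>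

lemma MX_measurableD:
  fixes f :: "m4 \<Rightarrow> real"
  assumes "f \<in> borel_measurable MX"
  shows "f \<in> borel_measurable borel" "g \<in> Gam \<Longrightarrow> f (mm M g) = f M" "c > 0 \<Longrightarrow> f (c *\<^sub>R M) = f M"
proof -
  have S: "f -` A \<in> invs" if "A \<in> sets borel" for A
    using measurable_sets[OF assms that] by (simp add: sets_MX)
  show "f \<in> borel_measurable borel"
  proof (rule measurableI)
    fix A :: "real set" assume "A \<in> sets borel"
    then show "f -` A \<inter> space borel \<in> sets borel" using S by (simp add: invs_def)
  qed simp
  have I: "f -` {f M} \<in> invs" by (rule S) simp
  show "g \<in> Gam \<Longrightarrow> f (mm M g) = f M" using I by (simp add: invs_def)
  show "c > 0 \<Longrightarrow> f (c *\<^sub>R M) = f M" using I by (simp add: invs_def)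
qed

lemma MX_measurable_mm [measurable]: "mm h \<in> measurable MX MX"
proof (rule measurableI)
  fix A assume "A \<in> sets MX"
  then have A: "A \<in> sets borel" "\<And>M g. g \<in> Gam \<Longrightarrow> mm M g \<in> A \<longleftrightarrow> M \<in> A" "\<And>M c. c > 0 \<Longrightarrow> c *\<^sub>R M \<in> A \<longleftrightarrow> M \<in> A"
    unfolding sets_MX invs_def by blast+
  have "mm h -` A \<inter> space borel \<in> sets borel" by (rule measurable_sets[OF _ A(1)]) measurable
  then show "mm h -` A \<inter> space MX \<in> sets MX" using A
    by (simp add: sets_MX invs_def mm_assoc[symmetric])
qed simp

lemma MX_emeasure: "A \<in> sets MX \<Longrightarrow> emeasure MX A = emeasure mu A"
  unfolding MX_def using emeasure_restr_to_subalg[OF subalgebra_invs]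
  by (simp add: sets_restr_to_subalg[OF subalgebra_invs])

lemma MX_distr: assumes "dt h = 1" shows "distr MX MX (mm h) = MX"
proof (rule measure_eqI)
  fix A assume "A \<in> sets (distr MX MX (mm h))"
  then have A: "A \<in> sets MX" by simp
  then have [measurable]: "A \<in> sets borel" and inv: "\<And>M g. g \<in> Gam \<Longrightarrow> mm M g \<in> A \<longleftrightarrow> M \<in> A"
    unfolding sets_MX invs_def by blast+
  have "emeasure (distr MX MX (mm h)) A = emeasure MX (mm h -` A \<inter> space MX)"
    using A by (intro emeasure_distr) measurable
  also have "\<dots> = emeasure mu (mm h -` A)"
    using measurable_sets[OF MX_measurable_mm[of h] A] by (simp add: MX_emeasure)
  also have "\<dots> = (\<integral>\<^sup>+M. indicator A (mm h M) \<partial>mu)"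
  proof -
    have "mm h -` A \<inter> space borel \<in> sets borel" by (rule measurable_sets) measurable
    then have "(\<integral>\<^sup>+M. indicator (mm h -` A) M \<partial>mu) = emeasure mu (mm h -` A)"
      by (intro nn_integral_indicator) simp
    then show ?thesis by (simp add: indicator_vimage[symmetric] indicator_def)
  qed
  also have "\<dots> = (\<integral>\<^sup>+M. indicator A M \<partial>mu)"
    using inv by (intro nn_integral_mu_left assms) (auto simp: indicator_def)
  also have "\<dots> = emeasure MX A" using A by (simp add: MX_emeasure)
  finally show "emeasure (distr MX MX (mm h)) A = emeasure MX A" .
qed simp

lemma integral_MX:
  fixes f :: "m4 \<Rightarrow> real"
  shows "f \<in> borel_measurable MX \<Longrightarrow> (\<integral>M. f M \<partial>MX) = (\<integral>M. f M \<partial>mu)"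
  unfolding MX_def by (rule integral_subalgebra2[OF subalgebra_invs measurable_in_subalg'[OF subalgebra_invs]])

lemma integral_MX_mm:
  fixes f :: "m4 \<Rightarrow> real"
  assumes "f \<in> borel_measurable MX" "dt h = 1"
  shows "(\<integral>M. f (mm h M) \<partial>MX) = (\<integral>M. f M \<partial>MX)"
  using integral_distr[OF MX_measurable_mm[of h] assms(1)] MX_distr[OF assms(2)] by simp

end

section \<open>The mean ergodic theorem\<close>

definition birkhoff :: "('a \<Rightarrow> 'a) \<Rightarrow> ('a \<Rightarrow> real) \<Rightarrow> nat \<Rightarrow> 'a \<Rightarrow> real" where
  "birkhoff T f n x = (\<Sum>k<n. f ((T ^^ k) x)) / real n"

lemma birkhoff_bounded:
  assumes "\<And>x. \<bar>f x\<bar> \<le> C"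
  shows "\<bar>birkhoff T f n x\<bar> \<le> C"
proof (cases "n = 0")
  case True
  then show ?thesis using assms[of x] by (simp add: birkhoff_def)
next
  case False
  have "\<bar>\<Sum>k<n. f ((T ^^ k) x)\<bar> \<le> (\<Sum>k<n. C)"
    by (rule order_trans[OF sum_abs]) (intro sum_mono assms)
  then show ?thesis using False by (simp add: birkhoff_def field_simps)
qed

text \<open>Each unit shift drops a term at one end and gains one at the other, a change of at most
  2 C.\<close>

lemma sum_window_shift:
  fixes a :: "nat \<Rightarrow> real"
  assumes "\<And>k. \<bar>a k\<bar> \<le> C"
  shows "\<bar>(\<Sum>k<n. a (k + j)) - (\<Sum>k<n. a k)\<bar> \<le> 2 * real j * C"
proof (induction j)
  case 0
  then show ?case using assms[of 0] by simp
next
  case (Suc j)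
  have "(\<Sum>k<n. a (Suc k + j)) - (\<Sum>k<n. a (k + j)) = a (n + j) - a j"
    using sum_lessThan_telescope[of "\<lambda>k. a (k + j)" n] by (simp add: sum_subtractf)
  then have "\<bar>(\<Sum>k<n. a (k + Suc j)) - (\<Sum>k<n. a (k + j))\<bar> \<le> 2 * C"
    using assms[of "n + j"] assms[of j] by simp
  then show ?case using Suc by (simp add: algebra_simps)
qed

text \<open>After the sums are exchanged, the average of averages is a mean over j < m of windows
  shifted by j. Averaging \<open>birkhoff T f m\<close> is thus asymptotically the same as averaging
  f.\<close>

lemma birkhoff_birkhoff:
  assumes C: "\<And>x. \<bar>f x\<bar> \<le> C" and "m > 0" "n > 0"
  shows "\<bar>birkhoff T (birkhoff T f m) n x - birkhoff T f n x\<bar> \<le> 2 * real m * C / real n"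
proof -
  define a where "a k = f ((T ^^ k) x)" for k
  have "birkhoff T (birkhoff T f m) n x = (\<Sum>k<n. (\<Sum>j<m. a (k + j))) / (real m * real n)"
  proof -
    have "(T ^^ j) ((T ^^ k) x) = (T ^^ (k + j)) x" for j k
      by (metis add.commute comp_apply funpow_add)
    then show ?thesis
      unfolding birkhoff_def a_def by (simp add: sum_divide_distrib[symmetric])
  qed
  also have "\<dots> = (\<Sum>j<m. (\<Sum>k<n. a (k + j))) / (real m * real n)"
    by (subst sum.swap) simp
  moreover have "birkhoff T f n x = (\<Sum>j<m. (\<Sum>k<n. a k)) / (real m * real n)"
    using assms by (simp add: birkhoff_def a_def)
  ultimately have "birkhoff T (birkhoff T f m) n x - birkhoff T f n x
    = (\<Sum>j<m. (\<Sum>k<n. a (k + j)) - (\<Sum>k<n. a k)) / (real m * real n)"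
    by (simp add: sum_subtractf diff_divide_distrib)
  moreover have "\<bar>\<Sum>j<m. (\<Sum>k<n. a (k + j)) - (\<Sum>k<n. a k)\<bar> \<le> (\<Sum>j<m. 2 * real m * C)"
  proof (rule order_trans[OF sum_abs], intro sum_mono)
    fix j assume "j \<in> {..<m}"
    have "0 \<le> C" using C[of x] by simp
    have "\<bar>(\<Sum>k<n. a (k + j)) - (\<Sum>k<n. a k)\<bar> \<le> 2 * real j * C"
      by (rule sum_window_shift) (simp add: a_def C)
    also have "\<dots> \<le> 2 * real m * C"
      using \<open>j \<in> _\<close> \<open>0 \<le> C\<close> by (intro mult_right_mono) auto
    finally show "\<bar>(\<Sum>k<n. a (k + j)) - (\<Sum>k<n. a k)\<bar> \<le> 2 * real m * C" .
  qed
  ultimately have "\<bar>birkhoff T (birkhoff T f m) n x - birkhoff T f n x\<bar> \<le> (\<Sum>j<m. 2 * real m * C) / (real m * real n)"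
    using divide_right_mono[of "\<bar>\<Sum>j<m. (\<Sum>k<n. a (k + j)) - (\<Sum>k<n. a k)\<bar>" "\<Sum>j<m. 2 * real m * C" "real m * real n"]
    by (simp only: abs_divide abs_mult abs_of_nat) simp
  also have "\<dots> = 2 * real m * C / real n" using assms by simp
  finally show ?thesis .
qed

lemma birkhoff_sq_le:
  "(birkhoff T f n x)\<^sup>2 \<le> birkhoff T (\<lambda>x. (f x)\<^sup>2) n x"
proof (cases "n = 0")
  case False
  have "(\<Sum>k<n. f ((T ^^ k) x))\<^sup>2 \<le> real n * (\<Sum>k<n. (f ((T ^^ k) x))\<^sup>2)"
    using Cauchy_Schwarz_ineq_sum[of "\<lambda>_. 1" "\<lambda>k. f ((T ^^ k) x)" "{..<n}"] by simp
  then show ?thesis using False by (simp add: birkhoff_def power_divide field_simps power2_eq_square)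
qed (simp add: birkhoff_def)

locale mpt = finite_measure M for M :: "'a measure" +
  fixes T :: "'a \<Rightarrow> 'a"
  assumes T_meas [measurable]: "T \<in> measurable M M" and T_distr: "distr M M T = M"
begin

lemma int_bdd:
  fixes h :: "'a \<Rightarrow> real"
  assumes "h \<in> borel_measurable M" "\<And>x. \<bar>h x\<bar> \<le> K" shows "integrable M h"
  using assms by (intro integrable_const_bound[of _ K]) auto

lemma int_bdd_diff:
  fixes u v :: "'a \<Rightarrow> real"
  assumes [measurable]: "u \<in> borel_measurable M" "v \<in> borel_measurable M"
    and "\<And>x. \<bar>u x\<bar> \<le> K" "\<And>x. \<bar>v x\<bar> \<le> K"
  shows "integrable M (\<lambda>x. \<bar>u x - v x\<bar>)"
proof (rule int_bdd)
  fix x show "\<bar>\<bar>u x - v x\<bar>\<bar> \<le> 2 * K" using assms(3)[of x] assms(4)[of x] by linarith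
qed measurable

lemma int_bdd_sq:
  fixes h :: "'a \<Rightarrow> real"
  assumes [measurable]: "h \<in> borel_measurable M" and "\<And>x. \<bar>h x\<bar> \<le> K"
  shows "integrable M (\<lambda>x. (h x)\<^sup>2)"
proof (rule int_bdd)
  fix x show "\<bar>(h x)\<^sup>2\<bar> \<le> K\<^sup>2"
    using power_mono[OF assms(2)[of x], of 2] by simp
qed measurable

lemma Tpow_meas [measurable]: "(T ^^ k) \<in> measurable M M"
  by (induction k) (auto simp: id_def intro: measurable_comp)

lemma integral_Tpow:
  fixes h :: "'a \<Rightarrow> real"
  assumes [measurable]: "h \<in> borel_measurable M"
  shows "(\<integral>x. h ((T ^^ k) x) \<partial>M) = (\<integral>x. h x \<partial>M)"
proof (induction k)
  case (Suc k)
  have "(\<integral>x. h ((T ^^ Suc k) x) \<partial>M) = (\<integral>x. h ((T ^^ k) (T x)) \<partial>M)" by (simp add: funpow_swap1)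
  also have "\<dots> = (\<integral>x. h ((T ^^ k) x) \<partial>distr M M T)" by (subst integral_distr) auto
  finally show ?case using Suc by (simp add: T_distr)
qed simp

lemma birkhoff_meas [measurable]:
  assumes [measurable]: "h \<in> borel_measurable M" shows "birkhoff T h n \<in> borel_measurable M"
  unfolding birkhoff_def[abs_def] by measurable

text \<open>The square of an average is at most the average of the squares, and T preserves the
  integral.\<close>

lemma birkhoff_contract:
  assumes [measurable]: "h \<in> borel_measurable M" and K: "\<And>x. \<bar>h x\<bar> \<le> K"
  shows "(\<integral>x. (birkhoff T h n x)\<^sup>2 \<partial>M) \<le> (\<integral>x. (h x)\<^sup>2 \<partial>M)"
proof (cases "n = 0")
  case True
  then show ?thesis by (simp add: birkhoff_def)
next
  case False
  have sq: "\<bar>(h x)\<^sup>2\<bar> \<le> K\<^sup>2" for x using K[of x] by (simp add: abs_le_square_iff[symmetric])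
  have "(\<integral>x. (birkhoff T h n x)\<^sup>2 \<partial>M) \<le> (\<integral>x. birkhoff T (\<lambda>x. (h x)\<^sup>2) n x \<partial>M)"
  proof (rule integral_mono)
    show "integrable M (\<lambda>x. (birkhoff T h n x)\<^sup>2)"
      using birkhoff_bounded[of h K T n, OF K]
      by (intro int_bdd[of _ "K\<^sup>2"]) (auto simp: abs_le_square_iff[symmetric] intro: order_trans[OF _ abs_ge_self])
    show "integrable M (birkhoff T (\<lambda>x. (h x)\<^sup>2) n)"
      by (intro int_bdd[of _ "K\<^sup>2"] birkhoff_bounded sq) auto
  qed (rule birkhoff_sq_le)
  also have "\<dots> = (\<Sum>k<n. \<integral>x. (h ((T ^^ k) x))\<^sup>2 \<partial>M) / real n"
    unfolding birkhoff_def using sq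
    by (simp add: Bochner_Integration.integral_sum int_bdd[of _ "K\<^sup>2"])
  also have "\<dots> = (\<integral>x. (h x)\<^sup>2 \<partial>M)"
    using integral_Tpow[of "\<lambda>x. (h x)\<^sup>2"] False by simp
  finally show ?thesis .
qed

text \<open>A subsequence with summable increments converges almost everywhere. Dominated
  convergence makes this convergence in L1, and the Cauchy property extends it to the whole
  sequence.\<close>

lemma L1_limit_of_Cauchy:
  fixes a :: "nat \<Rightarrow> 'a \<Rightarrow> real"
  assumes [measurable]: "\<And>n. a n \<in> borel_measurable M" and C: "\<And>n x. \<bar>a n x\<bar> \<le> C"
    and cauchy: "\<And>e. e > 0 \<Longrightarrow> \<exists>N. \<forall>m\<ge>N. \<forall>n\<ge>N. (\<integral>x. \<bar>a m x - a n x\<bar> \<partial>M) < e"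
  obtains P where "P \<in> borel_measurable M" "\<And>x. \<bar>P x\<bar> \<le> C" "(\<lambda>n. \<integral>x. \<bar>a n x - P x\<bar> \<partial>M) \<longlonglongrightarrow> 0"
proof -
  have C0: "0 \<le> C" using C[of 0 undefined] by simp
  define N where "N k = (SOME N. \<forall>m\<ge>N. \<forall>n\<ge>N. (\<integral>x. \<bar>a m x - a n x\<bar> \<partial>M) < (1/2)^k)" for k
  have N: "(\<integral>x. \<bar>a m x - a n x\<bar> \<partial>M) < (1/2)^k" if "m \<ge> N k" "n \<ge> N k" for m n k
    using someI_ex[OF cauchy[of "(1/2)^k"]] that by (simp add: N_def)
  \<comment> \<open>Partial sums of the thresholds are increasing indices that still lie above
    \<open>N k\<close>.\<close>
  define r where "r k = (\<Sum>i\<le>k. N i)" for k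
  have r: "N k \<le> r k" "r k \<le> r (Suc k)" for k
    unfolding r_def by (auto intro: member_le_sum)
  define d where "d k x = \<bar>a (r (Suc k)) x - a (r k) x\<bar>" for k x
  have [measurable]: "d k \<in> borel_measurable M" for k unfolding d_def by measurable
  have dint: "integrable M (d k)" for k
    unfolding d_def by (intro int_bdd_diff[of _ _ C] C) measurable
  have dle: "(\<integral>x. d k x \<partial>M) \<le> (1/2)^k" for k
    unfolding d_def using r[of k] by (intro less_imp_le[OF N]) auto
  have "(\<integral>\<^sup>+x. (\<Sum>k. ennreal (d k x)) \<partial>M) = (\<Sum>k. \<integral>\<^sup>+x. ennreal (d k x) \<partial>M)"
    by (rule nn_integral_suminf) measurable
  also have "\<dots> = (\<Sum>k. ennreal (\<integral>x. d k x \<partial>M))"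
    by (intro suminf_cong nn_integral_eq_integral dint) (simp add: d_def)
  also have "\<dots> \<le> (\<Sum>k. ennreal ((1/2)^k))"
    by (intro suminf_le ennreal_leI dle) auto
  also have "\<dots> = ennreal (\<Sum>k. (1/2)^k)"
    by (intro suminf_ennreal2) (auto intro: summable_geometric)
  also have "\<dots> < \<infinity>" by simp
  finally have "(\<integral>\<^sup>+x. (\<Sum>k. ennreal (d k x)) \<partial>M) \<noteq> \<infinity>" by simp
  then have "AE x in M. (\<Sum>k. ennreal (d k x)) \<noteq> \<infinity>"
    by (intro nn_integral_PInf_AE) auto
  then have conv: "AE x in M. convergent (\<lambda>k. a (r k) x)"
  proof (rule AE_mp, intro AE_I2 impI)
    fix x assume "(\<Sum>k. ennreal (d k x)) \<noteq> \<infinity>"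
    then have "summable (\<lambda>k. d k x)" by (intro summable_suminf_not_top) (auto simp: d_def)
    then have "summable (\<lambda>k. a (r (Suc k)) x - a (r k) x)"
      unfolding d_def by (rule summable_rabs_cancel)
    then have "convergent (\<lambda>n. \<Sum>k<n. a (r (Suc k)) x - a (r k) x)" by (simp add: summable_iff_convergent)
    then have "convergent (\<lambda>n. (a (r n) x - a (r 0) x) + a (r 0) x)"
      using sum_lessThan_telescope[of "\<lambda>k. a (r k) x"]
      by (intro convergent_add convergent_const) simp
    then show "convergent (\<lambda>k. a (r k) x)" by simp
  qed
  \<comment> \<open>\<open>lim\<close> is unspecified where the subsequence diverges; clamping makes
    the bound C hold at every point.\<close>
  define P where "P x = max (- C) (min C (lim (\<lambda>k. a (r k) x)))" for x
  have [measurable]: "P \<in> borel_measurable M" unfolding P_def by measurable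
  have PC: "\<bar>P x\<bar> \<le> C" for x using C0 by (auto simp: P_def)
  have lim: "AE x in M. (\<lambda>k. \<bar>a (r k) x - P x\<bar>) \<longlonglongrightarrow> 0"
    using conv
  proof (rule AE_mp, intro AE_I2 impI)
    fix x assume "convergent (\<lambda>k. a (r k) x)"
    then have l: "(\<lambda>k. a (r k) x) \<longlonglongrightarrow> lim (\<lambda>k. a (r k) x)" by (simp add: convergent_LIMSEQ_iff)
    have "lim (\<lambda>k. a (r k) x) \<le> C" using C by (intro LIMSEQ_le_const2[OF l]) (auto simp: abs_le_iff)
    moreover have "- C \<le> lim (\<lambda>k. a (r k) x)"
      using C by (intro LIMSEQ_le_const[OF l]) (auto simp: abs_le_iff minus_le_iff)
    ultimately have "P x = lim (\<lambda>k. a (r k) x)" by (simp add: P_def)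
    then show "(\<lambda>k. \<bar>a (r k) x - P x\<bar>) \<longlonglongrightarrow> 0" using l by (simp add: LIM_zero tendsto_rabs_zero)
  qed
  have "(\<lambda>k. \<integral>x. \<bar>a (r k) x - P x\<bar> \<partial>M) \<longlonglongrightarrow> (\<integral>x. 0 \<partial>M)"
  proof (rule integral_dominated_convergence[where w = "\<lambda>_. 2 * C"])
    fix k show "AE x in M. norm \<bar>a (r k) x - P x\<bar> \<le> 2 * C"
      using C PC by (intro AE_I2) (smt (verit) real_norm_def)
  qed (use lim in auto)
  then have rlim: "(\<lambda>k. \<integral>x. \<bar>a (r k) x - P x\<bar> \<partial>M) \<longlonglongrightarrow> 0" by simp
  have "(\<lambda>n. \<integral>x. \<bar>a n x - P x\<bar> \<partial>M) \<longlonglongrightarrow> 0"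
  proof (rule LIMSEQ_I)
    fix e :: real assume e: "0 < e"
    obtain k0 where k0: "\<And>k. k \<ge> k0 \<Longrightarrow> (\<integral>x. \<bar>a (r k) x - P x\<bar> \<partial>M) < e / 2"
      using LIMSEQ_D[OF rlim, of "e/2"] e by (auto simp: abs_less_iff)
    obtain k1 where k1: "(1/2::real)^k1 < e / 2"
      using real_arch_pow_inv[of "e/2" "1/2"] e by auto
    define k where "k = max k0 k1"
    have kk: "(1/2::real)^k < e/2"
      by (rule le_less_trans[OF _ k1]) (auto simp: k_def intro!: power_decreasing)
    show "\<exists>n0. \<forall>n\<ge>n0. norm ((\<integral>x. \<bar>a n x - P x\<bar> \<partial>M) - 0) < e"
    proof (intro exI allI impI)
      fix n assume n: "n \<ge> N k"
      have i: "integrable M (\<lambda>x. \<bar>a n x - a (r k) x\<bar>)" "integrable M (\<lambda>x. \<bar>a (r k) x - P x\<bar>)" "integrable M (\<lambda>x. \<bar>a n x - P x\<bar>)"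
        by (intro int_bdd_diff[of _ _ C] C PC; measurable)+
      have "(\<integral>x. \<bar>a n x - P x\<bar> \<partial>M) \<le> (\<integral>x. \<bar>a n x - a (r k) x\<bar> + \<bar>a (r k) x - P x\<bar> \<partial>M)"
        using i by (intro integral_mono Bochner_Integration.integrable_add) auto
      also have "\<dots> = (\<integral>x. \<bar>a n x - a (r k) x\<bar> \<partial>M) + (\<integral>x. \<bar>a (r k) x - P x\<bar> \<partial>M)"
        using i by (intro Bochner_Integration.integral_add)
      also have "\<dots> < (1/2)^k + e/2"
        using N[of k n "r k"] n r(1)[of k] k0[of k] by (simp add: k_def add_strict_mono)
      finally have "(\<integral>x. \<bar>a n x - P x\<bar> \<partial>M) < e" using kk by simp
      moreover have "0 \<le> (\<integral>x. \<bar>a n x - P x\<bar> \<partial>M)" by simp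
      ultimately show "norm ((\<integral>x. \<bar>a n x - P x\<bar> \<partial>M) - 0) < e" by simp
    qed
  qed
  then show thesis using PC by (intro that[of P]) auto
qed

text \<open>This is the minimal norm argument: the squared norms of the averages tend to their
  infimum, the midpoint of two averages cannot have a smaller norm, and the parallelogram identity
  then makes the averages a Cauchy sequence. As the total mass is finite, the L2 estimate gives one
  in L1.\<close>

theorem mean_ergodic:
  assumes f [measurable]: "f \<in> borel_measurable M" and C: "\<And>x. \<bar>f x\<bar> \<le> C"
  obtains P where "P \<in> borel_measurable M" "\<And>x. \<bar>P x\<bar> \<le> C"
    "(\<lambda>n. \<integral>x. \<bar>birkhoff T f n x - P x\<bar> \<partial>M) \<longlonglongrightarrow> 0" "AE x in M. P (T x) = P x"
proof -
  have C0: "0 \<le> C" using C[of undefined] by simp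
  define A where "A = birkhoff T f"
  have [measurable]: "A n \<in> borel_measurable M" for n unfolding A_def by measurable
  have AC: "\<bar>A n x\<bar> \<le> C" for n x unfolding A_def by (rule birkhoff_bounded) (rule C)
  have sqC: "\<bar>(A n x)\<^sup>2\<bar> \<le> C\<^sup>2" for n x using AC[of n x] by (simp add: abs_le_square_iff[symmetric])
  define V where "V = measure M (space M)"
  define a where "a n = (\<integral>x. (A n x)\<^sup>2 \<partial>M)" for n
  \<comment> \<open>Averaging contracts the norm, so a competitor h whose averages stay within K / n
    of those of f has squared norm at least \<open>a n\<close>, up to an error of order 1 /
    n.\<close>
  have key: "a n \<le> (\<integral>x. (h x)\<^sup>2 \<partial>M) + 2 * C * (K / real n) * V"
    if [measurable]: "h \<in> borel_measurable M" and hC: "\<And>x. \<bar>h x\<bar> \<le> C" and n: "n > 0"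
      and hK: "\<And>x. \<bar>birkhoff T h n x - A n x\<bar> \<le> K / real n" for h K n
  proof -
    have bC: "\<bar>birkhoff T h n x\<bar> \<le> C" for x by (rule birkhoff_bounded) (rule hC)
    have pt: "(A n x)\<^sup>2 \<le> (birkhoff T h n x)\<^sup>2 + 2 * C * (K / real n)" for x
    proof -
      have "(A n x)\<^sup>2 - (birkhoff T h n x)\<^sup>2 = (A n x - birkhoff T h n x) * (A n x + birkhoff T h n x)"
        by (simp add: power2_eq_square algebra_simps)
      also have "\<dots> \<le> \<bar>A n x - birkhoff T h n x\<bar> * \<bar>A n x + birkhoff T h n x\<bar>"
        by (simp add: abs_mult[symmetric])
      also have "\<dots> \<le> (K / real n) * (2 * C)"
        using AC[of n x] bC[of x] hK[of x] by (intro mult_mono) (auto simp: abs_minus_commute)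
      finally show ?thesis by (simp add: algebra_simps)
    qed
    have i: "integrable M (\<lambda>x. (birkhoff T h n x)\<^sup>2)"
      using bC by (intro int_bdd[of _ "C\<^sup>2"]) (auto simp: abs_le_square_iff[symmetric] intro: order_trans[OF _ abs_ge_self])
    have "a n \<le> (\<integral>x. (birkhoff T h n x)\<^sup>2 + 2 * C * (K / real n) \<partial>M)"
      unfolding a_def using i sqC by (intro integral_mono pt int_bdd[of "\<lambda>x. (A n x)\<^sup>2" "C\<^sup>2"]) auto
    also have "\<dots> = (\<integral>x. (birkhoff T h n x)\<^sup>2 \<partial>M) + 2 * C * (K / real n) * V"
      using i by (simp add: V_def)
    also have "\<dots> \<le> (\<integral>x. (h x)\<^sup>2 \<partial>M) + 2 * C * (K / real n) * V"
      using birkhoff_contract[of h C n] hC by simp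
    finally show ?thesis .
  qed
  \<comment> \<open>The index 0 is left out: division by 0 makes that average 0.\<close>
  define m0 where "m0 = (INF n\<in>{0<..}. a n)"
  have bdd: "bdd_below (a ` {0<..})" by (rule bdd_belowI2[of _ 0]) (simp add: a_def)
  have m0: "m0 \<le> a n" if "n > 0" for n unfolding m0_def using that bdd by (intro cINF_lower) auto
  have lim0: "(\<lambda>n. 2 * C * (K / real n) * V) \<longlonglongrightarrow> 0" for K
    by (intro tendsto_mult_left_zero tendsto_mult_right_zero lim_const_over_n)
  have low: "m0 \<le> (\<integral>x. (h x)\<^sup>2 \<partial>M)"
    if "h \<in> borel_measurable M" "\<And>x. \<bar>h x\<bar> \<le> C"
      "\<And>n x. n > 0 \<Longrightarrow> \<bar>birkhoff T h n x - A n x\<bar> \<le> K / real n" for h K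
  proof (rule LIMSEQ_le_const)
    show "(\<lambda>n. (\<integral>x. (h x)\<^sup>2 \<partial>M) + 2 * C * (K / real n) * V) \<longlonglongrightarrow> (\<integral>x. (h x)\<^sup>2 \<partial>M)"
      using tendsto_add[OF tendsto_const lim0] by simp
    show "\<exists>N. \<forall>n\<ge>N. m0 \<le> (\<integral>x. (h x)\<^sup>2 \<partial>M) + 2 * C * (K / real n) * V"
      using m0 key[OF that(1,2), of _ K] that(3)
      by (intro exI[of _ 1]) (metis Suc_le_eq One_nat_def order_trans)
  qed
  have a_lim: "a \<longlonglongrightarrow> m0"
  proof (rule order_tendstoI)
    fix e assume "e < m0"
    then show "eventually (\<lambda>n. e < a n) sequentially"
      using m0 by (intro eventually_sequentiallyI[of 1]) (metis One_nat_def Suc_le_eq less_le_trans)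
  next
    fix e assume e: "m0 < e"
    then obtain m where m: "m > 0" "a m < e"
      unfolding m0_def using cINF_less_iff[OF _ bdd] by auto
    have up: "a n \<le> a m + 2 * C * (2 * real m * C / real n) * V" if "n > 0" for n
      unfolding a_def[of m] using that m C birkhoff_birkhoff[of f C m n T, OF C]
      by (intro key AC) (auto simp: A_def)
    have "(\<lambda>n. a m + 2 * C * (2 * real m * C / real n) * V) \<longlonglongrightarrow> a m + 0"
      by (intro tendsto_add tendsto_const lim0)
    then have "eventually (\<lambda>n. a m + 2 * C * (2 * real m * C / real n) * V < e) sequentially"
      using m by (intro order_tendstoD) auto
    then show "eventually (\<lambda>n. a n < e) sequentially"
      using eventually_gt_at_top[of 0] by eventually_elim (use up le_less_trans in blast)
  qed
  \<comment> \<open>The midpoint of two averages is an admissible competitor, because averaging an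
    average again returns nearly the average of f.\<close>
  have sqdiff: "(\<integral>x. (A m x - A n x)\<^sup>2 \<partial>M) \<le> 2 * (a m - m0) + 2 * (a n - m0)" if mn: "m > 0" "n > 0" for m n
  proof -
    define h where "h x = (A m x + A n x) / 2" for x
    have [measurable]: "h \<in> borel_measurable M" unfolding h_def by measurable
    have hC: "\<bar>h x\<bar> \<le> C" for x using AC[of m x] AC[of n x] by (simp add: h_def)
    have "m0 \<le> (\<integral>x. (h x)\<^sup>2 \<partial>M)"
    proof (rule low[of h "2 * real (m + n) * C"])
      fix N x assume N: "(N::nat) > 0"
      have e: "birkhoff T h N x = (birkhoff T (A m) N x + birkhoff T (A n) N x) / 2"
        by (simp add: birkhoff_def h_def sum.distrib sum_divide_distrib[symmetric] add_divide_distrib)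
      have "\<bar>birkhoff T (A m) N x - A N x\<bar> \<le> 2 * real m * C / real N"
        "\<bar>birkhoff T (A n) N x - A N x\<bar> \<le> 2 * real n * C / real N"
        unfolding A_def using mn N C by (intro birkhoff_birkhoff; simp)+
      then have "\<bar>birkhoff T h N x - A N x\<bar> \<le> (2 * real m * C / real N + 2 * real n * C / real N) / 2"
        unfolding e by (auto simp: abs_le_iff field_simps)
      also have "\<dots> \<le> 2 * real (m + n) * C / real N"
        using C0 N by (simp add: field_simps)
      finally show "\<bar>birkhoff T h N x - A N x\<bar> \<le> 2 * real (m + n) * C / real N" .
    qed (use hC in auto)
    moreover have "(\<integral>x. (A m x - A n x)\<^sup>2 \<partial>M) = 2 * a m + 2 * a n - 4 * (\<integral>x. (h x)\<^sup>2 \<partial>M)"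
    proof -
      have "(A m x - A n x)\<^sup>2 = 2 * (A m x)\<^sup>2 + 2 * (A n x)\<^sup>2 - 4 * (h x)\<^sup>2" for x
        by (simp add: h_def power2_eq_square field_simps)
      moreover have "integrable M (\<lambda>x. (A n x)\<^sup>2)" for n using sqC by (intro int_bdd[of _ "C\<^sup>2"]) auto
      moreover have "integrable M (\<lambda>x. (h x)\<^sup>2)" using hC
        by (intro int_bdd[of _ "C\<^sup>2"]) (auto simp: abs_le_square_iff[symmetric] intro: order_trans[OF _ abs_ge_self])
      ultimately show ?thesis by (simp add: a_def)
    qed
    ultimately show ?thesis by simp
  qed
  have cauchy: "\<exists>N. \<forall>m\<ge>N. \<forall>n\<ge>N. (\<integral>x. \<bar>A m x - A n x\<bar> \<partial>M) < e" if e: "e > 0" for e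
  proof -
    \<comment> \<open>From \<bar>u\<bar> \<le> d + u^2 / d the L1 norm is at most d (V + 1) as soon
      as the squared norm is at most d^2. V is the total mass, and V + 1 avoids a division by
      0.\<close>
    define d where "d = e / (2 * (V + 1))"
    have V0: "0 \<le> V" by (simp add: V_def)
    have d: "0 < d" using e V0 by (simp add: d_def)
    have "eventually (\<lambda>n. a n < m0 + d\<^sup>2 / 4) sequentially"
      using a_lim d by (intro order_tendstoD) auto
    then obtain N where N: "\<And>n. n \<ge> N \<Longrightarrow> a n < m0 + d\<^sup>2 / 4" by (auto simp: eventually_sequentially)
    show ?thesis
    proof (intro exI allI impI)
      fix m n assume mn: "m \<ge> Suc N" "n \<ge> Suc N"
      have sq: "(\<integral>x. (A m x - A n x)\<^sup>2 \<partial>M) \<le> d\<^sup>2"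
        using sqdiff[of m n] N[of m] N[of n] mn by simp
      have i: "integrable M (\<lambda>x. (A m x - A n x)\<^sup>2)" "integrable M (\<lambda>x. \<bar>A m x - A n x\<bar>)"
      proof -
        have b: "\<bar>A m x - A n x\<bar> \<le> 2 * C" for x using AC[of m x] AC[of n x] by linarith
        show "integrable M (\<lambda>x. (A m x - A n x)\<^sup>2)" by (rule int_bdd_sq[OF _ b]) measurable
        show "integrable M (\<lambda>x. \<bar>A m x - A n x\<bar>)" by (intro int_bdd_diff[of _ _ C] AC) measurable
      qed
      have "(\<integral>x. \<bar>A m x - A n x\<bar> \<partial>M) \<le> (\<integral>x. d + (A m x - A n x)\<^sup>2 / d \<partial>M)"
      proof (rule integral_mono)
        fix x
        have "d * \<bar>A m x - A n x\<bar> \<le> d * d + (A m x - A n x)\<^sup>2"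
        proof -
          have "2 * d * \<bar>A m x - A n x\<bar> \<le> d * d + (A m x - A n x)\<^sup>2"
            using sum_squares_bound[of d "\<bar>A m x - A n x\<bar>"] by (simp add: power2_eq_square)
          moreover have "0 \<le> d * \<bar>A m x - A n x\<bar>" using d by simp
          ultimately show ?thesis by linarith
        qed
        then show "\<bar>A m x - A n x\<bar> \<le> d + (A m x - A n x)\<^sup>2 / d" using d by (simp add: field_simps)
      qed (use i in auto)
      also have "\<dots> = d * V + (\<integral>x. (A m x - A n x)\<^sup>2 \<partial>M) / d" using i by (simp add: V_def)
      also have "\<dots> \<le> d * V + d\<^sup>2 / d" using sq d by (intro add_left_mono divide_right_mono) auto
      also have "\<dots> = d * (V + 1)" using d by (simp add: power2_eq_square algebra_simps)
      also have "\<dots> = e / 2"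
      proof -
        have "V + 1 \<noteq> 0" using V0 by simp
        then show ?thesis unfolding d_def times_divide_eq_left
          by (rule nonzero_mult_divide_mult_cancel_right)
      qed
      also have "\<dots> < e" using e by simp
      finally show "(\<integral>x. \<bar>A m x - A n x\<bar> \<partial>M) < e" .
    qed
  qed
  obtain P where P [measurable]: "P \<in> borel_measurable M" and PC: "\<And>x. \<bar>P x\<bar> \<le> C"
    and lim: "(\<lambda>n. \<integral>x. \<bar>A n x - P x\<bar> \<partial>M) \<longlonglongrightarrow> 0"
    using L1_limit_of_Cauchy[of A C] AC cauchy by auto
  have "AE x in M. P (T x) = P x"
  proof -
    have i: "integrable M (\<lambda>x. \<bar>P (T x) - P x\<bar>)" by (intro int_bdd_diff[of _ _ C] PC) measurable
    have iA: "integrable M (\<lambda>x. \<bar>A n x - P x\<bar>)" for n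
      by (intro int_bdd_diff[of _ _ C] AC PC) measurable
    have iAT: "integrable M (\<lambda>x. \<bar>A n (T x) - P (T x)\<bar>)" for n
      by (intro int_bdd_diff[of _ _ C] AC PC) measurable
    \<comment> \<open>The errors are those of the average at T x and at x, equal after integration
      by invariance, and the change of the average under one step.\<close>
    have le: "(\<integral>x. \<bar>P (T x) - P x\<bar> \<partial>M) \<le> 2 * (\<integral>x. \<bar>A n x - P x\<bar> \<partial>M) + 2 * C / real n * V" if n: "n > 0" for n
    proof -
      have AT: "\<bar>A n (T x) - A n x\<bar> \<le> 2 * C / real n" for x
      proof -
        have "A n (T x) - A n x = ((\<Sum>k<n. f ((T ^^ (k + 1)) x)) - (\<Sum>k<n. f ((T ^^ k) x))) / real n"
          by (simp add: A_def birkhoff_def funpow_swap1 diff_divide_distrib)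
        then show ?thesis
          using sum_window_shift[of "\<lambda>k. f ((T ^^ k) x)" C 1 n] C by (simp add: abs_divide divide_right_mono)
      qed
      have "(\<integral>x. \<bar>P (T x) - P x\<bar> \<partial>M) \<le> (\<integral>x. \<bar>A n (T x) - P (T x)\<bar> + \<bar>A n x - P x\<bar> + 2 * C / real n \<partial>M)"
      proof (rule integral_mono)
        fix x show "\<bar>P (T x) - P x\<bar> \<le> \<bar>A n (T x) - P (T x)\<bar> + \<bar>A n x - P x\<bar> + 2 * C / real n"
          using AT[of x] by linarith
      qed (use i iA iAT in auto)
      also have "\<dots> = (\<integral>x. \<bar>A n (T x) - P (T x)\<bar> \<partial>M) + (\<integral>x. \<bar>A n x - P x\<bar> \<partial>M) + 2 * C / real n * V"
        using iA iAT by (simp add: V_def)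
      also have "(\<integral>x. \<bar>A n (T x) - P (T x)\<bar> \<partial>M) = (\<integral>x. \<bar>A n x - P x\<bar> \<partial>M)"
        using integral_Tpow[of "\<lambda>x. \<bar>A n x - P x\<bar>" 1] by simp
      finally show ?thesis by simp
    qed
    have "(\<lambda>n. 2 * (\<integral>x. \<bar>A n x - P x\<bar> \<partial>M) + 2 * C / real n * V) \<longlonglongrightarrow> 2 * 0 + 0"
      by (intro tendsto_intros lim tendsto_mult_left_zero lim_const_over_n)
    then have "(\<integral>x. \<bar>P (T x) - P x\<bar> \<partial>M) \<le> 2 * 0 + 0"
      by (rule LIMSEQ_le_const) (use le in \<open>auto intro!: exI[of _ 1]\<close>)
    then have "(\<integral>x. \<bar>P (T x) - P x\<bar> \<partial>M) = 0"
      by (intro antisym) auto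
    then have "AE x in M. \<bar>P (T x) - P x\<bar> = 0"
      using integral_nonneg_eq_0_iff_AE[OF i] by simp
    then show ?thesis by simp
  qed
  then show thesis using that P PC lim unfolding A_def by blast
qed

end

section \<open>The volume of the quotient\<close>

lemma nn_integral_scale2:
  fixes f :: "real \<times> real \<Rightarrow> ennreal"
  assumes [measurable]: "f \<in> borel_measurable borel" and c: "c > 0"
  shows "(\<integral>\<^sup>+p. f ((1 / c) *\<^sub>R p) \<partial>lborel) = ennreal (c\<^sup>2) * (\<integral>\<^sup>+p. f p \<partial>lborel)"
proof -
  have "(\<integral>\<^sup>+p. f p \<partial>lborel)
      = (\<integral>\<^sup>+p. f p \<partial>density (distr lborel borel (\<lambda>x. 0 + (1 / c) *\<^sub>R x)) (\<lambda>_. \<bar>1 / c\<bar> ^ DIM(real \<times> real)))"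
    using c by (subst lborel_affine[of "1 / c" "0 :: real \<times> real"]) auto
  also have "\<dots> = (\<integral>\<^sup>+p. ennreal ((1 / c)\<^sup>2) * f ((1 / c) *\<^sub>R p) \<partial>lborel)"
    using c by (simp add: nn_integral_density nn_integral_distr power_divide power2_eq_square)
  also have "\<dots> = ennreal ((1 / c)\<^sup>2) * (\<integral>\<^sup>+p. f ((1 / c) *\<^sub>R p) \<partial>lborel)"
    by (rule nn_integral_cmult) measurable
  finally have "ennreal (c\<^sup>2) * (\<integral>\<^sup>+p. f p \<partial>lborel)
      = (ennreal (c\<^sup>2) * ennreal ((1 / c)\<^sup>2)) * (\<integral>\<^sup>+p. f ((1 / c) *\<^sub>R p) \<partial>lborel)"
    by (simp add: mult.assoc)
  also have "ennreal (c\<^sup>2) * ennreal ((1 / c)\<^sup>2) = 1"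
    using c by (simp add: ennreal_mult[symmetric] power_divide)
  finally show ?thesis by simp
qed

text \<open>For a fixed first row (x, z) the second row is (s x, (d + z s x) / x). The factor x from
  the first of these cancels the factor 1 / x from the second, so slope and determinant carry
  Lebesgue measure.\<close>

lemma nn_integral_coords:
  fixes F :: "real \<Rightarrow> real \<times> real \<Rightarrow> real \<Rightarrow> ennreal"
  assumes F: "(\<lambda>u. F (fst u) (fst (snd u)) (snd (snd u))) \<in> borel_measurable borel"
  shows "(\<integral>\<^sup>+M. F (dt M) (fst M) (sl M) * indicator {M. 0 < fst (fst M)} M \<partial>lborel)
    = (\<integral>\<^sup>+p. (\<integral>\<^sup>+s. \<integral>\<^sup>+d. F d p s \<partial>lborel \<partial>lborel) * indicator {p. 0 < fst p} p \<partial>lborel)"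
proof -
  have Fm [measurable (raw)]: "(\<lambda>x. F (f x) (g x) (h x)) \<in> borel_measurable N"
    if "f \<in> borel_measurable N" "g \<in> borel_measurable N" "h \<in> borel_measurable N" for f g h and N :: "'c measure"
    using measurable_compose[OF borel_measurable_Pair[OF that(1) borel_measurable_Pair[OF that(2,3)]] F] by simp
  have m0: "(\<lambda>M. F (dt M) (fst M) (sl M) * indicator {M. 0 < fst (fst M)} M) \<in> borel_measurable borel"
    by measurable
  have "(\<integral>\<^sup>+M. F (dt M) (fst M) (sl M) * indicator {M. 0 < fst (fst M)} M \<partial>(lborel \<Otimes>\<^sub>M lborel))
      = (\<integral>\<^sup>+p. \<integral>\<^sup>+r. F (dt (p, r)) p (sl (p, r)) * indicator {p. 0 < fst p} p \<partial>lborel \<partial>lborel)"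
  proof (subst lborel.nn_integral_fst[symmetric])
    show "(\<lambda>M. F (dt M) (fst M) (sl M) * indicator {M. 0 < fst (fst M)} M) \<in> borel_measurable (lborel \<Otimes>\<^sub>M lborel)"
      using m0 by (simp add: lborel_prod)
  qed (simp add: indicator_def)
  also have "\<dots> = (\<integral>\<^sup>+p. (\<integral>\<^sup>+s. \<integral>\<^sup>+d. F d p s \<partial>lborel \<partial>lborel) * indicator {p. 0 < fst p} p \<partial>lborel)"
  proof (rule nn_integral_cong)
    fix p :: "real \<times> real"
    obtain x z where p: "p = (x, z)" by (cases p)
    show "(\<integral>\<^sup>+r. F (dt (p, r)) p (sl (p, r)) * indicator {p. 0 < fst p} p \<partial>lborel)
      = (\<integral>\<^sup>+s. \<integral>\<^sup>+d. F d p s \<partial>lborel \<partial>lborel) * indicator {p. 0 < fst p} p"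
    proof (cases "0 < x")
      case x: True
      define K where "K s = (\<integral>\<^sup>+d. F d p s \<partial>lborel)" for s
      have Km [measurable]: "K \<in> borel_measurable borel" unfolding K_def by measurable
      have w: "(\<integral>\<^sup>+w. F (x * w - z * y) p (y / x) \<partial>lborel) = ennreal (1 / x) * K (y / x)" for y
      proof -
        have "K (y / x) = ennreal \<bar>x\<bar> * (\<integral>\<^sup>+w. F (- (z * y) + x * w) p (y / x) \<partial>lborel)"
          unfolding K_def using x by (intro nn_integral_real_affine) auto
        then have "ennreal (1 / x) * K (y / x) = (ennreal (1 / x) * ennreal x) * (\<integral>\<^sup>+w. F (- (z * y) + x * w) p (y / x) \<partial>lborel)"
          using x by (simp add: mult.assoc)
        also have "ennreal (1 / x) * ennreal x = 1" using x by (simp add: ennreal_mult[symmetric])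
        finally show ?thesis by (simp add: algebra_simps)
      qed
      have "(\<integral>\<^sup>+r. F (dt (p, r)) p (sl (p, r)) \<partial>(lborel \<Otimes>\<^sub>M lborel)) = (\<integral>\<^sup>+y. \<integral>\<^sup>+w. F (x * w - z * y) p (y / x) \<partial>lborel \<partial>lborel)"
      proof (subst lborel.nn_integral_fst[symmetric])
        have "(\<lambda>r. F (dt (p, r)) p (sl (p, r))) \<in> borel_measurable borel" by measurable
        then show "(\<lambda>r. F (dt (p, r)) p (sl (p, r))) \<in> borel_measurable (lborel \<Otimes>\<^sub>M lborel)" by (simp add: lborel_prod)
      qed (simp add: p)
      also have "\<dots> = (\<integral>\<^sup>+y. ennreal (1 / x) * K (0 + (1 / x) * y) \<partial>lborel)" by (simp add: w)
      also have "\<dots> = ennreal \<bar>1 / x\<bar> * (\<integral>\<^sup>+y. K (0 + (1 / x) * y) \<partial>lborel)"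
        using x by (subst nn_integral_cmult) auto
      also have "\<dots> = (\<integral>\<^sup>+s. K s \<partial>lborel)"
        using x by (intro nn_integral_real_affine[symmetric]) auto
      finally show ?thesis using x by (simp add: p K_def lborel_prod)
    qed (simp add: p)
  qed
  finally show ?thesis by (simp add: lborel_prod)
qed

lemma nn_integral_id_unit: "(\<integral>\<^sup>+d. ennreal d * indicator {0<..1::real} d \<partial>lborel) = ennreal (1 / 2)"
proof -
  have "((\<lambda>x::real. x) has_integral (1\<^sup>2 - 0\<^sup>2) / 2) {0..1}" by (rule ident_has_integral) simp
  then have "((\<lambda>x::real. x) has_integral (1 / 2)) {0<..1}"
    by (subst has_integral_spike_set_eq[of _ "{0..1}"]) (auto intro: negligible_subset[of "{0}"])
  from nn_integral_has_integral_lebesgue'[OF _ this] show ?thesis by auto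
qed

text \<open>The factor \<open>1/2\<close> is the integral of the determinant over \<open>(0,1]\<close>.\<close>

lemma nn_integral_normalised:
  fixes k :: "real \<times> real \<Rightarrow> real \<Rightarrow> ennreal"
  assumes k: "(\<lambda>u. k (fst u) (snd u)) \<in> borel_measurable borel"
  shows "(\<integral>\<^sup>+M. k ((1 / sqrt (dt M)) *\<^sub>R fst M) (sl M) * indicator {M. 0 < fst (fst M)} M
        * indicator {M. 0 < dt M \<and> dt M \<le> 1} M \<partial>lborel)
    = ennreal (1 / 2) * (\<integral>\<^sup>+p. (\<integral>\<^sup>+s. k p s \<partial>lborel) * indicator {p. 0 < fst p} p \<partial>lborel)"
proof -
  have km [measurable (raw)]: "(\<lambda>x. k (f x) (g x)) \<in> borel_measurable N"
    if "f \<in> borel_measurable N" "g \<in> borel_measurable N" for f g and N :: "'c measure"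
    using measurable_compose[OF borel_measurable_Pair[OF that] k] by simp
  define F where "F d p s = k ((1 / sqrt d) *\<^sub>R p) s * indicator {0<..1} d" for d :: real and p :: "real \<times> real" and s :: real
  define Kp where "Kp p = (\<integral>\<^sup>+s. k p s \<partial>lborel)" for p
  have Kpm [measurable]: "Kp \<in> borel_measurable borel"
    unfolding Kp_def by measurable
  define W where "W = (\<integral>\<^sup>+p. Kp p * indicator {p. 0 < fst p} p \<partial>lborel)"
  have "(\<integral>\<^sup>+M. k ((1 / sqrt (dt M)) *\<^sub>R fst M) (sl M) * indicator {M. 0 < fst (fst M)} M
        * indicator {M. 0 < dt M \<and> dt M \<le> 1} M \<partial>lborel)
      = (\<integral>\<^sup>+M. F (dt M) (fst M) (sl M) * indicator {M. 0 < fst (fst M)} M \<partial>lborel)"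
    by (intro nn_integral_cong) (auto simp: F_def indicator_def)
  also have "\<dots> = (\<integral>\<^sup>+p. (\<integral>\<^sup>+s. \<integral>\<^sup>+d. F d p s \<partial>lborel \<partial>lborel) * indicator {p. 0 < fst p} p \<partial>lborel)"
    unfolding F_def by (rule nn_integral_coords) measurable
  also have "\<dots> = (\<integral>\<^sup>+p. (\<integral>\<^sup>+d. Kp ((1 / sqrt d) *\<^sub>R p) * indicator {p. 0 < fst p} p * indicator {0<..1} d \<partial>lborel) \<partial>lborel)"
  proof (rule nn_integral_cong)
    fix p :: "real \<times> real"
    have "(\<lambda>u. F (snd u) p (fst u)) \<in> borel_measurable borel" unfolding F_def by measurable
    then have "(\<lambda>u. F (snd u) p (fst u)) \<in> borel_measurable (lborel \<Otimes>\<^sub>M lborel)" by (simp add: lborel_prod)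
    then have "(\<integral>\<^sup>+s. \<integral>\<^sup>+d. F d p s \<partial>lborel \<partial>lborel) = (\<integral>\<^sup>+d. \<integral>\<^sup>+s. F d p s \<partial>lborel \<partial>lborel)"
      using lborel_pair.Fubini'[of "\<lambda>s d. F d p s"] by (simp add: case_prod_beta)
    also have "\<dots> = (\<integral>\<^sup>+d. Kp ((1 / sqrt d) *\<^sub>R p) * indicator {0<..1} d \<partial>lborel)"
      unfolding F_def Kp_def by (intro nn_integral_cong nn_integral_multc) measurable
    finally have "(\<integral>\<^sup>+s. \<integral>\<^sup>+d. F d p s \<partial>lborel \<partial>lborel) * indicator {p. 0 < fst p} p
      = (\<integral>\<^sup>+d. Kp ((1 / sqrt d) *\<^sub>R p) * indicator {0<..1} d * indicator {p. 0 < fst p} p \<partial>lborel)"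
      by (subst nn_integral_multc) auto
    then show "(\<integral>\<^sup>+s. \<integral>\<^sup>+d. F d p s \<partial>lborel \<partial>lborel) * indicator {p. 0 < fst p} p
      = (\<integral>\<^sup>+d. Kp ((1 / sqrt d) *\<^sub>R p) * indicator {p. 0 < fst p} p * indicator {0<..1} d \<partial>lborel)"
      by (simp add: mult_ac)
  qed
  also have "\<dots> = (\<integral>\<^sup>+d. (\<integral>\<^sup>+p. Kp ((1 / sqrt d) *\<^sub>R p) * indicator {p. 0 < fst p} p * indicator {0<..1} d \<partial>lborel) \<partial>lborel)"
  proof -
    have "(\<lambda>u. Kp ((1 / sqrt (snd u)) *\<^sub>R fst u) * indicator {p. 0 < fst p} (fst u) * indicator {0<..1} (snd u)) \<in> borel_measurable borel"
      by measurable
    then have "(\<lambda>u. Kp ((1 / sqrt (snd u)) *\<^sub>R fst u) * indicator {p. 0 < fst p} (fst u) * indicator {0<..1} (snd u)) \<in> borel_measurable (lborel \<Otimes>\<^sub>M lborel)"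
      by (simp add: lborel_prod)
    then show ?thesis
      using lborel_pair.Fubini'[of "\<lambda>p d. Kp ((1 / sqrt d) *\<^sub>R p) * indicator {p. 0 < fst p} p * indicator {0<..1} d"]
      by (simp add: case_prod_beta)
  qed
  also have "\<dots> = (\<integral>\<^sup>+d. W * (ennreal d * indicator {0<..1} d) \<partial>lborel)"
  proof (rule nn_integral_cong)
    \<comment> \<open>For a fixed determinant d, rescaling the row by its square root has Jacobian d
      in the plane.\<close>
    fix d :: real
    show "(\<integral>\<^sup>+p. Kp ((1 / sqrt d) *\<^sub>R p) * indicator {p. 0 < fst p} p * indicator {0<..1} d \<partial>lborel)
      = W * (ennreal d * indicator {0<..1} d)"
    proof (cases "0 < d \<and> d \<le> 1")
      case True
      have "(\<integral>\<^sup>+p. Kp ((1 / sqrt d) *\<^sub>R p) * indicator {p. 0 < fst p} p \<partial>lborel)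
        = (\<integral>\<^sup>+p. (\<lambda>p. Kp p * indicator {p. 0 < fst p} p) ((1 / sqrt d) *\<^sub>R p) \<partial>lborel)"
        using True by (intro nn_integral_cong) (auto simp: indicator_def zero_less_divide_iff)
      also have "\<dots> = ennreal ((sqrt d)\<^sup>2) * W"
        unfolding W_def using True by (intro nn_integral_scale2) auto
      finally show ?thesis using True by (simp add: mult_ac)
    qed auto
  qed
  also have "\<dots> = W * ennreal (1 / 2)"
    by (subst nn_integral_cmult) (auto simp: nn_integral_id_unit)
  finally show ?thesis by (simp add: W_def Kp_def mult.commute)
qed

section \<open>The return time and the fibres of the fundamental domain\<close>

context hecke
begin

definition gm :: "real \<times> real \<Rightarrow> m4" where "gm p = (p, (0, 1 / fst p))"

lemma measurable_gm [measurable]: "gm \<in> borel_measurable borel"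
  unfolding gm_def by (intro borel_measurable_Pair) measurable

lemma dt_gm: "fst p \<noteq> 0 \<Longrightarrow> dt (gm p) = 1"
  by (cases p) (simp add: gm_def)

lemma tup_g_mat: "tup (g_mat a b) = gm (a, b)"
  by (simp add: g_mat_def gm_def)

definition col :: "m4 \<Rightarrow> real^2" where "col M = vec2 (fst (fst M)) (fst (snd M))"

lemma col_component [simp]: "col M $ 1 = fst (fst M)" "col M $ 2 = fst (snd M)"
  by (simp_all add: col_def vec2_def)

lemma slope_col: "slope (col M) = sl M"
  by (simp add: slope_def sl_def)

lemma matrix_vec2_10: "A *v vec2 1 0 = col (tup A)"
  by (simp add: vec_eq_iff forall_2 matrix_vector_mult_def sum_2) (simp add: vec2_def tup_def)

lemma lat_eq: "lat A q = (\<lambda>g. col (mm (tup A) g)) ` Gam"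
  unfolding lat_def Lambda_q_def Gam_eq image_image
  by (simp only: matrix_vector_mul_assoc matrix_vec2_10[of "A ** _"] tup_mult)

definition RS :: "real \<times> real \<Rightarrow> real set" where
  "RS p = {sl (mm (gm p) g) |g. g \<in> Gam \<and> 0 < fst (fst (mm (gm p) g)) \<and> fst (fst (mm (gm p) g)) \<le> 1 \<and> 0 < sl (mm (gm p) g)}"

lemma R_q_eq: "R_q q p = Inf (RS p)"
proof -
  have "{slope v |v. v \<in> lat (g_mat (fst p) (snd p)) q \<inter> strip 1 \<and> 0 < slope v} = RS p"
    unfolding RS_def lat_eq tup_g_mat
    by (intro equalityI subsetI; elim CollectE exE conjE IntE imageE)
       (auto simp: strip_def slope_col intro!: exI[of _ "col (mm (gm p) g)" for g])
  then show ?thesis by (simp add: R_q_def)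
qed

text \<open>The slope is s / (a x), where a and x lie in (0, 1] and s is a positive entry of a group
  element, hence at least 1.\<close>

lemma RS_ge_1:
  assumes "p \<in> Tq q" "r \<in> RS p" shows "1 \<le> r"
proof -
  obtain a b where p: "p = (a, b)" by (cases p)
  have ab: "0 < a" "a \<le> 1" using assms by (auto simp: p Tq_iff)
  obtain g where g: "g \<in> Gam" "0 < fst (fst (mm (gm p) g))" "fst (fst (mm (gm p) g)) \<le> 1"
    "r = sl (mm (gm p) g)" "0 < r" using assms(2) unfolding RS_def by blast
  obtain u v s t where ge: "g = ((u, v), (s, t))" by (cases g rule: m4_cases)
  define x where "x = a * u + b * s"
  have x: "0 < x" "x \<le> 1" "r = s / (a * x)" using g by (simp_all add: ge p gm_def x_def)
  then have "0 < s" using g(5) ab by (metis mult_pos_pos zero_less_divide_iff less_asym)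
  then have "1 \<le> s" using Gam_entries(3) g(1) by (fastforce simp: ge)
  moreover have "a * x \<le> 1" using ab x by (simp add: mult_le_one)
  ultimately show ?thesis using x ab by (simp add: le_divide_eq)
qed

text \<open>The first column of \<open>Uj j\<close>, multiplied by \<open>gm (a, b)\<close>, has the
  linear form as its first coordinate. These explicit slopes bound the return time from
  above.\<close>

lemma RS_Uj:
  assumes p: "(a, b) \<in> Tq q" and j: "2 \<le> j" "j \<le> q - 1"
    and L: "0 < a * sg (real j + 1) + b * sg (real j)" "a * sg (real j + 1) + b * sg (real j) \<le> 1"
  shows "sg (real j) / (a * (a * sg (real j + 1) + b * sg (real j))) \<in> RS (a, b)"
proof -
  have a: "0 < a" using p by (simp add: Tq_iff)
  have s: "1 \<le> sg (real j)" using j q3 by (intro sg_ge_1) auto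
  show ?thesis unfolding RS_def
    using L a s Uj_Gam[of j] by (auto intro!: exI[of _ "Uj (real j)"] simp: Uj_def gm_def)
qed

lemma RS_nonempty: assumes "p \<in> Tq q" shows "RS p \<noteq> {}"
proof -
  obtain a b where p: "p = (a, b)" by (cases p)
  obtain j :: nat where "2 \<le> j" "j \<le> q - 1" "0 < a * sg (real j + 1) + b * sg (real j)" "a * sg (real j + 1) + b * sg (real j) \<le> 1"
    using next_form[of a b] assms by (auto simp: p add.commute)
  from RS_Uj[OF _ this] assms show ?thesis unfolding p by blast
qed

lemma RS_bdd: "bdd_below (RS p)"
  unfolding RS_def by (rule bdd_belowI[of _ 0]) auto

lemma R_q_ge_1: "p \<in> Tq q \<Longrightarrow> 1 \<le> R_q q p"
  unfolding R_q_eq by (intro cInf_greatest RS_nonempty RS_ge_1)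

lemma R_q_le: "r \<in> RS p \<Longrightarrow> R_q q p \<le> r"
  unfolding R_q_eq by (intro cInf_lower RS_bdd)

lemma R_q_less_iff: "p \<in> Tq q \<Longrightarrow> R_q q p < c \<longleftrightarrow> (\<exists>r\<in>RS p. r < c)"
  unfolding R_q_eq by (intro cInf_less_iff RS_nonempty RS_bdd)

text \<open>Extended by 0, so that integrals over the plane are integrals over the section.\<close>

definition Rh :: "real \<times> real \<Rightarrow> real" where "Rh p = (if p \<in> Tq q then R_q q p else 0)"

lemma Rh_nonneg: "0 \<le> Rh p"
  using R_q_ge_1[of p] by (cases "p \<in> Tq q") (simp_all add: Rh_def)

lemma Rh_measurable [measurable]: "Rh \<in> borel_measurable borel"
proof (rule borel_measurableI_less)
  fix c :: real
  define E where "E = (\<Union>g\<in>Gam. {p. 0 < fst (fst (mm (gm p) g)) \<and> fst (fst (mm (gm p) g)) \<le> 1 \<and>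
    0 < sl (mm (gm p) g) \<and> sl (mm (gm p) g) < c})"
  have E: "E \<in> sets borel" unfolding E_def using countable_Gam
  proof (rule sets.countable_UN'')
    fix g assume "g \<in> Gam"
    show "{p. 0 < fst (fst (mm (gm p) g)) \<and> fst (fst (mm (gm p) g)) \<le> 1 \<and>
      0 < sl (mm (gm p) g) \<and> sl (mm (gm p) g) < c} \<in> sets borel" by measurable
  qed
  have RE: "(\<exists>r\<in>RS p. r < c) \<longleftrightarrow> p \<in> E" for p unfolding RS_def E_def by blast
  have "{p \<in> space borel. Rh p < c} = (Tq q \<inter> E) \<union> (if 0 < c then - Tq q else {})"
    using R_q_less_iff RE by (auto simp: Rh_def)
  moreover have "\<dots> \<in> sets borel" using E by auto
  ultimately show "{p \<in> space borel. Rh p < c} \<in> sets borel" by simp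
qed

text \<open>Membership in \<open>Dom\<close> of \<open>mm (lo s) (gm p)\<close>, which has a hit of
  slope s: no further hit may occur up to slope 0.\<close>

definition kD :: "real \<times> real \<Rightarrow> real \<Rightarrow> bool" where
  "kD p s \<longleftrightarrow> p \<in> Tq q \<and> s \<le> 0 \<and> (\<forall>g\<in>Gam. \<not> (hit 1 (mm (gm p) g) \<and> 0 < sl (mm (gm p) g) \<and> sl (mm (gm p) g) \<le> - s))"

lemma kD_measurable: "{u. kD (fst u) (snd u)} \<in> sets borel"
proof -
  have "(\<Inter>g\<in>Gam. {u. \<not> (hit 1 (mm (gm (fst u)) g) \<and> 0 < sl (mm (gm (fst u)) g) \<and> sl (mm (gm (fst u)) g) \<le> - snd u)}) \<in> sets borel"
  proof (rule sets.countable_INT'')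
    fix g show "{u::(real\<times>real)\<times>real. \<not> (hit 1 (mm (gm (fst u)) g) \<and> 0 < sl (mm (gm (fst u)) g) \<and> sl (mm (gm (fst u)) g) \<le> - snd u)} \<in> sets borel"
      by measurable
  qed (use countable_Gam in auto)
  moreover have "{u::(real\<times>real)\<times>real. fst u \<in> Tq q \<and> snd u \<le> 0} \<in> sets borel" by measurable
  moreover have "{u. kD (fst u) (snd u)} = {u. fst u \<in> Tq q \<and> snd u \<le> 0} \<inter>
    (\<Inter>g\<in>Gam. {u. \<not> (hit 1 (mm (gm (fst u)) g) \<and> 0 < sl (mm (gm (fst u)) g) \<and> sl (mm (gm (fst u)) g) \<le> - snd u)})"
    unfolding kD_def by blast
  ultimately show ?thesis by simp
qed

lemma hit_fst_pos:
  assumes "hit t M" "0 < t" shows "0 < fst (fst M)"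
proof -
  obtain x z y w where M: "M = ((x, z), (y, w))" by (cases M rule: m4_cases)
  have "0 < dt M" using assms by (simp add: hit_def)
  then show ?thesis using hit_iff[OF refl, of x z y w t] assms by (simp add: M)
qed

text \<open>With c the square root of the determinant, M is c times \<open>mm (lo s) (gm p)\<close>.
  Scalars and \<open>lo s\<close> preserve hits, and \<open>lo s\<close> adds s to their
  slopes.\<close>

lemma Dom_iff_kD:
  assumes "0 < dt M" "dt M \<le> 1" "0 < fst (fst M)"
  shows "M \<in> Dom \<longleftrightarrow> kD ((1 / sqrt (dt M)) *\<^sub>R fst M) (sl M)"
proof -
  define c where "c = sqrt (dt M)"
  define p where "p = (1 / c) *\<^sub>R fst M"
  define s where "s = sl M"
  have c: "0 < c" "c\<^sup>2 = dt M" using assms by (auto simp: c_def)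
  obtain x z y w where M: "M = ((x, z), (y, w))" by (cases M rule: m4_cases)
  have x: "0 < x" using assms by (simp add: M)
  have dc: "x * w - z * y = c * c" using c by (simp add: M power2_eq_square)
  have p0: "fst p \<noteq> 0" using x c by (simp add: p_def M)
  have "w = y / x * z + c * c / x" using x dc by (simp add: field_simps)
  then have Me: "M = c *\<^sub>R mm (lo s) (gm p)"
    using x c(1) by (simp add: M p_def s_def gm_def distrib_left)
  have dN: "dt (gm p) = 1" using p0 by (rule dt_gm)
  have hN: "hit 1 (mm M g) \<longleftrightarrow> hit 1 (mm (gm p) g)" for g
  proof -
    have "hit 1 (mm (lo s) N) \<longleftrightarrow> hit 1 N" for N
      by (cases N rule: m4_cases) (simp add: hit_def algebra_simps)
    then show ?thesis using c by (simp add: Me mm_assoc)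
  qed
  have sN: "sl (mm M g) = s + sl (mm (gm p) g)" if "hit 1 (mm (gm p) g)" for g
  proof -
    have "sl (mm (lo s) N) = s + sl N" if "hit 1 N" for N
    proof -
      obtain x z y w where N: "N = ((x, z), (y, w))" by (cases N rule: m4_cases)
      have "0 < x" using hit_fst_pos[OF that] by (simp add: N)
      then show ?thesis by (simp add: N add_divide_distrib)
    qed
    from this[OF that] show ?thesis using c by (simp add: Me mm_assoc)
  qed
  have h1: "hit 1 M \<longleftrightarrow> p \<in> Tq q" using assms by (simp add: hit_def p_def c_def)
  have "M \<in> Dom \<longleftrightarrow> p \<in> Tq q \<and> s \<le> 0 \<and>
      (\<forall>g\<in>Gam. \<not> (hit 1 (mm M g) \<and> s < sl (mm M g) \<and> sl (mm M g) \<le> 0))"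
    unfolding Dom_def using h1 assms by (simp add: s_def)
  also have "(\<forall>g\<in>Gam. \<not> (hit 1 (mm M g) \<and> s < sl (mm M g) \<and> sl (mm M g) \<le> 0))
      \<longleftrightarrow> (\<forall>g\<in>Gam. \<not> (hit 1 (mm (gm p) g) \<and> 0 < sl (mm (gm p) g) \<and> sl (mm (gm p) g) \<le> - s))"
  proof (rule ball_cong[OF refl])
    fix g
    show "(\<not> (hit 1 (mm M g) \<and> s < sl (mm M g) \<and> sl (mm M g) \<le> 0))
      = (\<not> (hit 1 (mm (gm p) g) \<and> 0 < sl (mm (gm p) g) \<and> sl (mm (gm p) g) \<le> - s))"
      using sN[of g] by (cases "hit 1 (mm (gm p) g)") (auto simp: hN)
  qed
  finally show ?thesis by (simp add: kD_def p_def s_def c_def)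
qed

text \<open>The fibre lies between a half-open and a closed interval of length
  \<open>R_q q p\<close>, so its length is the same whether or not the infimum is attained.\<close>

lemma kD_length:
  assumes "p \<in> Tq q" shows "(\<integral>\<^sup>+s. indicator {u. kD (fst u) (snd u)} (p, s) \<partial>lborel) = ennreal (R_q q p)"
proof -
  define A where "A = {s. kD p s}"
  have [measurable]: "A \<in> sets borel"
  proof -
    have "(\<lambda>s. (p, s)) -` {u. kD (fst u) (snd u)} \<inter> space borel \<in> sets (borel :: real measure)"
      by (rule measurable_sets[OF _ kD_measurable]) measurable
    then show ?thesis by (simp add: A_def vimage_def)
  qed
  have p0: "dt (gm p) = 1" "0 < dt (gm p)"
  proof -
    have "0 < fst p" using assms by (cases p) (simp add: Tq_iff)
    then show "dt (gm p) = 1" by (intro dt_gm) simp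
    then show "0 < dt (gm p)" by simp
  qed
  have hitR: "hit 1 (mm (gm p) g) \<Longrightarrow> 0 < sl (mm (gm p) g) \<Longrightarrow> g \<in> Gam \<Longrightarrow> sl (mm (gm p) g) \<in> RS p" for g
  proof -
    assume h: "hit 1 (mm (gm p) g)" "0 < sl (mm (gm p) g)" "g \<in> Gam"
    obtain x z y w where N: "mm (gm p) g = ((x, z), (y, w))" by (cases "mm (gm p) g" rule: m4_cases)
    have "dt ((x, z), (y, w)) = 1" using p0 dt_Gam[OF h(3)] N by (metis dt_mm mult.right_neutral)
    then have "0 < x" "x \<le> 1" using h(1) hit_iff[of x z y w 1 1] by (simp_all add: N)
    then have "0 < fst (fst (mm (gm p) g)) \<and> fst (fst (mm (gm p) g)) \<le> 1" by (simp add: N)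
    then show ?thesis using h(2,3) unfolding RS_def by blast
  qed
  have sub1: "{- R_q q p<..0} \<subseteq> A"
  proof
    fix s assume s: "s \<in> {- R_q q p<..0}"
    have "\<not> (hit 1 (mm (gm p) g) \<and> 0 < sl (mm (gm p) g) \<and> sl (mm (gm p) g) \<le> - s)" if "g \<in> Gam" for g
      using R_q_le[OF hitR[of g]] that s by fastforce
    then show "s \<in> A" using s assms by (simp add: A_def kD_def)
  qed
  have sub2: "A \<subseteq> {- R_q q p..0}"
  proof
    fix s assume s: "s \<in> A"
    have "- R_q q p \<le> s"
    proof (rule ccontr)
      assume "\<not> - R_q q p \<le> s"
      then have "R_q q p < - s" by simp
      then obtain r where "r \<in> RS p" "r < - s" using R_q_less_iff[OF assms] by blast
      then obtain g where g: "g \<in> Gam" "0 < fst (fst (mm (gm p) g))" "fst (fst (mm (gm p) g)) \<le> 1"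
        "0 < sl (mm (gm p) g)" "sl (mm (gm p) g) < - s"
        unfolding RS_def by blast
      \<comment> \<open>The infimum ranges over strip vectors and \<open>kD\<close> over hits; this
        passes from the one to the other.\<close>
      have "\<exists>g'\<in>Gam. hit 1 (mm (gm p) g') \<and> sl (mm (gm p) g') = sl (mm (gm p) g)
        \<and> fst (fst (mm (gm p) g')) = fst (fst (mm (gm p) g)) \<and> fst (snd (mm (gm p) g')) = fst (snd (mm (gm p) g))"
        using g by (intro hit_of_column[OF p0(1)]) simp_all
      then obtain g' where g': "g' \<in> Gam" "hit 1 (mm (gm p) g')" "sl (mm (gm p) g') = sl (mm (gm p) g)"
        by (elim bexE conjE)
      moreover have "\<not> (hit 1 (mm (gm p) g') \<and> 0 < sl (mm (gm p) g') \<and> sl (mm (gm p) g') \<le> - s)"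
        using s g'(1) unfolding A_def kD_def by (elim CollectE conjE bspec)
      ultimately show False using g(4,5) by simp
    qed
    then show "s \<in> {- R_q q p..0}" using s by (simp add: A_def kD_def)
  qed
  have R0: "0 \<le> R_q q p" using R_q_ge_1[OF assms] by simp
  have "(\<integral>\<^sup>+s. indicator {u. kD (fst u) (snd u)} (p, s) \<partial>lborel) = (\<integral>\<^sup>+s. indicator A s \<partial>lborel)"
    by (intro nn_integral_cong) (simp add: A_def indicator_def)
  also have "\<dots> = emeasure lborel A" by simp
  also have "\<dots> = ennreal (R_q q p)"
  proof (rule antisym)
    show "emeasure lborel A \<le> ennreal (R_q q p)"
      using emeasure_mono[OF sub2, of lborel] R0 by simp
    show "ennreal (R_q q p) \<le> emeasure lborel A"
      using emeasure_mono[OF sub1, of lborel] R0 by simp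
  qed
  finally show ?thesis .
qed

lemma emeasure_mu: "emeasure mu UNIV = ennreal (1 / 2) * (\<integral>\<^sup>+p. ennreal (Rh p) \<partial>lborel)"
proof -
  define k where "k p s = (indicator {u. kD (fst u) (snd u)} (p, s) :: ennreal)" for p s
  have "emeasure mu UNIV = (\<integral>\<^sup>+M. indicator Dom M \<partial>lborel)"
    unfolding mu_def by (subst emeasure_density) auto
  also have "\<dots> = (\<integral>\<^sup>+M. k ((1 / sqrt (dt M)) *\<^sub>R fst M) (sl M) * indicator {M. 0 < fst (fst M)} M
        * indicator {M. 0 < dt M \<and> dt M \<le> 1} M \<partial>lborel)"
  proof (rule nn_integral_cong)
    fix M
    show "indicator Dom M = k ((1 / sqrt (dt M)) *\<^sub>R fst M) (sl M) * indicator {M. 0 < fst (fst M)} M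
        * indicator {M. 0 < dt M \<and> dt M \<le> 1} M"
    proof (cases "0 < dt M \<and> dt M \<le> 1 \<and> 0 < fst (fst M)")
      case True
      then show ?thesis using Dom_iff_kD[of M] by (simp add: k_def indicator_def)
    next
      case False
      have "M \<notin> Dom"
      proof
        assume D: "M \<in> Dom"
        then have "hit 1 M" by (simp add: Dom_def)
        then have "0 < fst (fst M)" by (rule hit_fst_pos) simp
        then show False using False Dom_dt[OF D] by simp
      qed
      then show ?thesis using False by (auto simp: indicator_def)
    qed
  qed
  also have "\<dots> = ennreal (1 / 2) * (\<integral>\<^sup>+p. (\<integral>\<^sup>+s. k p s \<partial>lborel) * indicator {p. 0 < fst p} p \<partial>lborel)"
    unfolding k_def using kD_measurable by (intro nn_integral_normalised) simp
  also have "(\<integral>\<^sup>+p. (\<integral>\<^sup>+s. k p s \<partial>lborel) * indicator {p. 0 < fst p} p \<partial>lborel) = (\<integral>\<^sup>+p. ennreal (Rh p) \<partial>lborel)"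
  proof (rule nn_integral_cong)
    fix p :: "real \<times> real"
    show "(\<integral>\<^sup>+s. k p s \<partial>lborel) * indicator {p. 0 < fst p} p = ennreal (Rh p)"
    proof (cases "p \<in> Tq q")
      case True
      then have "0 < fst p" by (cases p) (simp add: Tq_iff)
      then show ?thesis using kD_length[OF True] True by (simp add: k_def Rh_def)
    next
      case False
      then have "k p s = 0" for s by (simp add: k_def kD_def)
      then show ?thesis using False by (simp add: Rh_def)
    qed
  qed
  finally show ?thesis .
qed

end

section \<open>Integrability of the return time\<close>

definition usq :: "real \<Rightarrow> real" where "usq t = 1 / sqrt t * indicator {0<..1} t"

lemma usq_measurable [measurable]: "usq \<in> borel_measurable borel"
  unfolding usq_def by measurable

lemma usq_nonneg: "0 \<le> usq t"
  by (simp add: usq_def indicator_def)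

lemma usq_finite: "(\<integral>\<^sup>+t. ennreal (usq t) \<partial>lborel) < \<infinity>"
proof -
  obtain I where I: "((\<lambda>x::real. x powr (- 1 / 2)) has_integral I) {0<..1}"
    using integrable_on_powr_from_0'[of "- 1 / 2" 1] by (auto simp: integrable_on_def)
  have "(\<integral>\<^sup>+t. ennreal (usq t) \<partial>lborel) = (\<integral>\<^sup>+t. ennreal (t powr (- 1 / 2)) * indicator {0<..1} t \<partial>lborel)"
    by (intro nn_integral_cong)
       (auto simp: usq_def indicator_def powr_minus powr_half_sqrt divide_simps simp flip: minus_divide_left)
  also have "\<dots> = ennreal I" by (rule nn_integral_has_integral_lebesgue'[OF _ I]) simp
  finally show ?thesis by simp
qed

context hecke
begin

lemma sg_le: "sg x \<le> 1 / sin th"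
  using sin_th_pos by (simp add: sg_def divide_right_mono)

text \<open>For the form l selected by \<open>next_form\<close> the return time is at most B / (a
  l), and 1 - a < B l, where B bounds every \<open>sg\<close>. If a \<le> 1/2, then 1 / l is below 2
  B. If a > 1/2, one of the two square roots in 1 / l is bounded through 1 - a: a singularity not
  integrable in l alone becomes a product of inverse square roots in two variables. The sum over j
  covers the unknown index, and a = 1 is excluded because \<open>usq 0\<close> is 0.\<close>

lemma Rh_bound:
  assumes "(a, b) \<in> Tq q" "a \<noteq> 1"
  defines "B \<equiv> 1 / sin th"
  shows "Rh (a, b) \<le> 2 * B\<^sup>2 / a + 2 * B\<^sup>2 * (usq (1 - a) * (\<Sum>j\<in>{2..q - 1}. usq (a * sg (real j + 1) + b * sg (real j))))"
proof -
  have B1: "1 \<le> B" using sin_th_pos by (simp add: B_def)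
  have ab: "0 < a" "a < 1" using assms by (auto simp: Tq_iff)
  obtain j :: nat where j: "2 \<le> j" "j \<le> q - 1"
    and L: "a * sg (real j + 1) + b * sg (real j) \<le> 1" "0 < a * sg (real j + 1) + b * sg (real j)"
      "sg (real j) - a < sg (real j - 1) * (a * sg (real j + 1) + b * sg (real j))"
    using next_form[OF assms(1)] by (auto simp: add.commute)
  define l where "l = a * sg (real j + 1) + b * sg (real j)"
  have l: "0 < l" "l \<le> 1" using L by (auto simp: l_def)
  have sj: "1 \<le> sg (real j)" using j q3 by (intro sg_ge_1) auto
  have "sg (real j - 1) * l \<le> B * l" using l sg_le by (intro mult_right_mono) (auto simp: B_def)
  then have Bl: "1 - a < B * l" using L(3) sj by (simp add: l_def)
  have "Rh (a, b) \<le> sg (real j) / (a * l)"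
    unfolding l_def using R_q_le[OF RS_Uj[OF assms(1) j L(2,1)]] assms(1) by (simp add: Rh_def)
  also have "\<dots> \<le> B / (a * l)"
    using sg_le[of "real j"] ab l by (intro divide_right_mono) (auto simp: B_def)
  finally have R: "Rh (a, b) \<le> B / (a * l)" .
  have rest: "0 \<le> 2 * B\<^sup>2 * (usq (1 - a) * (\<Sum>j\<in>{2..q - 1}. usq (a * sg (real j + 1) + b * sg (real j))))"
    by (intro mult_nonneg_nonneg usq_nonneg sum_nonneg) auto
  show ?thesis
  proof (cases "a \<le> 1 / 2")
    case True
    then have "1 / 2 < B * l" using Bl by simp
    then have "B / (a * l) \<le> 2 * B\<^sup>2 / a"
      using ab l B1 by (simp add: divide_simps power2_eq_square)
    then show ?thesis using R rest by linarith
  next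
    case False
    have "B / (a * l) \<le> 2 * B / l"
      using False ab l B1 by (simp add: divide_simps)
    also have "\<dots> = 2 * B * ((1 / sqrt l) * (1 / sqrt l))" using l by simp
    also have "\<dots> \<le> 2 * B * ((B * usq (1 - a)) * usq l)"
    proof (intro mult_left_mono mult_mono)
      have "sqrt (1 - a) \<le> sqrt (B * l)" using Bl by simp
      also have "\<dots> \<le> B * sqrt l"
      proof -
        have "sqrt B \<le> B" using B1 by (simp add: real_le_lsqrt power2_eq_square)
        then show ?thesis using l by (simp add: real_sqrt_mult mult_right_mono)
      qed
      finally have "1 / sqrt l \<le> B / sqrt (1 - a)" using l ab by (simp add: divide_simps mult.commute)
      then show "1 / sqrt l \<le> B * usq (1 - a)" using ab by (simp add: usq_def)
      show "1 / sqrt l \<le> usq l" using l by (simp add: usq_def)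
    qed (use B1 l usq_nonneg in auto)
    also have "\<dots> = 2 * B\<^sup>2 * (usq (1 - a) * usq l)" by (simp add: power2_eq_square)
    also have "\<dots> \<le> 2 * B\<^sup>2 * (usq (1 - a) * (\<Sum>j\<in>{2..q - 1}. usq (a * sg (real j + 1) + b * sg (real j))))"
    proof (intro mult_left_mono usq_nonneg)
      show "usq l \<le> (\<Sum>j\<in>{2..q - 1}. usq (a * sg (real j + 1) + b * sg (real j)))"
        unfolding l_def using j usq_nonneg
        by (intro member_le_sum[of j _ "\<lambda>j. usq (a * sg (real j + 1) + b * sg (real j))"]) auto
    qed simp
    finally have "Rh (a, b) \<le> 2 * B\<^sup>2 * (usq (1 - a) * (\<Sum>j\<in>{2..q - 1}. usq (a * sg (real j + 1) + b * sg (real j))))"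
      using R by simp
    moreover have "0 \<le> 2 * B\<^sup>2 / a" using ab by simp
    ultimately show ?thesis by linarith
  qed
qed

text \<open>The fibre of the section over a has length \<open>lam\<close> a, which cancels 1 / a. In
  the other terms b is replaced by the linear form, whose coefficient \<open>sg j\<close> is at
  least 1, and the double integral splits into two finite ones.\<close>

lemma Rh_finite: "(\<integral>\<^sup>+p. ennreal (Rh p) \<partial>lborel) < \<infinity>"
proof -
  define B where "B = 1 / sin th"
  define J where "J = {2..q - 1}"
  define Ku where "Ku = (\<integral>\<^sup>+t. ennreal (usq t) \<partial>lborel)"
  define F1 where "F1 p = ennreal (2 * B\<^sup>2 / fst p) * indicator (Tq q) p" for p :: "real \<times> real"
  define F2 where "F2 j p = ennreal (2 * B\<^sup>2) * (ennreal (usq (1 - fst p)) * ennreal (usq (fst p * sg (real j + 1) + snd p * sg (real j))))"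
    for j :: nat and p :: "real \<times> real"
  have [measurable]: "F1 \<in> borel_measurable borel" "\<And>j. F2 j \<in> borel_measurable borel"
    unfolding F1_def F2_def by measurable
  have n1: "AE p in (lborel :: (real \<times> real) measure). fst p \<noteq> 1"
  proof -
    have "negligible {p :: real \<times> real. (1, 0) \<bullet> p = 1}"
      by (rule negligible_hyperplane) (auto simp: zero_prod_def)
    moreover have "{p :: real \<times> real. (1, 0) \<bullet> p = 1} = {p. fst p = 1}" by auto
    moreover have "{p :: real \<times> real. fst p = 1} \<in> sets borel" by measurable
    ultimately have "{p :: real \<times> real. fst p = 1} \<in> null_sets lborel"
      by (simp add: negligible_iff_null_sets null_sets_def)
    then show ?thesis by (rule AE_I') auto
  qed
  have "(\<integral>\<^sup>+p. ennreal (Rh p) \<partial>lborel) \<le> (\<integral>\<^sup>+p. F1 p + (\<Sum>j\<in>J. F2 j p) \<partial>lborel)"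
  proof (rule nn_integral_mono_AE, use n1 in eventually_elim)
    fix p :: "real \<times> real" assume p1: "fst p \<noteq> 1"
    obtain a b where p: "p = (a, b)" by (cases p)
    show "ennreal (Rh p) \<le> F1 p + (\<Sum>j\<in>J. F2 j p)"
    proof (cases "p \<in> Tq q")
      case False
      then show ?thesis by (simp add: Rh_def)
    next
      case True
      have a: "0 < a" using True by (simp add: p Tq_iff)
      have "ennreal (Rh p) \<le> ennreal (2 * B\<^sup>2 / a + 2 * B\<^sup>2 * (usq (1 - a) * (\<Sum>j\<in>J. usq (a * sg (real j + 1) + b * sg (real j)))))"
        using Rh_bound[of a b] True p1 by (intro ennreal_leI) (simp add: p B_def J_def)
      also have "\<dots> = ennreal (2 * B\<^sup>2 / a) + ennreal (2 * B\<^sup>2) * (ennreal (usq (1 - a)) * (\<Sum>j\<in>J. ennreal (usq (a * sg (real j + 1) + b * sg (real j)))))"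
        using a usq_nonneg by (simp add: ennreal_plus ennreal_mult sum_nonneg mult_nonneg_nonneg)
      also have "\<dots> = F1 p + (\<Sum>j\<in>J. F2 j p)"
        using True by (simp add: F1_def F2_def p sum_distrib_left)
      finally show ?thesis .
    qed
  qed
  also have "\<dots> = (\<integral>\<^sup>+p. F1 p \<partial>lborel) + (\<Sum>j\<in>J. \<integral>\<^sup>+p. F2 j p \<partial>lborel)"
    by (subst nn_integral_add) (auto simp: nn_integral_sum)
  also have "\<dots> < \<infinity>"
  proof -
    have F1b: "(\<integral>\<^sup>+p. F1 p \<partial>lborel) < \<infinity>"
    proof -
      have "(\<integral>\<^sup>+p. F1 p \<partial>lborel) = (\<integral>\<^sup>+a. \<integral>\<^sup>+b. F1 (a, b) \<partial>lborel \<partial>lborel)"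
        unfolding lborel_prod[symmetric] by (rule lborel.nn_integral_fst[symmetric]) (simp add: lborel_prod)
      also have "\<dots> \<le> (\<integral>\<^sup>+a. ennreal (2 * B\<^sup>2 * lam) * indicator {0..1::real} a \<partial>lborel)"
      proof (rule nn_integral_mono)
        fix a :: real
        show "(\<integral>\<^sup>+b. F1 (a, b) \<partial>lborel) \<le> ennreal (2 * B\<^sup>2 * lam) * indicator {0..1} a"
        proof (cases "0 < a \<and> a \<le> 1")
          case True
          have "(\<integral>\<^sup>+b. F1 (a, b) \<partial>lborel) = (\<integral>\<^sup>+b. ennreal (2 * B\<^sup>2 / a) * indicator {1 - lam * a<..1} b \<partial>lborel)"
            using True by (intro nn_integral_cong) (auto simp: F1_def Tq_iff indicator_def)
          also have "\<dots> = ennreal (2 * B\<^sup>2 / a) * ennreal (lam * a)"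
            using True lam_bounds by (subst nn_integral_cmult_indicator) auto
          also have "\<dots> = ennreal (2 * B\<^sup>2 * lam)"
            using True lam_bounds by (simp add: ennreal_mult[symmetric])
          finally show ?thesis using True by simp
        next
          case False
          then have "F1 (a, b) = 0" for b by (auto simp: F1_def Tq_iff indicator_def)
          then show ?thesis by simp
        qed
      qed
      also have "\<dots> < \<infinity>" by (subst nn_integral_cmult_indicator) (auto simp: ennreal_mult_less_top)
      finally show ?thesis .
    qed
    have F2b: "(\<integral>\<^sup>+p. F2 j p \<partial>lborel) < \<infinity>" if "j \<in> J" for j
    proof -
      have sj: "1 \<le> sg (real j)" using that q3 by (intro sg_ge_1) (auto simp: J_def)
      have "(\<integral>\<^sup>+p. F2 j p \<partial>lborel) = (\<integral>\<^sup>+a. \<integral>\<^sup>+b. F2 j (a, b) \<partial>lborel \<partial>lborel)"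
        unfolding lborel_prod[symmetric] by (rule lborel.nn_integral_fst[symmetric]) (simp add: lborel_prod)
      also have "\<dots> \<le> (\<integral>\<^sup>+a. ennreal (2 * B\<^sup>2) * Ku * ennreal (usq (1 + (- 1) * a)) \<partial>lborel)"
      proof (rule nn_integral_mono)
        fix a :: real
        have "Ku = ennreal \<bar>sg (real j)\<bar> * (\<integral>\<^sup>+b. ennreal (usq (a * sg (real j + 1) + sg (real j) * b)) \<partial>lborel)"
          unfolding Ku_def using sj by (intro nn_integral_real_affine) auto
        moreover have "1 * (\<integral>\<^sup>+b. ennreal (usq (a * sg (real j + 1) + sg (real j) * b)) \<partial>lborel)
          \<le> ennreal \<bar>sg (real j)\<bar> * (\<integral>\<^sup>+b. ennreal (usq (a * sg (real j + 1) + sg (real j) * b)) \<partial>lborel)"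
          using sj by (intro mult_right_mono) (auto simp flip: ennreal_1)
        ultimately have i: "(\<integral>\<^sup>+b. ennreal (usq (a * sg (real j + 1) + b * sg (real j))) \<partial>lborel) \<le> Ku"
          by (simp add: mult.commute)
        have "(\<integral>\<^sup>+b. F2 j (a, b) \<partial>lborel)
          = ennreal (2 * B\<^sup>2) * (ennreal (usq (1 - a)) * (\<integral>\<^sup>+b. ennreal (usq (a * sg (real j + 1) + b * sg (real j))) \<partial>lborel))"
          unfolding F2_def by (simp add: nn_integral_cmult)
        also have "\<dots> \<le> ennreal (2 * B\<^sup>2) * (ennreal (usq (1 - a)) * Ku)"
          by (intro mult_left_mono i) auto
        finally show "(\<integral>\<^sup>+b. F2 j (a, b) \<partial>lborel) \<le> ennreal (2 * B\<^sup>2) * Ku * ennreal (usq (1 + (- 1) * a))"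
          by (simp add: mult_ac)
      qed
      also have "\<dots> = ennreal (2 * B\<^sup>2) * Ku * (\<integral>\<^sup>+a. ennreal (usq (1 + (- 1) * a)) \<partial>lborel)"
        by (rule nn_integral_cmult) measurable
      also have "(\<integral>\<^sup>+a. ennreal (usq (1 + (- 1) * a)) \<partial>lborel) = Ku"
        unfolding Ku_def by (subst nn_integral_real_affine[of "\<lambda>t. ennreal (usq t)" "-1" 1]) auto
      finally have "(\<integral>\<^sup>+p. F2 j p \<partial>lborel) \<le> ennreal (2 * B\<^sup>2) * Ku * Ku" .
      also have "\<dots> < \<infinity>" using usq_finite by (simp add: Ku_def ennreal_mult_less_top)
      finally show ?thesis .
    qed
    show ?thesis using F1b F2b by (simp add: J_def)
  qed
  finally show ?thesis .
qed

definition Rint :: real where "Rint = (\<integral>p. Rh p \<partial>lborel)"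

lemma Rh_integrable: "integrable lborel Rh"
  using Rh_finite Rh_nonneg by (intro integrableI_nonneg) auto

lemma nn_integral_Rh: "(\<integral>\<^sup>+p. ennreal (Rh p) \<partial>lborel) = ennreal Rint"
  unfolding Rint_def using Rh_integrable Rh_nonneg by (intro nn_integral_eq_integral) auto

lemma emeasure_mu_Rint: "emeasure mu UNIV = ennreal (Rint / 2)"
proof -
  have "0 \<le> Rint" unfolding Rint_def using Rh_nonneg by simp
  then have "ennreal (1 / 2) * ennreal Rint = ennreal (1 / 2 * Rint)" by (intro ennreal_mult[symmetric]) auto
  then show ?thesis unfolding emeasure_mu nn_integral_Rh by simp
qed

lemma nn_integral_Tq:
  "(\<integral>\<^sup>+p. indicator (Tq q) p \<partial>lborel) = ennreal (lam / 2)"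
proof -
  have "(\<integral>\<^sup>+p. indicator (Tq q) p \<partial>lborel) = (\<integral>\<^sup>+a. \<integral>\<^sup>+b. indicator (Tq q) (a, b) \<partial>lborel \<partial>lborel)"
    unfolding lborel_prod[symmetric] by (rule lborel.nn_integral_fst[symmetric]) (simp add: lborel_prod)
  also have "\<dots> = (\<integral>\<^sup>+a. ennreal lam * (ennreal a * indicator {0<..1} a) \<partial>lborel)"
  proof (rule nn_integral_cong)
    fix a :: real
    show "(\<integral>\<^sup>+b. indicator (Tq q) (a, b) \<partial>lborel) = ennreal lam * (ennreal a * indicator {0<..1} a)"
    proof (cases "0 < a \<and> a \<le> 1")
      case True
      have "(\<integral>\<^sup>+b. indicator (Tq q) (a, b) \<partial>lborel) = (\<integral>\<^sup>+b. indicator {1 - lam * a<..1} b \<partial>lborel)"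
        using True by (intro nn_integral_cong) (auto simp: Tq_iff indicator_def)
      also have "\<dots> = ennreal (lam * a)" using True lam_bounds by simp
      finally show ?thesis using True lam_bounds by (simp add: ennreal_mult)
    next
      case False
      then have "indicator (Tq q) (a, b) = (0::ennreal)" for b by (auto simp: Tq_iff indicator_def)
      then show ?thesis using False by auto
    qed
  qed
  also have "\<dots> = ennreal (lam / 2)"
  proof -
    have "ennreal lam * ennreal (1 / 2) = ennreal (lam * (1 / 2))"
      using lam_bounds by (intro ennreal_mult[symmetric]) auto
    then show ?thesis by (subst nn_integral_cmult) (auto simp: nn_integral_id_unit simp del: ennreal_half)
  qed
  finally show ?thesis .
qed

lemma Rint_pos: "0 < Rint"
proof -
  have "ennreal (lam / 2) \<le> (\<integral>\<^sup>+p. ennreal (Rh p) \<partial>lborel)"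
    unfolding nn_integral_Tq[symmetric]
  proof (rule nn_integral_mono)
    fix p show "indicator (Tq q) p \<le> ennreal (Rh p)"
      using R_q_ge_1[of p] by (cases "p \<in> Tq q") (simp_all add: Rh_def)
  qed
  then have "0 < ennreal Rint" using lam_bounds unfolding nn_integral_Rh
    by (metis ennreal_less_zero_iff half_gt_zero order_less_le_trans)
  then show ?thesis by (simp add: ennreal_less_zero_iff)
qed

sublocale mu: finite_measure mu
  by (rule finite_measureI) (simp add: emeasure_mu_Rint)

sublocale MX: finite_measure MX
  unfolding MX_def by (rule finite_measure_restr_to_subalg[OF subalgebra_invs]) (rule mu.finite_measure_axioms)

lemma measure_MX: "measure MX UNIV = Rint / 2"
proof -
  have "UNIV \<in> sets MX" using sets.top[of MX] by simp
  then have "emeasure MX UNIV = ennreal (Rint / 2)" by (simp add: MX_emeasure emeasure_mu_Rint)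
  then show ?thesis using Rint_pos by (simp add: measure_def)
qed

end

section \<open>Ergodicity and mixing\<close>

text \<open>A measurable function is an almost everywhere limit of continuous ones, and clamping
  these to [-C, C] permits dominated convergence on the ball.\<close>

lemma bounded_continuous_approx:
  fixes P :: "'a::euclidean_space \<Rightarrow> real"
  assumes [measurable]: "P \<in> borel_measurable borel" and C: "\<And>x. \<bar>P x\<bar> \<le> C" and e: "e > 0"
  obtains k where "continuous_on UNIV k" "\<And>x. \<bar>k x\<bar> \<le> C"
    "(\<integral>\<^sup>+x. ennreal \<bar>P x - k x\<bar> * indicator (cball 0 r) x \<partial>lborel) < ennreal e"
proof -
  have C0: "0 \<le> C" using C[of undefined] by simp
  have [measurable]: "cball (0::'a) r \<in> sets borel" by simp
  have "P measurable_on UNIV"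
    by (rule lebesgue_measurable_imp_measurable_on_real) (auto intro: measurable_completion)
  then obtain N g where N: "negligible N" and g: "\<And>n. continuous_on UNIV (g n)"
    and lim: "\<And>x. x \<notin> N \<Longrightarrow> (\<lambda>n. g n x) \<longlonglongrightarrow> P x"
    unfolding measurable_on_def by auto
  define k where "k n x = max (- C) (min C (g n x))" for n :: nat and x
  have kc: "continuous_on UNIV (k n)" for n unfolding k_def by (intro continuous_intros g)
  then have km [measurable]: "k n \<in> borel_measurable borel" for n by (rule borel_measurable_continuous_onI)
  have kC: "\<bar>k n x\<bar> \<le> C" for n x using C0 by (auto simp: k_def)
  have AEN: "AE x in lborel. x \<notin> N"
  proof -
    have "AE x in lebesgue. x \<notin> N" using N by (simp add: negligible_iff_null_sets AE_not_in)
    then show ?thesis by (simp add: AE_completion_iff)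
  qed
  have "(\<lambda>n. \<integral>x. \<bar>P x - k n x\<bar> * indicator (cball 0 r) x \<partial>lborel) \<longlonglongrightarrow> (\<integral>x. 0 \<partial>(lborel :: 'a measure))"
  proof (rule integral_dominated_convergence[where w = "\<lambda>x. 2 * C * indicator (cball 0 r) x"])
    show "integrable lborel (\<lambda>x::'a. 2 * C * indicator (cball 0 r) x)"
      using emeasure_bounded_finite[OF bounded_cball, of "0::'a" r]
      by (intro integrable_mult_right integrable_real_indicator) auto
    show "AE x in lborel. (\<lambda>n. \<bar>P x - k n x\<bar> * indicator (cball 0 r) x) \<longlonglongrightarrow> 0"
      using AEN
    proof eventually_elim
      fix x assume "x \<notin> N"
      then have "(\<lambda>n. k n x) \<longlonglongrightarrow> max (- C) (min C (P x))"
        unfolding k_def by (intro tendsto_max tendsto_min tendsto_const lim)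
      also have "max (- C) (min C (P x)) = P x" using C[of x] by auto
      finally have "(\<lambda>n. \<bar>P x - k n x\<bar> * indicator (cball 0 r) x) \<longlonglongrightarrow> \<bar>P x - P x\<bar> * indicator (cball 0 r) x"
        by (intro tendsto_intros)
      then show "(\<lambda>n. \<bar>P x - k n x\<bar> * indicator (cball 0 r) x) \<longlonglongrightarrow> 0" by simp
    qed
    fix n show "AE x in lborel. norm (\<bar>P x - k n x\<bar> * indicator (cball 0 r) x) \<le> 2 * C * indicator (cball 0 r) x"
    proof (intro AE_I2)
      fix x show "norm (\<bar>P x - k n x\<bar> * indicator (cball 0 r) x) \<le> 2 * C * indicator (cball 0 r) x"
        using C[of x] kC[of n x] by (auto simp: indicator_def)
    qed
    show "(\<lambda>x. \<bar>P x - k n x\<bar> * indicator (cball 0 r) x) \<in> borel_measurable lborel" for n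
      by measurable
  qed simp
  then have "eventually (\<lambda>n. (\<integral>x. \<bar>P x - k n x\<bar> * indicator (cball 0 r) x \<partial>lborel) < e) sequentially"
    using e by (intro order_tendstoD) auto
  then obtain n where n: "(\<integral>x. \<bar>P x - k n x\<bar> * indicator (cball 0 r) x \<partial>lborel) < e"
    by (auto simp: eventually_sequentially)
  have i: "integrable lborel (\<lambda>x. \<bar>P x - k n x\<bar> * indicator (cball 0 r) x)"
  proof (rule Bochner_Integration.integrable_bound[of _ "\<lambda>x. 2 * C * indicator (cball 0 r) x"])
    show "integrable lborel (\<lambda>x::'a. 2 * C * indicator (cball 0 r) x)"
      using emeasure_bounded_finite[OF bounded_cball, of "0::'a" r]
      by (intro integrable_mult_right integrable_real_indicator) auto
    show "AE x in lborel. norm (\<bar>P x - k n x\<bar> * indicator (cball 0 r) x) \<le> norm (2 * C * indicator (cball 0 r) x)"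
    proof (intro AE_I2)
      fix x show "norm (\<bar>P x - k n x\<bar> * indicator (cball 0 r) x) \<le> norm (2 * C * indicator (cball 0 r) x)"
        using C[of x] kC[of n x] by (auto simp: indicator_def)
    qed
    show "(\<lambda>x. \<bar>P x - k n x\<bar> * indicator (cball 0 r) x) \<in> borel_measurable lborel"
      by measurable
  qed
  have "(\<integral>\<^sup>+x. ennreal \<bar>P x - k n x\<bar> * indicator (cball 0 r) x \<partial>lborel)
      = (\<integral>\<^sup>+x. ennreal (\<bar>P x - k n x\<bar> * indicator (cball 0 r) x) \<partial>lborel)"
    by (intro nn_integral_cong) (auto simp: indicator_def)
  also have "\<dots> = ennreal (\<integral>x. \<bar>P x - k n x\<bar> * indicator (cball 0 r) x \<partial>lborel)"
    by (rule nn_integral_eq_integral[OF i]) auto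
  also have "\<dots> < ennreal e" using n e by (simp add: ennreal_less_iff)
  finally show thesis using that[of "k n"] kc kC by blast
qed

lemma norm_mm_le:
  "norm (mm g M) \<le> (\<bar>fst (fst g)\<bar> + \<bar>snd (fst g)\<bar> + \<bar>fst (snd g)\<bar> + \<bar>snd (snd g)\<bar>) * norm M"
proof -
  have r: "norm (a *\<^sub>R fst M + b *\<^sub>R snd M) \<le> (\<bar>a\<bar> + \<bar>b\<bar>) * norm M" for a b
  proof -
    have "norm (a *\<^sub>R fst M + b *\<^sub>R snd M) \<le> \<bar>a\<bar> * norm (fst M) + \<bar>b\<bar> * norm (snd M)"
      by (rule order_trans[OF norm_triangle_ineq]) simp
    also have "\<dots> \<le> \<bar>a\<bar> * norm M + \<bar>b\<bar> * norm M"
      using norm_fst_le[of "fst M" "snd M"] norm_snd_le[of "snd M" "fst M"] by (intro add_mono mult_left_mono) auto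
    finally show ?thesis by (simp add: algebra_simps)
  qed
  have "norm (mm g M) \<le> norm (fst (mm g M)) + norm (snd (mm g M))"
    using norm_Pair_le[of "fst (mm g M)" "snd (mm g M)"] by simp
  also have "\<dots> \<le> (\<bar>fst (fst g)\<bar> + \<bar>snd (fst g)\<bar>) * norm M + (\<bar>fst (snd g)\<bar> + \<bar>snd (snd g)\<bar>) * norm M"
    unfolding mm_def fst_conv snd_conv by (intro add_mono r)
  finally show ?thesis by (simp add: algebra_simps)
qed

context hecke
begin

lemma integral_less_of_nn:
  fixes h :: "m4 \<Rightarrow> real"
  assumes "h \<in> borel_measurable mu" "\<And>x. 0 \<le> h x" "(\<integral>\<^sup>+x. ennreal (h x) \<partial>mu) < ennreal e"
  shows "(\<integral>x. h x \<partial>mu) < e"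
proof -
  have "(\<integral>x. h x \<partial>mu) = enn2real (\<integral>\<^sup>+x. ennreal (h x) \<partial>mu)"
    using assms by (intro integral_eq_nn_integral) auto
  moreover have "ennreal (enn2real (\<integral>\<^sup>+x. ennreal (h x) \<partial>mu)) = (\<integral>\<^sup>+x. ennreal (h x) \<partial>mu)"
    using assms(3) by (simp add: ennreal_enn2real_if less_top[symmetric]) (metis infinity_ennreal_def top.not_eq_extremum ennreal_less_top order_less_trans)
  ultimately have "ennreal (\<integral>x. h x \<partial>mu) < ennreal e" using assms(3) by simp
  then show ?thesis by (metis ennreal_leI leD leI)
qed

text \<open>\<open>mu\<close> is at most Lebesgue measure, which is invariant under left
  multiplication. So the error of a continuous approximation on a large ball is controlled both
  before and after the translation, and little mass of \<open>mu\<close> lies outside a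
  ball.\<close>

lemma L1_translation_mu:
  fixes P :: "m4 \<Rightarrow> real"
  assumes P [measurable]: "P \<in> borel_measurable borel" and C: "\<And>x. \<bar>P x\<bar> \<le> C"
    and g: "g \<longlonglongrightarrow> one4" "\<And>n. dt (g n) = 1"
  shows "(\<lambda>n. \<integral>M. \<bar>P (mm (g n) M) - P M\<bar> \<partial>mu) \<longlonglongrightarrow> 0"
proof (rule LIMSEQ_I)
  fix e :: real assume e: "0 < e"
  have C0: "0 \<le> C" by (rule order_trans[OF abs_ge_zero C])
  \<comment> \<open>The complement of the ball contributes at most \<open>2 * C * e1\<close>; C + 1
    avoids a division by 0.\<close>
  define e1 where "e1 = e / (8 * (C + 1))"
  have e1: "0 < e1" "2 * C * e1 \<le> e / 4"
    using e C0 by (auto simp: e1_def field_simps mult_left_mono)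
  have "(\<lambda>n. measure mu (cball 0 (real n))) \<longlonglongrightarrow> measure mu (\<Union>n. cball 0 (real n))"
    by (intro mu.finite_Lim_measure_incseq) (auto simp: incseq_def)
  moreover have "(\<Union>n. cball 0 (real n)) = (UNIV :: m4 set)"
    by (auto simp: real_arch_simple simp del: split_paired_All split_paired_Ex)
  ultimately have "(\<lambda>n. measure mu (cball 0 (real n))) \<longlonglongrightarrow> measure mu UNIV" by simp
  then have "eventually (\<lambda>n. measure mu UNIV - e1 < measure mu (cball 0 (real n))) sequentially"
    using e1 by (intro order_tendstoD) auto
  then obtain r where r: "measure mu UNIV - e1 < measure mu (cball 0 (real r))" by (auto simp: eventually_sequentially)
  define K where "K = (cball 0 (real r) :: m4 set)"
  have [measurable]: "K \<in> sets borel" "cball (0::m4) (4 * real r) \<in> sets borel" by (simp_all add: K_def)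
  have Kc: "measure mu (UNIV - K) < e1"
    using mu.finite_measure_compl[of K] r by (simp add: K_def)
  \<comment> \<open>The radius is 4 r because the absolute entries of \<open>g n\<close> eventually
    sum to less than 4, so the ball of radius r is carried into this one.\<close>
  obtain k where kc: "continuous_on UNIV k" and kC: "\<And>x. \<bar>k x\<bar> \<le> C"
    and kP: "(\<integral>\<^sup>+x. ennreal \<bar>P x - k x\<bar> * indicator (cball 0 (4 * real r)) x \<partial>lborel) < ennreal (e / 8)"
    using bounded_continuous_approx[OF P C, of "e / 8" "4 * real r"] e by auto
  have [measurable]: "k \<in> borel_measurable borel" using kc by (rule borel_measurable_continuous_onI)
  have t3: "(\<lambda>n. \<integral>M. \<bar>k (mm (g n) M) - k M\<bar> \<partial>mu) \<longlonglongrightarrow> (\<integral>M. 0 \<partial>mu)"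
  proof (rule integral_dominated_convergence[where w = "\<lambda>_. 2 * C"])
    show "AE M in mu. (\<lambda>n. \<bar>k (mm (g n) M) - k M\<bar>) \<longlonglongrightarrow> 0"
    proof (rule AE_I2)
      fix M
      have "isCont (\<lambda>g. mm g M) one4"
        by (rule continuous_on_interior[of UNIV]) (auto intro!: continuous_intros)
      then have "(\<lambda>n. mm (g n) M) \<longlonglongrightarrow> mm one4 M" using g(1) by (rule isCont_tendsto_compose)
      moreover have "isCont k M" using kc by (simp add: continuous_on_eq_continuous_within)
      ultimately have "(\<lambda>n. k (mm (g n) M)) \<longlonglongrightarrow> k M" using isCont_tendsto_compose[of M k] by simp
      then show "(\<lambda>n. \<bar>k (mm (g n) M) - k M\<bar>) \<longlonglongrightarrow> 0" by (simp add: LIM_zero tendsto_rabs_zero)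
    qed
    fix n show "AE M in mu. norm \<bar>k (mm (g n) M) - k M\<bar> \<le> 2 * C"
    proof (rule AE_I2)
      fix M show "norm \<bar>k (mm (g n) M) - k M\<bar> \<le> 2 * C"
        using kC[of M] kC[of "mm (g n) M"] by simp
    qed
  qed auto
  have ev1: "eventually (\<lambda>n. (\<integral>M. \<bar>k (mm (g n) M) - k M\<bar> \<partial>mu) < e / 8) sequentially"
    using t3 e by (intro order_tendstoD) auto
  have ev2: "eventually (\<lambda>n. \<bar>fst (fst (g n))\<bar> + \<bar>snd (fst (g n))\<bar> + \<bar>fst (snd (g n))\<bar> + \<bar>snd (snd (g n))\<bar> < 4) sequentially"
  proof -
    have "(\<lambda>n. \<bar>fst (fst (g n))\<bar> + \<bar>snd (fst (g n))\<bar> + \<bar>fst (snd (g n))\<bar> + \<bar>snd (snd (g n))\<bar>)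
      \<longlonglongrightarrow> \<bar>fst (fst one4)\<bar> + \<bar>snd (fst one4)\<bar> + \<bar>fst (snd one4)\<bar> + \<bar>snd (snd one4)\<bar>"
      by (intro tendsto_intros g(1))
    then show ?thesis by (rule order_tendstoD) simp
  qed
  define w where "w M = \<bar>P M - k M\<bar>" for M
  have [measurable]: "w \<in> borel_measurable borel" unfolding w_def by measurable
  have w0: "0 \<le> w M" "w M \<le> 2 * C" for M using C[of M] kC[of M] by (auto simp: w_def)
  have small: "(\<integral>M. indicator K M * w (mm h M) \<partial>mu) < e / 8"
    if h: "dt h = 1" "\<bar>fst (fst h)\<bar> + \<bar>snd (fst h)\<bar> + \<bar>fst (snd h)\<bar> + \<bar>snd (snd h)\<bar> < 4" for h
  proof (rule integral_less_of_nn)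
    show "(\<lambda>M. indicator K M * w (mm h M)) \<in> borel_measurable mu" by measurable
    show "\<And>M. 0 \<le> indicator K M * w (mm h M)" using w0 by simp
    have "(\<integral>\<^sup>+M. ennreal (indicator K M * w (mm h M)) \<partial>mu)
        = (\<integral>\<^sup>+M. indicator Dom M * ennreal (indicator K M * w (mm h M)) \<partial>lborel)"
      by (rule nn_integral_mu) measurable
    also have "\<dots> \<le> (\<integral>\<^sup>+M. ennreal \<bar>P (mm h M) - k (mm h M)\<bar> * indicator (cball 0 (4 * real r)) (mm h M) \<partial>lborel)"
    proof (rule nn_integral_mono)
      fix M
      have "mm h M \<in> cball 0 (4 * real r)" if "M \<in> K"
      proof -
        have "norm (mm h M) \<le> 4 * norm M"
          using norm_mm_le[of h M] h(2) by (meson less_imp_le mult_right_mono norm_ge_zero order_trans)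
        then show ?thesis using that by (simp add: K_def)
      qed
      then show "indicator Dom M * ennreal (indicator K M * w (mm h M))
        \<le> ennreal \<bar>P (mm h M) - k (mm h M)\<bar> * indicator (cball 0 (4 * real r)) (mm h M)"
        by (cases "M \<in> K"; cases "M \<in> Dom") (simp_all add: w_def)
    qed
    also have "\<dots> = (\<integral>\<^sup>+M. ennreal \<bar>P M - k M\<bar> * indicator (cball 0 (4 * real r)) M \<partial>lborel)"
      by (rule presD[OF left_pres[OF h(1)]]) measurable
    finally show "(\<integral>\<^sup>+M. ennreal (indicator K M * w (mm h M)) \<partial>mu) < ennreal (e / 8)"
      using kP by simp
  qed
  have main: "(\<integral>M. \<bar>P (mm (g n) M) - P M\<bar> \<partial>mu) < e"
    if n: "(\<integral>M. \<bar>k (mm (g n) M) - k M\<bar> \<partial>mu) < e / 8"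
      "\<bar>fst (fst (g n))\<bar> + \<bar>snd (fst (g n))\<bar> + \<bar>fst (snd (g n))\<bar> + \<bar>snd (snd (g n))\<bar> < 4" for n
  proof -
    have ib: "integrable mu h" if "h \<in> borel_measurable borel" "\<And>x. \<bar>h x\<bar> \<le> D" for h :: "m4 \<Rightarrow> real" and D
      using that by (intro mu.integrable_const_bound[of _ D]) auto
    have i1: "integrable mu (\<lambda>M. 2 * C * indicator (UNIV - K) M)" using C0 by (intro ib[of _ "2 * C"]) (auto simp: indicator_def)
    have i2: "integrable mu (\<lambda>M. indicator K M * w (mm h M))" for h
    proof (rule ib[of _ "2 * C"])
      fix M show "\<bar>indicator K M * w (mm h M)\<bar> \<le> 2 * C" using w0[of "mm h M"] C0 by (simp add: indicator_def)
    qed measurable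
    have i2': "integrable mu (\<lambda>M. indicator K M * w M)" using i2[of one4] by simp
    have i3: "integrable mu (\<lambda>M. \<bar>k (mm (g n) M) - k M\<bar>)"
    proof (rule ib[of _ "2 * C"])
      fix M show "\<bar>\<bar>k (mm (g n) M) - k M\<bar>\<bar> \<le> 2 * C" using kC[of M] kC[of "mm (g n) M"] by simp
    qed measurable
    have i4: "integrable mu (\<lambda>M. \<bar>P (mm (g n) M) - P M\<bar>)"
    proof (rule ib[of _ "2 * C"])
      fix M show "\<bar>\<bar>P (mm (g n) M) - P M\<bar>\<bar> \<le> 2 * C" using C[of M] C[of "mm (g n) M"] by simp
    qed measurable
    have "(\<integral>M. \<bar>P (mm (g n) M) - P M\<bar> \<partial>mu) \<le>
      (\<integral>M. 2 * C * indicator (UNIV - K) M + indicator K M * w (mm (g n) M) + \<bar>k (mm (g n) M) - k M\<bar> + indicator K M * w M \<partial>mu)"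
    proof (rule integral_mono[OF i4])
      show "integrable mu (\<lambda>M. 2 * C * indicator (UNIV - K) M + indicator K M * w (mm (g n) M) + \<bar>k (mm (g n) M) - k M\<bar> + indicator K M * w M)"
        by (intro Bochner_Integration.integrable_add i1 i2 i3 i2')
      fix M
      show "\<bar>P (mm (g n) M) - P M\<bar> \<le> 2 * C * indicator (UNIV - K) M + indicator K M * w (mm (g n) M) + \<bar>k (mm (g n) M) - k M\<bar> + indicator K M * w M"
      proof (cases "M \<in> K")
        case True
        then show ?thesis by (simp add: w_def)
      next
        case False
        then show ?thesis using C[of M] C[of "mm (g n) M"] by simp
      qed
    qed
    also have "\<dots> = (\<integral>M. 2 * C * indicator (UNIV - K) M \<partial>mu) + (\<integral>M. indicator K M * w (mm (g n) M) \<partial>mu)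
        + (\<integral>M. \<bar>k (mm (g n) M) - k M\<bar> \<partial>mu) + (\<integral>M. indicator K M * w M \<partial>mu)"
      by (simp only: Bochner_Integration.integral_add i1 i2 i2' i3 Bochner_Integration.integrable_add)
    also have "(\<integral>M. 2 * C * indicator (UNIV - K) M \<partial>mu) = 2 * C * measure mu (UNIV - K)" by simp
    also have "2 * C * measure mu (UNIV - K) \<le> e / 4"
      using Kc C0 e1 by (intro order_trans[OF mult_left_mono e1(2)]) auto
    finally show ?thesis
      using small[OF g(2) n(2)] small[of one4] n(1) e by simp
  qed
  have "eventually (\<lambda>n. (\<integral>M. \<bar>P (mm (g n) M) - P M\<bar> \<partial>mu) < e) sequentially"
    using ev1 ev2 by eventually_elim (rule main)
  then obtain N where N: "\<And>n. n \<ge> N \<Longrightarrow> (\<integral>M. \<bar>P (mm (g n) M) - P M\<bar> \<partial>mu) < e" by (auto simp: eventually_sequentially)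
  show "\<exists>N. \<forall>n\<ge>N. norm ((\<integral>M. \<bar>P (mm (g n) M) - P M\<bar> \<partial>mu) - 0) < e"
    using N by (intro exI[of _ N]) simp
qed

lemma MX_compose [measurable]: "P \<in> borel_measurable MX \<Longrightarrow> (\<lambda>M. P (mm h M)) \<in> borel_measurable MX"
  using measurable_compose[OF MX_measurable_mm] .

lemma L1_translation:
  fixes P :: "m4 \<Rightarrow> real"
  assumes P [measurable]: "P \<in> borel_measurable MX" and C: "\<And>x. \<bar>P x\<bar> \<le> C"
    and g: "g \<longlonglongrightarrow> one4" "\<And>n. dt (g n) = 1"
  shows "(\<lambda>n. \<integral>M. \<bar>P (mm (g n) M) - P M\<bar> \<partial>MX) \<longlonglongrightarrow> 0"
proof -
  have "(\<integral>M. \<bar>P (mm (g n) M) - P M\<bar> \<partial>MX) = (\<integral>M. \<bar>P (mm (g n) M) - P M\<bar> \<partial>mu)" for n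
    by (rule integral_MX) measurable
  then show ?thesis using L1_translation_mu[OF MX_measurableD(1)[OF P] C g] by simp
qed

end

definition dg :: "real \<Rightarrow> m4" where "dg t = ((1 / t, 0), (0, t))"

lemma dt_dg [simp]: "t \<noteq> 0 \<Longrightarrow> dt (dg t) = 1"
  by (simp add: dg_def)

section \<open>Invariant functions are constant\<close>

context hecke
begin

lemma AE_MX_shift:
  assumes "dt h = 1" "AE M in MX. Q M" shows "AE M in MX. Q (mm h M)"
proof -
  have "AE M in distr MX MX (mm h). Q M" unfolding MX_distr[OF assms(1)] by (rule assms(2))
  then show ?thesis by (rule AE_distrD[OF MX_measurable_mm])
qed

lemma MX_int_bdd:
  fixes h :: "m4 \<Rightarrow> real"
  assumes "h \<in> borel_measurable MX" "\<And>x. \<bar>h x\<bar> \<le> K" shows "integrable MX h"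
  using assms by (intro MX.integrable_const_bound[of _ K]) auto

lemma MX_int_diff:
  fixes u v :: "m4 \<Rightarrow> real"
  assumes [measurable]: "u \<in> borel_measurable MX" "v \<in> borel_measurable MX"
    and "\<And>x. \<bar>u x\<bar> \<le> K" "\<And>x. \<bar>v x\<bar> \<le> K"
  shows "integrable MX (\<lambda>x. \<bar>u x - v x\<bar>)"
proof (rule MX_int_bdd)
  fix x show "\<bar>\<bar>u x - v x\<bar>\<bar> \<le> 2 * K" using assms(3)[of x] assms(4)[of x] by linarith
qed measurable

text \<open>The Mautner phenomenon in \<open>L\<^sup>1\<close>: invariance passes to an element \<open>d\<close> which can be approximated by
  products \<open>a g b\<close> with \<open>a\<close>, \<open>b\<close> leaving the function invariant and \<open>g\<close> tending to the identity.\<close>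

lemma mautner_limit:
  fixes P :: "m4 \<Rightarrow> real" and a b g h :: "nat \<Rightarrow> m4"
  assumes P [measurable]: "P \<in> borel_measurable MX" and C: "\<And>x. \<bar>P x\<bar> \<le> C"
    and a: "\<And>n. AE M in MX. P (mm (a n) M) = P M" and b: "\<And>n. AE M in MX. P (mm (b n) M) = P M"
    and db: "\<And>n. dt (b n) = 1" and dg: "\<And>n. dt (g n) = 1" and dh: "\<And>n. dt (h n) = 1"
    and g: "g \<longlonglongrightarrow> one4" and h: "h \<longlonglongrightarrow> one4"
    and eq: "\<And>n. mm (a n) (mm (g n) (b n)) = mm d (h n)"
  shows "AE M in MX. P (mm d M) = P M"
proof -
  have i: "integrable MX (\<lambda>M. \<bar>P (mm u M) - P (mm v M)\<bar>)" for u v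
    by (rule MX_int_diff[of _ _ C]) (use C in measurable)
  have i': "integrable MX (\<lambda>M. \<bar>P (mm u M) - P M\<bar>)" for u using i[of u one4] by simp
  \<comment> \<open>The value at d h M is inserted, which is the value at a g b M. Invariance
    removes a there, inserts b in the term it is compared with, and a change of variable then
    cancels b.\<close>
  have le: "(\<integral>M. \<bar>P (mm d M) - P M\<bar> \<partial>MX) \<le>
    (\<integral>M. \<bar>P (mm d (mm (h n) M)) - P (mm d M)\<bar> \<partial>MX) + (\<integral>M. \<bar>P (mm (g n) M) - P M\<bar> \<partial>MX)" for n
  proof -
    have "(\<integral>M. \<bar>P (mm d M) - P M\<bar> \<partial>MX) \<le>
      (\<integral>M. \<bar>P (mm (mm d (h n)) M) - P (mm d M)\<bar> + \<bar>P (mm (mm d (h n)) M) - P M\<bar> \<partial>MX)"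
      by (intro integral_mono Bochner_Integration.integrable_add i i') linarith
    also have "\<dots> = (\<integral>M. \<bar>P (mm (mm d (h n)) M) - P (mm d M)\<bar> \<partial>MX) + (\<integral>M. \<bar>P (mm (mm d (h n)) M) - P M\<bar> \<partial>MX)"
      by (intro Bochner_Integration.integral_add i i')
    also have "(\<integral>M. \<bar>P (mm (mm d (h n)) M) - P M\<bar> \<partial>MX) = (\<integral>M. \<bar>P (mm (g n) (mm (b n) M)) - P (mm (b n) M)\<bar> \<partial>MX)"
    proof (rule integral_cong_AE)
      have "dt (mm (g n) (b n)) = 1" using db dg by simp
      from AE_MX_shift[OF this a[of n]] b[of n]
      show "AE M in MX. \<bar>P (mm (mm d (h n)) M) - P M\<bar> = \<bar>P (mm (g n) (mm (b n) M)) - P (mm (b n) M)\<bar>"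
      proof eventually_elim
        fix M assume A: "P (mm (a n) (mm (mm (g n) (b n)) M)) = P (mm (mm (g n) (b n)) M)" and B: "P (mm (b n) M) = P M"
        have "P (mm (mm d (h n)) M) = P (mm (g n) (mm (b n) M))"
          using A unfolding eq[symmetric] mm_assoc .
        then show "\<bar>P (mm (mm d (h n)) M) - P M\<bar> = \<bar>P (mm (g n) (mm (b n) M)) - P (mm (b n) M)\<bar>" using B by simp
      qed
      have [measurable]: "(\<lambda>M. P (mm (g n) (mm (b n) M))) \<in> borel_measurable MX"
        using MX_compose[OF P, of "mm (g n) (b n)"] by (simp add: mm_assoc)
      show "(\<lambda>M. \<bar>P (mm (g n) (mm (b n) M)) - P (mm (b n) M)\<bar>) \<in> borel_measurable MX" by measurable
    qed measurable
    also have "\<dots> = (\<integral>M. \<bar>P (mm (g n) M) - P M\<bar> \<partial>MX)"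
      using integral_MX_mm[of "\<lambda>M. \<bar>P (mm (g n) M) - P M\<bar>" "b n"] db by simp
    finally show ?thesis by (simp add: mm_assoc)
  qed
  have "(\<lambda>n. \<integral>M. \<bar>P (mm d (mm (h n) M)) - P (mm d M)\<bar> \<partial>MX) \<longlonglongrightarrow> 0"
    by (rule L1_translation[of "\<lambda>M. P (mm d M)" C]) (use C h dh in auto)
  moreover have "(\<lambda>n. \<integral>M. \<bar>P (mm (g n) M) - P M\<bar> \<partial>MX) \<longlonglongrightarrow> 0"
    by (rule L1_translation[OF P C g dg])
  ultimately have "(\<lambda>n. (\<integral>M. \<bar>P (mm d (mm (h n) M)) - P (mm d M)\<bar> \<partial>MX) + (\<integral>M. \<bar>P (mm (g n) M) - P M\<bar> \<partial>MX)) \<longlonglongrightarrow> 0 + 0"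
    by (rule tendsto_add)
  then have "(\<integral>M. \<bar>P (mm d M) - P M\<bar> \<partial>MX) \<le> 0 + 0"
    by (rule LIMSEQ_le_const) (use le in blast)
  then have "(\<integral>M. \<bar>P (mm d M) - P M\<bar> \<partial>MX) = 0"
    by (intro antisym) auto
  then have "AE M in MX. \<bar>P (mm d M) - P M\<bar> = 0"
    using integral_nonneg_eq_0_iff_AE[OF i'] by simp
  then show ?thesis by simp
qed

lemma AE_inv_mm:
  assumes "dt h = 1" "AE M in MX. P (mm g M) = P M" "AE M in MX. P (mm h M) = P M"
  shows "AE M in MX. P (mm (mm g h) M) = P M"
  using AE_MX_shift[OF assms(1,2)] assms(3) by eventually_elim (simp add: mm_assoc)

lemma AE_inv_adj:
  assumes "dt g = 1" "AE M in MX. P (mm g M) = P M"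
  shows "AE M in MX. P (mm (adj g) M) = P M"
proof -
  have "AE M in MX. P (mm g (mm (adj g) M)) = P (mm (adj g) M)"
    by (rule AE_MX_shift[OF _ assms(2)]) (simp add: assms)
  then show ?thesis by eventually_elim (simp add: mm_adj_cancel[OF assms(1)])
qed

lemma tendsto_m4:
  assumes "a \<longlonglongrightarrow> a0" "b \<longlonglongrightarrow> b0" "c \<longlonglongrightarrow> c0" "d \<longlonglongrightarrow> d0"
  shows "(\<lambda>n. ((a n, b n), (c n, d n)) :: m4) \<longlonglongrightarrow> ((a0, b0), (c0, d0))"
  by (intro tendsto_Pair assms)

text \<open>Powers of diag(2, 1/2) conjugate \<open>up (r * (1/4)^n)\<close> to \<open>up r\<close>
  and, inverted, \<open>lo (s * (1/4)^n)\<close> to \<open>lo s\<close>. Invariance under the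
  diagonal element thus gives all shears, and these generate the group.\<close>

lemma inv_up_imp_inv:
  fixes P :: "m4 \<Rightarrow> real"
  assumes P [measurable]: "P \<in> borel_measurable MX" and C: "\<And>x. \<bar>P x\<bar> \<le> C"
    and up1: "AE M in MX. P (mm (up 1) M) = P M" and h: "dt h = 1"
  shows "AE M in MX. P (mm h M) = P M"
proof -
  define d2 :: m4 where "d2 = ((2, 0), (0, 1 / 2))"
  have upn: "AE M in MX. P (mm (up (real n)) M) = P M" for n :: nat
  proof (induction n)
    case (Suc n)
    have "AE M in MX. P (mm (mm (up 1) (up (real n))) M) = P M"
      by (rule AE_inv_mm[OF _ up1 Suc]) simp
    then show ?case by (simp add: add.commute)
  qed simp
  have upm: "AE M in MX. P (mm (up (- real n)) M) = P M" for n :: nat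
    using AE_inv_adj[OF _ upn[of n]] by simp
  have inv_d2: "AE M in MX. P (mm d2 M) = P M"
  proof (rule mautner_limit[OF P C, of "\<lambda>n. up (real (2 * Suc n))" "\<lambda>n. up (- real (Suc n))"
        "\<lambda>n. lo (1 / (2 * real (Suc n)))" "\<lambda>n. lo (1 / real (Suc n))"])
    have z: "(\<lambda>n. c / real (Suc n)) \<longlonglongrightarrow> 0" for c
      using LIMSEQ_Suc[OF lim_const_over_n[of c]] .
    show "(\<lambda>n. lo (1 / (2 * real (Suc n)))) \<longlonglongrightarrow> one4"
      using z[of "1/2"] by (intro tendsto_m4 tendsto_const) simp
    show "(\<lambda>n. lo (1 / real (Suc n))) \<longlonglongrightarrow> one4"
      using z[of 1] by (intro tendsto_m4 tendsto_const)
    show "AE M in MX. P (mm (up (real (2 * Suc n))) M) = P M" for n by (rule upn)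
    show "AE M in MX. P (mm (up (- real (Suc n))) M) = P M" for n by (rule upm)
    \<comment> \<open>The two upper shears cancel the upper right entry exactly and make the
      diagonal (2, 1/2); the factor left over on the right tends to the identity.\<close>
    show "mm (up (real (2 * Suc n))) (mm (lo (1 / (2 * real (Suc n)))) (up (- real (Suc n)))) = mm d2 (lo (1 / real (Suc n)))" for n
    proof -
      define k where "k = real (Suc n)"
      have k: "0 < k" by (simp add: k_def)
      have "mm (up (2 * k)) (mm (lo (1 / (2 * k))) (up (- k))) = mm d2 (lo (1 / k))"
        using k by (simp add: d2_def field_simps)
      then show ?thesis by (simp add: k_def)
    qed
  qed simp_all
  have dd2: "dt d2 = 1" by (simp add: d2_def)
  define dn :: "nat \<Rightarrow> m4" where "dn n = ((2 ^ n, 0), (0, (1 / 2) ^ n))" for n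
  have ddn: "dt (dn n) = 1" for n by (simp add: dn_def power_mult_distrib[symmetric])
  have inv_dn: "AE M in MX. P (mm (dn n) M) = P M" for n
  proof (induction n)
    case (Suc n)
    have "AE M in MX. P (mm (mm d2 (dn n)) M) = P M" by (rule AE_inv_mm[OF ddn inv_d2 Suc])
    then show ?case by (simp add: d2_def dn_def)
  qed (simp add: dn_def)
  have inv_dn': "AE M in MX. P (mm (adj (dn n)) M) = P M" for n
    by (rule AE_inv_adj[OF ddn inv_dn])
  have z4: "(\<lambda>n. s * (1 / 4) ^ n) \<longlonglongrightarrow> 0" for s :: real
    using tendsto_mult_right_zero[OF LIMSEQ_power_zero[of "1/4::real"]] by simp
  have p4: "((1/4)::real) ^ n = (1/2) ^ n * (1/2) ^ n" for n by (simp add: power_mult_distrib[symmetric])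
  have p1: "(2::real) ^ n * (1/2) ^ n = 1" for n by (simp add: power_mult_distrib[symmetric])
  have inv_up: "AE M in MX. P (mm (up r) M) = P M" for r
  proof (rule mautner_limit[OF P C inv_dn inv_dn', where g = "\<lambda>n. up (r * (1/4)^n)" and h = "\<lambda>_. one4"])
    show "(\<lambda>n. up (r * (1/4)^n)) \<longlonglongrightarrow> one4" by (intro tendsto_m4 tendsto_const z4)
    show "mm (dn n) (mm (up (r * (1/4)^n)) (adj (dn n))) = mm (up r) one4" for n
    proof -
      have "2 ^ n * (r * (1/4)^n * 2 ^ n) = r * ((2 ^ n * (1/2)^n) * (2 ^ n * (1/2)^n))"
        unfolding p4 by (simp only: mult_ac)
      then show ?thesis using p1[of n] by (simp add: dn_def mult.commute)
    qed
  qed (simp_all add: ddn)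
  have inv_lo: "AE M in MX. P (mm (lo s) M) = P M" for s
  proof (rule mautner_limit[OF P C inv_dn' inv_dn, where g = "\<lambda>n. lo (s * (1/4)^n)" and h = "\<lambda>_. one4"])
    show "(\<lambda>n. lo (s * (1/4)^n)) \<longlonglongrightarrow> one4" by (intro tendsto_m4 tendsto_const z4)
    show "mm (adj (dn n)) (mm (lo (s * (1/4)^n)) (dn n)) = mm (lo s) one4" for n
    proof -
      have "2 ^ n * (s * (1/4)^n * 2 ^ n) = s * ((2 ^ n * (1/2)^n) * (2 ^ n * (1/2)^n))"
        unfolding p4 by (simp only: mult_ac)
      then show ?thesis using p1[of n] by (simp add: dn_def mult.commute)
    qed
  qed (simp_all add: ddn)
  \<comment> \<open>The determinant is carried through the induction because
    \<open>AE_inv_mm\<close> asks for it at the right factor.\<close>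
  have "(AE M in MX. P (mm h M) = P M) \<and> dt h = 1"
    using h
  proof (induction rule: sl2_shear_induct)
    case (mm g h)
    have "AE M in MX. P (mm (mm g h) M) = P M"
      by (rule AE_inv_mm[OF conjunct2[OF mm(2)] conjunct1[OF mm(1)] conjunct1[OF mm(2)]])
    then show ?case using mm by (simp only: dt_mm) simp
  next
    case (up r)
    show ?case using inv_up by simp
  next
    case (lo s)
    show ?case using inv_lo by simp
  qed
  then show ?thesis by blast
qed

lemma AE_MX_imp_mu: "AE M in MX. Q M \<Longrightarrow> AE M in mu. Q M"
  unfolding MX_def by (rule AE_restr_to_subalg[OF subalgebra_invs])

text \<open>Fubini turns invariance under each g into one base point M0 at which P (g M0) = P M0 for
  almost every g of positive determinant. The products g M0 exhaust almost all matrices of positive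
  determinant.\<close>

lemma inv_imp_const:
  fixes P :: "m4 \<Rightarrow> real"
  assumes P [measurable]: "P \<in> borel_measurable MX"
    and inv: "\<And>h. dt h = 1 \<Longrightarrow> AE M in MX. P (mm h M) = P M"
  shows "\<exists>c. AE M in MX. P M = c"
proof -
  have Pb [measurable]: "P \<in> borel_measurable borel" and Ps: "\<And>c M. c > 0 \<Longrightarrow> P (c *\<^sub>R M) = P M"
    using MX_measurableD[OF P] by blast+
  have 1: "AE g in lborel. AE M in mu. 0 < dt g \<longrightarrow> P (mm g M) = P M"
  proof (rule AE_I2)
    fix g
    show "AE M in mu. 0 < dt g \<longrightarrow> P (mm g M) = P M"
    proof (cases "0 < dt g")
      case True
      then obtain c g1 where g1: "0 < c" "dt g1 = 1" "g = c *\<^sub>R g1" by (rule unimodular_scale)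
      then show ?thesis using AE_MX_imp_mu[OF inv[OF g1(2)]] by (simp add: Ps)
    qed simp
  qed
  interpret pair_sigma_finite lborel mu ..
  have "{x \<in> space (lborel \<Otimes>\<^sub>M mu). 0 < dt (fst x) \<longrightarrow> P (mm (fst x) (snd x)) = P (snd x)} \<in> sets (lborel \<Otimes>\<^sub>M mu)"
    by measurable
  then have 2: "AE M in mu. AE g in lborel. 0 < dt g \<longrightarrow> P (mm g M) = P M"
    by (rule iffD1[OF AE_commute 1])
  have 3: "AE M in mu. 0 < dt M"
    unfolding mu_def by (subst AE_density) (simp_all add: indicator_def Dom_dt)
  have "\<exists>M. (AE g in lborel. 0 < dt g \<longrightarrow> P (mm g M) = P M) \<and> 0 < dt M"
  proof (rule ccontr)
    assume n: "\<not> ?thesis"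
    have "AE M in mu. False"
      using 2 3
    proof eventually_elim
      fix M assume "AE g in lborel. 0 < dt g \<longrightarrow> P (mm g M) = P M" "0 < dt M"
      then show False using n by blast
    qed
    then have "emeasure mu UNIV = 0" using AE_iff_measurable[of UNIV mu "\<lambda>_. False"] by simp
    then show False using Rint_pos by (simp add: emeasure_mu_Rint)
  qed
  then obtain M0 where M0: "AE g in lborel. 0 < dt g \<longrightarrow> P (mm g M0) = P M0" "0 < dt M0" by blast
  obtain c M1 where M1: "0 < c" "dt M1 = 1" "M0 = c *\<^sub>R M1" using M0(2) by (rule unimodular_scale)
  have "AE g in lborel. 0 < dt (mm g (adj M1)) \<longrightarrow> P (mm (mm g (adj M1)) M0) = P M0"
    by (rule AE_pres[OF right_pres M0(1)]) (simp add: M1)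
  then have "AE M in lborel. 0 < dt M \<longrightarrow> P M = P M0"
    by eventually_elim (simp add: M1 Ps mm_adj_cancel)
  then have "AE M in lborel. 0 < (indicator Dom M :: ennreal) \<longrightarrow> P M = P M0"
    by eventually_elim (simp add: indicator_def Dom_dt)
  then have "AE M in mu. P M = P M0"
    unfolding mu_def by (subst AE_density) simp_all
  then have "AE M in MX. P M = P M0"
    unfolding MX_def
  proof (rule AE_restr_to_subalg2[OF subalgebra_invs])
    have [measurable]: "P \<in> borel_measurable (sigma UNIV invs)"
      by (rule measurable_in_subalg'[OF subalgebra_invs]) (use P in \<open>simp add: MX_def\<close>)
    show "Measurable.pred (sigma UNIV invs) (\<lambda>M. P M = P M0)" by measurable
  qed
  then show ?thesis ..
qed

section \<open>Mixing of the geodesic flow\<close>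

sublocale up1: mpt MX "mm (up 1)"
  by unfold_locales (simp_all add: MX_distr)

lemma funpow_up1: "(mm (up 1) ^^ k) M = mm (up (real k)) M"
  by (induction k) (simp_all add: mm_assoc[symmetric] add.commute)

text \<open>The limit is constant by ergodicity. Averaging preserves the integral and the total mass
  is \<open>Rint / 2\<close>, which fixes the constant.\<close>

lemma horocycle_mean_ergodic:
  fixes f :: "m4 \<Rightarrow> real"
  assumes f [measurable]: "f \<in> borel_measurable MX" and C: "\<And>x. \<bar>f x\<bar> \<le> C"
  shows "(\<lambda>n. \<integral>M. \<bar>birkhoff (mm (up 1)) f n M - (\<integral>M. f M \<partial>MX) / (Rint / 2)\<bar> \<partial>MX) \<longlonglongrightarrow> 0"
proof -
  obtain P where P [measurable]: "P \<in> borel_measurable MX" and PC: "\<And>x. \<bar>P x\<bar> \<le> C"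
    and lim: "(\<lambda>n. \<integral>x. \<bar>birkhoff (mm (up 1)) f n x - P x\<bar> \<partial>MX) \<longlonglongrightarrow> 0"
    and inv: "AE x in MX. P (mm (up 1) x) = P x"
    by (rule up1.mean_ergodic[OF f C], rule that)
  obtain c where c: "AE M in MX. P M = c"
    using inv_imp_const[OF P inv_up_imp_inv[OF P PC inv]] by blast
  have bC: "\<bar>birkhoff (mm (up 1)) f n x\<bar> \<le> C" for n x by (rule birkhoff_bounded) (rule C)
  have e: "(\<integral>x. \<bar>birkhoff (mm (up 1)) f n x - P x\<bar> \<partial>MX) = (\<integral>x. \<bar>birkhoff (mm (up 1)) f n x - c\<bar> \<partial>MX)" for n
    using c by (intro integral_cong_AE) auto
  have ib: "integrable MX (birkhoff (mm (up 1)) f n)" for n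
    by (rule MX_int_bdd[OF _ bC]) measurable
  have ib': "integrable MX (\<lambda>x. f (mm h x))" for h by (rule MX_int_bdd[OF _ C]) measurable
  have int: "(\<integral>x. birkhoff (mm (up 1)) f n x \<partial>MX) = (\<integral>M. f M \<partial>MX)" if "n > 0" for n
  proof -
    have "(\<integral>x. birkhoff (mm (up 1)) f n x \<partial>MX) = (\<Sum>k<n. \<integral>x. f (mm (up (real k)) x) \<partial>MX) / real n"
      unfolding birkhoff_def funpow_up1 using ib' by simp
    then show ?thesis using that integral_MX_mm[OF f] by simp
  qed
  have "\<bar>(\<integral>M. f M \<partial>MX) - c * (Rint / 2)\<bar> \<le> (\<integral>x. \<bar>birkhoff (mm (up 1)) f n x - c\<bar> \<partial>MX)" if "n > 0" for n
  proof -
    have "(\<integral>M. f M \<partial>MX) - c * (Rint / 2) = (\<integral>x. birkhoff (mm (up 1)) f n x - c \<partial>MX)"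
      using int[OF that] ib[of n] by (simp add: measure_MX)
    also have "\<bar>\<dots>\<bar> \<le> (\<integral>x. \<bar>birkhoff (mm (up 1)) f n x - c\<bar> \<partial>MX)" by (rule integral_abs_bound)
    finally show ?thesis .
  qed
  then have "\<bar>(\<integral>M. f M \<partial>MX) - c * (Rint / 2)\<bar> \<le> 0"
    using lim unfolding e by (intro LIMSEQ_le_const[of _ 0]) (auto intro!: exI[of _ 1])
  then have "(\<integral>M. f M \<partial>MX) / (Rint / 2) = c" using Rint_pos by (simp add: field_simps)
  then show ?thesis using lim unfolding e by simp
qed

text \<open>Translating k by \<open>up j\<close> amounts, by invariance of the measure, to
  translating f by an upper shear of size j / t^2, which costs little in L1 for large t. Averaging
  over j < N therefore replaces k by a Birkhoff average, which is close to a constant in L1.\<close>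

theorem geodesic_mixing:
  fixes f k :: "m4 \<Rightarrow> real" and t :: "nat \<Rightarrow> real"
  assumes f [measurable]: "f \<in> borel_measurable MX" and fC: "\<And>x. \<bar>f x\<bar> \<le> C"
    and k [measurable]: "k \<in> borel_measurable MX" and kC: "\<And>x. \<bar>k x\<bar> \<le> C"
    and t: "filterlim t at_top sequentially" and t0: "\<And>n. 0 < t n"
  shows "(\<lambda>n. \<integral>M. f (mm (dg (t n)) M) * k M \<partial>MX) \<longlonglongrightarrow> (\<integral>M. f M \<partial>MX) * (\<integral>M. k M \<partial>MX) / (Rint / 2)"
proof (rule LIMSEQ_I)
  fix e :: real assume e: "0 < e"
  have C0: "0 \<le> C" by (rule order_trans[OF abs_ge_zero fC])
  define c where "c = (\<integral>M. k M \<partial>MX) / (Rint / 2)"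
  define A where "A = birkhoff (mm (up 1)) k"
  have [measurable]: "A n \<in> borel_measurable MX" for n unfolding A_def by measurable
  have AC: "\<bar>A n x\<bar> \<le> C" for n x unfolding A_def by (rule birkhoff_bounded) (rule kC)
  have "(\<lambda>n. C * (\<integral>M. \<bar>A n M - c\<bar> \<partial>MX)) \<longlonglongrightarrow> C * 0"
    unfolding A_def c_def by (intro tendsto_intros horocycle_mean_ergodic[OF k kC])
  then have "eventually (\<lambda>n. C * (\<integral>M. \<bar>A n M - c\<bar> \<partial>MX) < e / 2) sequentially"
    using e by (intro order_tendstoD) auto
  then have "eventually (\<lambda>n. C * (\<integral>M. \<bar>A n M - c\<bar> \<partial>MX) < e / 2 \<and> 0 < n) sequentially"
    using eventually_gt_at_top by (rule eventually_conj)
  then obtain N where N: "C * (\<integral>M. \<bar>A N M - c\<bar> \<partial>MX) < e / 2" "0 < N" by (auto simp: eventually_sequentially)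
  \<comment> \<open>N is fixed before n varies, so this error is a finite sum of terms tending to
    0.\<close>
  define E where "E n = C * (\<Sum>j<N. \<integral>M. \<bar>f (mm (up (real j / (t n)\<^sup>2)) M) - f M\<bar> \<partial>MX)" for n
  have E: "E \<longlonglongrightarrow> 0"
  proof -
    have "(\<lambda>n. real j / (t n)\<^sup>2) \<longlonglongrightarrow> 0" for j
      by (intro real_tendsto_divide_at_top[OF tendsto_const] filterlim_pow_at_top t) auto
    then have "(\<lambda>n. \<integral>M. \<bar>f (mm (up (real j / (t n)\<^sup>2)) M) - f M\<bar> \<partial>MX) \<longlonglongrightarrow> 0" for j
      by (intro L1_translation[OF f fC] tendsto_m4 tendsto_const) auto
    then have "E \<longlonglongrightarrow> C * (\<Sum>j<N. 0)" unfolding E_def by (intro tendsto_intros)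
    then show ?thesis by simp
  qed
  have bnd: "\<bar>(\<integral>M. f (mm (dg (t n)) M) * k M \<partial>MX) - c * (\<integral>M. f M \<partial>MX)\<bar> \<le> E n + C * (\<integral>M. \<bar>A N M - c\<bar> \<partial>MX)" for n
  proof -
    define s where "s = dg (t n)"
    have ds: "dt s = 1" using t0[of n] by (simp add: s_def)
    have com: "mm s (mm (up (real j)) M) = mm (up (real j / (t n)\<^sup>2)) (mm s M)" for j M
      using t0[of n] by (simp add: s_def dg_def mm_assoc[symmetric] power2_eq_square)
    have iprod: "integrable MX (\<lambda>M. f (mm g M) * k (mm h M))" for g h
      by (rule MX_int_bdd[of _ "C * C"]) (auto simp: abs_mult intro!: mult_mono fC kC C0)
    have step: "\<bar>(\<integral>M. f (mm s M) * k M \<partial>MX) - (\<integral>M. f (mm s M) * k (mm (up (real j)) M) \<partial>MX)\<bar>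
      \<le> C * (\<integral>M. \<bar>f (mm (up (real j / (t n)\<^sup>2)) M) - f M\<bar> \<partial>MX)" for j
    proof -
      define u where "u = up (real j / (t n)\<^sup>2)"
      have "(\<integral>M. f (mm s M) * k M \<partial>MX) = (\<integral>M. f (mm s (mm (up (real j)) M)) * k (mm (up (real j)) M) \<partial>MX)"
        using integral_MX_mm[of "\<lambda>M. f (mm s M) * k M" "up (real j)"] by simp
      also have "\<dots> = (\<integral>M. f (mm (mm u s) M) * k (mm (up (real j)) M) \<partial>MX)"
        by (simp only: com u_def mm_assoc)
      finally have eq: "(\<integral>M. f (mm s M) * k M \<partial>MX) - (\<integral>M. f (mm s M) * k (mm (up (real j)) M) \<partial>MX)
        = (\<integral>M. f (mm (mm u s) M) * k (mm (up (real j)) M) - f (mm s M) * k (mm (up (real j)) M) \<partial>MX)"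
        by (simp only: Bochner_Integration.integral_diff iprod)
      have "\<bar>(\<integral>M. f (mm s M) * k M \<partial>MX) - (\<integral>M. f (mm s M) * k (mm (up (real j)) M) \<partial>MX)\<bar>
          \<le> (\<integral>M. \<bar>f (mm (mm u s) M) * k (mm (up (real j)) M) - f (mm s M) * k (mm (up (real j)) M)\<bar> \<partial>MX)"
        unfolding eq by (rule integral_abs_bound)
      also have "\<dots> \<le> (\<integral>M. C * \<bar>f (mm (mm u s) M) - f (mm s M)\<bar> \<partial>MX)"
      proof (rule integral_mono)
        show "integrable MX (\<lambda>M. \<bar>f (mm (mm u s) M) * k (mm (up (real j)) M) - f (mm s M) * k (mm (up (real j)) M)\<bar>)"
          by (rule integrable_abs, rule Bochner_Integration.integrable_diff[OF iprod[of "mm u s" "up (real j)"] iprod[of s "up (real j)"]])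
        show "integrable MX (\<lambda>M. C * \<bar>f (mm (mm u s) M) - f (mm s M)\<bar>)"
          by (rule integrable_mult_right[OF MX_int_diff[OF MX_compose[OF f] MX_compose[OF f] fC fC]])
        fix M
        have "\<bar>f (mm (mm u s) M) * k (mm (up (real j)) M) - f (mm s M) * k (mm (up (real j)) M)\<bar>
          = \<bar>k (mm (up (real j)) M)\<bar> * \<bar>f (mm (mm u s) M) - f (mm s M)\<bar>"
          by (simp only: left_diff_distrib[symmetric] abs_mult mult.commute)
        also have "\<dots> \<le> C * \<bar>f (mm (mm u s) M) - f (mm s M)\<bar>" by (intro mult_right_mono kC) simp
        finally show "\<bar>f (mm (mm u s) M) * k (mm (up (real j)) M) - f (mm s M) * k (mm (up (real j)) M)\<bar>
          \<le> C * \<bar>f (mm (mm u s) M) - f (mm s M)\<bar>" .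
      qed
      also have "\<dots> = C * (\<integral>M. \<bar>f (mm u (mm s M)) - f (mm s M)\<bar> \<partial>MX)" by (simp add: mm_assoc)
      also have "(\<integral>M. \<bar>f (mm u (mm s M)) - f (mm s M)\<bar> \<partial>MX) = (\<integral>M. \<bar>f (mm u M) - f M\<bar> \<partial>MX)"
        using integral_MX_mm[of "\<lambda>M. \<bar>f (mm u M) - f M\<bar>" s] ds by simp
      finally show ?thesis by (simp add: u_def)
    qed
    define I where "I = (\<integral>M. f (mm s M) * k M \<partial>MX)"
    have avg: "(\<integral>M. f (mm s M) * A N M \<partial>MX) = (\<Sum>j<N. \<integral>M. f (mm s M) * k (mm (up (real j)) M) \<partial>MX) / real N"
    proof -
      have "(\<integral>M. f (mm s M) * A N M \<partial>MX) = (\<integral>M. (\<Sum>j<N. f (mm s M) * k (mm (up (real j)) M)) / real N \<partial>MX)"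
        by (simp add: A_def birkhoff_def funpow_up1 sum_distrib_left)
      then show ?thesis by (simp add: Bochner_Integration.integral_sum iprod)
    qed
    have "I - (\<integral>M. f (mm s M) * A N M \<partial>MX) = (\<Sum>j<N. I - (\<integral>M. f (mm s M) * k (mm (up (real j)) M) \<partial>MX)) / real N"
      unfolding avg using N(2) by (simp add: sum_subtractf field_simps)
    then have "\<bar>I - (\<integral>M. f (mm s M) * A N M \<partial>MX)\<bar> = \<bar>\<Sum>j<N. I - (\<integral>M. f (mm s M) * k (mm (up (real j)) M) \<partial>MX)\<bar> / real N"
      by simp
    also have "\<dots> \<le> E n / real N"
      unfolding E_def sum_distrib_left I_def
      by (intro divide_right_mono order_trans[OF sum_abs] sum_mono step) auto
    also have "\<dots> \<le> E n"
    proof -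
      have "0 \<le> E n" unfolding E_def using C0 by (intro mult_nonneg_nonneg sum_nonneg) auto
      then show ?thesis using N(2) by (simp add: divide_le_eq mult_left_le mult_le_cancel_left1)
    qed
    finally have 1: "\<bar>I - (\<integral>M. f (mm s M) * A N M \<partial>MX)\<bar> \<le> E n" .
    have "(\<integral>M. f (mm s M) \<partial>MX) = (\<integral>M. f M \<partial>MX)" by (rule integral_MX_mm[OF f ds])
    moreover have iA: "integrable MX (\<lambda>M. f (mm s M) * A N M)"
      by (rule MX_int_bdd[of _ "C * C"]) (auto simp: abs_mult intro!: mult_mono fC AC C0)
    moreover have ifs: "integrable MX (\<lambda>M. f (mm s M))" by (rule MX_int_bdd[OF _ fC]) measurable
    ultimately have eq: "(\<integral>M. f (mm s M) * A N M \<partial>MX) - c * (\<integral>M. f M \<partial>MX) = (\<integral>M. f (mm s M) * A N M - c * f (mm s M) \<partial>MX)"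
      by simp
    have "\<bar>(\<integral>M. f (mm s M) * A N M \<partial>MX) - c * (\<integral>M. f M \<partial>MX)\<bar>
        \<le> (\<integral>M. \<bar>f (mm s M) * A N M - c * f (mm s M)\<bar> \<partial>MX)"
      unfolding eq by (rule integral_abs_bound)
    also have "\<dots> \<le> (\<integral>M. C * \<bar>A N M - c\<bar> \<partial>MX)"
    proof (rule integral_mono)
      show "integrable MX (\<lambda>M. \<bar>f (mm s M) * A N M - c * f (mm s M)\<bar>)" using iA ifs by simp
      show "integrable MX (\<lambda>M. C * \<bar>A N M - c\<bar>)"
        by (intro integrable_mult_right integrable_abs Bochner_Integration.integrable_diff MX_int_bdd[of "A N" C] AC) auto
      fix M
      have "\<bar>f (mm s M) * A N M - c * f (mm s M)\<bar> = \<bar>f (mm s M)\<bar> * \<bar>A N M - c\<bar>"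
        by (simp only: mult.commute[of c] right_diff_distrib[symmetric] abs_mult)
      also have "\<dots> \<le> C * \<bar>A N M - c\<bar>" by (intro mult_right_mono fC) simp
      finally show "\<bar>f (mm s M) * A N M - c * f (mm s M)\<bar> \<le> C * \<bar>A N M - c\<bar>" .
    qed
    also have "\<dots> = C * (\<integral>M. \<bar>A N M - c\<bar> \<partial>MX)" by simp
    finally have 2: "\<bar>(\<integral>M. f (mm s M) * A N M \<partial>MX) - c * (\<integral>M. f M \<partial>MX)\<bar> \<le> C * (\<integral>M. \<bar>A N M - c\<bar> \<partial>MX)" .
    show ?thesis using 1 2 unfolding I_def s_def by linarith
  qed
  have "eventually (\<lambda>n. E n < e / 2) sequentially" using E e by (intro order_tendstoD) auto
  then obtain n0 where n0: "\<And>n. n \<ge> n0 \<Longrightarrow> E n < e / 2" by (auto simp: eventually_sequentially)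
  show "\<exists>n0. \<forall>n\<ge>n0. norm ((\<integral>M. f (mm (dg (t n)) M) * k M \<partial>MX) - (\<integral>M. f M \<partial>MX) * (\<integral>M. k M \<partial>MX) / (Rint / 2)) < e"
  proof (intro exI allI impI)
    fix n assume "n \<ge> n0"
    then have "\<bar>(\<integral>M. f (mm (dg (t n)) M) * k M \<partial>MX) - c * (\<integral>M. f M \<partial>MX)\<bar> < e"
      using bnd[of n] n0[of n] N(1) by linarith
    then show "norm ((\<integral>M. f (mm (dg (t n)) M) * k M \<partial>MX) - (\<integral>M. f M \<partial>MX) * (\<integral>M. k M \<partial>MX) / (Rint / 2)) < e"
      unfolding c_def by (simp add: mult_ac)
  qed
qed

end

section \<open>Equidistribution of the Farey parameters\<close>

context hecke
begin

definition hits :: "real \<Rightarrow> real set \<Rightarrow> m4 \<Rightarrow> m4 set" where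
  "hits t J M = {g \<in> Gam. hit t (mm M g) \<and> sl (mm M g) \<in> J}"

definition pt :: "real \<Rightarrow> m4 \<Rightarrow> real \<times> real" where
  "pt t M = (1 / (t * sqrt (dt M))) *\<^sub>R fst M"

definition Ssum :: "(real \<times> real \<Rightarrow> real) \<Rightarrow> real \<Rightarrow> real set \<Rightarrow> m4 \<Rightarrow> real" where
  "Ssum f t J M = (\<Sum>g\<in>hits t J M. f (pt t (mm M g)))"

lemma hit_pt: "hit t M \<longleftrightarrow> 0 < dt M \<and> pt t M \<in> Tq q"
  by (simp add: hit_def pt_def)

lemma pt_scaleR: "c > 0 \<Longrightarrow> pt t (c *\<^sub>R M) = pt t M"
  by (simp add: pt_def real_sqrt_mult)

lemma measurable_pt [measurable]: "pt t \<in> borel_measurable borel"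
  unfolding pt_def by measurable

lemma inj_sl_hits: "0 < t \<Longrightarrow> inj_on (\<lambda>g. sl (mm M g)) (hits t J M)"
proof (rule inj_onI, rule ccontr)
  fix g g' assume t: "0 < t" and g: "g \<in> hits t J M" "g' \<in> hits t J M" "sl (mm M g) = sl (mm M g')" "g \<noteq> g'"
  then have "1 / t\<^sup>2 \<le> \<bar>sl (mm M g') - sl (mm M g)\<bar>"
    by (intro hit_gap2) (simp_all add: hits_def)
  then show False using g t by simp
qed

text \<open>Slopes of different hits are at least 1 / t^2 apart, so each cell of that length,
  counted from u, holds at most one of them.\<close>

lemma hits_card:
  assumes t: "0 < t" and J: "J \<subseteq> {u..v}" and uv: "u \<le> v"
  shows "finite (hits t J M)" "real (card (hits t J M)) \<le> (v - u) * t\<^sup>2 + 1"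
proof -
  define F where "F g = nat \<lfloor>(sl (mm M g) - u) * t\<^sup>2\<rfloor>" for g
  define K where "K = nat \<lfloor>(v - u) * t\<^sup>2\<rfloor>"
  have range: "0 \<le> (sl (mm M g) - u) * t\<^sup>2" "(sl (mm M g) - u) * t\<^sup>2 \<le> (v - u) * t\<^sup>2" if "g \<in> hits t J M" for g
    using that J by (auto simp: hits_def intro!: mult_right_mono)
  have inj: "inj_on F (hits t J M)"
  proof (rule inj_onI, rule ccontr)
    fix g g' assume g: "g \<in> hits t J M" "g' \<in> hits t J M" "F g = F g'" "g \<noteq> g'"
    have "1 / t\<^sup>2 \<le> \<bar>sl (mm M g') - sl (mm M g)\<bar>"
      using g t by (intro hit_gap2) (simp_all add: hits_def)
    then have "1 \<le> \<bar>sl (mm M g') - sl (mm M g)\<bar> * t\<^sup>2" using t by (simp add: pos_divide_le_eq)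
    also have "\<dots> = \<bar>(sl (mm M g') - sl (mm M g)) * t\<^sup>2\<bar>" by (simp add: abs_mult)
    also have "\<dots> = \<bar>(sl (mm M g') - u) * t\<^sup>2 - (sl (mm M g) - u) * t\<^sup>2\<bar>" by (simp add: algebra_simps)
    finally have "\<lfloor>(sl (mm M g') - u) * t\<^sup>2\<rfloor> \<noteq> \<lfloor>(sl (mm M g) - u) * t\<^sup>2\<rfloor>" by linarith
    then show False using g(3) range[OF g(1)] range[OF g(2)] by (simp add: F_def nat_eq_iff2)
  qed
  have sub: "F ` hits t J M \<subseteq> {..K}"
  proof (rule image_subsetI)
    fix g assume "g \<in> hits t J M"
    from range(2)[OF this] show "F g \<in> {..K}" unfolding F_def K_def atMost_iff by (intro nat_mono floor_mono)
  qed
  show fin: "finite (hits t J M)" using finite_imageD[OF finite_subset[OF sub] inj] by simp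
  have "card (hits t J M) \<le> card {..K}" using card_inj_on_le[OF inj sub] by simp
  also have "\<dots> = K + 1" by simp
  finally have "real (card (hits t J M)) \<le> real K + 1" by simp
  also have "real K \<le> (v - u) * t\<^sup>2"
    using uv unfolding K_def by (subst of_nat_nat) auto
  finally show "real (card (hits t J M)) \<le> (v - u) * t\<^sup>2 + 1" by simp
qed

lemma hits_translate:
  assumes "h \<in> Gam" shows "bij_betw (mm h) (hits t J (mm M h)) (hits t J M)"
proof (rule bij_betwI[of _ _ _ "mm (adj h)"])
  have h: "dt h = 1" using assms by (rule dt_Gam)
  show "mm h \<in> hits t J (mm M h) \<rightarrow> hits t J M"
    using assms Gam_mm by (intro funcsetI) (simp add: hits_def mm_assoc)
  show "mm (adj h) \<in> hits t J M \<rightarrow> hits t J (mm M h)"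
    using assms Gam_mm Gam_adj by (intro funcsetI) (simp add: hits_def mm_assoc mm_adj_cancel(1)[OF h])
qed (simp_all add: mm_adj_cancel dt_Gam[OF assms])

lemma Ssum_translate:
  assumes "h \<in> Gam" shows "Ssum f t J (mm M h) = Ssum f t J M"
proof -
  have "Ssum f t J M = (\<Sum>g\<in>hits t J (mm M h). f (pt t (mm M (mm h g))))"
    unfolding Ssum_def by (rule sum.reindex_bij_betw[OF hits_translate[OF assms], symmetric])
  then show ?thesis by (simp add: Ssum_def mm_assoc)
qed

lemma hits_scaleR: "c > 0 \<Longrightarrow> hits t J (c *\<^sub>R M) = hits t J M"
  by (simp add: hits_def)

lemma Ssum_scaleR: "c > 0 \<Longrightarrow> Ssum f t J (c *\<^sub>R M) = Ssum f t J M"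
  by (simp add: Ssum_def hits_scaleR pt_scaleR)

text \<open>Slopes of hits at t = 1 are at least 1 apart, so over this half-open window the sum has
  at most one term, and a bound for f bounds it.\<close>

definition phi :: "(real \<times> real \<Rightarrow> real) \<Rightarrow> m4 \<Rightarrow> real" where
  "phi f M = Ssum f 1 {0..<1} M"

definition beta :: "(real \<times> real \<Rightarrow> real) \<Rightarrow> m4 \<Rightarrow> ennreal" where
  "beta f M = ennreal (f (pt 1 M)) * indicator {M. hit 1 M \<and> 0 \<le> sl M \<and> sl M < 1} M"

lemma beta_measurable [measurable]:
  assumes [measurable]: "f \<in> borel_measurable borel" shows "beta f \<in> borel_measurable borel"
  unfolding beta_def by measurable

lemma hits_unit_card: "finite (hits 1 {0..<1} M)" "card (hits 1 {0..<1} M) \<le> 1"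
proof -
  show fin: "finite (hits 1 {0..<1} M)" by (rule hits_card[of 1 _ 0 1]) auto
  have "g = g'" if "g \<in> hits 1 {0..<1} M" "g' \<in> hits 1 {0..<1} M" for g g'
  proof (rule ccontr)
    assume "g \<noteq> g'"
    then have "1 / 1\<^sup>2 \<le> \<bar>sl (mm M g') - sl (mm M g)\<bar>"
      using that by (intro hit_gap2) (simp_all add: hits_def)
    then show False using that by (simp add: hits_def) linarith
  qed
  then show "card (hits 1 {0..<1} M) \<le> 1" by (simp add: card_le_Suc0_iff_eq[OF fin])
qed

lemma phi_bound:
  assumes "\<And>p. 0 \<le> f p" "\<And>p. f p \<le> C" shows "0 \<le> phi f M" "phi f M \<le> C"
proof -
  show "0 \<le> phi f M" unfolding phi_def Ssum_def by (intro sum_nonneg assms)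
  have C0: "0 \<le> C" using assms order_trans by blast
  have "phi f M \<le> real (card (hits 1 {0..<1} M)) * C"
    unfolding phi_def Ssum_def by (intro sum_bounded_above assms)
  also have "\<dots> \<le> 1 * C" using hits_unit_card(2)[of M] C0 by (intro mult_right_mono) auto
  finally show "phi f M \<le> C" by simp
qed

text \<open>The hits are the group elements at which \<open>beta\<close> can be nonzero, so
  \<open>phi f\<close> is a Poincare series. This gives its measurability and lets its integral
  unfold.\<close>

lemma ennreal_phi:
  assumes "\<And>p. 0 \<le> f p" shows "ennreal (phi f M) = sumG (beta f) M"
proof -
  have "sumG (beta f) M = (\<Sum>g\<in>hits 1 {0..<1} M. beta f (mm M g))"
    unfolding sumG_def
  proof (rule nn_integral_count_space')
    show "finite (hits 1 {0..<1} M)" by (rule hits_unit_card)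
    show "hits 1 {0..<1} M \<subseteq> Gam" unfolding hits_def by blast
    fix g assume "g \<in> Gam" "g \<notin> hits 1 {0..<1} M"
    then show "beta f (mm M g) = 0" by (simp add: beta_def hits_def indicator_def)
  qed
  also have "\<dots> = (\<Sum>g\<in>hits 1 {0..<1} M. ennreal (f (pt 1 (mm M g))))"
    by (intro sum.cong) (simp_all add: beta_def hits_def)
  also have "\<dots> = ennreal (phi f M)"
    unfolding phi_def Ssum_def using assms by (intro sum_ennreal) auto
  finally show ?thesis by simp
qed

lemma phi_MX:
  assumes f [measurable]: "f \<in> borel_measurable borel" and f0: "\<And>p. 0 \<le> f p"
  shows "phi f \<in> borel_measurable MX"
proof (rule MX_measurableI)
  have "phi f M = enn2real (sumG (beta f) M)" for M
  proof -
    have "0 \<le> phi f M" by (simp add: phi_def Ssum_def sum_nonneg f0)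
    then show ?thesis by (simp add: ennreal_phi[OF f0, symmetric])
  qed
  then have "phi f = (\<lambda>M. enn2real (sumG (beta f) M))" by (rule ext)
  then show "phi f \<in> borel_measurable borel" by simp
qed (simp_all add: phi_def Ssum_translate Ssum_scaleR)

text \<open>The unfolded integral runs over the section, a slope interval of length 1 and the
  determinant, which contributes the factor 1/2.\<close>

lemma integral_phi:
  assumes f [measurable]: "f \<in> borel_measurable borel" and f0: "\<And>p. 0 \<le> f p" and fC: "\<And>p. f p \<le> C"
  shows "(\<integral>M. phi f M \<partial>MX) = (\<integral>p. f p * indicator (Tq q) p \<partial>lborel) / 2"
proof -
  define k where "k p s = ennreal (f p * indicator (Tq q) p) * indicator {0..<1} s" for p and s :: real
  have [measurable]: "phi f \<in> borel_measurable MX" by (rule phi_MX[OF f f0])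
  then have [measurable]: "phi f \<in> borel_measurable borel" by (rule MX_measurableD)
  have p0: "0 \<le> phi f M" "phi f M \<le> C" for M using phi_bound[of f C] f0 fC by auto
  have "(\<integral>\<^sup>+M. ennreal (phi f M) \<partial>mu) = (\<integral>\<^sup>+M. indicator Dom M * sumG (beta f) M \<partial>lborel)"
    unfolding ennreal_phi[OF f0] by (rule nn_integral_mu) measurable
  also have "\<dots> = (\<integral>\<^sup>+M. beta f M * indicator {M. 0 < dt M \<and> dt M \<le> 1} M \<partial>lborel)"
    by (rule unfolding_Dom) measurable
  also have "\<dots> = (\<integral>\<^sup>+M. k ((1 / sqrt (dt M)) *\<^sub>R fst M) (sl M) * indicator {M. 0 < fst (fst M)} M
        * indicator {M. 0 < dt M \<and> dt M \<le> 1} M \<partial>lborel)"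
  proof (rule nn_integral_cong)
    fix M
    show "beta f M * indicator {M. 0 < dt M \<and> dt M \<le> 1} M = k ((1 / sqrt (dt M)) *\<^sub>R fst M) (sl M) * indicator {M. 0 < fst (fst M)} M
        * indicator {M. 0 < dt M \<and> dt M \<le> 1} M"
    proof (cases "hit 1 M")
      case True
      then show ?thesis using hit_fst_pos[OF True] unfolding beta_def k_def
        by (simp add: hit_def indicator_def pt_def)
    next
      case False
      then show ?thesis unfolding beta_def k_def by (auto simp: hit_def indicator_def)
    qed
  qed
  also have "\<dots> = ennreal (1 / 2) * (\<integral>\<^sup>+p. (\<integral>\<^sup>+s. k p s \<partial>lborel) * indicator {p. 0 < fst p} p \<partial>lborel)"
    unfolding k_def by (rule nn_integral_normalised) measurable
  also have "(\<integral>\<^sup>+p. (\<integral>\<^sup>+s. k p s \<partial>lborel) * indicator {p. 0 < fst p} p \<partial>lborel) = (\<integral>\<^sup>+p. ennreal (f p * indicator (Tq q) p) \<partial>lborel)"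
  proof (rule nn_integral_cong)
    fix p :: "real \<times> real"
    have "(\<integral>\<^sup>+s. k p s \<partial>lborel) = ennreal (f p * indicator (Tq q) p)"
      unfolding k_def by (subst nn_integral_cmult_indicator) auto
    moreover have "p \<in> Tq q \<Longrightarrow> 0 < fst p" by (cases p) (simp add: Tq_iff)
    ultimately show "(\<integral>\<^sup>+s. k p s \<partial>lborel) * indicator {p. 0 < fst p} p = ennreal (f p * indicator (Tq q) p)"
      by (cases "p \<in> Tq q") (simp_all add: indicator_def)
  qed
  finally have e: "(\<integral>\<^sup>+M. ennreal (phi f M) \<partial>mu) = ennreal (1 / 2) * (\<integral>\<^sup>+p. ennreal (f p * indicator (Tq q) p) \<partial>lborel)" .
  have "(\<integral>M. phi f M \<partial>MX) = (\<integral>M. phi f M \<partial>mu)" by (rule integral_MX) measurable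
  also have "\<dots> = enn2real (\<integral>\<^sup>+M. ennreal (phi f M) \<partial>mu)"
    using p0 by (intro integral_eq_nn_integral) auto
  also have "\<dots> = enn2real (\<integral>\<^sup>+p. ennreal (f p * indicator (Tq q) p) \<partial>lborel) / 2"
  proof -
    have "enn2real (ennreal (1 / 2)) = 1 / 2" by (rule enn2real_ennreal) simp
    then show ?thesis unfolding e enn2real_mult by (simp del: ennreal_half)
  qed
  also have "enn2real (\<integral>\<^sup>+p. ennreal (f p * indicator (Tq q) p) \<partial>lborel) = (\<integral>p. f p * indicator (Tq q) p \<partial>lborel)"
    using f0 by (intro integral_eq_nn_integral[symmetric]) auto
  finally show ?thesis .
qed

text \<open>\<open>lo (- s)\<close> moves slope s to 0, and \<open>dg t\<close> divides first
  coordinates by t and multiplies slopes by t^2. A window of length 1 / t^2 in the strip of width t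
  becomes the unit window at width 1.\<close>

lemma hits_renormalise:
  assumes t: "0 < t"
  shows "hits 1 {0..<1} (mm (dg t) (mm (lo (- s)) M)) = hits t {s..<s + 1 / t\<^sup>2} M"
    and "pt 1 (mm (mm (dg t) (mm (lo (- s)) M)) g) = pt t (mm (M) g)"
proof -
  define E where "E N = mm (dg t) (mm (lo (- s)) N)" for N
  have pE: "pt 1 (E N) = pt t N" and dE: "dt (E N) = dt N" for N
    using t by (cases N rule: m4_cases; simp add: E_def dg_def pt_def algebra_simps)+
  have hE: "hit 1 (E N) \<longleftrightarrow> hit t N" for N by (simp add: hit_pt pE dE)
  have sE: "sl (E N) = t\<^sup>2 * (sl N - s)" if "hit t N" for N
  proof -
    obtain x z y w where N: "N = ((x, z), (y, w))" by (cases N rule: m4_cases)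
    have "0 < x" using hit_fst_pos[OF that t] by (simp add: N)
    then show ?thesis using t by (simp add: N E_def dg_def field_simps power2_eq_square)
  qed
  have EE: "mm (mm (dg t) (mm (lo (- s)) M)) g = E (mm M g)" for g by (simp add: E_def mm_assoc)
  have iff: "t\<^sup>2 * (x - s) \<in> {0..<1} \<longleftrightarrow> x \<in> {s..<s + 1 / t\<^sup>2}" for x
  proof -
    have "t\<^sup>2 * (x - s) < 1 \<longleftrightarrow> x - s < 1 / t\<^sup>2" using t by (simp add: pos_less_divide_eq mult.commute)
    moreover have "0 \<le> t\<^sup>2 * (x - s) \<longleftrightarrow> s \<le> x" using t by (simp add: zero_le_mult_iff)
    ultimately show ?thesis by auto
  qed
  show "hits 1 {0..<1} (mm (dg t) (mm (lo (- s)) M)) = hits t {s..<s + 1 / t\<^sup>2} M"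
    unfolding hits_def EE hE
  proof (rule Collect_cong, rule conj_cong[OF refl], rule conj_cong[OF refl])
    fix g assume "hit t (mm M g)"
    from sE[OF this] show "(sl (E (mm M g)) \<in> {0..<1}) = (sl (mm M g) \<in> {s..<s + 1 / t\<^sup>2})"
      using iff by simp
  qed
  show "pt 1 (mm (mm (dg t) (mm (lo (- s)) M)) g) = pt t (mm M g)" by (simp add: EE pE)
qed

lemma phi_renormalise:
  "0 < t \<Longrightarrow> phi f (mm (dg t) (mm (lo (- s)) M)) = Ssum f t {s..<s + 1 / t\<^sup>2} M"
  unfolding phi_def Ssum_def hits_renormalise(1) by (simp add: hits_renormalise(2))

lemma Ssum_Un:
  assumes "J1 \<inter> J2 = {}" "finite (hits t J1 M)" "finite (hits t J2 M)"
  shows "Ssum f t (J1 \<union> J2) M = Ssum f t J1 M + Ssum f t J2 M"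
proof -
  have "hits t (J1 \<union> J2) M = hits t J1 M \<union> hits t J2 M" "hits t J1 M \<inter> hits t J2 M = {}"
    using assms(1) unfolding hits_def by blast+
  then show ?thesis unfolding Ssum_def using assms by (simp add: sum.union_disjoint)
qed

lemma Ssum_tile:
  assumes t: "0 < t"
  shows "(\<Sum>k<K. phi f (mm (dg t) (mm (lo (- (\<alpha> + real k / t\<^sup>2))) M))) = Ssum f t {\<alpha>..<\<alpha> + real K / t\<^sup>2} M"
proof (induction K)
  case 0
  then show ?case by (simp add: Ssum_def hits_def)
next
  case (Suc K)
  have "{\<alpha>..<\<alpha> + real (Suc K) / t\<^sup>2} = {\<alpha>..<\<alpha> + real K / t\<^sup>2} \<union> {\<alpha> + real K / t\<^sup>2..<\<alpha> + real K / t\<^sup>2 + 1 / t\<^sup>2}"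
  proof -
    have "\<alpha> + real (Suc K) / t\<^sup>2 = \<alpha> + real K / t\<^sup>2 + 1 / t\<^sup>2" by (simp add: add_divide_distrib)
    moreover have "\<alpha> \<le> \<alpha> + real K / t\<^sup>2" "\<alpha> + real K / t\<^sup>2 \<le> \<alpha> + real K / t\<^sup>2 + 1 / t\<^sup>2" by auto
    ultimately show ?thesis by (simp only: ivl_disj_un_two(3))
  qed
  moreover have "finite (hits t {u..<v} M)" for u v
  proof (cases "u \<le> v")
    case True
    show ?thesis by (rule hits_card(1)[OF t _ True]) auto
  qed (simp add: hits_def)
  ultimately have "Ssum f t {\<alpha>..<\<alpha> + real (Suc K) / t\<^sup>2} M
    = Ssum f t {\<alpha>..<\<alpha> + real K / t\<^sup>2} M + Ssum f t {\<alpha> + real K / t\<^sup>2..<\<alpha> + real K / t\<^sup>2 + 1 / t\<^sup>2} M"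
    by (simp add: Ssum_Un)
  then show ?case using phi_renormalise[OF t, of f "\<alpha> + real K / t\<^sup>2" M]
    by (simp only: sum.lessThan_Suc Suc)
qed

lemma L1_translation_lo:
  fixes P :: "m4 \<Rightarrow> real"
  assumes P: "P \<in> borel_measurable MX" and C: "\<And>x. \<bar>P x\<bar> \<le> C" and e: "e > 0"
  shows "\<exists>d>0. \<forall>s. \<bar>s\<bar> < d \<longrightarrow> (\<integral>M. \<bar>P (mm (lo s) M) - P M\<bar> \<partial>MX) < e"
proof -
  have "((\<lambda>s. \<integral>M. \<bar>P (mm (lo s) M) - P M\<bar> \<partial>MX) \<longlongrightarrow> 0) (at 0)"
    unfolding tendsto_at_iff_sequentially comp_def
  proof (intro allI impI)
    fix X :: "nat \<Rightarrow> real" assume "X \<longlonglongrightarrow> 0"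
    then show "(\<lambda>n. \<integral>M. \<bar>P (mm (lo (X n)) M) - P M\<bar> \<partial>MX) \<longlonglongrightarrow> 0"
      by (intro L1_translation[OF P C] tendsto_m4 tendsto_const) auto
  qed
  then have "eventually (\<lambda>s. (\<integral>M. \<bar>P (mm (lo s) M) - P M\<bar> \<partial>MX) < e) (at 0)"
    using e by (intro order_tendstoD) auto
  then obtain d where d: "d > 0" "\<And>s. s \<noteq> 0 \<Longrightarrow> \<bar>s\<bar> < d \<Longrightarrow> (\<integral>M. \<bar>P (mm (lo s) M) - P M\<bar> \<partial>MX) < e"
    unfolding eventually_at by (auto simp: dist_real_def)
  have "(\<integral>M. \<bar>P (mm (lo s) M) - P M\<bar> \<partial>MX) < e" if "\<bar>s\<bar> < d" for s
    using d(2)[of s] that e by (cases "s = 0") auto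
  then show ?thesis using d(1) by blast
qed

text \<open>Since \<open>s\<close> ranges over a compact interval and the correlations are equicontinuous in \<open>s\<close>,
  mixing is uniform along a bounded piece of the expanding horocycle.\<close>

lemma uniform_mixing:
  fixes f k :: "m4 \<Rightarrow> real" and t :: "nat \<Rightarrow> real"
  assumes f [measurable]: "f \<in> borel_measurable MX" and fC: "\<And>x. \<bar>f x\<bar> \<le> C"
    and k [measurable]: "k \<in> borel_measurable MX" and kC: "\<And>x. \<bar>k x\<bar> \<le> C"
    and t: "filterlim t at_top sequentially" and t0: "\<And>n. 0 < t n" and e: "e > 0"
  shows "eventually (\<lambda>n. \<forall>s\<in>{\<alpha>..\<beta>}. \<bar>(\<integral>M. f (mm (dg (t n)) M) * k (mm (lo s) M) \<partial>MX)
      - (\<integral>M. f M \<partial>MX) * (\<integral>M. k M \<partial>MX) / (Rint / 2)\<bar> < e) sequentially"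
proof -
  define m where "m = (\<integral>M. f M \<partial>MX) * (\<integral>M. k M \<partial>MX) / (Rint / 2)"
  define a where "a n s = (\<integral>M. f (mm (dg (t n)) M) * k (mm (lo s) M) \<partial>MX)" for n s
  have C0: "0 \<le> C" by (rule order_trans[OF abs_ge_zero fC])
  have km: "(\<lambda>M. k (mm h M)) \<in> borel_measurable MX" for h by (rule MX_compose[OF k])
  have fm: "(\<lambda>M. f (mm h M)) \<in> borel_measurable MX" for h by (rule MX_compose[OF f])
  have lim: "(\<lambda>n. a n s) \<longlonglongrightarrow> m" for s
  proof -
    have "(\<integral>M. k (mm (lo s) M) \<partial>MX) = (\<integral>M. k M \<partial>MX)" by (rule integral_MX_mm[OF k]) simp
    then show ?thesis
      using geodesic_mixing[OF f fC km[of "lo s"] kC t t0] by (simp add: a_def m_def)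
  qed
  obtain d where d: "d > 0" "\<And>s. \<bar>s\<bar> < d \<Longrightarrow> (\<integral>M. \<bar>k (mm (lo s) M) - k M\<bar> \<partial>MX) < e / (2 * (C + 1))"
    using L1_translation_lo[OF k kC, of "e / (2 * (C + 1))"] e C0 by auto
  have iprod: "integrable MX (\<lambda>M. f (mm g M) * k (mm h M))" for g h
    using fm[of g] km[of h] by (intro MX_int_bdd[of _ "C * C"]) (auto simp: abs_mult intro!: mult_mono fC kC C0)
  have eqc: "\<bar>a n s - a n s'\<bar> < e / 2" if "\<bar>s - s'\<bar> < d" for n s s'
  proof -
    have eq: "a n s - a n s' = (\<integral>M. f (mm (dg (t n)) M) * k (mm (lo s) M) - f (mm (dg (t n)) M) * k (mm (lo s') M) \<partial>MX)"
      unfolding a_def by (rule Bochner_Integration.integral_diff[symmetric]; rule iprod)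
    have "\<bar>a n s - a n s'\<bar> \<le> (\<integral>M. \<bar>f (mm (dg (t n)) M) * k (mm (lo s) M) - f (mm (dg (t n)) M) * k (mm (lo s') M)\<bar> \<partial>MX)"
      unfolding eq by (rule integral_abs_bound)
    also have "\<dots> \<le> (\<integral>M. C * \<bar>k (mm (lo s) M) - k (mm (lo s') M)\<bar> \<partial>MX)"
    proof (rule integral_mono)
      show "integrable MX (\<lambda>M. \<bar>f (mm (dg (t n)) M) * k (mm (lo s) M) - f (mm (dg (t n)) M) * k (mm (lo s') M)\<bar>)"
        by (rule integrable_abs, rule Bochner_Integration.integrable_diff; rule iprod)
      show "integrable MX (\<lambda>M. C * \<bar>k (mm (lo s) M) - k (mm (lo s') M)\<bar>)"
        by (rule integrable_mult_right[OF MX_int_diff[OF km km kC kC]])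
      fix M
      have "\<bar>f (mm (dg (t n)) M) * k (mm (lo s) M) - f (mm (dg (t n)) M) * k (mm (lo s') M)\<bar>
        = \<bar>f (mm (dg (t n)) M)\<bar> * \<bar>k (mm (lo s) M) - k (mm (lo s') M)\<bar>"
        by (simp only: right_diff_distrib[symmetric] abs_mult)
      also have "\<dots> \<le> C * \<bar>k (mm (lo s) M) - k (mm (lo s') M)\<bar>" by (intro mult_right_mono fC) simp
      finally show "\<bar>f (mm (dg (t n)) M) * k (mm (lo s) M) - f (mm (dg (t n)) M) * k (mm (lo s') M)\<bar>
        \<le> C * \<bar>k (mm (lo s) M) - k (mm (lo s') M)\<bar>" .
    qed
    also have "\<dots> = C * (\<integral>M. \<bar>k (mm (lo (s - s')) (mm (lo s') M)) - k (mm (lo s') M)\<bar> \<partial>MX)"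
      by (simp add: mm_assoc[symmetric])
    also have "(\<integral>M. \<bar>k (mm (lo (s - s')) (mm (lo s') M)) - k (mm (lo s') M)\<bar> \<partial>MX) = (\<integral>M. \<bar>k (mm (lo (s - s')) M) - k M\<bar> \<partial>MX)"
    proof -
      have "(\<lambda>M. \<bar>k (mm (lo (s - s')) M) - k M\<bar>) \<in> borel_measurable MX" using km[of "lo (s - s')"] k by simp
      from integral_MX_mm[OF this, of "lo s'"] show ?thesis by simp
    qed
    also have "C * \<dots> \<le> C * (e / (2 * (C + 1)))" using d(2)[OF that] C0 by (intro mult_left_mono) auto
    also have "\<dots> < e / 2" using e C0 by (simp add: field_simps)
    finally show ?thesis .
  qed
  \<comment> \<open>On the grid of step d / 2 every s of the interval is within d of a grid point
    whose index is at most J.\<close>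
  define J where "J = nat \<lceil>(\<beta> - \<alpha>) / (d / 2)\<rceil>"
  have "eventually (\<lambda>n. \<forall>j\<in>{..J}. \<bar>a n (\<alpha> + real j * (d / 2)) - m\<bar> < e / 2) sequentially"
  proof (rule eventually_ball_finite)
    show "\<forall>j\<in>{..J}. eventually (\<lambda>n. \<bar>a n (\<alpha> + real j * (d / 2)) - m\<bar> < e / 2) sequentially"
      using tendstoD[OF lim, of "e / 2"] e by (auto simp: dist_real_def)
  qed simp
  then show ?thesis
  proof eventually_elim
    fix n assume n: "\<forall>j\<in>{..J}. \<bar>a n (\<alpha> + real j * (d / 2)) - m\<bar> < e / 2"
    have "\<bar>a n s - m\<bar> < e" if s: "s \<in> {\<alpha>..\<beta>}" for s
    proof -
      define j where "j = nat \<lfloor>(s - \<alpha>) / (d / 2)\<rfloor>"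
      have q0: "0 \<le> (s - \<alpha>) / (d / 2)" using s d by simp
      have "(s - \<alpha>) / (d / 2) \<le> (\<beta> - \<alpha>) / (d / 2)" using s d by (intro divide_right_mono) auto
      then have "j \<le> J" unfolding j_def J_def by (intro nat_mono) linarith
      have "real j \<le> (s - \<alpha>) / (d / 2)" "(s - \<alpha>) / (d / 2) < real j + 1"
        using q0 unfolding j_def by (simp_all add: of_nat_nat)
      then have "real j * (d / 2) \<le> s - \<alpha>" "s - \<alpha> < (real j + 1) * (d / 2)"
        using d(1) by (simp_all add: pos_le_divide_eq pos_divide_less_eq)
      then have "\<bar>s - (\<alpha> + real j * (d / 2))\<bar> < d" using d(1) by (simp add: algebra_simps abs_less_iff)
      then have "\<bar>a n s - a n (\<alpha> + real j * (d / 2))\<bar> < e / 2" by (rule eqc)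
      moreover have "\<bar>a n (\<alpha> + real j * (d / 2)) - m\<bar> < e / 2" using n \<open>j \<le> J\<close> by blast
      ultimately show ?thesis by linarith
    qed
    then show "\<forall>s\<in>{\<alpha>..\<beta>}. \<bar>(\<integral>M. f (mm (dg (t n)) M) * k (mm (lo s) M) \<partial>MX)
      - (\<integral>M. f M \<partial>MX) * (\<integral>M. k M \<partial>MX) / (Rint / 2)\<bar> < e"
      unfolding a_def m_def by blast
  qed
qed

end

section \<open>Moving the base matrix\<close>

definition near_one :: "real \<Rightarrow> m4 \<Rightarrow> bool" where
  "near_one \<delta> h \<longleftrightarrow> \<bar>fst (fst h) - 1\<bar> < \<delta> \<and> \<bar>snd (fst h)\<bar> < \<delta> \<and> \<bar>fst (snd h)\<bar> < \<delta> \<and> \<bar>snd (snd h) - 1\<bar> < \<delta>"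

lemma near_one_adj: "near_one \<delta> h \<Longrightarrow> near_one \<delta> (adj h)"
  by (cases h rule: m4_cases) (simp add: near_one_def)

text \<open>Left multiplication by h scales the first coordinate of a vector of slope s by h1 + h2 s
  and moves its slope by a Moebius map. The numerator of the displacement is quadratic in s and
  bounded by \<delta> (1 + 2 B + B^2); the denominator is at least 1/2.\<close>

lemma moebius_near:
  assumes h: "near_one \<delta> ((h1, h2), (h3, h4))" and s: "\<bar>s\<bar> \<le> B" and \<delta>: "\<delta> * (1 + B)\<^sup>2 \<le> \<eta> / 2" and \<eta>: "0 < \<eta>" "\<eta> \<le> 1"
  shows "\<bar>h1 + h2 * s - 1\<bar> \<le> \<eta> / 2" "\<bar>(h3 + h4 * s) / (h1 + h2 * s) - s\<bar> \<le> \<eta>" "\<bar>h2\<bar> \<le> \<eta>"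
proof -
  have B0: "0 \<le> B" using s by simp
  have h': "\<bar>h1 - 1\<bar> < \<delta>" "\<bar>h2\<bar> < \<delta>" "\<bar>h3\<bar> < \<delta>" "\<bar>h4 - 1\<bar> < \<delta>" using h by (auto simp: near_one_def)
  have \<delta>0: "0 < \<delta>" using h' by linarith
  have "\<delta> * 1 \<le> \<delta> * (1 + B)\<^sup>2" using \<delta>0 B0 by (intro mult_left_mono) (auto simp: power2_eq_square algebra_simps)
  then show "\<bar>h2\<bar> \<le> \<eta>" using h' \<delta> \<eta> by linarith
  have h2s: "\<bar>h2 * s\<bar> \<le> \<delta> * B" unfolding abs_mult using h' s by (intro mult_mono) auto
  have "\<bar>h1 + h2 * s - 1\<bar> \<le> \<delta> + \<delta> * B" using h' h2s by linarith
  also have "\<dots> = \<delta> * (1 + B)" by (simp add: algebra_simps)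
  also have "\<dots> \<le> \<delta> * (1 + B)\<^sup>2" using \<delta>0 B0 by (intro mult_left_mono) (auto simp: power2_eq_square algebra_simps)
  finally show den: "\<bar>h1 + h2 * s - 1\<bar> \<le> \<eta> / 2" using \<delta> by linarith
  have d: "1 / 2 \<le> h1 + h2 * s" using den \<eta> by linarith
  have "(h3 + h4 * s) / (h1 + h2 * s) - s = (h3 + h4 * s - s * (h1 + h2 * s)) / (h1 + h2 * s)"
    using d by (simp add: diff_divide_distrib)
  also have "h3 + h4 * s - s * (h1 + h2 * s) = h3 + (h4 - h1) * s - (h2 * s) * s" by (simp add: algebra_simps)
  finally have "(h3 + h4 * s) / (h1 + h2 * s) - s = (h3 + (h4 - h1) * s - (h2 * s) * s) / (h1 + h2 * s)" .
  then have "\<bar>(h3 + h4 * s) / (h1 + h2 * s) - s\<bar> = \<bar>h3 + (h4 - h1) * s - (h2 * s) * s\<bar> / (h1 + h2 * s)"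
    using d by simp
  also have "\<dots> \<le> (\<delta> * (1 + B)\<^sup>2) / (1 / 2)"
  proof (intro frac_le)
    have "\<bar>(h4 - h1) * s\<bar> \<le> (2 * \<delta>) * B" unfolding abs_mult using h' s by (intro mult_mono) auto
    moreover have "\<bar>(h2 * s) * s\<bar> \<le> (\<delta> * B) * B" unfolding abs_mult[of "h2 * s"] using h2s s \<delta>0 B0 by (intro mult_mono) auto
    ultimately have "\<bar>h3 + (h4 - h1) * s - (h2 * s) * s\<bar> \<le> \<delta> + (2 * \<delta>) * B + (\<delta> * B) * B" using h' by linarith
    also have "\<dots> = \<delta> * (1 + B)\<^sup>2" by (simp add: power2_eq_square algebra_simps)
    finally show "\<bar>h3 + (h4 - h1) * s - (h2 * s) * s\<bar> \<le> \<delta> * (1 + B)\<^sup>2" .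
  qed (use d \<delta>0 in auto)
  finally show "\<bar>(h3 + h4 * s) / (h1 + h2 * s) - s\<bar> \<le> \<eta>" using \<delta> by simp
qed

context hecke
begin

text \<open>The interval is tiled by windows of renormalised length 1, whose correlations with k
  approach one limit m uniformly along the interval, so the sum behaves like \<open>K n\<close>
  terms equal to m.\<close>

lemma weak_equidistribution:
  fixes f :: "real \<times> real \<Rightarrow> real" and k :: "m4 \<Rightarrow> real" and t :: "nat \<Rightarrow> real" and K :: "nat \<Rightarrow> nat"
  assumes f [measurable]: "f \<in> borel_measurable borel" and f0: "\<And>p. 0 \<le> f p" and fC: "\<And>p. f p \<le> C"
    and k [measurable]: "k \<in> borel_measurable MX" and kC: "\<And>x. \<bar>k x\<bar> \<le> C"
    and t: "filterlim t at_top sequentially" and t0: "\<And>n. 0 < t n"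
    and K: "(\<lambda>n. real (K n) / (t n)\<^sup>2) \<longlonglongrightarrow> L"
  shows "(\<lambda>n. \<integral>M. Ssum f (t n) {\<alpha>..<\<alpha> + real (K n) / (t n)\<^sup>2} M / (t n)\<^sup>2 * k M \<partial>MX)
    \<longlonglongrightarrow> L * ((\<integral>p. f p * indicator (Tq q) p \<partial>lborel) / Rint * (\<integral>M. k M \<partial>MX))"
proof -
  define m where "m = (\<integral>M. phi f M \<partial>MX) * (\<integral>M. k M \<partial>MX) / (Rint / 2)"
  have me: "m = (\<integral>p. f p * indicator (Tq q) p \<partial>lborel) / Rint * (\<integral>M. k M \<partial>MX)"
    unfolding m_def integral_phi[OF f f0 fC] by simp
  define R where "R n = real (K n) / (t n)\<^sup>2" for n
  define S where "S n = (\<integral>M. Ssum f (t n) {\<alpha>..<\<alpha> + real (K n) / (t n)\<^sup>2} M / (t n)\<^sup>2 * k M \<partial>MX)" for n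
  define a where "a n s = (\<integral>M. phi f (mm (dg (t n)) M) * k (mm (lo s) M) \<partial>MX)" for n s
  have C0: "0 \<le> C" using f0 fC order_trans by blast
  have pm: "phi f \<in> borel_measurable MX" by (rule phi_MX[OF f f0])
  have pC: "\<bar>phi f M\<bar> \<le> C" for M using phi_bound[of f C] f0 fC by simp
  have iprod: "integrable MX (\<lambda>M. phi f (mm g M) * k (mm h M))" for g h
    using MX_compose[OF pm, of g] MX_compose[OF k, of h]
    by (intro MX_int_bdd[of _ "C * C"]) (auto simp: abs_mult intro!: mult_mono pC kC C0)
  have Se: "S n = (\<Sum>j<K n. a n (\<alpha> + real j / (t n)\<^sup>2)) / (t n)\<^sup>2" for n
  proof -
    \<comment> \<open>Invariance of the measure transfers the horocycle shift from the window
      function to k, which is the form treated by \<open>uniform_mixing\<close>.\<close>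
    have shift: "(\<integral>M. phi f (mm (mm (dg (t n)) (lo (- s))) M) * k M \<partial>MX) = a n s" for s
    proof -
      have "(\<lambda>M. phi f (mm (mm (dg (t n)) (lo (- s))) M) * k M) \<in> borel_measurable MX"
        using MX_compose[OF pm] k by (intro borel_measurable_times) auto
      from integral_MX_mm[OF this, of "lo s"] show ?thesis by (simp add: a_def mm_assoc) (simp add: mm_assoc[symmetric])
    qed
    have "S n = (\<integral>M. (\<Sum>j<K n. phi f (mm (mm (dg (t n)) (lo (- (\<alpha> + real j / (t n)\<^sup>2)))) M) * k M) / (t n)\<^sup>2 \<partial>MX)"
      unfolding S_def by (simp add: Ssum_tile[OF t0, symmetric] sum_distrib_right mm_assoc)
    also have "\<dots> = (\<integral>M. (\<Sum>j<K n. phi f (mm (mm (dg (t n)) (lo (- (\<alpha> + real j / (t n)\<^sup>2)))) M) * k M) \<partial>MX) / (t n)\<^sup>2"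
      by simp
    also have "(\<integral>M. (\<Sum>j<K n. phi f (mm (mm (dg (t n)) (lo (- (\<alpha> + real j / (t n)\<^sup>2)))) M) * k M) \<partial>MX)
      = (\<Sum>j<K n. \<integral>M. phi f (mm (mm (dg (t n)) (lo (- (\<alpha> + real j / (t n)\<^sup>2)))) M) * k M \<partial>MX)"
    proof (rule Bochner_Integration.integral_sum)
      fix j show "integrable MX (\<lambda>M. phi f (mm (mm (dg (t n)) (lo (- (\<alpha> + real j / (t n)\<^sup>2)))) M) * k M)"
        using iprod[of "mm (dg (t n)) (lo (- (\<alpha> + real j / (t n)\<^sup>2)))" one4] by simp
    qed
    also have "\<dots> = (\<Sum>j<K n. a n (\<alpha> + real j / (t n)\<^sup>2))" by (simp only: shift)
    finally show ?thesis .
  qed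
  have L0: "0 \<le> L" using K by (rule LIMSEQ_le_const) auto
  have "(\<lambda>n. S n - R n * m) \<longlonglongrightarrow> 0"
  proof (rule LIMSEQ_I)
    fix e :: real assume e: "0 < e"
    define e' where "e' = (e / 2) / (L + 1)"
    have e': "0 < e'" "(L + 1) * e' < e"
    proof -
      have L1: "L + 1 \<noteq> 0" "0 < L + 1" using L0 by auto
      then show "0 < e'" using e by (simp add: e'_def)
      have "(L + 1) * e' = e / 2" using nonzero_eq_divide_eq[OF L1(1), THEN iffD1, OF e'_def] by (simp add: mult.commute)
      then show "(L + 1) * e' < e" using e by simp
    qed
    have "eventually (\<lambda>n. R n < L + 1) sequentially" unfolding R_def using K by (rule order_tendstoD) simp
    \<comment> \<open>The interval reaches to \<alpha> + L + 1 because the covered length is only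
      known to be eventually below L + 1.\<close>
    moreover have "eventually (\<lambda>n. \<forall>s\<in>{\<alpha>..\<alpha> + L + 1}. \<bar>a n s - m\<bar> < e') sequentially"
      unfolding a_def m_def by (rule uniform_mixing[OF pm pC k kC t t0 e'(1)])
    ultimately have "eventually (\<lambda>n. norm (S n - R n * m - 0) < e) sequentially"
    proof eventually_elim
      fix n assume Rn: "R n < L + 1" and un: "\<forall>s\<in>{\<alpha>..\<alpha> + L + 1}. \<bar>a n s - m\<bar> < e'"
      have t2: "0 < (t n)\<^sup>2" using t0[of n] by simp
      have "S n - R n * m = (\<Sum>j<K n. a n (\<alpha> + real j / (t n)\<^sup>2) - m) / (t n)\<^sup>2"
        unfolding Se R_def by (simp add: sum_subtractf diff_divide_distrib)
      then have "\<bar>S n - R n * m\<bar> = \<bar>\<Sum>j<K n. a n (\<alpha> + real j / (t n)\<^sup>2) - m\<bar> / (t n)\<^sup>2"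
        by simp
      also have "\<dots> \<le> (\<Sum>j<K n. e') / (t n)\<^sup>2"
      proof (intro divide_right_mono order_trans[OF sum_abs] sum_mono)
        fix j assume "j \<in> {..<K n}"
        then have "real j / (t n)\<^sup>2 \<le> R n" unfolding R_def using t2 by (intro divide_right_mono) auto
        then have "\<alpha> + real j / (t n)\<^sup>2 \<in> {\<alpha>..\<alpha> + L + 1}" using Rn t2 by auto
        then show "\<bar>a n (\<alpha> + real j / (t n)\<^sup>2) - m\<bar> \<le> e'" using un less_imp_le by blast
      qed simp
      also have "\<dots> = R n * e'" by (simp add: R_def)
      also have "\<dots> \<le> (L + 1) * e'" using Rn e' by (intro mult_right_mono) auto
      finally show "norm (S n - R n * m - 0) < e" using e' by simp
    qed
    then show "\<exists>n0. \<forall>n\<ge>n0. norm (S n - R n * m - 0) < e" by (simp add: eventually_sequentially)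
  qed
  moreover have "(\<lambda>n. R n * m) \<longlonglongrightarrow> L * m" unfolding R_def by (intro tendsto_mult K tendsto_const)
  ultimately have "(\<lambda>n. (S n - R n * m) + R n * m) \<longlonglongrightarrow> 0 + L * m" by (rule tendsto_add)
  then show ?thesis unfolding S_def me by simp
qed

definition nbhd :: "m4 \<Rightarrow> real \<Rightarrow> m4 set" where
  "nbhd A \<delta> = {M. 0 < dt M \<and> near_one \<delta> ((1 / sqrt (dt M)) *\<^sub>R mm M (adj A))}"

lemma nbhd_scaleR: "c > 0 \<Longrightarrow> c *\<^sub>R M \<in> nbhd A \<delta> \<longleftrightarrow> M \<in> nbhd A \<delta>"
  by (simp add: nbhd_def real_sqrt_mult zero_less_mult_iff)

lemma nbhd_borel [measurable]: "nbhd A \<delta> \<in> sets borel"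
  unfolding nbhd_def near_one_def by measurable

lemma nbhdD:
  assumes A: "dt A = 1" and M: "M \<in> nbhd A \<delta>"
  shows "\<exists>c>0. \<exists>h. dt h = 1 \<and> near_one \<delta> h \<and> M = c *\<^sub>R mm h A"
proof (intro exI conjI)
  have d: "0 < dt M" using M by (simp add: nbhd_def)
  show "0 < sqrt (dt M)" using d by simp
  show "dt ((1 / sqrt (dt M)) *\<^sub>R mm M (adj A)) = 1" using d A by (simp add: power_divide)
  show "near_one \<delta> ((1 / sqrt (dt M)) *\<^sub>R mm M (adj A))" using M by (simp add: nbhd_def)
  show "M = sqrt (dt M) *\<^sub>R mm ((1 / sqrt (dt M)) *\<^sub>R mm M (adj A)) A"
    using d A by (simp add: mm_adj_cancel)
qed

text \<open>The neighbourhood contains a nonempty open set of matrices with determinant below 1. As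
  A has determinant 1, the edge of that range, A / 2 serves as its point.\<close>

lemma nbhd_positive:
  assumes A: "dt A = 1" and \<delta>: "0 < \<delta>"
  shows "0 < (\<integral>\<^sup>+M. indicator (nbhd A \<delta>) M * indicator {M. 0 < dt M \<and> dt M \<le> 1} M \<partial>lborel)"
proof -
  define U where "U = {M. 0 < dt M \<and> dt M < 1} \<inter> {M. near_one \<delta> ((1 / sqrt (dt M)) *\<^sub>R mm M (adj A))}"
  have 1: "open {M::m4. 0 < dt M \<and> dt M < 1}"
    by (intro open_Collect_conj open_Collect_less continuous_intros)
  have cont: "continuous_on {M. 0 < dt M \<and> dt M < 1} (\<lambda>M. (1 / sqrt (dt M)) *\<^sub>R mm M (adj A))"
    by (intro continuous_intros) auto
  have N: "open {h. near_one \<delta> h}"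
    unfolding near_one_def by (intro open_Collect_conj open_Collect_less continuous_intros)
  have op: "open U"
    using continuous_open_preimage[OF cont 1 N] by (simp add: U_def vimage_def Int_def)
  have "(1 / 2) *\<^sub>R A \<in> U"
  proof -
    have d: "dt ((1 / 2) *\<^sub>R A) = 1 / 4" using A by (simp add: power2_eq_square)
    have "sqrt (1 / 4) = 1 / 2" by (simp add: real_sqrt_divide)
    then have "(1 / sqrt (1 / 4)) *\<^sub>R mm ((1 / 2) *\<^sub>R A) (adj A) = one4"
      using mm_adj(1)[OF A] by (simp only: mm_scaleR) simp
    then show ?thesis using \<delta> unfolding U_def mem_Collect_eq Int_iff d by (simp add: near_one_def)
  qed
  then have "\<not> negligible U" using open_not_negligible[OF op] by blast
  moreover have Ub: "U \<in> sets borel" using op by simp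
  ultimately have "emeasure lborel U \<noteq> 0"
    by (auto simp: negligible_iff_null_sets null_sets_def)
  then have "0 < emeasure lborel U" by (simp add: zero_less_iff_neq_zero)
  also have "emeasure lborel U \<le> (\<integral>\<^sup>+M. indicator (nbhd A \<delta>) M * indicator {M. 0 < dt M \<and> dt M \<le> 1} M \<partial>lborel)"
  proof -
    have "emeasure lborel U = (\<integral>\<^sup>+M. indicator U M \<partial>lborel)" using Ub by simp
    also have "\<dots> \<le> (\<integral>\<^sup>+M. indicator (nbhd A \<delta>) M * indicator {M. 0 < dt M \<and> dt M \<le> 1} M \<partial>lborel)"
    proof (rule nn_integral_mono)
      fix M show "indicator U M \<le> (indicator (nbhd A \<delta>) M * indicator {M. 0 < dt M \<and> dt M \<le> 1} M :: ennreal)"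
        by (cases "M \<in> U") (simp_all add: U_def nbhd_def)
    qed
    finally show ?thesis .
  qed
  finally show ?thesis .
qed

text \<open>k is the indicator of the union of all group translates of
  \<open>nbhd A \<delta>\<close>; were this null, unfolding would make the neighbourhood null. On it
  some translate of M is a scalar times h A with h near the identity, which ties averages against k
  to the value at A.\<close>

lemma test_function:
  assumes A: "dt A = 1" and \<delta>: "0 < \<delta>"
  obtains k where "k \<in> borel_measurable MX" "\<And>M. 0 \<le> k M" "\<And>M. k M \<le> (1::real)" "0 < (\<integral>M. k M \<partial>MX)"
    "\<And>M. k M \<noteq> 0 \<Longrightarrow> \<exists>g\<in>Gam. \<exists>c>0. \<exists>h. dt h = 1 \<and> near_one \<delta> h \<and> mm M g = c *\<^sub>R mm h A"
proof -
  define Om where "Om = (\<Union>g\<in>Gam. {M. mm M g \<in> nbhd A \<delta>})"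
  have Om: "M \<in> Om \<longleftrightarrow> (\<exists>g\<in>Gam. mm M g \<in> nbhd A \<delta>)" for M by (simp add: Om_def)
  have Ob [measurable]: "Om \<in> sets borel"
    unfolding Om_def
  proof (rule sets.countable_UN''[OF countable_Gam])
    fix g show "{M. mm M g \<in> nbhd A \<delta>} \<in> sets borel" by measurable
  qed
  have inv1: "mm M h \<in> Om \<longleftrightarrow> M \<in> Om" if h: "h \<in> Gam" for M h
  proof
    assume "mm M h \<in> Om"
    then obtain g where "g \<in> Gam" "mm M (mm h g) \<in> nbhd A \<delta>" unfolding Om mm_assoc by blast
    then show "M \<in> Om" unfolding Om using Gam_mm[OF h] by blast
  next
    assume "M \<in> Om"
    then obtain g where g: "g \<in> Gam" "mm M g \<in> nbhd A \<delta>" unfolding Om by blast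
    have "mm (mm M h) (mm (adj h) g) = mm M g" by (simp add: mm_assoc mm_adj_cancel dt_Gam[OF h])
    then show "mm M h \<in> Om" unfolding Om using g Gam_mm[OF Gam_adj[OF h] g(1)] by (intro bexI[of _ "mm (adj h) g"]) simp_all
  qed
  have inv2: "c *\<^sub>R M \<in> Om \<longleftrightarrow> M \<in> Om" if "c > 0" for M c
    unfolding Om by (simp only: mm_scaleR nbhd_scaleR[OF that])
  have km: "indicator Om \<in> borel_measurable MX"
  proof (rule borel_measurable_indicator)
    show "Om \<in> sets MX" unfolding sets_MX invs_def using Ob inv1 inv2 by simp
  qed
  have OX: "Om \<in> sets MX" unfolding sets_MX invs_def using Ob inv1 inv2 by simp
  have pos: "0 < measure MX Om"
  proof (rule ccontr)
    assume "\<not> 0 < measure MX Om"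
    then have "measure MX Om = 0" by (simp add: zero_less_measure_iff)
    then have "emeasure MX Om = 0" by (simp add: MX.emeasure_eq_measure)
    then have "emeasure mu Om = 0" using MX_emeasure[OF OX] by simp
    then have null: "Om \<in> null_sets mu" by (simp add: null_sets_def)
    have "(\<integral>\<^sup>+M. indicator (nbhd A \<delta>) M * indicator {M. 0 < dt M \<and> dt M \<le> 1} M \<partial>lborel)
      = (\<integral>\<^sup>+M. indicator Dom M * sumG (indicator (nbhd A \<delta>)) M \<partial>lborel)"
      by (rule unfolding_Dom[symmetric]) measurable
    also have "\<dots> = (\<integral>\<^sup>+M. sumG (indicator (nbhd A \<delta>)) M \<partial>mu)"
      by (rule nn_integral_mu[symmetric]) measurable
    also have "\<dots> = (\<integral>\<^sup>+M. 0 \<partial>mu)"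
    proof (rule nn_integral_cong_AE, use AE_not_in[OF null] in eventually_elim)
      fix M assume "M \<notin> Om"
      then have "mm M g \<notin> nbhd A \<delta>" if "g \<in> Gam" for g using that unfolding Om by blast
      then have "sumG (indicator (nbhd A \<delta>)) M = (\<integral>\<^sup>+g. 0 \<partial>count_space Gam)"
        unfolding sumG_def by (intro nn_integral_cong) simp
      then show "sumG (indicator (nbhd A \<delta>)) M = 0" by simp
    qed
    finally show False using nbhd_positive[OF A \<delta>] by simp
  qed
  show thesis
  proof (rule that[OF km])
    show "0 \<le> (indicator Om M :: real)" "indicator Om M \<le> (1::real)" for M by (simp_all add: indicator_def)
    show "0 < (\<integral>M. (indicator Om M :: real) \<partial>MX)" using pos OX by simp
    fix M assume "indicator Om M \<noteq> (0::real)"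
    then have "M \<in> Om" by (simp add: indicator_def split: if_splits)
    then obtain g where g: "g \<in> Gam" "mm M g \<in> nbhd A \<delta>" unfolding Om by blast
    show "\<exists>g\<in>Gam. \<exists>c>0. \<exists>h. dt h = 1 \<and> near_one \<delta> h \<and> mm M g = c *\<^sub>R mm h A"
      using g(1) nbhdD[OF A g(2)] by (rule bexI[rotated])
  qed
qed

lemma column_mm_cancel:
  assumes h: "dt h = 1"
    and "fst (fst (mm h N)) = fst (fst (mm h N'))" "fst (snd (mm h N)) = fst (snd (mm h N'))"
  shows "sl N = sl N'"
proof -
  have c: "fst (fst (mm k M)) = fst (fst k) * fst (fst M) + snd (fst k) * fst (snd M)"
    "fst (snd (mm k M)) = fst (snd k) * fst (fst M) + snd (snd k) * fst (snd M)" for k M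
    by (simp_all add: mm_def)
  have "fst (fst (mm (adj h) (mm h N))) = fst (fst (mm (adj h) (mm h N')))"
    "fst (snd (mm (adj h) (mm h N))) = fst (snd (mm (adj h) (mm h N')))"
    unfolding c[of "adj h"] using assms(2,3) by simp_all
  then show ?thesis unfolding mm_adj_cancel(2)[OF h] by (simp add: sl_def)
qed

text \<open>A hit of A gives a vector of h A in the wider strip whose slope has moved by at most
  \<eta>. The second entry may leave its window, so another group element with the same column is
  chosen. Equal columns after h force equal slopes before, which keeps the choice injective.\<close>

lemma count_perturb:
  assumes A: "dt A = 1" and h: "dt h = 1" "near_one \<delta> h" and I: "I \<subseteq> {a..b}" and B: "\<bar>a\<bar> \<le> B" "\<bar>b\<bar> \<le> B"
    and \<eta>: "0 < \<eta>" "\<eta> \<le> 1" and \<delta>: "\<delta> * (1 + B)\<^sup>2 \<le> \<eta> / 2" and t: "0 < t" and J: "{a - \<eta>..b + \<eta>} \<subseteq> J" "J \<subseteq> {u..v}" "u \<le> v"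
  shows "card (hits t I A) \<le> card (hits (t * (1 + \<eta>)) J (mm h A))"
proof -
  obtain h1 h2 h3 h4 where he: "h = ((h1, h2), (h3, h4))" by (cases h rule: m4_cases)
  define t' where "t' = t * (1 + \<eta>)"
  have t': "0 < t'" using t \<eta> by (simp add: t'_def)
  have ex: "\<exists>g'. g' \<in> hits t' J (mm h A) \<and> fst (fst (mm (mm h A) g')) = fst (fst (mm (mm h A) g))
      \<and> fst (snd (mm (mm h A) g')) = fst (snd (mm (mm h A) g))" if g: "g \<in> hits t I A" for g
  proof -
    have gG: "g \<in> Gam" and hg: "hit t (mm A g)" and sI: "sl (mm A g) \<in> I" using g by (simp_all add: hits_def)
    obtain x z y w where N: "mm A g = ((x, z), (y, w))" by (cases "mm A g" rule: m4_cases)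
    have d1: "dt ((x, z), (y, w)) = 1" using A dt_Gam[OF gG] N by (metis dt_mm mult.right_neutral)
    have x: "0 < x" "x \<le> t" using hg hit_iff[OF d1, of t] t unfolding N by simp_all
    define s where "s = y / x"
    have s: "s \<in> I" using sI by (simp add: N s_def)
    then have sB: "\<bar>s\<bar> \<le> B" "a \<le> s" "s \<le> b" using I B by (auto simp: abs_le_iff)
    have y: "y = s * x" using x by (simp add: s_def)
    have m: "\<bar>h1 + h2 * s - 1\<bar> \<le> \<eta> / 2" "\<bar>(h3 + h4 * s) / (h1 + h2 * s) - s\<bar> \<le> \<eta>"
      using moebius_near[OF h(2)[unfolded he] sB(1) \<delta> \<eta>] by simp_all
    have pos: "0 < h1 + h2 * s" "h1 + h2 * s \<le> 1 + \<eta>" using m(1) \<eta> by linarith+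
    have x': "fst (fst (mm (mm h A) g)) = x * (h1 + h2 * s)" "fst (snd (mm (mm h A) g)) = x * (h3 + h4 * s)"
      by (simp_all add: mm_assoc N he y algebra_simps)
    have sl': "sl (mm (mm h A) g) = (h3 + h4 * s) / (h1 + h2 * s)" using x unfolding sl_def x' by simp
    have "x * (h1 + h2 * s) \<le> t * (1 + \<eta>)" using x pos by (intro mult_mono) auto
    then have "\<exists>g'\<in>Gam. hit t' (mm (mm h A) g') \<and> sl (mm (mm h A) g') = sl (mm (mm h A) g)
      \<and> fst (fst (mm (mm h A) g')) = fst (fst (mm (mm h A) g)) \<and> fst (snd (mm (mm h A) g')) = fst (snd (mm (mm h A) g))"
      using x pos A h t' by (intro hit_of_column[OF _ _ _ gG, of _ 1]) (simp_all add: x' t'_def)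
    then obtain g' where g': "g' \<in> Gam" "hit t' (mm (mm h A) g')" "sl (mm (mm h A) g') = sl (mm (mm h A) g)"
      "fst (fst (mm (mm h A) g')) = fst (fst (mm (mm h A) g))" "fst (snd (mm (mm h A) g')) = fst (snd (mm (mm h A) g))"
      by (elim bexE conjE)
    have "sl (mm (mm h A) g) \<in> {a - \<eta>..b + \<eta>}" using m(2) sB unfolding sl' by (simp add: abs_le_iff)
    then have "sl (mm (mm h A) g) \<in> J" using J(1) by blast
    then have "g' \<in> hits t' J (mm h A)" using g' by (simp add: hits_def)
    then show ?thesis using g'(4,5) by blast
  qed
  define r where "r g = (SOME g'. g' \<in> hits t' J (mm h A) \<and> fst (fst (mm (mm h A) g')) = fst (fst (mm (mm h A) g))
      \<and> fst (snd (mm (mm h A) g')) = fst (snd (mm (mm h A) g)))" for g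
  have r: "r g \<in> hits t' J (mm h A)" "fst (fst (mm (mm h A) (r g))) = fst (fst (mm (mm h A) g))"
    "fst (snd (mm (mm h A) (r g))) = fst (snd (mm (mm h A) g))" if "g \<in> hits t I A" for g
    using someI_ex[OF ex[OF that]] unfolding r_def by blast+
  have inj: "inj_on r (hits t I A)"
  proof (rule inj_onI)
    fix g g' assume g: "g \<in> hits t I A" "g' \<in> hits t I A" "r g = r g'"
    have "sl (mm A g) = sl (mm A g')"
      using r(2,3)[OF g(1)] r(2,3)[OF g(2)] g(3) by (intro column_mm_cancel[OF h(1)]) (simp_all add: mm_assoc)
    then show "g = g'" using inj_onD[OF inj_sl_hits[OF t]] g(1,2) by blast
  qed
  have "card (hits t I A) \<le> card (hits t' J (mm h A))"
    using inj r(1) hits_card(1)[OF t' J(2,3)] by (intro card_inj_on_le[of r]) blast+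
  then show ?thesis by (simp add: t'_def)
qed

text \<open>Here the group element is kept, since Farey parameters are compared: f is positive only
  where an \<epsilon>-box around the point lies in \<open>Tq q\<close>, so a hit with positive value
  remains a hit. The lower bound \<rho> on first coordinates controls the term h2 / x of the new
  first row, and \<omega> is the loss per hit.\<close>

lemma sum_perturb:
  assumes A: "dt M = 1" and h: "dt h = 1" "near_one \<delta> h" and J: "J \<subseteq> {u..v}" "u \<le> v" and B: "\<bar>u\<bar> \<le> B" "\<bar>v\<bar> \<le> B"
    and \<eta>: "0 < \<eta>" "\<eta> \<le> 1" and \<delta>: "\<delta> * (1 + B)\<^sup>2 \<le> \<eta> / 2" and t: "1 \<le> t"
    and I: "\<And>s s'. s \<in> J \<Longrightarrow> \<bar>s' - s\<bar> \<le> \<eta> \<Longrightarrow> s' \<in> I" "I \<subseteq> {a..b}" "a \<le> b"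
    and f: "\<And>p. 0 \<le> f p" "\<And>p. 0 < f p \<Longrightarrow> \<rho> \<le> fst p" "0 < \<rho>"
      "\<And>p p'. 0 < f p \<Longrightarrow> \<bar>fst p' - fst p\<bar> \<le> \<epsilon> \<Longrightarrow> \<bar>snd p' - snd p\<bar> \<le> \<epsilon> \<Longrightarrow> p' \<in> Tq q \<and> f p \<le> f p' + \<omega>"
    and \<epsilon>: "\<eta> * (1 + 1 / \<rho>) \<le> \<epsilon>" and \<omega>: "0 \<le> \<omega>"
  shows "Ssum f t J M \<le> Ssum f t I (mm h M) + \<omega> * real (card (hits t J M))"
proof -
  obtain h1 h2 h3 h4 where he: "h = ((h1, h2), (h3, h4))" by (cases h rule: m4_cases)
  have t0: "0 < t" using t by simp
  have fin: "finite (hits t J M)" "finite (hits t I (mm h M))"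
    using hits_card(1)[OF t0 J] hits_card(1)[OF t0 I(2,3)] .
  define G0 where "G0 = {g \<in> hits t J M. 0 < f (pt t (mm M g))}"
  have G0: "G0 \<subseteq> hits t J M" by (auto simp: G0_def)
  have key: "g \<in> hits t I (mm h M) \<and> f (pt t (mm M g)) \<le> f (pt t (mm (mm h M) g)) + \<omega>" if g: "g \<in> G0" for g
  proof -
    have gG: "g \<in> Gam" and hg: "hit t (mm M g)" and sJ: "sl (mm M g) \<in> J" and fp: "0 < f (pt t (mm M g))"
      using g by (simp_all add: hits_def G0_def)
    obtain x z y w where N: "mm M g = ((x, z), (y, w))" by (cases "mm M g" rule: m4_cases)
    have d1: "dt ((x, z), (y, w)) = 1" using A dt_Gam[OF gG] N by (metis dt_mm mult.right_neutral)
    have x: "0 < x" "x \<le> t" "t - lam * x < z" "z \<le> t" using hg hit_iff[OF d1, of t] t0 unfolding N by simp_all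
    define s where "s = y / x"
    have s: "s \<in> J" using sJ by (simp add: N s_def)
    then have sB: "\<bar>s\<bar> \<le> B" using J B by (auto simp: abs_le_iff)
    have y: "y = s * x" using x by (simp add: s_def)
    \<comment> \<open>The determinant eliminates w, so that the new second entry is \<kappa> z + h2
      / x.\<close>
    have w: "w = s * z + 1 / x" using d1 x by (simp add: y field_simps)
    have m: "\<bar>h1 + h2 * s - 1\<bar> \<le> \<eta> / 2" "\<bar>(h3 + h4 * s) / (h1 + h2 * s) - s\<bar> \<le> \<eta>" "\<bar>h2\<bar> \<le> \<eta>"
      using moebius_near[OF h(2)[unfolded he] sB \<delta> \<eta>] by simp_all
    define \<kappa> where "\<kappa> = h1 + h2 * s"
    have \<kappa>: "\<bar>\<kappa> - 1\<bar> \<le> \<eta> / 2" "0 < \<kappa>" using m(1) \<eta> unfolding \<kappa>_def by linarith+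
    have e: "mm (mm h M) g = ((\<kappa> * x, \<kappa> * z + h2 / x), (x * (h3 + h4 * s), h3 * z + h4 * w))"
      unfolding mm_assoc N he by (simp add: y w \<kappa>_def algebra_simps)
    have sl': "sl (mm (mm h M) g) = (h3 + h4 * s) / \<kappa>" using x unfolding e by simp
    have dm: "dt (mm (mm h M) g) = 1" using A h dt_Gam[OF gG] by simp
    define p where "p = pt t (mm M g)"
    define p' where "p' = pt t (mm (mm h M) g)"
    have pe: "p = (x / t, z / t)" using d1 by (simp add: p_def pt_def N)
    have pe': "p' = (\<kappa> * x / t, (\<kappa> * z + h2 / x) / t)" using dm by (simp add: p'_def pt_def) (simp add: e)
    have xa: "\<rho> * t \<le> x" using f(2)[OF fp] t0 by (simp add: p_def[symmetric] pe pos_le_divide_eq)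
    have x1: "\<bar>x / t\<bar> \<le> 1" using x t0 by simp
    have lx: "lam * x \<le> 2 * t" using lam_bounds x by (intro mult_mono) auto
    have z1: "\<bar>z / t\<bar> \<le> 1" using x lx t0 by (simp add: abs_le_iff pos_divide_le_eq minus_le_iff pos_le_divide_eq)
    have "fst p' - fst p = (\<kappa> - 1) * (x / t)" unfolding pe pe' by (simp add: algebra_simps diff_divide_distrib)
    then have "\<bar>fst p' - fst p\<bar> = \<bar>\<kappa> - 1\<bar> * \<bar>x / t\<bar>" by (simp only: abs_mult)
    also have "\<dots> \<le> \<eta> / 2 * 1" using \<kappa> x1 \<eta> by (intro mult_mono) auto
    finally have d_fst: "\<bar>fst p' - fst p\<bar> \<le> \<eta>" using \<eta> by simp
    have sn: "snd p' - snd p = (\<kappa> - 1) * (z / t) + h2 / (x * t)"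
      unfolding pe pe' by (simp add: algebra_simps diff_divide_distrib add_divide_distrib)
    have "\<bar>(\<kappa> - 1) * (z / t)\<bar> \<le> \<eta> / 2 * 1" unfolding abs_mult using \<kappa> z1 \<eta> by (intro mult_mono) auto
    moreover have "\<bar>h2 / (x * t)\<bar> \<le> \<eta> / \<rho>"
    proof -
      have "\<rho> * 1 \<le> \<rho> * t" using f(3) t by (intro mult_left_mono) auto
      then have "\<rho> \<le> x" using xa by simp
      have "\<rho> * 1 \<le> x * t" using \<open>\<rho> \<le> x\<close> t f(3) by (intro mult_mono) auto
      then have "\<bar>h2\<bar> / \<bar>x * t\<bar> \<le> \<eta> / \<rho>" using m(3) f(3) x t0 \<eta> by (intro frac_le) auto
      then show ?thesis by simp
    qed
    ultimately have "\<bar>snd p' - snd p\<bar> \<le> \<eta> / 2 * 1 + \<eta> / \<rho>"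
      unfolding sn by (intro order_trans[OF abs_triangle_ineq] add_mono)
    then have d_snd: "\<bar>snd p' - snd p\<bar> \<le> \<eta> + \<eta> / \<rho>" using \<eta> by simp
    have "0 \<le> \<eta> / \<rho>" using \<eta> f(3) by simp
    moreover have "\<eta> + \<eta> / \<rho> \<le> \<epsilon>" using \<epsilon> by (simp add: algebra_simps)
    ultimately have "\<bar>fst p' - fst p\<bar> \<le> \<epsilon>" "\<bar>snd p' - snd p\<bar> \<le> \<epsilon>"
      using d_fst d_snd by linarith+
    then have p': "p' \<in> Tq q" "f p \<le> f p' + \<omega>" using f(4)[OF fp[folded p_def]] by simp_all
    have "hit t (mm (mm h M) g)" using p'(1) dm by (simp add: hit_pt p'_def)
    moreover have "sl (mm (mm h M) g) \<in> I" unfolding sl' using I(1)[OF s] m(2) by (simp add: \<kappa>_def)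
    ultimately show ?thesis using p'(2) gG by (simp add: hits_def p_def p'_def)
  qed
  have "Ssum f t J M = (\<Sum>g\<in>G0. f (pt t (mm M g)))"
    unfolding Ssum_def
  proof (rule sum.mono_neutral_right[OF fin(1) G0])
    show "\<forall>g\<in>hits t J M - G0. f (pt t (mm M g)) = 0"
      using f(1) unfolding G0_def by (metis (mono_tags, lifting) DiffE less_eq_real_def mem_Collect_eq)
  qed
  also have "\<dots> \<le> (\<Sum>g\<in>G0. f (pt t (mm (mm h M) g)) + \<omega>)" using key by (intro sum_mono) blast
  also have "\<dots> = (\<Sum>g\<in>G0. f (pt t (mm (mm h M) g))) + \<omega> * real (card G0)" by (simp add: sum.distrib)
  also have "(\<Sum>g\<in>G0. f (pt t (mm (mm h M) g))) \<le> Ssum f t I (mm h M)"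
    unfolding Ssum_def using key f(1) fin(2) by (intro sum_mono2) blast+
  also have "\<omega> * real (card G0) \<le> \<omega> * real (card (hits t J M))"
    using card_mono[OF fin(1) G0] \<omega> by (intro mult_left_mono) auto
  finally show ?thesis by simp
qed

section \<open>Upper bound for counts and lower bound for sums\<close>

lemma Ssum_MX:
  assumes f: "f \<in> borel_measurable borel" "\<And>p. 0 \<le> f p" "\<And>p. f p \<le> C" and t: "0 < t"
  shows "(\<lambda>M. Ssum f t {\<alpha>..<\<alpha> + real K / t\<^sup>2} M) \<in> borel_measurable MX"
    "0 \<le> Ssum f t {\<alpha>..<\<alpha> + real K / t\<^sup>2} M" "Ssum f t {\<alpha>..<\<alpha> + real K / t\<^sup>2} M \<le> real K * C"
proof -
  have m: "(\<lambda>M. phi f (mm (dg t) (mm (lo (- s)) M))) \<in> borel_measurable MX" for s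
    using MX_compose[OF phi_MX[OF f(1,2)], of "mm (dg t) (lo (- s))"] by (simp only: mm_assoc)
  show "(\<lambda>M. Ssum f t {\<alpha>..<\<alpha> + real K / t\<^sup>2} M) \<in> borel_measurable MX"
    unfolding Ssum_tile[OF t, symmetric] by (rule borel_measurable_sum, rule m)
  show "0 \<le> Ssum f t {\<alpha>..<\<alpha> + real K / t\<^sup>2} M" unfolding Ssum_def by (intro sum_nonneg f)
  have "Ssum f t {\<alpha>..<\<alpha> + real K / t\<^sup>2} M \<le> real (card {..<K}) * C"
    unfolding Ssum_tile[OF t, symmetric] by (intro sum_bounded_above phi_bound(2)[OF f(2,3)])
  then show "Ssum f t {\<alpha>..<\<alpha> + real K / t\<^sup>2} M \<le> real K * C" by simp
qed

lemma floor_ratio_tendsto: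
  assumes t: "filterlim t at_top sequentially" and t0: "\<And>n. 0 < t n" and L: "0 \<le> L"
  shows "(\<lambda>n. real (nat \<lceil>L * (t n)\<^sup>2\<rceil>) / (t n)\<^sup>2) \<longlonglongrightarrow> L" "(\<lambda>n. real (nat \<lfloor>L * (t n)\<^sup>2\<rfloor>) / (t n)\<^sup>2) \<longlonglongrightarrow> L"
proof -
  have z: "(\<lambda>n. 1 / (t n)\<^sup>2) \<longlonglongrightarrow> 0"
    by (intro real_tendsto_divide_at_top[OF tendsto_const] filterlim_pow_at_top t) auto
  have up: "(\<lambda>n. L + 1 / (t n)\<^sup>2) \<longlonglongrightarrow> L + 0" and low: "(\<lambda>n. L - 1 / (t n)\<^sup>2) \<longlonglongrightarrow> L - 0"
    by (intro tendsto_intros z)+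
  have t2: "0 < (t n)\<^sup>2" for n using t0[of n] by simp
  have nn: "0 \<le> L * (t n)\<^sup>2" for n using L by simp
  have c: "L \<le> real (nat \<lceil>L * (t n)\<^sup>2\<rceil>) / (t n)\<^sup>2" "real (nat \<lceil>L * (t n)\<^sup>2\<rceil>) / (t n)\<^sup>2 \<le> L + 1 / (t n)\<^sup>2" for n
  proof -
    have r: "real (nat \<lceil>L * (t n)\<^sup>2\<rceil>) = of_int \<lceil>L * (t n)\<^sup>2\<rceil>" using nn[of n] by (subst of_nat_nat) auto
    have "L * (t n)\<^sup>2 \<le> real (nat \<lceil>L * (t n)\<^sup>2\<rceil>)" "real (nat \<lceil>L * (t n)\<^sup>2\<rceil>) \<le> L * (t n)\<^sup>2 + 1"
      unfolding r by linarith+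
    then show "L \<le> real (nat \<lceil>L * (t n)\<^sup>2\<rceil>) / (t n)\<^sup>2" "real (nat \<lceil>L * (t n)\<^sup>2\<rceil>) / (t n)\<^sup>2 \<le> L + 1 / (t n)\<^sup>2"
      using t2[of n] by (simp_all add: pos_le_divide_eq pos_divide_le_eq distrib_right)
  qed
  have f: "L - 1 / (t n)\<^sup>2 \<le> real (nat \<lfloor>L * (t n)\<^sup>2\<rfloor>) / (t n)\<^sup>2" "real (nat \<lfloor>L * (t n)\<^sup>2\<rfloor>) / (t n)\<^sup>2 \<le> L" for n
  proof -
    have r: "real (nat \<lfloor>L * (t n)\<^sup>2\<rfloor>) = of_int \<lfloor>L * (t n)\<^sup>2\<rfloor>" using nn[of n] by (subst of_nat_nat) auto
    have "L * (t n)\<^sup>2 - 1 \<le> real (nat \<lfloor>L * (t n)\<^sup>2\<rfloor>)" "real (nat \<lfloor>L * (t n)\<^sup>2\<rfloor>) \<le> L * (t n)\<^sup>2"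
      unfolding r by linarith+
    then show "L - 1 / (t n)\<^sup>2 \<le> real (nat \<lfloor>L * (t n)\<^sup>2\<rfloor>) / (t n)\<^sup>2" "real (nat \<lfloor>L * (t n)\<^sup>2\<rfloor>) / (t n)\<^sup>2 \<le> L"
      using t2[of n] by (simp_all add: pos_le_divide_eq pos_divide_le_eq left_diff_distrib)
  qed
  show "(\<lambda>n. real (nat \<lceil>L * (t n)\<^sup>2\<rceil>) / (t n)\<^sup>2) \<longlonglongrightarrow> L"
    by (rule tendsto_sandwich[OF _ _ tendsto_const[of L] up[simplified]]) (use c in auto)
  show "(\<lambda>n. real (nat \<lfloor>L * (t n)\<^sup>2\<rfloor>) / (t n)\<^sup>2) \<longlonglongrightarrow> L"
    by (rule tendsto_sandwich[OF _ _ low[simplified] tendsto_const[of L]]) (use f in auto)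
qed

text \<open>\<open>count_perturb\<close> is integrated against k. The wider strip costs the factor
  (1 + \<eta>)^2. Of the additional length 3 \<eta>, two parts absorb the change of slopes, and the
  third lets a half-open interval contain the closed one.\<close>

lemma count_upper:
  assumes A: "dt A = 1" and I: "I \<subseteq> {a..b}" "a < b"
    and t: "filterlim t at_top sequentially" and t1: "\<And>n. 1 \<le> t n" and e: "0 < e"
  shows "eventually (\<lambda>n. real (card (hits (t n) I A)) / (t n)\<^sup>2 < (b - a) * ((lam / 2) / Rint) + e) sequentially"
proof -
  define c1 where "c1 = (lam / 2) / Rint"
  \<comment> \<open>\<eta> is chosen by continuity at 0 from the right, so that both losses together
    stay below e.\<close>
  have "((\<lambda>\<eta>. (1 + \<eta>)\<^sup>2 * ((b - a + 3 * \<eta>) * c1)) \<longlongrightarrow> (1 + 0)\<^sup>2 * ((b - a + 3 * 0) * c1)) (at_right 0)"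
    by (intro tendsto_intros)
  then have "eventually (\<lambda>\<eta>. (1 + \<eta>)\<^sup>2 * ((b - a + 3 * \<eta>) * c1) < (b - a) * c1 + e) (at_right 0)"
    using e by (intro order_tendstoD) auto
  moreover have "eventually (\<lambda>\<eta>. \<eta> \<in> {0<..<1::real}) (at_right 0)" by (rule eventually_at_right_real) simp
  ultimately have "eventually (\<lambda>\<eta>. (1 + \<eta>)\<^sup>2 * ((b - a + 3 * \<eta>) * c1) < (b - a) * c1 + e \<and> \<eta> \<in> {0<..<1::real}) (at_right 0)"
    by (rule eventually_conj)
  then obtain \<eta> :: real where \<eta>: "(1 + \<eta>)\<^sup>2 * ((b - a + 3 * \<eta>) * c1) < (b - a) * c1 + e" "0 < \<eta>" "\<eta> < 1"
    using eventually_happens'[of "at_right (0::real)"] by (auto simp: trivial_limit_at_right_real)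
  define B where "B = max \<bar>a\<bar> \<bar>b\<bar>"
  define \<delta> where "\<delta> = \<eta> / 2 / (1 + B)\<^sup>2"
  have B0: "0 < (1 + B)\<^sup>2" by (simp add: B_def zero_less_power)
  have \<delta>: "0 < \<delta>" "\<delta> * (1 + B)\<^sup>2 \<le> \<eta> / 2" using \<eta> B0 by (simp_all add: \<delta>_def)
  obtain k where k: "k \<in> borel_measurable MX" "\<And>M. 0 \<le> k M" "\<And>M. k M \<le> (1::real)" "0 < (\<integral>M. k M \<partial>MX)"
    and kn: "\<And>M. k M \<noteq> 0 \<Longrightarrow> \<exists>g\<in>Gam. \<exists>c>0. \<exists>h. dt h = 1 \<and> near_one \<delta> h \<and> mm M g = c *\<^sub>R mm h A"
    using test_function[OF A \<delta>(1)] by metis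
  define P where "P = (\<integral>M. k M \<partial>MX)"
  define L where "L = b - a + 3 * \<eta>"
  define t' where "t' n = t n * (1 + \<eta>)" for n
  define K where "K n = nat \<lceil>L * (t' n)\<^sup>2\<rceil>" for n
  have t0: "0 < t n" for n using t1[of n] by simp
  have t'0: "0 < t' n" for n using t0[of n] \<eta> by (simp add: t'_def)
  have t': "filterlim t' at_top sequentially"
    unfolding t'_def by (rule filterlim_at_top_mult_tendsto_pos[OF tendsto_const _ t]) (use \<eta> in auto)
  have L0: "0 \<le> L" using I \<eta> by (simp add: L_def)
  have K: "(\<lambda>n. real (K n) / (t' n)\<^sup>2) \<longlonglongrightarrow> L" unfolding K_def by (rule floor_ratio_tendsto[OF t' t'0 L0])
  have KL: "L \<le> real (K n) / (t' n)\<^sup>2" for n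
  proof -
    have "L * (t' n)\<^sup>2 \<le> real (K n)" unfolding K_def by linarith
    then show ?thesis using t'0[of n] by (simp add: pos_le_divide_eq)
  qed
  define J where "J n = {a - \<eta>..<a - \<eta> + real (K n) / (t' n)\<^sup>2}" for n
  define S where "S n = (\<integral>M. Ssum (\<lambda>_. 1) (t' n) (J n) M / (t' n)\<^sup>2 * k M \<partial>MX)" for n
  have "S \<longlonglongrightarrow> L * ((\<integral>p. 1 * indicator (Tq q) p \<partial>lborel) / Rint * P)"
    unfolding S_def J_def P_def
    by (rule weak_equidistribution[where C = 1, OF _ _ _ k(1) _ t' t'0 K]) (use k(2,3) in \<open>auto simp: abs_le_iff intro: order_trans[of _ 0]\<close>)
  moreover have "(\<integral>p. 1 * indicator (Tq q) p \<partial>lborel) = lam / 2"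
  proof -
    have "emeasure lborel (Tq q) = ennreal (lam / 2)" using nn_integral_Tq by simp
    then show ?thesis using lam_bounds by (simp add: measure_def)
  qed
  ultimately have S: "S \<longlonglongrightarrow> L * (c1 * P)" by (simp only: c1_def)
  have le: "real (card (hits (t n) I A)) / (t n)\<^sup>2 \<le> (1 + \<eta>)\<^sup>2 * (S n / P)" for n
  proof -
    have Jsub: "{a - \<eta>..b + \<eta>} \<subseteq> J n" "J n \<subseteq> {a - \<eta>..a - \<eta> + real (K n) / (t' n)\<^sup>2}" "a - \<eta> \<le> a - \<eta> + real (K n) / (t' n)\<^sup>2"
      using KL[of n] \<eta> L0 unfolding J_def by (auto simp: L_def)
    have pt: "real (card (hits (t n) I A)) * k M \<le> Ssum (\<lambda>_. 1) (t' n) (J n) M * k M" for M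
    proof (cases "k M = 0")
      case False
      then obtain g c h where g: "g \<in> Gam" "c > 0" "dt h = 1" "near_one \<delta> h" "mm M g = c *\<^sub>R mm h A" using kn by blast
      have "Ssum (\<lambda>_. 1) (t' n) (J n) M = Ssum (\<lambda>_. 1) (t' n) (J n) (mm M g)" by (rule Ssum_translate[OF g(1), symmetric])
      also have "\<dots> = Ssum (\<lambda>_. 1) (t' n) (J n) (mm h A)" unfolding g(5) by (rule Ssum_scaleR[OF g(2)])
      also have "\<dots> = real (card (hits (t' n) (J n) (mm h A)))" by (simp add: Ssum_def)
      finally have e: "Ssum (\<lambda>_. 1) (t' n) (J n) M = real (card (hits (t' n) (J n) (mm h A)))" .
      have "card (hits (t n) I A) \<le> card (hits (t n * (1 + \<eta>)) (J n) (mm h A))"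
        by (rule count_perturb[OF A g(3,4) I(1) _ _ \<eta>(2) less_imp_le[OF \<eta>(3)] \<delta>(2) t0 Jsub]) (simp_all add: B_def)
      then show ?thesis unfolding e unfolding t'_def using k(2)[of M] by (intro mult_right_mono) auto
    qed simp
    have m: "(\<lambda>M. Ssum (\<lambda>_. 1) (t' n) (J n) M) \<in> borel_measurable MX" and b: "\<And>M. 0 \<le> Ssum (\<lambda>_. 1) (t' n) (J n) M"
      "\<And>M. Ssum (\<lambda>_. 1) (t' n) (J n) M \<le> real (K n)"
      unfolding J_def using Ssum_MX[where f = "\<lambda>_. 1" and C = 1, OF _ _ _ t'0[of n]] by auto
    have i1: "integrable MX (\<lambda>M. Ssum (\<lambda>_. 1) (t' n) (J n) M * k M)"
    proof (rule MX_int_bdd)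
      show "(\<lambda>M. Ssum (\<lambda>_. 1) (t' n) (J n) M * k M) \<in> borel_measurable MX" using m k(1) by simp
      fix M show "\<bar>Ssum (\<lambda>_. 1) (t' n) (J n) M * k M\<bar> \<le> real (K n) * 1"
        unfolding abs_mult using b[of M] k(2,3)[of M] by (intro mult_mono) auto
    qed
    have i2: "integrable MX k" using k(1-3) by (intro MX_int_bdd[of _ 1]) (auto simp: abs_le_iff intro: order_trans[of _ 0])
    have "real (card (hits (t n) I A)) * P = (\<integral>M. real (card (hits (t n) I A)) * k M \<partial>MX)" by (simp add: P_def)
    also have "\<dots> \<le> (\<integral>M. Ssum (\<lambda>_. 1) (t' n) (J n) M * k M \<partial>MX)"
      using i1 i2 by (intro integral_mono pt) auto
    also have "\<dots> = (t' n)\<^sup>2 * S n" using t'0[of n] by (simp add: S_def)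
    finally have "real (card (hits (t n) I A)) * P \<le> (t' n)\<^sup>2 * S n" .
    then have "real (card (hits (t n) I A)) \<le> (t n)\<^sup>2 * ((1 + \<eta>)\<^sup>2 * (S n / P))"
      using k(4) by (simp add: P_def[symmetric] t'_def power_mult_distrib pos_le_divide_eq mult.assoc)
    then show ?thesis using t0[of n] by (simp add: pos_divide_le_eq mult.commute)
  qed
  have "(\<lambda>n. (1 + \<eta>)\<^sup>2 * (S n / P)) \<longlonglongrightarrow> (1 + \<eta>)\<^sup>2 * ((L * (c1 * P)) / P)"
    using k(4) by (intro tendsto_intros S) (simp add: P_def)
  moreover have "(1 + \<eta>)\<^sup>2 * ((L * (c1 * P)) / P) < (b - a) * c1 + e" using \<eta>(1) k(4) by (simp add: P_def L_def)
  ultimately have "eventually (\<lambda>n. (1 + \<eta>)\<^sup>2 * (S n / P) < (b - a) * c1 + e) sequentially"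
    by (rule order_tendstoD)
  then show ?thesis unfolding c1_def[symmetric] by eventually_elim (rule le_less_trans[OF le])
qed

text \<open>\<open>sum_perturb\<close> is applied from h A back to A, through the inverse of h, and
  integrated against k. The interval is shortened by at least 2 \<eta> at each end so that moved
  slopes stay inside I, and the losses \<omega> are summed with the a priori bound on the number of
  hits.\<close>

lemma sum_lower:
  assumes A: "dt A = 1" and I: "{a<..<b} \<subseteq> I" "I \<subseteq> {a..b}" "a < b"
    and t: "filterlim t at_top sequentially" and t1: "\<And>n. 1 \<le> t n" and e: "0 < e"
    and f: "f \<in> borel_measurable borel" "\<And>p. 0 \<le> f p" "\<And>p. f p \<le> C" "\<And>p. 0 < f p \<Longrightarrow> a0 \<le> fst p" "0 < a0"
    and uc: "\<And>\<omega>. 0 < \<omega> \<Longrightarrow> \<exists>\<eta>1>0. \<forall>p p'. 0 < f p \<longrightarrow> \<bar>fst p' - fst p\<bar> \<le> \<eta>1 \<longrightarrow> \<bar>snd p' - snd p\<bar> \<le> \<eta>1 \<longrightarrow> p' \<in> Tq q \<and> f p \<le> f p' + \<omega>"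
  shows "eventually (\<lambda>n. (b - a) * ((\<integral>p. f p * indicator (Tq q) p \<partial>lborel) / Rint) - e < Ssum f (t n) I A / (t n)\<^sup>2) sequentially"
proof -
  define cf where "cf = (\<integral>p. f p * indicator (Tq q) p \<partial>lborel) / Rint"
  have cf0: "0 \<le> cf" unfolding cf_def using f(2) Rint_pos by (intro divide_nonneg_pos integral_nonneg) auto
  have C0: "0 \<le> C" using f(2,3) order_trans by blast
  \<comment> \<open>At most (b - a + 1) t^2 hits occur, so the total loss divided by t^2 is at most
    e / 3.\<close>
  define \<omega> where "\<omega> = (e / 3) / (b - a + 1)"
  have \<omega>: "0 < \<omega>" "\<omega> * (b - a + 1) = e / 3"
  proof -
    have n: "b - a + 1 \<noteq> 0" using I(3) by simp
    show "0 < \<omega>" using e I(3) by (simp add: \<omega>_def)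
    show "\<omega> * (b - a + 1) = e / 3" by (rule nonzero_eq_divide_eq[OF n, THEN iffD1, OF \<omega>_def])
  qed
  obtain \<eta>1 where \<eta>1: "0 < \<eta>1" and u: "\<And>p p'. 0 < f p \<Longrightarrow> \<bar>fst p' - fst p\<bar> \<le> \<eta>1 \<Longrightarrow> \<bar>snd p' - snd p\<bar> \<le> \<eta>1 \<Longrightarrow> p' \<in> Tq q \<and> f p \<le> f p' + \<omega>"
    using uc[OF \<omega>(1)] by blast
  \<comment> \<open>The four constraints give, in order: the Moebius estimate, a nonempty shortened
    interval, displacements of the parameter of at most \<eta>1, and a loss of at most e / 3 from
    the missing length 4 \<eta>.\<close>
  define \<eta> where "\<eta> = min (min 1 ((b - a) / 8)) (min (\<eta>1 / (1 + 1 / a0)) ((e / 3) / (4 * (cf + 1))))"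
  have q1: "0 < 1 + 1 / a0" using f(5) by (simp add: add_pos_pos)
  have \<eta>: "0 < \<eta>" "\<eta> \<le> 1" "\<eta> \<le> (b - a) / 8" "\<eta> \<le> \<eta>1 / (1 + 1 / a0)" "\<eta> \<le> (e / 3) / (4 * (cf + 1))"
  proof -
    have "\<eta> \<le> min 1 ((b - a) / 8)" "\<eta> \<le> min (\<eta>1 / (1 + 1 / a0)) ((e / 3) / (4 * (cf + 1)))"
      unfolding \<eta>_def by (rule min.cobounded1, rule min.cobounded2)
    then show "\<eta> \<le> 1" "\<eta> \<le> (b - a) / 8" "\<eta> \<le> \<eta>1 / (1 + 1 / a0)" "\<eta> \<le> (e / 3) / (4 * (cf + 1))"
      by (simp_all only: min.bounded_iff)
    have "0 < (b - a) / 8" "0 < \<eta>1 / (1 + 1 / a0)" "0 < (e / 3) / (4 * (cf + 1))"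
      using q1 \<eta>1 e I(3) cf0 by simp_all
    then show "0 < \<eta>" unfolding \<eta>_def by (simp only: min_less_iff_conj zero_less_one)
  qed
  have \<eta>a: "\<eta> * (1 + 1 / a0) \<le> \<eta>1" using \<eta>(4) q1 by (simp only: pos_le_divide_eq)
  have \<eta>c: "4 * \<eta> * cf \<le> e / 3"
  proof -
    have "0 < 4 * (cf + 1)" using cf0 by simp
    then have "\<eta> * (4 * (cf + 1)) \<le> e / 3" using \<eta>(5) by (simp only: pos_le_divide_eq)
    then show ?thesis using \<eta>(1) by (simp add: algebra_simps)
  qed
  define B where "B = max \<bar>a\<bar> \<bar>b\<bar>"
  define \<delta> where "\<delta> = \<eta> / 2 / (1 + B)\<^sup>2"
  have B0: "0 < (1 + B)\<^sup>2" by (simp add: B_def zero_less_power)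
  have \<delta>: "0 < \<delta>" "\<delta> * (1 + B)\<^sup>2 \<le> \<eta> / 2" using \<eta> B0 by (simp_all add: \<delta>_def)
  obtain k where k: "k \<in> borel_measurable MX" "\<And>M. 0 \<le> k M" "\<And>M. k M \<le> (1::real)" "0 < (\<integral>M. k M \<partial>MX)"
    and kn: "\<And>M. k M \<noteq> 0 \<Longrightarrow> \<exists>g\<in>Gam. \<exists>c>0. \<exists>h. dt h = 1 \<and> near_one \<delta> h \<and> mm M g = c *\<^sub>R mm h A"
    using test_function[OF A \<delta>(1)] by metis
  define P where "P = (\<integral>M. k M \<partial>MX)"
  define L where "L = b - a - 4 * \<eta>"
  define K where "K n = nat \<lfloor>L * (t n)\<^sup>2\<rfloor>" for n
  have t0: "0 < t n" for n using t1[of n] by simp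
  have L0: "0 \<le> L" using I(3) \<eta>(3) by (simp add: L_def)
  have K: "(\<lambda>n. real (K n) / (t n)\<^sup>2) \<longlonglongrightarrow> L" unfolding K_def by (rule floor_ratio_tendsto[OF t t0 L0])
  have KL: "real (K n) / (t n)\<^sup>2 \<le> L" for n
  proof -
    have "real (K n) \<le> L * (t n)\<^sup>2" unfolding K_def using L0 by (subst of_nat_nat) auto
    then show ?thesis using t0[of n] by (simp add: pos_divide_le_eq)
  qed
  define J where "J n = {a + 2 * \<eta>..<a + 2 * \<eta> + real (K n) / (t n)\<^sup>2}" for n
  define S where "S n = (\<integral>M. Ssum f (t n) (J n) M / (t n)\<^sup>2 * k M \<partial>MX)" for n
  have S: "S \<longlonglongrightarrow> L * (cf * P)"
    unfolding S_def J_def P_def cf_def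
    \<comment> \<open>One constant has to bound both f and k.\<close>
    by (rule weak_equidistribution[where C = "max C 1", OF f(1,2) _ k(1) _ t t0 K])
       (use k(2,3) f(3) in \<open>auto simp: abs_le_iff le_max_iff_disj intro: order_trans[of _ 0]\<close>)
  have le: "S n / P - \<omega> * (b - a + 1) \<le> Ssum f (t n) I A / (t n)\<^sup>2" for n
  proof -
    have t2: "0 < (t n)\<^sup>2" using t0[of n] by simp
    have Jsub: "J n \<subseteq> {a + 2 * \<eta>..b - 2 * \<eta>}" using KL[of n] unfolding J_def L_def by auto
    have Jab: "a + 2 * \<eta> \<le> b - 2 * \<eta>" using \<eta>(3) I(3) by simp
    have pt: "Ssum f (t n) (J n) M * k M \<le> (Ssum f (t n) I A + \<omega> * ((b - a + 1) * (t n)\<^sup>2)) * k M" for M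
    proof (cases "k M = 0")
      case False
      then obtain g c h where g: "g \<in> Gam" "c > 0" "dt h = 1" "near_one \<delta> h" "mm M g = c *\<^sub>R mm h A" using kn by blast
      have "Ssum f (t n) (J n) M = Ssum f (t n) (J n) (mm M g)" by (rule Ssum_translate[OF g(1), symmetric])
      also have "\<dots> = Ssum f (t n) (J n) (mm h A)" unfolding g(5) by (rule Ssum_scaleR[OF g(2)])
      also have "\<dots> \<le> Ssum f (t n) I (mm (adj h) (mm h A)) + \<omega> * real (card (hits (t n) (J n) (mm h A)))"
      proof (rule sum_perturb[where \<eta> = \<eta> and \<delta> = \<delta> and B = B and \<epsilon> = \<eta>1 and \<rho> = a0 and \<omega> = \<omega> and u = "a + 2 * \<eta>" and v = "b - 2 * \<eta>" and a = a and b = b])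
        show "dt (mm h A) = 1" "dt (adj h) = 1" using A g by simp_all
        show "near_one \<delta> (adj h)" using g(4) by (rule near_one_adj)
        show "J n \<subseteq> {a + 2 * \<eta>..b - 2 * \<eta>}" by (rule Jsub)
        show "a + 2 * \<eta> \<le> b - 2 * \<eta>" by (rule Jab)
        show "\<bar>a + 2 * \<eta>\<bar> \<le> B" "\<bar>b - 2 * \<eta>\<bar> \<le> B" using \<eta>(1) Jab unfolding B_def by linarith+
        show "\<And>s s'. s \<in> J n \<Longrightarrow> \<bar>s' - s\<bar> \<le> \<eta> \<Longrightarrow> s' \<in> I"
        proof -
          fix s s' assume "s \<in> J n" "\<bar>s' - s\<bar> \<le> \<eta>"
          then have "s' \<in> {a<..<b}" using Jsub \<eta>(1) by (auto simp: abs_le_iff subset_iff)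
          then show "s' \<in> I" using I(1) by blast
        qed
      qed (use \<eta>(1,2) \<delta>(2) t1[of n] I(2,3) f(2,4,5) \<eta>a less_imp_le[OF \<omega>(1)] u in \<open>simp_all\<close>)
      also have "mm (adj h) (mm h A) = A" by (rule mm_adj_cancel(2)[OF g(3)])
      also have "\<omega> * real (card (hits (t n) (J n) (mm h A))) \<le> \<omega> * ((b - a + 1) * (t n)\<^sup>2)"
      proof (intro mult_left_mono)
        have "real (card (hits (t n) (J n) (mm h A))) \<le> (b - 2 * \<eta> - (a + 2 * \<eta>)) * (t n)\<^sup>2 + 1"
          by (rule hits_card(2)[OF t0 Jsub Jab])
        also have "\<dots> \<le> (b - a) * (t n)\<^sup>2 + 1 * (t n)\<^sup>2"
          using \<eta>(1) t1[of n] by (intro add_mono mult_right_mono) auto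
        finally show "real (card (hits (t n) (J n) (mm h A))) \<le> (b - a + 1) * (t n)\<^sup>2" by (simp add: algebra_simps)
      qed (use \<omega> in simp)
      finally have "Ssum f (t n) (J n) M \<le> Ssum f (t n) I A + \<omega> * ((b - a + 1) * (t n)\<^sup>2)" by simp
      then show ?thesis using k(2)[of M] by (rule mult_right_mono)
    qed simp
    have m: "(\<lambda>M. Ssum f (t n) (J n) M) \<in> borel_measurable MX" and b: "\<And>M. 0 \<le> Ssum f (t n) (J n) M"
      "\<And>M. Ssum f (t n) (J n) M \<le> real (K n) * C"
      unfolding J_def using Ssum_MX[OF f(1-3) t0[of n]] by auto
    have i1: "integrable MX (\<lambda>M. Ssum f (t n) (J n) M * k M)"
    proof (rule MX_int_bdd)
      show "(\<lambda>M. Ssum f (t n) (J n) M * k M) \<in> borel_measurable MX" using m k(1) by simp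
      fix M show "\<bar>Ssum f (t n) (J n) M * k M\<bar> \<le> (real (K n) * C) * 1"
        unfolding abs_mult using b[of M] k(2,3)[of M] C0 by (intro mult_mono) auto
    qed
    have i2: "integrable MX k" using k(1-3) by (intro MX_int_bdd[of _ 1]) (auto simp: abs_le_iff intro: order_trans[of _ 0])
    have "(t n)\<^sup>2 * S n = (\<integral>M. Ssum f (t n) (J n) M * k M \<partial>MX)" using t0[of n] by (simp add: S_def)
    also have "\<dots> \<le> (\<integral>M. (Ssum f (t n) I A + \<omega> * ((b - a + 1) * (t n)\<^sup>2)) * k M \<partial>MX)"
      using i1 i2 by (intro integral_mono pt) auto
    also have "\<dots> = (Ssum f (t n) I A + \<omega> * ((b - a + 1) * (t n)\<^sup>2)) * P" by (simp add: P_def)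
    finally have "(t n)\<^sup>2 * S n \<le> (Ssum f (t n) I A + \<omega> * ((b - a + 1) * (t n)\<^sup>2)) * P" .
    then have "(t n)\<^sup>2 * S n / P \<le> Ssum f (t n) I A + \<omega> * ((b - a + 1) * (t n)\<^sup>2)"
      using k(4) by (simp only: P_def[symmetric] pos_divide_le_eq)
    then have "(S n / P - \<omega> * (b - a + 1)) * (t n)\<^sup>2 \<le> Ssum f (t n) I A" by (simp add: algebra_simps)
    then show ?thesis using t2 by (simp only: pos_le_divide_eq)
  qed
  have P0: "0 < P" using k(4) by (simp add: P_def)
  have "(\<lambda>n. S n / P - \<omega> * (b - a + 1)) \<longlonglongrightarrow> (L * (cf * P)) / P - \<omega> * (b - a + 1)"
    using P0 by (intro tendsto_intros S) simp
  moreover have "(b - a) * cf - e < (L * (cf * P)) / P - \<omega> * (b - a + 1)"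
  proof -
    have "(L * (cf * P)) / P = L * cf" using P0 by simp
    also have "\<dots> = (b - a) * cf - 4 * \<eta> * cf" by (simp add: L_def algebra_simps)
    finally have "(L * (cf * P)) / P = (b - a) * cf - 4 * \<eta> * cf" .
    then show ?thesis using \<eta>c \<omega>(2) e by linarith
  qed
  ultimately have "eventually (\<lambda>n. (b - a) * cf - e < S n / P - \<omega> * (b - a + 1)) sequentially"
    by (rule order_tendstoD)
  then show ?thesis unfolding cf_def[symmetric] by eventually_elim (rule less_le_trans[OF _ le])
qed

section \<open>Cutoff near the boundary of the section\<close>

definition bdist :: "real \<times> real \<Rightarrow> real" where "bdist p = infdist p (- Tq q)"

lemma compl_Tq_nonempty: "- Tq q \<noteq> {}"
proof -
  have "(0, 0) \<in> - Tq q" by (simp add: Tq_iff)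
  then show ?thesis by blast
qed

lemma bdist_le: "p' \<notin> Tq q \<Longrightarrow> bdist p \<le> dist p p'"
  unfolding bdist_def by (rule infdist_le) simp

lemma bdist_notin: "p \<notin> Tq q \<Longrightarrow> bdist p = 0"
  unfolding bdist_def by (rule infdist_zero) simp

lemma bdist_nonneg: "0 \<le> bdist p"
  unfolding bdist_def by (rule infdist_nonneg)

lemma bdist_cont: "continuous_on S bdist"
  unfolding bdist_def by (intro continuous_intros)

lemma Tq_norm: "p \<in> Tq q \<Longrightarrow> norm p \<le> 2"
proof -
  assume p: "p \<in> Tq q"
  obtain a b where e: "p = (a, b)" by (cases p)
  have ab: "0 < a" "a \<le> 1" "1 - lam * a < b" "b \<le> 1" using p by (simp_all add: e Tq_iff)
  have "lam * a \<le> 2 * 1" using ab lam_bounds by (intro mult_mono) auto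
  then have "\<bar>b\<bar> \<le> 1" using ab by linarith
  then show ?thesis using norm_Pair_le[of a b] ab by (simp add: e)
qed

text \<open>\<open>Tq q\<close> is open up to the two edges on which a coordinate equals 1, and
  these are null sets.\<close>

lemma AE_bdist_pos: "AE p in lborel. p \<in> Tq q \<longrightarrow> 0 < bdist p"
proof -
  have n: "{p :: real \<times> real. fst p = 1} \<in> null_sets lborel" "{p :: real \<times> real. snd p = 1} \<in> null_sets lborel"
  proof -
    have "negligible {p :: real \<times> real. (1, 0) \<bullet> p = 1}" "negligible {p :: real \<times> real. (0, 1) \<bullet> p = 1}"
      by (rule negligible_hyperplane, simp add: zero_prod_def)+
    moreover have "{p :: real \<times> real. (1, 0) \<bullet> p = 1} = {p. fst p = 1}" "{p :: real \<times> real. (0, 1) \<bullet> p = 1} = {p. snd p = 1}" by auto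
    moreover have "{p :: real \<times> real. fst p = 1} \<in> sets borel" "{p :: real \<times> real. snd p = 1} \<in> sets borel" by measurable
    ultimately show "{p :: real \<times> real. fst p = 1} \<in> null_sets lborel" "{p :: real \<times> real. snd p = 1} \<in> null_sets lborel"
      by (simp_all add: negligible_iff_null_sets null_sets_def)
  qed
  define U where "U = {p :: real \<times> real. 0 < fst p \<and> fst p < 1 \<and> 1 - lam * fst p < snd p \<and> snd p < 1}"
  have U: "open U" unfolding U_def by (intro open_Collect_conj open_Collect_less continuous_intros)
  have UT: "U \<subseteq> Tq q" by (auto simp: U_def Tq_iff)
  have pos: "0 < bdist p" if "p \<in> U" for p
  proof -
    have "closure (- Tq q) \<subseteq> - U" using UT U by (intro closure_minimal) auto
    then have "p \<notin> closure (- Tq q)" using that by blast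
    then have "bdist p \<noteq> 0" unfolding bdist_def using in_closure_iff_infdist_zero[OF compl_Tq_nonempty] by blast
    then show ?thesis using bdist_nonneg[of p] by simp
  qed
  have "AE p in lborel. p \<notin> {p :: real \<times> real. fst p = 1}" "AE p in lborel. p \<notin> {p :: real \<times> real. snd p = 1}"
    by (rule AE_not_in[OF n(1)], rule AE_not_in[OF n(2)])
  then show ?thesis
  proof eventually_elim
    fix p :: "real \<times> real" assume "p \<notin> {p. fst p = 1}" "p \<notin> {p. snd p = 1}"
    then have "p \<in> Tq q \<Longrightarrow> p \<in> U" by (cases p) (auto simp: U_def Tq_iff)
    then show "p \<in> Tq q \<longrightarrow> 0 < bdist p" using pos by blast
  qed
qed

text \<open>For k > 0 the factor vanishes where \<open>bdist\<close> is at most 1 / k and is 1 from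
  2 / k on. Continuity of F is assumed on \<open>Tq q\<close> only, whence the case
  distinction.\<close>

definition cutoff :: "(real \<times> real \<Rightarrow> real) \<Rightarrow> nat \<Rightarrow> real \<times> real \<Rightarrow> real" where
  "cutoff F k p = (if p \<in> Tq q then F p * min 1 (max 0 (real k * bdist p - 1)) else 0)"

lemma cutoff_measurable:
  assumes "continuous_on (Tq q) F" shows "cutoff F k \<in> borel_measurable borel"
proof -
  have "(\<lambda>p. indicator (Tq q) p *\<^sub>R (F p * min 1 (max 0 (real k * bdist p - 1)))) \<in> borel_measurable borel"
    by (intro borel_measurable_continuous_on_indicator Tq_borel continuous_intros assms bdist_cont)
  moreover have "cutoff F k = (\<lambda>p. indicator (Tq q) p *\<^sub>R (F p * min 1 (max 0 (real k * bdist p - 1))))"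
    by (auto simp: cutoff_def indicator_def)
  ultimately show ?thesis by simp
qed

lemma cutoff_bounds:
  assumes "\<And>p. p \<in> Tq q \<Longrightarrow> 0 \<le> F p" "\<And>p. p \<in> Tq q \<Longrightarrow> F p \<le> C" "0 \<le> C"
  shows "0 \<le> cutoff F k p" "cutoff F k p \<le> C" "p \<in> Tq q \<Longrightarrow> cutoff F k p \<le> F p"
proof -
  have m: "0 \<le> min 1 (max 0 (real k * bdist p - 1))" "min 1 (max 0 (real k * bdist p - 1)) \<le> 1" by auto
  show "0 \<le> cutoff F k p" using assms(1)[of p] m by (simp add: cutoff_def)
  show le: "cutoff F k p \<le> F p" if "p \<in> Tq q"
    using mult_left_mono[OF m(2) assms(1)[OF that]] that by (simp add: cutoff_def)
  show "cutoff F k p \<le> C"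
  proof (cases "p \<in> Tq q")
    case True
    then show ?thesis using le assms(2) order_trans by blast
  qed (simp add: cutoff_def assms(3))
qed

text \<open>The point (0, b) lies outside \<open>Tq q\<close>, so \<open>bdist\<close> is at most
  the first coordinate. This supplies the lower bound on first coordinates that
  \<open>sum_perturb\<close> asks for.\<close>

lemma cutoff_pos:
  assumes "0 < cutoff F k p" "0 < k"
  shows "p \<in> Tq q" "1 / real k < bdist p" "1 / real k \<le> fst p"
proof -
  show p: "p \<in> Tq q" using assms by (auto simp: cutoff_def split: if_splits)
  have "min 1 (max 0 (real k * bdist p - 1)) \<noteq> 0" using assms by (auto simp: cutoff_def split: if_splits)
  then have "1 < real k * bdist p" by (auto simp: min_def max_def split: if_splits)
  then show d: "1 / real k < bdist p" using assms(2) by (simp add: pos_divide_less_eq mult.commute)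
  obtain a b where e: "p = (a, b)" by (cases p)
  have "bdist p \<le> dist p (0, b)" by (rule bdist_le) (simp add: Tq_iff)
  also have "\<dots> = a" using p by (simp add: e dist_Pair_Pair Tq_iff)
  finally show "1 / real k \<le> fst p" using d by (simp add: e)
qed

text \<open>The points with \<open>bdist\<close> at least 1 / (2 k) form, within a ball, a compact
  subset of \<open>Tq q\<close> that contains the support with a margin. Heine-Cantor applies there,
  and small displacements from the support do not leave it.\<close>

lemma cutoff_uniform:
  assumes F: "continuous_on (Tq q) F" and k: "0 < k" and \<omega>: "0 < \<omega>"
  shows "\<exists>\<eta>>0. \<forall>p p'. 0 < cutoff F k p \<longrightarrow> \<bar>fst p' - fst p\<bar> \<le> \<eta> \<longrightarrow> \<bar>snd p' - snd p\<bar> \<le> \<eta>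
    \<longrightarrow> p' \<in> Tq q \<and> cutoff F k p \<le> cutoff F k p' + \<omega>"
proof -
  define Kc where "Kc = cball 0 2 \<inter> {p. 1 / (2 * real k) \<le> bdist p}"
  have k2: "0 < 1 / (2 * real k)" using k by simp
  have comp: "compact Kc"
    unfolding Kc_def by (intro compact_Int_closed compact_cball closed_Collect_le bdist_cont continuous_on_const)
  have KT: "Kc \<subseteq> Tq q"
  proof
    fix p assume "p \<in> Kc"
    then have "1 / (2 * real k) \<le> bdist p" unfolding Kc_def by simp
    with k2 have "0 < bdist p" by (rule less_le_trans)
    then show "p \<in> Tq q" using bdist_notin[of p] by (cases "p \<in> Tq q") auto
  qed
  have "continuous_on Kc (\<lambda>p. F p * min 1 (max 0 (real k * bdist p - 1)))"
    by (intro continuous_intros continuous_on_subset[OF F KT] bdist_cont)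
  then have "continuous_on Kc (cutoff F k)"
    by (rule continuous_on_cong[THEN iffD1, rotated 2, OF _ refl]) (use KT in \<open>auto simp: cutoff_def\<close>)
  then have "uniformly_continuous_on Kc (cutoff F k)" using comp by (rule compact_uniformly_continuous)
  then obtain d where d: "0 < d" "\<And>p p'. p \<in> Kc \<Longrightarrow> p' \<in> Kc \<Longrightarrow> dist p' p < d \<Longrightarrow> dist (cutoff F k p') (cutoff F k p) < \<omega>"
    using \<omega> unfolding uniformly_continuous_on_def by metis
  \<comment> \<open>The point moves by at most 2 \<eta>, which has to stay below d and below the
    margin 1 / k - 1 / (2 k).\<close>
  define \<eta> where "\<eta> = min (d / 3) (1 / (8 * real k))"
  have \<eta>: "0 < \<eta>" "2 * \<eta> < d" "2 * \<eta> < 1 / (2 * real k)" using d k by (auto simp: \<eta>_def min_def field_simps)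
  have "p' \<in> Tq q \<and> cutoff F k p \<le> cutoff F k p' + \<omega>"
    if p: "0 < cutoff F k p" "\<bar>fst p' - fst p\<bar> \<le> \<eta>" "\<bar>snd p' - snd p\<bar> \<le> \<eta>" for p p'
  proof -
    have "dist p' p \<le> \<bar>fst p' - fst p\<bar> + \<bar>snd p' - snd p\<bar>"
      using norm_Pair_le[of "fst p' - fst p" "snd p' - snd p"] by (simp add: dist_norm minus_prod_def)
    then have dist: "dist p' p \<le> 2 * \<eta>" using p by simp
    have dp: "1 / real k < bdist p" and pT: "p \<in> Tq q" using cutoff_pos[OF p(1) k] by auto
    have "\<bar>bdist p' - bdist p\<bar> \<le> dist p' p" unfolding bdist_def by (rule infdist_triangle_abs)
    moreover have "1 / real k = 1 / (2 * real k) + 1 / (2 * real k)" using k by (simp add: field_simps)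
    ultimately have dp': "1 / (2 * real k) < bdist p'" using dist dp \<eta>(3) by linarith
    then have p'T: "p' \<in> Tq q" using bdist_notin[of p'] k2 by (cases "p' \<in> Tq q") auto
    have "p \<in> Kc" "p' \<in> Kc"
      using Tq_norm[OF pT] Tq_norm[OF p'T] dp dp' k by (auto simp: Kc_def field_simps)
    then have "dist (cutoff F k p') (cutoff F k p) < \<omega>" using dist \<eta>(2) by (intro d) auto
    then show ?thesis using p'T by (simp add: dist_real_def)
  qed
  then show ?thesis using \<eta>(1) by blast
qed

lemma integral_cutoff_tendsto:
  assumes F: "continuous_on (Tq q) F" "\<And>p. p \<in> Tq q \<Longrightarrow> 0 \<le> F p" "\<And>p. p \<in> Tq q \<Longrightarrow> F p \<le> C" "0 \<le> C"
  shows "(\<lambda>k. \<integral>p. cutoff F k p * indicator (Tq q) p \<partial>lborel) \<longlonglongrightarrow> (\<integral>p. F p * indicator (Tq q) p \<partial>lborel)"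
proof (rule integral_dominated_convergence[where w = "\<lambda>p. C * indicator (Tq q) p"])
  show "integrable lborel (\<lambda>p. C * indicator (Tq q) p)"
    using nn_integral_Tq by (intro integrable_mult_right integrable_real_indicator) auto
  show "(\<lambda>p. F p * indicator (Tq q) p) \<in> borel_measurable lborel"
    using borel_measurable_continuous_on_indicator[OF Tq_borel F(1)] by (simp add: mult.commute)
  show "(\<lambda>p. cutoff F k p * indicator (Tq q) p) \<in> borel_measurable lborel" for k
    using cutoff_measurable[OF F(1), of k] by measurable
  show "AE p in lborel. norm (cutoff F k p * indicator (Tq q) p) \<le> C * indicator (Tq q) p" for k
    using cutoff_bounds(1,2)[where F = F and C = C and k = k, OF F(2,3,4)] by (intro AE_I2) (simp add: indicator_def)
  show "AE p in lborel. (\<lambda>k. cutoff F k p * indicator (Tq q) p) \<longlonglongrightarrow> F p * indicator (Tq q) p"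
    using AE_bdist_pos
  proof eventually_elim
    fix p assume d: "p \<in> Tq q \<longrightarrow> 0 < bdist p"
    show "(\<lambda>k. cutoff F k p * indicator (Tq q) p) \<longlonglongrightarrow> F p * indicator (Tq q) p"
    proof (cases "p \<in> Tq q")
      case True
      then have dp: "0 < bdist p" using d by blast
      obtain k0 :: nat where k0: "2 / bdist p < real k0" using reals_Archimedean2 by blast
      have "cutoff F k p = F p" if "k \<ge> k0" for k
      proof -
        have "2 / bdist p < real k" using k0 that by linarith
        then have "2 < real k * bdist p" using dp by (simp add: pos_divide_less_eq)
        then show ?thesis using True by (simp add: cutoff_def)
      qed
      then have "eventually (\<lambda>k. F p * indicator (Tq q) p = cutoff F k p * indicator (Tq q) p) sequentially"
        by (intro eventually_sequentiallyI[of k0]) simp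
      then show ?thesis by (rule Lim_transform_eventually[OF tendsto_const])
    qed simp
  qed
qed

text \<open>The cutoff functions lie below F and their integrals tend to that of F, so the lower
  bound passes to F.\<close>

lemma sum_lower_continuous:
  assumes A: "dt A = 1" and I: "{a<..<b} \<subseteq> I" "I \<subseteq> {a..b}" "a < b"
    and t: "filterlim t at_top sequentially" and t1: "\<And>n. 1 \<le> t n" and e: "0 < e"
    and F: "continuous_on (Tq q) F" "\<And>p. p \<in> Tq q \<Longrightarrow> 0 \<le> F p" "\<And>p. p \<in> Tq q \<Longrightarrow> F p \<le> C" "0 \<le> C"
  shows "eventually (\<lambda>n. (b - a) * ((\<integral>p. F p * indicator (Tq q) p \<partial>lborel) / Rint) - e < Ssum F (t n) I A / (t n)\<^sup>2) sequentially"
proof -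
  have "(\<lambda>k. (b - a) * ((\<integral>p. cutoff F k p * indicator (Tq q) p \<partial>lborel) / Rint)) \<longlonglongrightarrow> (b - a) * ((\<integral>p. F p * indicator (Tq q) p \<partial>lborel) / Rint)"
    using Rint_pos by (intro tendsto_intros integral_cutoff_tendsto[OF F]) auto
  then have "eventually (\<lambda>k. (b - a) * ((\<integral>p. F p * indicator (Tq q) p \<partial>lborel) / Rint) - e / 2
      < (b - a) * ((\<integral>p. cutoff F k p * indicator (Tq q) p \<partial>lborel) / Rint)) sequentially"
    using e by (intro order_tendstoD) auto
  then have "eventually (\<lambda>k. (b - a) * ((\<integral>p. F p * indicator (Tq q) p \<partial>lborel) / Rint) - e / 2
      < (b - a) * ((\<integral>p. cutoff F k p * indicator (Tq q) p \<partial>lborel) / Rint) \<and> 0 < k) sequentially"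
    using eventually_gt_at_top by (rule eventually_conj)
  then obtain k where k: "(b - a) * ((\<integral>p. F p * indicator (Tq q) p \<partial>lborel) / Rint) - e / 2
      < (b - a) * ((\<integral>p. cutoff F k p * indicator (Tq q) p \<partial>lborel) / Rint)" "0 < k"
    by (auto simp: eventually_sequentially)
  have "eventually (\<lambda>n. (b - a) * ((\<integral>p. cutoff F k p * indicator (Tq q) p \<partial>lborel) / Rint) - e / 2 < Ssum (cutoff F k) (t n) I A / (t n)\<^sup>2) sequentially"
  proof (rule sum_lower[OF A I t t1])
    show "cutoff F k \<in> borel_measurable borel" by (rule cutoff_measurable[OF F(1)])
    show "0 \<le> cutoff F k p" "cutoff F k p \<le> C" for p
      using cutoff_bounds(1,2)[where F = F and C = C and k = k and p = p, OF F(2,3,4)] by simp_all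
    show "0 < cutoff F k p \<Longrightarrow> 1 / real k \<le> fst p" for p using cutoff_pos(3)[of F k p] k(2) by blast
    show "0 < \<omega> \<Longrightarrow> \<exists>\<eta>>0. \<forall>p p'. 0 < cutoff F k p \<longrightarrow> \<bar>fst p' - fst p\<bar> \<le> \<eta> \<longrightarrow> \<bar>snd p' - snd p\<bar> \<le> \<eta>
      \<longrightarrow> p' \<in> Tq q \<and> cutoff F k p \<le> cutoff F k p' + \<omega>" for \<omega> by (rule cutoff_uniform[OF F(1) k(2)])
  qed (use e k(2) in auto)
  then show ?thesis
  proof eventually_elim
    fix n
    assume 1: "(b - a) * ((\<integral>p. cutoff F k p * indicator (Tq q) p \<partial>lborel) / Rint) - e / 2 < Ssum (cutoff F k) (t n) I A / (t n)\<^sup>2"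
    have "Ssum (cutoff F k) (t n) I A \<le> Ssum F (t n) I A"
      unfolding Ssum_def using cutoff_bounds(3)[where F = F and C = C, OF F(2,3,4)] by (intro sum_mono) (simp add: hits_def hit_pt)
    then have "Ssum (cutoff F k) (t n) I A / (t n)\<^sup>2 \<le> Ssum F (t n) I A / (t n)\<^sup>2" by (intro divide_right_mono) auto
    then show "(b - a) * ((\<integral>p. F p * indicator (Tq q) p \<partial>lborel) / Rint) - e < Ssum F (t n) I A / (t n)\<^sup>2"
      using 1 k(1) by linarith
  qed
qed

lemma integral_Tq_const: "(\<integral>p. c * indicator (Tq q) p \<partial>lborel) = c * (lam / 2)"
proof -
  have "emeasure lborel (Tq q) = ennreal (lam / 2)" using nn_integral_Tq by simp
  then show ?thesis using lam_bounds by (simp add: measure_def)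
qed

text \<open>The lower bound for F = 1 and \<open>count_upper\<close> have the same constant, so no
  mass is lost at the edge of the section.\<close>

lemma count_tendsto:
  assumes A: "dt A = 1" and I: "{a<..<b} \<subseteq> I" "I \<subseteq> {a..b}" "a < b"
    and t: "filterlim t at_top sequentially" and t1: "\<And>n. 1 \<le> t n"
  shows "(\<lambda>n. real (card (hits (t n) I A)) / (t n)\<^sup>2) \<longlonglongrightarrow> (b - a) * ((lam / 2) / Rint)"
proof (rule order_tendstoI)
  fix y assume "y < (b - a) * ((lam / 2) / Rint)"
  then have e: "0 < (b - a) * ((lam / 2) / Rint) - y" by simp
  have "eventually (\<lambda>n. (b - a) * ((\<integral>p. 1 * indicator (Tq q) p \<partial>lborel) / Rint) - ((b - a) * ((lam / 2) / Rint) - y) < Ssum (\<lambda>_. 1) (t n) I A / (t n)\<^sup>2) sequentially"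
    by (rule sum_lower_continuous[where C = 1, OF A I t t1 e]) auto
  then show "eventually (\<lambda>n. y < real (card (hits (t n) I A)) / (t n)\<^sup>2) sequentially"
    unfolding integral_Tq_const by (simp add: Ssum_def)
next
  fix y assume "(b - a) * ((lam / 2) / Rint) < y"
  then show "eventually (\<lambda>n. real (card (hits (t n) I A)) / (t n)\<^sup>2 < y) sequentially"
    using count_upper[OF A I(2,3) t t1, of "y - (b - a) * ((lam / 2) / Rint)"] by simp
qed

text \<open>C + F and C - F are nonnegative; their lower bounds become a lower and an upper bound
  for F once the known limit of the counts removes C.\<close>

lemma sum_tendsto:
  assumes A: "dt A = 1" and I: "{a<..<b} \<subseteq> I" "I \<subseteq> {a..b}" "a < b"
    and t: "filterlim t at_top sequentially" and t1: "\<And>n. 1 \<le> t n"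
    and F: "continuous_on (Tq q) F" "\<And>p. p \<in> Tq q \<Longrightarrow> \<bar>F p\<bar> \<le> C"
  shows "(\<lambda>n. Ssum F (t n) I A / (t n)\<^sup>2) \<longlonglongrightarrow> (b - a) * ((\<integral>p. F p * indicator (Tq q) p \<partial>lborel) / Rint)"
proof -
  define Nn where "Nn n = real (card (hits (t n) I A)) / (t n)\<^sup>2" for n
  define cN where "cN = (b - a) * ((lam / 2) / Rint)"
  have C0: "0 \<le> C"
  proof -
    have "(1, 1) \<in> Tq q" using lam_bounds by (simp add: Tq_iff)
    from F(2)[OF this] show ?thesis by simp
  qed
  have N: "(\<lambda>n. C * Nn n) \<longlonglongrightarrow> C * cN" unfolding Nn_def cN_def by (intro tendsto_intros count_tendsto[OF A I t t1])
  have iT: "integrable lborel (\<lambda>p. indicator (Tq q) p :: real)"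
    using nn_integral_Tq by (intro integrable_real_indicator) auto
  have iF: "integrable lborel (\<lambda>p. F p * indicator (Tq q) p)"
  proof (rule Bochner_Integration.integrable_bound[OF integrable_mult_right[OF iT, of C]])
    show "(\<lambda>p. F p * indicator (Tq q) p) \<in> borel_measurable lborel"
      using borel_measurable_continuous_on_indicator[OF Tq_borel F(1)] by (simp add: mult.commute)
    show "AE p in lborel. norm (F p * indicator (Tq q) p) \<le> norm (C * indicator (Tq q) p)"
      using F(2) C0 by (intro AE_I2) (simp add: indicator_def)
  qed
  define cF where "cF = (b - a) * ((\<integral>p. F p * indicator (Tq q) p \<partial>lborel) / Rint)"
  have lin: "Ssum (\<lambda>p. C + \<sigma> * F p) (t n) I A / (t n)\<^sup>2 = C * Nn n + \<sigma> * (Ssum F (t n) I A / (t n)\<^sup>2)" for \<sigma> n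
    by (simp add: Ssum_def sum.distrib sum_distrib_left[symmetric] Nn_def add_divide_distrib)
  have int: "(b - a) * ((\<integral>p. (C + \<sigma> * F p) * indicator (Tq q) p \<partial>lborel) / Rint) = C * cN + \<sigma> * cF" for \<sigma>
  proof -
    have "(\<integral>p. (C + \<sigma> * F p) * indicator (Tq q) p \<partial>lborel) = (\<integral>p. C * indicator (Tq q) p + \<sigma> * (F p * indicator (Tq q) p) \<partial>lborel)"
      by (intro Bochner_Integration.integral_cong) (auto simp: algebra_simps)
    also have "\<dots> = (\<integral>p. C * indicator (Tq q) p \<partial>lborel) + (\<integral>p. \<sigma> * (F p * indicator (Tq q) p) \<partial>lborel)"
      using iT iF by (intro Bochner_Integration.integral_add integrable_mult_right)
    also have "\<dots> = C * (lam / 2) + \<sigma> * (\<integral>p. F p * indicator (Tq q) p \<partial>lborel)"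
      unfolding integral_Tq_const by simp
    finally show ?thesis by (simp add: cN_def cF_def algebra_simps add_divide_distrib)
  qed
  have key: "eventually (\<lambda>n. \<sigma> * cF - e < \<sigma> * (Ssum F (t n) I A / (t n)\<^sup>2)) sequentially"
    if \<sigma>: "\<sigma> = 1 \<or> \<sigma> = - 1" and e: "0 < e" for \<sigma> e
  proof -
    have b: "0 \<le> C + \<sigma> * F p" "C + \<sigma> * F p \<le> 2 * C" if "p \<in> Tq q" for p
      using F(2)[OF that] \<sigma> by auto
    have "eventually (\<lambda>n. (b - a) * ((\<integral>p. (C + \<sigma> * F p) * indicator (Tq q) p \<partial>lborel) / Rint) - e / 2
        < Ssum (\<lambda>p. C + \<sigma> * F p) (t n) I A / (t n)\<^sup>2) sequentially"
      using e C0 b by (intro sum_lower_continuous[where C = "2 * C", OF A I t t1] continuous_intros F(1)) auto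
    then have "eventually (\<lambda>n. C * cN + \<sigma> * cF - e / 2 < C * Nn n + \<sigma> * (Ssum F (t n) I A / (t n)\<^sup>2)) sequentially"
      unfolding int lin .
    moreover have "eventually (\<lambda>n. C * Nn n < C * cN + e / 2) sequentially"
      using N e by (intro order_tendstoD) auto
    ultimately show ?thesis by eventually_elim linarith
  qed
  show ?thesis unfolding cF_def[symmetric]
  proof (rule order_tendstoI)
    fix y assume "y < cF"
    then show "eventually (\<lambda>n. y < Ssum F (t n) I A / (t n)\<^sup>2) sequentially" using key[of 1 "cF - y"] by simp
  next
    fix y assume "cF < y"
    then show "eventually (\<lambda>n. Ssum F (t n) I A / (t n)\<^sup>2 < y) sequentially" using key[of "-1" "y - cF"] by simp
  qed
qed

section \<open>Back to lattices and Farey parameters\<close>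

lemma lat_translate:
  assumes "tup X = mm (tup Y) g" "g \<in> Gam" shows "lat X q = lat Y q"
proof -
  have "mm g ` Gam = Gam" using bij_mm[OF assms(2)] by (simp add: bij_betw_def)
  then have "lat Y q = (\<lambda>h. col (mm (tup Y) h)) ` (mm g ` Gam)" by (simp add: lat_eq)
  then show ?thesis by (simp add: lat_eq assms(1) image_image mm_assoc)
qed

text \<open>The horizontal vector (a, 0) lies in the other lattice only through a group element
  preserving the horizontal axis, which gives a = a'. The vector (b, 1/a), obtained from the first
  column of \<open>S4\<close>, then gives b = b' modulo \<open>lam\<close> a, and the half-open
  window has exactly this length.\<close>

lemma g_mat_lat_inj:
  assumes p: "(a, b) \<in> Tq q" "(a', b') \<in> Tq q" and eq: "lat (g_mat a b) q = lat (g_mat a' b') q"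
  shows "(a, b) = (a', b')"
proof -
  have ab: "0 < a" "1 - lam * a < b" "b \<le> 1" "0 < a'" "1 - lam * a' < b'" "b' \<le> 1" using p by (simp_all add: Tq_iff)
  have mem: "\<exists>g\<in>Gam. fst (fst (mm (gm (a', b')) g)) = fst (fst (mm (gm (a, b)) h)) \<and> fst (snd (mm (gm (a', b')) g)) = fst (snd (mm (gm (a, b)) h))"
    if "h \<in> Gam" for h
  proof -
    have "col (mm (gm (a, b)) h) \<in> lat (g_mat a b) q" using that unfolding lat_eq tup_g_mat by (rule imageI)
    then have "col (mm (gm (a, b)) h) \<in> lat (g_mat a' b') q" by (simp only: eq)
    then obtain g where g: "g \<in> Gam" "col (mm (gm (a, b)) h) = col (mm (gm (a', b')) g)" unfolding lat_eq tup_g_mat by blast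
    have "col (mm (gm (a, b)) h) $ i = col (mm (gm (a', b')) g) $ i" for i using g(2) by simp
    from this[of 1] this[of 2] show ?thesis using g(1) unfolding col_component by metis
  qed
  obtain g where g: "g \<in> Gam" "fst (fst (mm (gm (a', b')) g)) = a" "fst (snd (mm (gm (a', b')) g)) = 0"
    using mem[OF Gam.one] unfolding mm_one by (auto simp: gm_def)
  obtain u v s w where ge: "g = ((u, v), (s, w))" by (cases g rule: m4_cases)
  have s0: "s = 0" using g(3) ab by (simp add: ge gm_def)
  then have ua: "a' * u = a" using g(2) by (simp add: ge gm_def)
  have "\<bar>u\<bar> = 1" using Gam_upper[of u v w] g(1) unfolding ge s0 by auto
  moreover have "0 < u" using ua ab by (metis zero_less_mult_pos)
  ultimately have aa: "a' = a" using ua by simp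
  obtain k where k: "k \<in> Gam" "fst (fst (mm (gm (a', b')) k)) = b" "fst (snd (mm (gm (a', b')) k)) = 1 / a"
    using mem[OF S_Gam] by (auto simp: gm_def)
  obtain u' v' s' w' where ke: "k = ((u', v'), (s', w'))" by (cases k rule: m4_cases)
  have s1: "s' = 1" using k(3) ab by (simp add: ke gm_def aa)
  obtain n :: int where n: "u' = of_int n * lam" using Gam_unit_row[of u' v' w'] k(1) unfolding ke s1 by blast
  have bb: "b = b' + of_int n * (lam * a)" using k(2) by (simp add: ke gm_def aa s1 n mult_ac)
  have "\<bar>of_int n * (lam * a)\<bar> < lam * a" using bb ab aa by (simp add: abs_less_iff)
  then have "\<bar>of_int n\<bar> * (lam * a) < 1 * (lam * a)" using ab lam_bounds by (simp add: abs_mult)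
  then have "\<bar>of_int n :: real\<bar> < 1" using ab lam_bounds by (simp add: mult_less_cancel_right)
  then have "n = 0" by linarith
  then show ?thesis using aa bb by simp
qed

text \<open>Shearing by the slope makes the representative upper triangular and the diagonal matrix
  divides its first row by t, so the result is \<open>gm p\<close>. By \<open>g_mat_lat_inj\<close>
  the definite description in \<open>FTR\<close> denotes this p.\<close>

lemma FTR_eq:
  assumes A: "det A = 1" and t: "0 < t" and g: "g \<in> hits t I (tup A)"
  shows "FTR q A t (col (mm (tup A) g)) = pt t (mm (tup A) g)"
proof -
  have gG: "g \<in> Gam" and hg: "hit t (mm (tup A) g)" using g by (simp_all add: hits_def)
  obtain x z y w where N: "mm (tup A) g = ((x, z), (y, w))" by (cases "mm (tup A) g" rule: m4_cases)
  have d1: "dt ((x, z), (y, w)) = 1" using A dt_Gam[OF gG] N by (metis dt_mm dt_tup mult.right_neutral)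
  have x: "0 < x" using hit_fst_pos[OF hg t] by (simp add: N)
  define u where "u = col (mm (tup A) g)"
  define X where "X = s_mat (1 / t) ** h_mat (slope u) ** A"
  define p where "p = pt t (mm (tup A) g)"
  have pe: "p = (x / t, z / t)" using d1 by (simp add: p_def pt_def N)
  have pT: "p \<in> Tq q" using hg by (simp add: hit_pt p_def)
  have sl: "slope u = y / x" by (simp add: u_def slope_col N)
  have tX: "tup X = mm (mm ((1 / t, 0), (0, t)) (lo (- (y / x)))) (tup A)"
    by (simp add: X_def tup_mult s_mat_def h_mat_def sl)
  have w: "w - y / x * z = 1 / x" using d1 x by (simp add: field_simps)
  have "mm (tup X) g = mm (mm ((1 / t, 0), (0, t)) (lo (- (y / x)))) ((x, z), (y, w))"
    unfolding tX by (simp only: mm_assoc N)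
  also have "\<dots> = ((x / t, z / t), (0, t * (w - y / x * z)))"
    using x by (simp add: algebra_simps)
  also have "\<dots> = gm p" unfolding w pe gm_def by simp
  finally have tg: "mm (tup X) g = gm p" .
  have lat: "lat (g_mat (fst p) (snd p)) q = lat X q"
    by (rule lat_translate[OF _ gG]) (simp add: tup_g_mat tg)
  have "(THE p. p \<in> Tq q \<and> lat X q = lat (g_mat (fst p) (snd p)) q) = p"
  proof (rule the_equality)
    show "p \<in> Tq q \<and> lat X q = lat (g_mat (fst p) (snd p)) q" using pT lat by simp
    fix p' assume p': "p' \<in> Tq q \<and> lat X q = lat (g_mat (fst p') (snd p')) q"
    have "(fst p', snd p') = (fst p, snd p)"
      by (rule g_mat_lat_inj) (use p' pT lat in simp_all)
    then show "p' = p" by (simp add: prod_eq_iff)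
  qed
  then show ?thesis unfolding FTR_def u_def[symmetric] p_def[symmetric] X_def .
qed

text \<open>Slopes separate hits, and \<open>hit_of_column\<close> makes every strip vector the
  column of a hit; so sums over vectors become sums over group elements.\<close>

lemma F_set_bij:
  assumes A: "det A = 1" and t: "0 < t"
  shows "bij_betw (\<lambda>g. col (mm (tup A) g)) (hits t I (tup A)) (F_set q A I t)"
proof (rule bij_betw_imageI)
  have dA: "dt (tup A) = 1" using A by (simp add: dt_tup)
  show "inj_on (\<lambda>g. col (mm (tup A) g)) (hits t I (tup A))"
  proof (rule inj_onI)
    fix g g' assume g: "g \<in> hits t I (tup A)" "g' \<in> hits t I (tup A)" "col (mm (tup A) g) = col (mm (tup A) g')"
    then have "sl (mm (tup A) g) = sl (mm (tup A) g')" using slope_col by metis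
    then show "g = g'" using inj_onD[OF inj_sl_hits[OF t]] g(1,2) by blast
  qed
  show "(\<lambda>g. col (mm (tup A) g)) ` hits t I (tup A) = F_set q A I t"
  proof (intro equalityI subsetI)
    fix v assume "v \<in> (\<lambda>g. col (mm (tup A) g)) ` hits t I (tup A)"
    then obtain g where g: "g \<in> hits t I (tup A)" "v = col (mm (tup A) g)" by blast
    have gG: "g \<in> Gam" and hg: "hit t (mm (tup A) g)" and sI: "sl (mm (tup A) g) \<in> I" using g(1) by (simp_all add: hits_def)
    obtain x z y w where N: "mm (tup A) g = ((x, z), (y, w))" by (cases "mm (tup A) g" rule: m4_cases)
    have d1: "dt ((x, z), (y, w)) = 1" using dA dt_Gam[OF gG] N by (metis dt_mm mult.right_neutral)
    have "0 < x" "x \<le> t" using hg hit_iff[OF d1, of t] t unfolding N by simp_all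
    then have "v \<in> strip t" by (simp add: g(2) strip_def N)
    moreover have "v \<in> lat A q" unfolding lat_eq g(2) using gG by (rule imageI)
    moreover have "slope v \<in> I" using sI by (simp add: g(2) slope_col)
    ultimately show "v \<in> F_set q A I t" by (simp add: F_set_def)
  next
    fix v assume v: "v \<in> F_set q A I t"
    then have "v \<in> lat A q" by (simp add: F_set_def)
    then obtain g where g: "g \<in> Gam" "v = col (mm (tup A) g)" unfolding lat_eq by blast
    have x: "0 < fst (fst (mm (tup A) g))" "fst (fst (mm (tup A) g)) \<le> t * sqrt 1" and sI: "sl (mm (tup A) g) \<in> I"
      using v by (simp_all add: F_set_def strip_def g(2) slope_col)
    have "\<exists>g'\<in>Gam. hit t (mm (tup A) g') \<and> sl (mm (tup A) g') = sl (mm (tup A) g)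
      \<and> fst (fst (mm (tup A) g')) = fst (fst (mm (tup A) g)) \<and> fst (snd (mm (tup A) g')) = fst (snd (mm (tup A) g))"
      by (rule hit_of_column[OF dA _ t g(1) x]) simp
    then obtain g' where g': "g' \<in> Gam" "hit t (mm (tup A) g')" "sl (mm (tup A) g') = sl (mm (tup A) g)"
      "fst (fst (mm (tup A) g')) = fst (fst (mm (tup A) g))" "fst (snd (mm (tup A) g')) = fst (snd (mm (tup A) g))"
      by (elim bexE conjE)
    have "g' \<in> hits t I (tup A)" using g'(1-3) sI by (simp add: hits_def)
    moreover have "v = col (mm (tup A) g')" unfolding g(2) col_def g'(4,5) ..
    ultimately show "v \<in> (\<lambda>g. col (mm (tup A) g)) ` hits t I (tup A)" by (rule rev_image_eqI)
  qed
qed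

lemma N_count_eq: "det A = 1 \<Longrightarrow> 0 < t \<Longrightarrow> N_count q A I t = card (hits t I (tup A))"
  unfolding N_count_def by (rule bij_betw_same_card[OF F_set_bij, symmetric])

lemma rho_integral_eq:
  assumes "det A = 1" "0 < t"
  shows "rho_integral q A I t f = Ssum f t I (tup A) / real (card (hits t I (tup A)))"
proof -
  have "(\<Sum>u\<in>F_set q A I t. f (FTR q A t u)) = (\<Sum>g\<in>hits t I (tup A). f (FTR q A t (col (mm (tup A) g))))"
    by (rule sum.reindex_bij_betw[OF F_set_bij[OF assms], symmetric])
  also have "\<dots> = Ssum f t I (tup A)"
    unfolding Ssum_def by (rule sum.cong[OF refl]) (simp add: FTR_eq[OF assms])
  finally show ?thesis by (simp add: rho_integral_def N_count_eq[OF assms])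
qed

lemma mq_integral_eq: "mq_integral q f = (2 / lam) * (\<integral>p. f p * indicator (Tq q) p \<partial>lborel)"
proof -
  have "mq_integral q f = (\<integral>p. (2 / lam) * (f p * indicator (Tq q) p) \<partial>lborel)"
    unfolding mq_integral_def set_lebesgue_integral_def lam_def by (simp add: mult_ac)
  also have "\<dots> = (2 / lam) * (\<integral>p. f p * indicator (Tq q) p \<partial>lborel)" by (rule integral_mult_right_zero)
  finally show ?thesis .
qed

lemma mq_integral_R: "mq_integral q (R_q q) = 2 * Rint / lam"
proof -
  have "(\<lambda>p. R_q q p * indicator (Tq q) p) = Rh" by (auto simp: Rh_def indicator_def)
  then show ?thesis unfolding mq_integral_eq Rint_def by simp
qed

theorem equidistribution:
  assumes A: "det A = 1" and I: "{a<..<b} \<subseteq> I" "I \<subseteq> {a..b}" "a < b"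
  shows "((\<lambda>t. real (N_count q A I t) / t\<^sup>2) \<longlongrightarrow> (b - a) / mq_integral q (R_q q)) at_top"
    and "continuous_on (Tq q) f \<Longrightarrow> bounded (f ` Tq q) \<Longrightarrow> ((\<lambda>t. rho_integral q A I t f) \<longlongrightarrow> mq_integral q f) at_top"
proof -
  have dA: "dt (tup A) = 1" using A by (simp add: dt_tup)
  \<comment> \<open>\<open>mq_integral q (R_q q)\<close> is \<open>2 * Rint / lam\<close>, and (lam
    / 2) / Rint is its reciprocal.\<close>
  have c: "(b - a) / mq_integral q (R_q q) = (b - a) * ((lam / 2) / Rint)"
    unfolding mq_integral_R using Rint_pos lam_bounds by simp
  \<comment> \<open>The sequential limits assume t \<ge> 1; the truncated sequence agrees with X
    from some index on.\<close>
  have max: "filterlim (\<lambda>n. max 1 (X n)) at_top sequentially" "eventually (\<lambda>n. max 1 (X n) = X n) sequentially"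
    if X: "filterlim X at_top sequentially" for X :: "nat \<Rightarrow> real"
  proof -
    have "eventually (\<lambda>n. 1 \<le> X n) sequentially" using X by (simp add: filterlim_at_top)
    then show ev: "eventually (\<lambda>n. max 1 (X n) = X n) sequentially" by eventually_elim simp
    show "filterlim (\<lambda>n. max 1 (X n)) at_top sequentially" by (rule filterlim_at_top_mono[OF X]) simp
  qed
  show "((\<lambda>t. real (N_count q A I t) / t\<^sup>2) \<longlongrightarrow> (b - a) / mq_integral q (R_q q)) at_top"
  proof (rule tendsto_at_topI_sequentially)
    fix X :: "nat \<Rightarrow> real" assume X: "filterlim X at_top sequentially"
    have "(\<lambda>n. real (card (hits (max 1 (X n)) I (tup A))) / (max 1 (X n))\<^sup>2) \<longlonglongrightarrow> (b - a) * ((lam / 2) / Rint)"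
      by (rule count_tendsto[OF dA I max(1)[OF X]]) simp
    then have "(\<lambda>n. real (N_count q A I (max 1 (X n))) / (max 1 (X n))\<^sup>2) \<longlonglongrightarrow> (b - a) * ((lam / 2) / Rint)"
      by (simp add: N_count_eq[OF A])
    then show "(\<lambda>n. real (N_count q A I (X n)) / (X n)\<^sup>2) \<longlonglongrightarrow> (b - a) / mq_integral q (R_q q)"
      unfolding c by (rule Lim_transform_eventually) (use max(2)[OF X] in eventually_elim, simp)
  qed
  assume f: "continuous_on (Tq q) f" "bounded (f ` Tq q)"
  obtain C where C: "\<And>p. p \<in> Tq q \<Longrightarrow> \<bar>f p\<bar> \<le> C" using f(2) unfolding bounded_iff by auto
  show "((\<lambda>t. rho_integral q A I t f) \<longlongrightarrow> mq_integral q f) at_top"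
  proof (rule tendsto_at_topI_sequentially)
    fix X :: "nat \<Rightarrow> real" assume X: "filterlim X at_top sequentially"
    define Y where "Y n = max 1 (X n)" for n
    have Y: "filterlim Y at_top sequentially" "\<And>n. 1 \<le> Y n" "\<And>n. 0 < Y n" unfolding Y_def using max(1)[OF X] by auto
    have "(\<lambda>n. (Ssum f (Y n) I (tup A) / (Y n)\<^sup>2) / (real (card (hits (Y n) I (tup A))) / (Y n)\<^sup>2))
        \<longlonglongrightarrow> ((b - a) * ((\<integral>p. f p * indicator (Tq q) p \<partial>lborel) / Rint)) / ((b - a) * ((lam / 2) / Rint))"
      using Rint_pos lam_bounds I(3)
      by (intro tendsto_divide sum_tendsto[OF dA I Y(1,2) f(1) C] count_tendsto[OF dA I Y(1,2)]) auto
    moreover have "((b - a) * ((\<integral>p. f p * indicator (Tq q) p \<partial>lborel) / Rint)) / ((b - a) * ((lam / 2) / Rint)) = mq_integral q f"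
      unfolding mq_integral_eq using Rint_pos lam_bounds I(3) by simp
    moreover have "(Ssum f (Y n) I (tup A) / (Y n)\<^sup>2) / (real (card (hits (Y n) I (tup A))) / (Y n)\<^sup>2) = rho_integral q A I (Y n) f" for n
      using Y(3)[of n] by (simp add: rho_integral_eq[OF A Y(3)])
    ultimately have "(\<lambda>n. rho_integral q A I (Y n) f) \<longlonglongrightarrow> mq_integral q f" by simp
    then show "(\<lambda>n. rho_integral q A I (X n) f) \<longlonglongrightarrow> mq_integral q f"
      unfolding Y_def by (rule Lim_transform_eventually) (use max(2)[OF X] in eventually_elim, simp)
  qed
qed

end

theorem mainTheorem10:
  fixes q :: nat and A :: "real^2^2" and I :: "real set" and a b :: real
  assumes "q \<ge> 3"
    and "det A = 1"
    and "is_interval I" and "a < b" and "{a<..<b} \<subseteq> I" and "I \<subseteq> {a..b}"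
  shows "(\<lambda>t. real (N_count q A I t)) \<sim>[at_top]
           (\<lambda>t. (b - a) / mq_integral q (R_q q) * t ^ 2) \<and>
         (\<forall>f. continuous_on (Tq q) f \<longrightarrow> bounded (f ` Tq q) \<longrightarrow>
           ((\<lambda>t. rho_integral q A I t f) \<longlongrightarrow> mq_integral q f) at_top)"
proof -
  interpret hecke q by unfold_locales (rule assms(1))
  note eq = equidistribution[OF assms(2,5,6,4)]
  define c where "c = (b - a) / mq_integral q (R_q q)"
  \<comment> \<open>Asymptotic equivalence is obtained from a quotient tending to 1, for which the
    constant must be nonzero.\<close>
  have c: "c \<noteq> 0" unfolding c_def mq_integral_R using Rint_pos lam_bounds assms(4) by simp
  have "(\<lambda>t. real (N_count q A I t)) \<sim>[at_top] (\<lambda>t. c * t ^ 2)"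
  proof (rule asymp_equivI')
    have "((\<lambda>t. (real (N_count q A I t) / t\<^sup>2) / c) \<longlongrightarrow> c / c) at_top"
      using c eq(1) unfolding c_def[symmetric] by (intro tendsto_divide tendsto_const)
    then show "((\<lambda>t. real (N_count q A I t) / (c * t ^ 2)) \<longlongrightarrow> 1) at_top" using c by (simp add: mult.commute)
  qed
  then show ?thesis using eq(2) unfolding c_def by blast
qed

end
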